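(* Let $\Gamma=\bigcup_{0\le j<N}\Gamma_j$ be a multipatch geometry with smooth non-singular parametrisations, and let all knot vectors be open and locally quasi-uniform (see context). Let $f\in H^{-1/2}(\Gamma)\cap H^s_{\mathrm{pw}}(\Gamma)$ for some $s\ge0$, and let $\mathcal P_{-1/2}f$ denote the $H^{-1/2}(\Gamma)$-orthogonal projection of $f$ onto $\mathbb S^2_{\boldsymbol p,\boldsymbol\Xi}(\Gamma)$. Then $$\|f-\mathcal P_{-1/2}f\|_{H^{-1/2}(\Gamma)}\lesssim h^{s+1/2}\,\|f\|_{H^s_{\mathrm{pw}}(\Gamma)},\qquad 0\le s\le p.$$
   Context: Univariate splines. For integers $1\le p<k$, a $p$-open knot vector is $\Xi=\{0=\xi_0=\dots=\xi_p<\xi_{p+1}\le\dots\le\xi_{k-1}<\xi_k=\dots=\xi_{k+p}=1\}$, with interior knots of multiplicity at most $p$. $S_p(\Xi)$ is the span of the $k$ B-splines of degree $p$ on $\Xi$ (Cox–de Boor recursion). $\Xi'$ denotes $\Xi$ without its first and last knot. $S_{p_1,p_2}(\Xi_1,\Xi_2)$ is the tensor-product spline space. Locally quasi-uniform: there is a fixed $\theta\ge1$ such that the ratio of lengths of any two neighbouring non-empty knot intervals lies in $[\theta^{-1},\theta]$. Geometry. $\Omega\subset\mathbb R^3$ is a Lipschitz domain and $\Gamma=\partial\Omega$ is a compact orientable surface $\Gamma=\bigcup_{0\le j<N}\Gamma_j$, with patches $\Gamma_j=\boldsymbol F_j([0,1]^2)$, where each $\boldsymbol F_j\in C^\infty([0,1]^2)$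 is an invertible, non-singular diffeomorphism onto $\Gamma_j$; the sets $\boldsymbol F_j((0,1)^2)$ are pairwise disjoint, and at every non-empty interface $\partial\Gamma_{j_0}\cap\partial\Gamma_{j_1}$ the two parametrisations coincide (no T-junctions, watertight). Spline space. Let $\kappa_j=\|\partial_{x_1}\boldsymbol F_j\times\partial_{x_2}\boldsymbol F_j\|$. For degrees $\boldsymbol p_j=(p_1,p_2)$ (positive integers) and knot vectors $\boldsymbol\Xi_j=(\Xi_1,\Xi_2)$ on patch $j$ (coinciding on patch interfaces), $$\mathbb S^2_{\boldsymbol p,\boldsymbol\Xi}(\Gamma)=\{f\in H^{-1/2}(\Gamma): \kappa_j\cdot(f|_{\Gamma_j}\circ\boldsymbol F_j)\in S_{p_1-1,p_2-1}(\Xi_1',\Xi_2')\ \text{for all } 0\le j<N\}.$$ $h$ is the maximal knot distance over all knot vectors and $p$ the minimal polynomial degree among all $\boldsymbol p_j$ (so the functions in $\mathbb S^2$ have mapped degree $p-1$ at least). Function spaces. $H^s(\Gamma)$ and $H^s(\Gamma_j)$, $s\ge0$, are the usual (Sobolev–Slobodeckij) spaces; $H^{-1/2}(\Gamma)$ is the dual of $H^{1/2}(\Gamma)$ with pivot space $L^2(\Gamma)$; $\|f\|^2_{H^s_{\mathrm{pw}}(\Gamma)}=\sum_j\|f|_{\Gamma_j}\|^2_{H^s(\Gamma_j)}$, and $H^s_{\mathrm{pw}}(\Gamma)$ is the set of $f\in L^2(\Gamma)$ for which this is finite. $M\lesssim T$ means $M\le C\,T$ with a constant $C>0$ independent of $h$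 (and of $f$); $C$ may depend on the degrees, $\theta$, $s$ and the parametrisation. *)

theory Defs
  imports "HOL-Analysis.Analysis"
begin

section \<open>Univariate and tensor-product splines\<close>

text \<open>Cox--de Boor recursion; the usual convention that a quotient with vanishing
  denominator is zero is the library convention for division.\<close>

primrec bspline :: "real list \<Rightarrow> nat \<Rightarrow> nat \<Rightarrow> real \<Rightarrow> real" where
  "bspline \<Xi> 0 i x = (if \<Xi> ! i \<le> x \<and> x < \<Xi> ! (i + 1) then 1 else 0)"
| "bspline \<Xi> (Suc p) i x =
     (x - \<Xi> ! i) / (\<Xi> ! (i + p + 1) - \<Xi> ! i) * bspline \<Xi> p i x
   + (\<Xi> ! (i + p + 2) - x) / (\<Xi> ! (i + p + 2) - \<Xi> ! (i + 1)) * bspline \<Xi> p (i + 1) x"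

text \<open>A knot vector of degree \<open>p\<close> with \<open>k\<close> B-splines has \<open>k + p + 1\<close> entries.\<close>

definition spline_dim :: "nat \<Rightarrow> real list \<Rightarrow> nat" where
  "spline_dim p \<Xi> = length \<Xi> - p - 1"

definition tensor_spline_space ::
    "nat \<Rightarrow> nat \<Rightarrow> real list \<Rightarrow> real list \<Rightarrow> (real^2 \<Rightarrow> real) set" where
  "tensor_spline_space p1 p2 \<Xi>1 \<Xi>2 =
     {w. \<exists>c :: nat \<Rightarrow> nat \<Rightarrow> real. w = (\<lambda>x. \<Sum>i<spline_dim p1 \<Xi>1. \<Sum>j<spline_dim p2 \<Xi>2.
            c i j * (bspline \<Xi>1 p1 i (x$1) * bspline \<Xi>2 p2 j (x$2)))}"

definition open_knot_vector :: "nat \<Rightarrow> real list \<Rightarrow> bool" where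
  "open_knot_vector p \<Xi> \<longleftrightarrow> (\<exists>k. 1 \<le> p \<and> p < k \<and> length \<Xi> = k + p + 1 \<and> sorted \<Xi> \<and>
     (\<forall>i\<le>p. \<Xi> ! i = 0) \<and> \<Xi> ! p < \<Xi> ! (p + 1) \<and>
     \<Xi> ! (k - 1) < \<Xi> ! k \<and> (\<forall>i\<in>{k..k + p}. \<Xi> ! i = 1) \<and>
     (\<forall>x. 0 < x \<and> x < 1 \<longrightarrow> count_list \<Xi> x \<le> p))"

definition drop_end_knots :: "real list \<Rightarrow> real list" where
  "drop_end_knots \<Xi> = butlast (tl \<Xi>)"

definition locally_quasi_uniform :: "real \<Rightarrow> real list \<Rightarrow> bool" where
  "locally_quasi_uniform \<theta> \<Xi> \<longleftrightarrow>
     (let z = sorted_list_of_set (set \<Xi>) in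
        \<forall>i. i + 2 < length z \<longrightarrow>
          (z ! (i + 2) - z ! (i + 1)) / (z ! (i + 1) - z ! i) \<in> {inverse \<theta>..\<theta>})"


section \<open>Smooth functions\<close>

definition partial :: "'n::finite \<Rightarrow> (real^'n \<Rightarrow> 'b::real_normed_vector) \<Rightarrow> real^'n \<Rightarrow> 'b" where
  "partial i f x = frechet_derivative f (at x) (axis i 1)"

text \<open>Only meaningful for open \<open>U\<close>.\<close>

primrec Ck_on :: "nat \<Rightarrow> (real^'n::finite) set \<Rightarrow> (real^'n \<Rightarrow> 'b::real_normed_vector) \<Rightarrow> bool" where
  "Ck_on 0 U f \<longleftrightarrow> continuous_on U f"
| "Ck_on (Suc k) U f \<longleftrightarrow> (\<forall>x\<in>U. f differentiable (at x)) \<and> (\<forall>i. Ck_on k U (partial i f))"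

definition smooth_on :: "(real^'n::finite) set \<Rightarrow> (real^'n \<Rightarrow> 'b::real_normed_vector) \<Rightarrow> bool" where
  "smooth_on U f \<longleftrightarrow> (\<forall>k. Ck_on k U f)"


section \<open>Multipatch geometries\<close>

text \<open>\<open>\<Omega>\<close> is a domain that is locally, in suitable Cartesian coordinates, the strict
  epigraph of a Lipschitz function. Unbounded domains with compact boundary are included.\<close>

definition Lipschitz_domain :: "(real^3) set \<Rightarrow> bool" where
  "Lipschitz_domain \<Omega> \<longleftrightarrow> open \<Omega> \<and> connected \<Omega> \<and> \<Omega> \<noteq> {} \<and>
     (\<forall>x0\<in>frontier \<Omega>. \<exists>(U :: (real^3) set) (T :: real^3 \<Rightarrow> real^3) (\<phi> :: real^2 \<Rightarrow> real) L.
        open U \<and> x0 \<in> U \<and> orthogonal_transformation T \<and> L-lipschitz_on UNIV \<phi> \<and>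
        \<Omega> \<inter> U = {x \<in> U. \<phi> (vector [T x $ 1, T x $ 2]) < T x $ 3})"

abbreviation closed_square :: "(real^2) set" where "closed_square \<equiv> cbox 0 1"
abbreviation open_square :: "(real^2) set" where "open_square \<equiv> box 0 1"

definition jac :: "(real^2 \<Rightarrow> real^3) \<Rightarrow> real^2 \<Rightarrow> real" where
  "jac F x = norm (cross3 (partial 1 F x) (partial 2 F x))"

text \<open>Smoothness up to the boundary of the square is expressed by letting the total function
  \<open>F\<close> itself be a smooth extension to a neighbourhood of it; nothing
  below depends on the choice of the extension.\<close>

definition regular_patch :: "(real^2 \<Rightarrow> real^3) \<Rightarrow> bool" where
  "regular_patch F \<longleftrightarrow> (\<exists>U. open U \<and> closed_square \<subseteq> U \<and> smooth_on U F) \<and>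
     inj_on F closed_square \<and> (\<forall>x\<in>closed_square. jac F x \<noteq> 0)"

text \<open>The edge of the square on which coordinate \<open>i\<close> equals \<open>c \<in> {0, 1}\<close>, parametrised by the
  other coordinate. That coordinate is \<open>i + 1\<close>, since arithmetic on the index type \<open>2\<close> is
  modulo two.\<close>

definition edge_pt :: "2 \<Rightarrow> real \<Rightarrow> real \<Rightarrow> real^2" where
  "edge_pt i c t = (\<chi> k. if k = i then c else t)"

definition corners :: "(real^2) set" where
  "corners = {v. \<forall>k. v $ k \<in> {0, 1}}"

text \<open>Two edges are matched if the two parametrisations coincide along them, in the same
  (\<open>flip = False\<close>) or in the opposite (\<open>flip = True\<close>) direction.\<close>

definition edges_match ::
    "(real^2 \<Rightarrow> real^3) \<Rightarrow> 2 \<Rightarrow> real \<Rightarrow> (real^2 \<Rightarrow> real^3) \<Rightarrow> 2 \<Rightarrow> real \<Rightarrow> bool \<Rightarrow> bool" where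
  "edges_match F i c F' i' c' flip \<longleftrightarrow> c \<in> {0, 1} \<and> c' \<in> {0, 1} \<and>
     (\<forall>t\<in>{0..1}. F (edge_pt i c t) = F' (edge_pt i' c' (if flip then 1 - t else t)))"

text \<open>No T-junctions: every point in the intersection of two patch boundaries is a common corner
  or lies on a complete common edge.\<close>

definition conforming_interface :: "(real^2 \<Rightarrow> real^3) \<Rightarrow> (real^2 \<Rightarrow> real^3) \<Rightarrow> bool" where
  "conforming_interface F F' \<longleftrightarrow>
     (\<forall>y \<in> F ` frontier closed_square \<inter> F' ` frontier closed_square.
        y \<in> F ` corners \<inter> F' ` corners \<or>
        (\<exists>i c i' c' flip. edges_match F i c F' i' c' flip \<and> y \<in> F ` edge_pt i c ` {0..1}))"

definition multipatch_geometry :: "(real^3) set \<Rightarrow> nat \<Rightarrow> (nat \<Rightarrow> real^2 \<Rightarrow> real^3) \<Rightarrow> bool" where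
  "multipatch_geometry \<Omega> N F \<longleftrightarrow> Lipschitz_domain \<Omega> \<and> 0 < N \<and>
     compact (frontier \<Omega>) \<and> frontier \<Omega> = (\<Union>j<N. F j ` closed_square) \<and>
     (\<forall>j<N. regular_patch (F j)) \<and>
     disjoint_family_on (\<lambda>j. F j ` open_square) {..<N} \<and>
     (\<forall>j<N. \<forall>j'<N. j \<noteq> j' \<longrightarrow> conforming_interface (F j) (F j'))"

text \<open>The surface measure: patch boundaries are null sets, so it is the sum of the push-forwards
  of the measures with density \<open>jac (F j)\<close> on the open square.\<close>

definition square_measure :: "(real^2) measure" where
  "square_measure = restrict_space lborel open_square"

definition surface_measure :: "nat \<Rightarrow> (nat \<Rightarrow> real^2 \<Rightarrow> real^3) \<Rightarrow> (real^3) measure" where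
  "surface_measure N F =
     distr (density (count_space {..<N} \<Otimes>\<^sub>M square_measure) (\<lambda>(j, x). ennreal (jac (F j) x)))
       borel (\<lambda>(j, x). F j x)"


section \<open>Sobolev--Slobodeckij spaces\<close>

text \<open>Functions are representatives of classes modulo null sets.\<close>

definition L2 :: "'a measure \<Rightarrow> ('a \<Rightarrow> real) set" where
  "L2 M = {u \<in> borel_measurable M. integrable M (\<lambda>x. (u x)\<^sup>2)}"

text \<open>The square of the Slobodeckij seminorm of order \<open>\<mu> \<in> (0, 1)\<close> for a two-dimensional measure.\<close>

definition slobodeckij :: "'a::euclidean_space measure \<Rightarrow> real \<Rightarrow> ('a \<Rightarrow> real) \<Rightarrow> ennreal" where
  "slobodeckij M \<mu> u =
     (\<integral>\<^sup>+ x. \<integral>\<^sup>+ y. ennreal ((u x - u y)\<^sup>2 / norm (x - y) powr (2 + 2 * \<mu>)) \<partial>M \<partial>M)"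

definition test_fun :: "(real^2 \<Rightarrow> real) set" where
  "test_fun = {\<phi>. smooth_on UNIV \<phi> \<and> compact (closure {x. \<phi> x \<noteq> 0}) \<and>
                 closure {x. \<phi> x \<noteq> 0} \<subseteq> open_square}"

definition mixed_partial :: "nat \<times> nat \<Rightarrow> (real^2 \<Rightarrow> real) \<Rightarrow> real^2 \<Rightarrow> real" where
  "mixed_partial \<alpha> \<phi> = (partial 1 ^^ fst \<alpha>) ((partial 2 ^^ snd \<alpha>) \<phi>)"

definition weak_deriv :: "nat \<times> nat \<Rightarrow> (real^2 \<Rightarrow> real) \<Rightarrow> (real^2 \<Rightarrow> real) \<Rightarrow> bool" where
  "weak_deriv \<alpha> u g \<longleftrightarrow> u \<in> L2 square_measure \<and> g \<in> L2 square_measure \<and>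
     (\<forall>\<phi>\<in>test_fun. (LINT x|square_measure. u x * mixed_partial \<alpha> \<phi> x) =
        (-1) ^ (fst \<alpha> + snd \<alpha>) * (LINT x|square_measure. g x * \<phi> x))"

text \<open>The weak derivative is unique up to null sets.\<close>

definition wderiv :: "nat \<times> nat \<Rightarrow> (real^2 \<Rightarrow> real) \<Rightarrow> real^2 \<Rightarrow> real" where
  "wderiv \<alpha> u = (SOME g. weak_deriv \<alpha> u g)"

definition sobolev_int :: "real \<Rightarrow> nat" where "sobolev_int s = nat \<lfloor>s\<rfloor>"
definition sobolev_frac :: "real \<Rightarrow> real" where "sobolev_frac s = s - real (sobolev_int s)"

text \<open>\<open>H\<^sup>s\<close> of the open unit square, \<open>s \<ge> 0\<close>.\<close>

definition Hs_square :: "real \<Rightarrow> (real^2 \<Rightarrow> real) set" where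
  "Hs_square s = {u \<in> L2 square_measure.
     (\<forall>\<alpha>. fst \<alpha> + snd \<alpha> \<le> sobolev_int s \<longrightarrow> (\<exists>g. weak_deriv \<alpha> u g)) \<and>
     (sobolev_frac s > 0 \<longrightarrow> (\<forall>\<alpha>. fst \<alpha> + snd \<alpha> = sobolev_int s \<longrightarrow>
        slobodeckij square_measure (sobolev_frac s) (wderiv \<alpha> u) < \<infinity>))}"

definition Hs_square_norm :: "real \<Rightarrow> (real^2 \<Rightarrow> real) \<Rightarrow> real" where
  "Hs_square_norm s u = sqrt (
     (\<Sum>\<alpha> | fst \<alpha> + snd \<alpha> \<le> sobolev_int s. LINT x|square_measure. (wderiv \<alpha> u x)\<^sup>2) +
     (if sobolev_frac s > 0
      then (\<Sum>\<alpha> | fst \<alpha> + snd \<alpha> = sobolev_int s.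
              enn2real (slobodeckij square_measure (sobolev_frac s) (wderiv \<alpha> u)))
      else 0))"

text \<open>On a patch, which is covered by a single smooth chart, \<open>H\<^sup>s\<close> is defined by pull-back.\<close>

definition Hs_pw :: "nat \<Rightarrow> (nat \<Rightarrow> real^2 \<Rightarrow> real^3) \<Rightarrow> real \<Rightarrow> (real^3 \<Rightarrow> real) set" where
  "Hs_pw N F s = {f \<in> L2 (surface_measure N F). \<forall>j<N. f \<circ> F j \<in> Hs_square s}"

definition Hs_pw_norm ::
    "nat \<Rightarrow> (nat \<Rightarrow> real^2 \<Rightarrow> real^3) \<Rightarrow> real \<Rightarrow> (real^3 \<Rightarrow> real) \<Rightarrow> real" where
  "Hs_pw_norm N F s f = sqrt (\<Sum>j<N. (Hs_square_norm s (f \<circ> F j))\<^sup>2)"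

definition H_half :: "nat \<Rightarrow> (nat \<Rightarrow> real^2 \<Rightarrow> real^3) \<Rightarrow> (real^3 \<Rightarrow> real) set" where
  "H_half N F = {u \<in> L2 (surface_measure N F). slobodeckij (surface_measure N F) (1/2) u < \<infinity>}"

definition H_half_norm :: "nat \<Rightarrow> (nat \<Rightarrow> real^2 \<Rightarrow> real^3) \<Rightarrow> (real^3 \<Rightarrow> real) \<Rightarrow> real" where
  "H_half_norm N F u = sqrt ((LINT x|surface_measure N F. (u x)\<^sup>2) +
     enn2real (slobodeckij (surface_measure N F) (1/2) u))"

type_synonym surface_functional = "(real^3 \<Rightarrow> real) \<Rightarrow> real"

text \<open>The dual of \<open>H_half\<close>. Functionals are set to zero outside \<open>H_half\<close>, so that equality of
  elements of the dual space is equality of functions. Boundedness makes the value independent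
  of the representative.\<close>

definition H_mhalf :: "nat \<Rightarrow> (nat \<Rightarrow> real^2 \<Rightarrow> real^3) \<Rightarrow> surface_functional set" where
  "H_mhalf N F = {l.
     (\<forall>u\<in>H_half N F. \<forall>v\<in>H_half N F. \<forall>a b. l (\<lambda>x. a * u x + b * v x) = a * l u + b * l v) \<and>
     (\<exists>C. \<forall>u\<in>H_half N F. \<bar>l u\<bar> \<le> C * H_half_norm N F u) \<and>
     (\<forall>u. u \<notin> H_half N F \<longrightarrow> l u = 0)}"

definition H_mhalf_norm :: "nat \<Rightarrow> (nat \<Rightarrow> real^2 \<Rightarrow> real^3) \<Rightarrow> surface_functional \<Rightarrow> real" where
  "H_mhalf_norm N F l = (SUP u \<in> {u \<in> H_half N F. H_half_norm N F u \<le> 1}. \<bar>l u\<bar>)"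

text \<open>The inner product that induces the dual norm, by polarisation.\<close>

definition H_mhalf_inner ::
    "nat \<Rightarrow> (nat \<Rightarrow> real^2 \<Rightarrow> real^3) \<Rightarrow> surface_functional \<Rightarrow> surface_functional \<Rightarrow> real" where
  "H_mhalf_inner N F l m = ((H_mhalf_norm N F (\<lambda>u. l u + m u))\<^sup>2
                           - (H_mhalf_norm N F (\<lambda>u. l u - m u))\<^sup>2) / 4"

text \<open>The identification of \<open>L2\<close> functions with elements of the dual space (\<open>L2\<close> is the pivot
  space).\<close>

definition L2_functional ::
    "nat \<Rightarrow> (nat \<Rightarrow> real^2 \<Rightarrow> real^3) \<Rightarrow> (real^3 \<Rightarrow> real) \<Rightarrow> surface_functional" where
  "L2_functional N F f =
     (\<lambda>u. if u \<in> H_half N F then (LINT x|surface_measure N F. f x * u x) else 0)"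

definition H_mhalf_projection ::
    "nat \<Rightarrow> (nat \<Rightarrow> real^2 \<Rightarrow> real^3) \<Rightarrow> surface_functional set \<Rightarrow>
       surface_functional \<Rightarrow> surface_functional" where
  "H_mhalf_projection N F V l =
     (THE q. q \<in> V \<and> (\<forall>v\<in>V. H_mhalf_inner N F (\<lambda>u. l u - q u) v = 0))"


section \<open>The multipatch spline space\<close>

text \<open>Degrees \<open>p j i\<close> and knot vectors \<open>\<Xi> j i\<close> are indexed by patch and parametric direction;
  direction \<open>i\<close> belongs to the coordinate \<open>x $ i\<close>.\<close>

definition interface_compatible ::
    "nat \<Rightarrow> (nat \<Rightarrow> real^2 \<Rightarrow> real^3) \<Rightarrow> (nat \<Rightarrow> 2 \<Rightarrow> nat) \<Rightarrow> (nat \<Rightarrow> 2 \<Rightarrow> real list) \<Rightarrow> bool" where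
  "interface_compatible N F p \<Xi> \<longleftrightarrow>
     (\<forall>j<N. \<forall>j'<N. \<forall>i c i' c' flip.
        j \<noteq> j' \<and> edges_match (F j) i c (F j') i' c' flip \<longrightarrow>
          p j' (i' + 1) = p j (i + 1) \<and>
          \<Xi> j' (i' + 1) =
            (if flip then rev (map (\<lambda>\<xi>. 1 - \<xi>) (\<Xi> j (i + 1))) else \<Xi> j (i + 1)))"

definition admissible_knots ::
    "nat \<Rightarrow> (nat \<Rightarrow> real^2 \<Rightarrow> real^3) \<Rightarrow> real \<Rightarrow>
       (nat \<Rightarrow> 2 \<Rightarrow> nat) \<Rightarrow> (nat \<Rightarrow> 2 \<Rightarrow> real list) \<Rightarrow> bool" where
  "admissible_knots N F \<theta> p \<Xi> \<longleftrightarrow>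
     (\<forall>j<N. \<forall>i. open_knot_vector (p j i) (\<Xi> j i) \<and> locally_quasi_uniform \<theta> (\<Xi> j i)) \<and>
     interface_compatible N F p \<Xi>"

definition spline_space_S2 ::
    "nat \<Rightarrow> (nat \<Rightarrow> real^2 \<Rightarrow> real^3) \<Rightarrow> (nat \<Rightarrow> 2 \<Rightarrow> nat) \<Rightarrow> (nat \<Rightarrow> 2 \<Rightarrow> real list) \<Rightarrow>
       surface_functional set" where
  "spline_space_S2 N F p \<Xi> = {l \<in> H_mhalf N F.
     \<exists>g \<in> L2 (surface_measure N F). l = L2_functional N F g \<and>
       (\<forall>j<N. \<exists>w \<in> tensor_spline_space (p j 1 - 1) (p j 2 - 1)
                      (drop_end_knots (\<Xi> j 1)) (drop_end_knots (\<Xi> j 2)).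
          \<forall>x\<in>open_square. jac (F j) x * g (F j x) = w x)}"

definition min_degree :: "nat \<Rightarrow> (nat \<Rightarrow> 2 \<Rightarrow> nat) \<Rightarrow> nat" where
  "min_degree N p = Min {p j i | j i. j < N}"

definition mesh_size :: "nat \<Rightarrow> (nat \<Rightarrow> 2 \<Rightarrow> real list) \<Rightarrow> real" where
  "mesh_size N \<Xi> = Max {\<Xi> j i ! (m + 1) - \<Xi> j i ! m | j i m. j < N \<and> m + 1 < length (\<Xi> j i)}"

end

theory Submission
  imports Defs "HOL-Computational_Algebra.Polynomial"
begin

text \<open>
  The projection error is at most the distance from \<open>f\<close> to any spline, since the \<open>H^{-1/2}\<close> dual
  norm satisfies the parallelogram law. The spline is chosen patchwise as the \<open>L^2\<close> projection of the
  weighted pullback \<open>\<phi> = jac * (f o F)\<close> onto the tensor product space. Its error \<open>e\<close> is orthogonal to all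
  tensor product splines, and everything follows from one estimate for the pairing of such an \<open>e\<close> with
  a function \<open>v\<close> of Sobolev regularity \<open>s\<close>: it is \<open>O(h^s)\<close> times the norms of \<open>v\<close> and \<open>e\<close>. With \<open>v\<close> the
  pullback of \<open>f\<close> and the smooth weight \<open>jac\<close> this bounds \<open>e\<close> by \<open>h^s\<close>, and with \<open>v\<close> the pullback of a
  test function in \<open>H^{1/2}\<close> it gives the remaining factor \<open>h^{1/2}\<close>.

  For the estimate, \<open>e\<close> is split into two parts, each orthogonal to the univariate splines on almost
  every line in one of the two directions. On a line, orthogonality to all splines of degree \<open>q\<close>
  makes the iterated antiderivatives up to order \<open>q + 1\<close> vanish at both ends, and the last of them at
  all knots, since by Marsden's identity the truncated powers at the knots are splines. Hence each
  antiderivative gains a factor \<open>h\<close>. Integration by parts moves the derivatives to \<open>v\<close>, whose weak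
  derivatives are absolutely continuous on almost every line; the fractional part of \<open>s\<close> is handled by
  smoothing the last derivative along the lines at scale \<open>h\<close>.
\<close>

section \<open>Square integrable functions\<close>

text \<open>The projection is given by a definite description and a polarised supremum norm, so its
  existence and uniqueness are part of the work. The spline space is the span of finitely many
  functionals; minimising over coefficients takes the place of completeness, and orthogonality of
  the minimiser follows from the parallelogram law alone. A patchwise spline is admissible because
  the space imposes no continuity across interfaces. Its weight cancels the surface element: paired
  with \<open>u\<close>, the error functional is the sum over patches of the unweighted pairings of
  \<open>e\<close> with \<open>u o F\<close>. The weight survives only in \<open>\<phi>\<close>,
  where integration by parts has to differentiate it together with \<open>f\<close>. The two uses of
  the pairing estimate form a duality argument: against \<open>\<phi>\<close> it bounds the square
  of the norm of \<open>e\<close> by \<open>h^s\<close> times that norm, which is then cancelled. An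
  \<open>L^2\<close> projection is not local, so orthogonality is exploited on whole lines instead
  of single knot intervals. With mapped degree \<open>q = p - 1\<close> there are
  \<open>q + 1 = p\<close> useful antiderivatives, which is why \<open>s = p\<close> is reached.
  Fractional orders are treated directly, without interpolation between Sobolev spaces.\<close>

definition l2_inner :: "'a measure \<Rightarrow> ('a \<Rightarrow> real) \<Rightarrow> ('a \<Rightarrow> real) \<Rightarrow> real" where
  "l2_inner M u v = (LINT x|M. u x * v x)"

definition l2_norm :: "'a measure \<Rightarrow> ('a \<Rightarrow> real) \<Rightarrow> real" where
  "l2_norm M u = sqrt (l2_inner M u u)"

text \<open>The discriminant criterion behind Cauchy-Schwarz. Functions are representatives, so
  \<open>B = 0\<close> can occur for a nonzero function; the sign of \<open>B\<close> is derived
  from the assumption.\<close>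

lemma discriminant_le:
  fixes A B C :: real
  assumes "\<And>t. 0 \<le> A + 2 * t * C + t\<^sup>2 * B"
  shows "C\<^sup>2 \<le> A * B"
proof (cases "B = 0")
  case True
  have "C = 0"
  proof (rule ccontr)
    assume "C \<noteq> 0"
    then have "A + 2 * (- (A + 1) / (2 * C)) * C = -1" by (simp add: field_simps)
    with assms[of "- (A + 1) / (2 * C)"] True show False by simp
  qed
  with True show ?thesis by simp
next
  case False
  have "B \<ge> 0"
  proof (rule ccontr)
    assume "\<not> B \<ge> 0"
    then have B: "B < 0" by simp
    \<comment> \<open>Chosen so large that \<open>2 * C + t * B\<close> is at most
      \<open>- \<bar>A\<bar> - 1\<close>; the final summand 1 gives
      \<open>t \<ge> 1\<close>.\<close>
    define t where "t = (2 * \<bar>C\<bar> + \<bar>A\<bar> + 1) / (- B) + 1"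
    have t1: "t \<ge> 1" using B by (simp add: t_def divide_nonneg_neg field_simps)
    have "t * (- B) = 2 * \<bar>C\<bar> + \<bar>A\<bar> + 1 - B" using B by (simp add: t_def field_simps)
    then have "2 * C + t * B \<le> - \<bar>A\<bar> - 1" using B by (simp only: mult_minus_right)
    then have "t * (2 * C + t * B) \<le> t * (- \<bar>A\<bar> - 1)"
      using t1 B by (intro mult_left_mono) (auto simp: algebra_simps)
    also have "\<dots> \<le> 1 * (- \<bar>A\<bar> - 1)" using t1 by (intro mult_right_mono_neg) auto
    finally have "A + 2 * t * C + t\<^sup>2 * B < 0"
      by (simp add: algebra_simps power2_eq_square)
    with assms[of t] show False by simp
  qed
  with False have B: "B > 0" by simp
  have "0 \<le> A + 2 * (- C / B) * C + (- C / B)\<^sup>2 * B" by (rule assms)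
  also have "\<dots> = A - C\<^sup>2 / B" using B by (simp add: field_simps power2_eq_square)
  finally show ?thesis using B by (simp add: field_simps)
qed

lemma L2_measurable [measurable_dest]: "u \<in> L2 M \<Longrightarrow> u \<in> borel_measurable M"
  by (simp add: L2_def)

lemma L2_integrable_mult:
  assumes "u \<in> L2 M" "v \<in> L2 M"
  shows "integrable M (\<lambda>x. u x * v x)"
proof (rule Bochner_Integration.integrable_bound)
  show "integrable M (\<lambda>x. (u x)\<^sup>2 + (v x)\<^sup>2)" using assms by (auto simp: L2_def)
  show "(\<lambda>x. u x * v x) \<in> borel_measurable M" using assms by (auto simp: L2_def)
  show "AE x in M. norm (u x * v x) \<le> norm ((u x)\<^sup>2 + (v x)\<^sup>2)"
  proof (intro AE_I2)
    fix x
    have "2 * (\<bar>u x\<bar> * \<bar>v x\<bar>) \<le> (u x)\<^sup>2 + (v x)\<^sup>2"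
      using sum_squares_bound[of "\<bar>u x\<bar>" "\<bar>v x\<bar>"] by simp
    moreover have "0 \<le> \<bar>u x\<bar> * \<bar>v x\<bar>" by simp
    ultimately show "norm (u x * v x) \<le> norm ((u x)\<^sup>2 + (v x)\<^sup>2)"
      unfolding real_norm_def abs_mult by linarith
  qed
qed

lemma L2_integrable_square: "u \<in> L2 M \<Longrightarrow> integrable M (\<lambda>x. (u x)\<^sup>2)"
  by (simp add: L2_def)

lemma L2_add: assumes "u \<in> L2 M" "v \<in> L2 M" shows "(\<lambda>x. u x + v x) \<in> L2 M"
proof -
  have "integrable M (\<lambda>x. (u x)\<^sup>2 + 2 * (u x * v x) + (v x)\<^sup>2)"
    using assms L2_integrable_mult[OF assms] by (auto simp: L2_def)
  then have "integrable M (\<lambda>x. (u x + v x)\<^sup>2)"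
    by (simp add: power2_sum algebra_simps)
  then show ?thesis using assms by (auto simp: L2_def)
qed

lemma L2_cmult: assumes "u \<in> L2 M" shows "(\<lambda>x. a * u x) \<in> L2 M"
  using assms by (auto simp: L2_def power_mult_distrib)

lemma L2_diff: assumes "u \<in> L2 M" "v \<in> L2 M" shows "(\<lambda>x. u x - v x) \<in> L2 M"
  using L2_add[OF assms(1) L2_cmult[OF assms(2), of "-1"]] by simp

lemma L2_zero: "(\<lambda>x. 0) \<in> L2 M" by (simp add: L2_def)

lemma L2_sum:
  assumes "\<And>i. i \<in> S \<Longrightarrow> u i \<in> L2 M" shows "(\<lambda>x. \<Sum>i\<in>S. u i x) \<in> L2 M"
  using assms by (induction S rule: infinite_finite_induct) (auto simp: L2_zero L2_add)

lemma L2_dominated: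
  assumes "v \<in> L2 M" "u \<in> borel_measurable M" "AE x in M. \<bar>u x\<bar> \<le> C * \<bar>v x\<bar>"
  shows "u \<in> L2 M"
proof -
  have "integrable M (\<lambda>x. (u x)\<^sup>2)"
  proof (rule Bochner_Integration.integrable_bound)
    show "integrable M (\<lambda>x. C\<^sup>2 * (v x)\<^sup>2)" using assms by (auto simp: L2_def)
    show "(\<lambda>x. (u x)\<^sup>2) \<in> borel_measurable M" using assms by auto
    show "AE x in M. norm ((u x)\<^sup>2) \<le> norm (C\<^sup>2 * (v x)\<^sup>2)"
      using assms(3)
    proof eventually_elim
      case (elim x)
      then have "\<bar>u x\<bar>\<^sup>2 \<le> (C * \<bar>v x\<bar>)\<^sup>2" by (intro power_mono) auto
      then show ?case by (simp add: power_mult_distrib)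
    qed
  qed
  then show ?thesis using assms by (auto simp: L2_def)
qed

lemma L2_bounded_mult:
  assumes "u \<in> L2 M" "w \<in> borel_measurable M" "\<And>x. x \<in> space M \<Longrightarrow> \<bar>w x\<bar> \<le> C"
  shows "(\<lambda>x. w x * u x) \<in> L2 M"
  using assms by (intro L2_dominated[OF assms(1), of _ C]) (auto simp: abs_mult intro!: AE_I2 mult_right_mono)

lemma l2_inner_commute: "l2_inner M u v = l2_inner M v u"
  by (simp add: l2_inner_def mult.commute)

lemma l2_inner_add_left:
  assumes "u \<in> L2 M" "v \<in> L2 M" "w \<in> L2 M"
  shows "l2_inner M (\<lambda>x. u x + v x) w = l2_inner M u w + l2_inner M v w"
  using L2_integrable_mult[of u M w] L2_integrable_mult[of v M w] assms
  by (simp add: l2_inner_def algebra_simps)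

lemma l2_inner_diff_left:
  assumes "u \<in> L2 M" "v \<in> L2 M" "w \<in> L2 M"
  shows "l2_inner M (\<lambda>x. u x - v x) w = l2_inner M u w - l2_inner M v w"
  using L2_integrable_mult[of u M w] L2_integrable_mult[of v M w] assms
  by (simp add: l2_inner_def algebra_simps)

lemma l2_inner_cmult_left: "l2_inner M (\<lambda>x. a * u x) w = a * l2_inner M u w"
  by (simp add: l2_inner_def mult.assoc)

lemma l2_inner_cmult_right: "l2_inner M u (\<lambda>x. a * w x) = a * l2_inner M u w"
  by (simp add: l2_inner_def mult.left_commute)

lemma l2_inner_sum_left:
  assumes "\<And>i. i \<in> S \<Longrightarrow> u i \<in> L2 M" "w \<in> L2 M"
  shows "l2_inner M (\<lambda>x. \<Sum>i\<in>S. u i x) w = (\<Sum>i\<in>S. l2_inner M (u i) w)"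
  using assms L2_integrable_mult[OF assms]
  by (auto simp: l2_inner_def sum_distrib_right)

lemma l2_inner_diff_right:
  assumes "u \<in> L2 M" "v \<in> L2 M" "w \<in> L2 M"
  shows "l2_inner M w (\<lambda>x. u x - v x) = l2_inner M w u - l2_inner M w v"
  using l2_inner_diff_left[OF assms] by (simp add: l2_inner_commute)

lemma l2_inner_add_right:
  assumes "u \<in> L2 M" "v \<in> L2 M" "w \<in> L2 M"
  shows "l2_inner M w (\<lambda>x. u x + v x) = l2_inner M w u + l2_inner M w v"
  using l2_inner_add_left[OF assms] by (simp add: l2_inner_commute)

lemma l2_inner_self_nonneg: "0 \<le> l2_inner M u u"
  by (simp add: l2_inner_def)

lemma l2_norm_nonneg: "0 \<le> l2_norm M u"
  by (simp add: l2_norm_def l2_inner_self_nonneg)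

lemma l2_norm_square: "(l2_norm M u)\<^sup>2 = l2_inner M u u"
  by (simp add: l2_norm_def l2_inner_self_nonneg)

lemma l2_norm_eq: "l2_norm M u = sqrt (LINT x|M. (u x)\<^sup>2)"
  by (simp add: l2_norm_def l2_inner_def power2_eq_square)

lemma l2_Cauchy_Schwarz:
  assumes "u \<in> L2 M" "v \<in> L2 M"
  shows "\<bar>l2_inner M u v\<bar> \<le> l2_norm M u * l2_norm M v"
proof -
  have "(l2_inner M u v)\<^sup>2 \<le> l2_inner M u u * l2_inner M v v"
  proof (rule discriminant_le)
    fix t
    have "0 \<le> l2_inner M (\<lambda>x. u x + t * v x) (\<lambda>x. u x + t * v x)"
      by (rule l2_inner_self_nonneg)
    also have "\<dots> = l2_inner M u u + 2 * t * l2_inner M u v + t\<^sup>2 * l2_inner M v v"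
      using assms
      by (simp add: l2_inner_add_left l2_inner_add_right L2_add L2_cmult l2_inner_cmult_left
          l2_inner_cmult_right l2_inner_commute[of M v u] power2_eq_square algebra_simps)
    finally show "0 \<le> l2_inner M u u + 2 * t * l2_inner M u v + t\<^sup>2 * l2_inner M v v" .
  qed
  then have "sqrt ((l2_inner M u v)\<^sup>2) \<le> sqrt (l2_inner M u u * l2_inner M v v)"
    by (rule real_sqrt_le_mono)
  then show ?thesis by (simp add: l2_norm_def real_sqrt_mult)
qed

lemma l2_norm_triangle:
  assumes "u \<in> L2 M" "v \<in> L2 M"
  shows "l2_norm M (\<lambda>x. u x + v x) \<le> l2_norm M u + l2_norm M v"
proof (rule power2_le_imp_le)
  have "(l2_norm M (\<lambda>x. u x + v x))\<^sup>2 = (l2_norm M u)\<^sup>2 + 2 * l2_inner M u v + (l2_norm M v)\<^sup>2"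
    using assms by (simp add: l2_norm_square l2_inner_add_left l2_inner_add_right L2_add
        l2_inner_commute[of M v u])
  also have "\<dots> \<le> (l2_norm M u + l2_norm M v)\<^sup>2"
    using l2_Cauchy_Schwarz[OF assms] by (simp add: power2_sum)
  finally show "(l2_norm M (\<lambda>x. u x + v x))\<^sup>2 \<le> (l2_norm M u + l2_norm M v)\<^sup>2" .
qed (simp add: l2_norm_nonneg)

lemma l2_norm_cmult: "l2_norm M (\<lambda>x. a * u x) = \<bar>a\<bar> * l2_norm M u"
  by (simp add: l2_norm_def l2_inner_cmult_left l2_inner_cmult_right real_sqrt_mult mult.assoc[symmetric])

lemma l2_norm_mono:
  assumes "v \<in> L2 M" "u \<in> borel_measurable M" "0 \<le> C" "AE x in M. \<bar>u x\<bar> \<le> C * \<bar>v x\<bar>"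
  shows "l2_norm M u \<le> C * l2_norm M v"
proof -
  have u: "u \<in> L2 M" by (rule L2_dominated[OF assms(1,2,4)])
  have "(LINT x|M. (u x)\<^sup>2) \<le> (LINT x|M. C\<^sup>2 * (v x)\<^sup>2)"
  proof (rule integral_mono_AE)
    show "integrable M (\<lambda>x. (u x)\<^sup>2)" "integrable M (\<lambda>x. C\<^sup>2 * (v x)\<^sup>2)"
      using u assms by (auto simp: L2_def)
    show "AE x in M. (u x)\<^sup>2 \<le> C\<^sup>2 * (v x)\<^sup>2"
      using assms(4)
    proof eventually_elim
      case (elim x)
      then have "\<bar>u x\<bar>\<^sup>2 \<le> (C * \<bar>v x\<bar>)\<^sup>2" by (intro power_mono) auto
      then show ?case by (simp add: power_mult_distrib)
    qed
  qed
  then have "l2_norm M u \<le> sqrt (C\<^sup>2 * (LINT x|M. (v x)\<^sup>2))"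
    unfolding l2_norm_eq by simp
  also have "\<dots> = C * l2_norm M v" using assms(3) by (simp add: l2_norm_eq real_sqrt_mult)
  finally show ?thesis .
qed

lemma l2_norm_mult_le:
  assumes "u \<in> L2 M" "w \<in> borel_measurable M" "0 \<le> C" "\<And>x. x \<in> space M \<Longrightarrow> \<bar>w x\<bar> \<le> C"
  shows "l2_norm M (\<lambda>x. w x * u x) \<le> C * l2_norm M u"
  using assms by (intro l2_norm_mono) (auto simp: abs_mult intro!: AE_I2 mult_right_mono)

text \<open>Gram-Schmidt for a family that may be dependent modulo null sets: a residual of norm 0
  is dropped, so \<open>r\<close> may be smaller than \<open>n\<close>. Dropped elements agree with
  combinations of \<open>g\<close> only almost everywhere; hence completeness is expressed through
  orthogonality and not through pointwise spans.\<close>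

lemma L2_orthonormal_basis:
  fixes b :: "nat \<Rightarrow> 'a \<Rightarrow> real"
  assumes "\<And>i. i < n \<Longrightarrow> b i \<in> L2 M"
  shows "\<exists>(r::nat) g. (\<forall>k<r. \<exists>c. g k = (\<lambda>x. \<Sum>i<n. c i * b i x)) \<and>
    (\<forall>k<r. \<forall>l<r. l2_inner M (g k) (g l) = (if k = l then 1 else 0)) \<and>
    (\<forall>v\<in>L2 M. (\<forall>k<r. l2_inner M v (g k) = 0) \<longrightarrow> (\<forall>i<n. l2_inner M v (b i) = 0))"
  using assms
proof (induction n)
  case 0
  show ?case by (rule exI[of _ "0::nat"]) simp
next
  case (Suc n)
  from Suc obtain r :: nat and g where
    span: "\<forall>k<r. \<exists>c. g k = (\<lambda>x. \<Sum>i<n. c i * b i x)" and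
    orth0: "\<forall>k<r. \<forall>l<r. l2_inner M (g k) (g l) = (if k = l then 1 else 0)" and
    compl: "\<forall>v\<in>L2 M. (\<forall>k<r. l2_inner M v (g k) = 0) \<longrightarrow> (\<forall>i<n. l2_inner M v (b i) = 0)"
    by auto
  note orth = orth0[rule_format]
  have g: "g k \<in> L2 M" if kr: "k < r" for k
  proof -
    obtain c where "g k = (\<lambda>x. \<Sum>i<n. c i * b i x)" using span kr by blast
    then show ?thesis using Suc.prems by (auto intro!: L2_sum L2_cmult)
  qed
  have bn: "b n \<in> L2 M" using Suc.prems by simp
  define res where "res = (\<lambda>x. b n x - (\<Sum>k<r. l2_inner M (b n) (g k) * g k x))"
  have S: "(\<lambda>x. \<Sum>k<r. l2_inner M (b n) (g k) * g k x) \<in> L2 M"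
    using g by (intro L2_sum L2_cmult) auto
  have res: "res \<in> L2 M" unfolding res_def using bn S by (rule L2_diff)
  have inner_res: "l2_inner M v (b n) = l2_inner M v res"
    if v: "v \<in> L2 M" "\<forall>k<r. l2_inner M v (g k) = 0" for v
  proof -
    have "l2_inner M v (\<lambda>x. \<Sum>k<r. l2_inner M (b n) (g k) * g k x) = 0"
      using v g by (subst l2_inner_commute, subst l2_inner_sum_left)
        (auto intro!: L2_cmult sum.neutral simp: l2_inner_cmult_left l2_inner_commute[of M _ v])
    then show ?thesis unfolding res_def using v bn S by (simp add: l2_inner_diff_right)
  qed
  have res_g: "l2_inner M res (g l) = 0" if l: "l < r" for l
  proof -
    have "l2_inner M (\<lambda>x. \<Sum>k<r. l2_inner M (b n) (g k) * g k x) (g l)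
        = (\<Sum>k<r. l2_inner M (b n) (g k) * (if k = l then 1 else 0))"
      using g l by (subst l2_inner_sum_left) (auto intro!: L2_cmult sum.cong simp: l2_inner_cmult_left orth)
    also have "\<dots> = l2_inner M (b n) (g l)" using l by (simp add: if_distrib cong: if_cong)
    finally show ?thesis unfolding res_def using bn S g l by (simp add: l2_inner_diff_left)
  qed
  obtain cc where cc: "\<And>k. k < r \<Longrightarrow> g k = (\<lambda>x. \<Sum>i<n. cc k i * b i x)" using span by metis
  define cr where "cr i = (if i = n then 1 else - (\<Sum>k<r. l2_inner M (b n) (g k) * cc k i))" for i
  have res_span: "res = (\<lambda>x. \<Sum>i<Suc n. cr i * b i x)"
  proof
    fix x
    have "(\<Sum>k<r. l2_inner M (b n) (g k) * g k x)
        = (\<Sum>k<r. \<Sum>i<n. l2_inner M (b n) (g k) * (cc k i * b i x))"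
      using cc by (auto simp: sum_distrib_left intro!: sum.cong)
    also have "\<dots> = (\<Sum>i<n. \<Sum>k<r. l2_inner M (b n) (g k) * (cc k i * b i x))"
      by (rule sum.swap)
    finally show "res x = (\<Sum>i<Suc n. cr i * b i x)"
      by (simp add: res_def cr_def sum_distrib_right sum_negf mult.assoc)
  qed
  have spanSuc: "\<exists>c. g k = (\<lambda>x. \<Sum>i<Suc n. c i * b i x)" if "k < r" for k
    using cc[OF that] by (intro exI[of _ "\<lambda>i. if i = n then 0 else cc k i"]) (auto intro!: sum.cong)
  show ?case
  proof (cases "l2_inner M res res = 0")
    case True
    have "l2_inner M v (b i) = 0" if "v \<in> L2 M" "\<forall>k<r. l2_inner M v (g k) = 0" "i < Suc n" for v i
    proof (cases "i = n")
      case i: True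
      have "\<bar>l2_inner M v res\<bar> \<le> l2_norm M v * l2_norm M res"
        using that res by (intro l2_Cauchy_Schwarz)
      then have "l2_inner M v res = 0" by (simp add: l2_norm_def True)
      then show ?thesis using inner_res that i by simp
    qed (use that compl in auto)
    then show ?thesis using spanSuc orth by (intro exI[of _ r] exI[of _ g]) simp
  next
    case False
    define a where "a = l2_norm M res"
    have a: "a > 0" "a * a = l2_inner M res res" using False l2_inner_self_nonneg[of M res]
      by (auto simp: a_def l2_norm_def)
    define g' where "g' k = (if k = r then (\<lambda>x. (1 / a) * res x) else g k)" for k
    have "\<exists>c. g' k = (\<lambda>x. \<Sum>i<Suc n. c i * b i x)" if "k < Suc r" for k
    proof (cases "k = r")
      case True
      have "(1 / a) * res x = (\<Sum>i<Suc n. ((1 / a) * cr i) * b i x)" for x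
        unfolding fun_cong[OF res_span, of x] sum_distrib_left by (simp only: mult.assoc)
      then have "g' k = (\<lambda>x. \<Sum>i<Suc n. ((1 / a) * cr i) * b i x)"
        using True by (simp only: g'_def if_True refl)
      then show ?thesis by (rule exI[of _ "\<lambda>i. (1 / a) * cr i"])
    qed (use that spanSuc in \<open>auto simp: g'_def\<close>)
    moreover have "l2_inner M (g' k) (g' l) = (if k = l then 1 else 0)"
      if "k < Suc r" "l < Suc r" for k l
    proof -
      have "l2_inner M (g k) res = 0" if "k < r" for k
        using res_g[OF that] by (simp add: l2_inner_commute)
      moreover have "1 / a * (1 / a * l2_inner M res res) = 1"
        using a by (simp add: a(2)[symmetric])
      ultimately show ?thesis
        using that orth res_g a unfolding g'_def
        by (auto simp: l2_inner_cmult_left[of _ "1/a"] l2_inner_cmult_right[of _ _ "1/a"] simp del: times_divide_eq_left mult_1_left)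
    qed
    moreover have "l2_inner M v (b i) = 0"
      if v: "v \<in> L2 M" "\<forall>k<Suc r. l2_inner M v (g' k) = 0" and "i < Suc n" for v i
    proof -
      have vg: "\<forall>k<r. l2_inner M v (g k) = 0"
      proof (intro allI impI)
        fix k assume "k < r" then show "l2_inner M v (g k) = 0"
          using v(2)[rule_format, of k] by (simp add: g'_def)
      qed
      have "l2_inner M v (g' r) = 0" using v by simp
      then have "(1 / a) * l2_inner M v res = 0"
        by (simp only: g'_def if_True refl l2_inner_cmult_right)
      then have "l2_inner M v res = 0" using a by simp
      then show ?thesis using inner_res[OF v(1) vg] vg compl v(1) that(3)
        by (cases "i = n") auto
    qed
    ultimately show ?thesis by (intro exI[of _ "Suc r"] exI[of _ g']) simp
  qed
qed

text \<open>The coefficients refer to \<open>b\<close> itself, since the spline on a patch has to be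
  a pointwise combination of B-splines; each \<open>g k\<close> is expanded for that
  purpose.\<close>

lemma L2_projection_exists:
  fixes b :: "nat \<Rightarrow> 'a \<Rightarrow> real"
  assumes b: "\<And>i. i < n \<Longrightarrow> b i \<in> L2 M" and v: "v \<in> L2 M"
  shows "\<exists>c. \<forall>i<n. l2_inner M (\<lambda>x. v x - (\<Sum>k<n. c k * b k x)) (b i) = 0"
proof -
  obtain r :: nat and g where
    span: "\<forall>k<r. \<exists>c. g k = (\<lambda>x. \<Sum>i<n. c i * b i x)" and
    orth0: "\<forall>k<r. \<forall>l<r. l2_inner M (g k) (g l) = (if k = l then 1 else 0)" and
    compl: "\<forall>v\<in>L2 M. (\<forall>k<r. l2_inner M v (g k) = 0) \<longrightarrow> (\<forall>i<n. l2_inner M v (b i) = 0)"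
    using L2_orthonormal_basis[of n b M] b by auto
  note orth = orth0[rule_format]
  obtain cc where cc: "\<And>k. k < r \<Longrightarrow> g k = (\<lambda>x. \<Sum>i<n. cc k i * b i x)" using span by metis
  have g: "g k \<in> L2 M" if "k < r" for k
    using cc[OF that] b by (auto intro!: L2_sum L2_cmult)
  define w where "w = (\<lambda>x. \<Sum>k<r. l2_inner M v (g k) * g k x)"
  have w: "w \<in> L2 M" unfolding w_def using g by (intro L2_sum L2_cmult) auto
  have "l2_inner M (\<lambda>x. v x - w x) (g l) = 0" if l: "l < r" for l
  proof -
    have "l2_inner M w (g l) = (\<Sum>k<r. l2_inner M v (g k) * (if k = l then 1 else 0))"
      unfolding w_def
      using g l by (subst l2_inner_sum_left) (auto intro!: L2_cmult sum.cong simp: l2_inner_cmult_left orth)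
    also have "\<dots> = l2_inner M v (g l)" using l by (simp add: if_distrib cong: if_cong)
    finally show ?thesis using v w g l by (simp add: l2_inner_diff_left)
  qed
  then have "\<forall>i<n. l2_inner M (\<lambda>x. v x - w x) (b i) = 0"
    using compl L2_diff[OF v w] by auto
  moreover have "w x = (\<Sum>i<n. (\<Sum>k<r. l2_inner M v (g k) * cc k i) * b i x)" for x
  proof -
    have "w x = (\<Sum>k<r. \<Sum>i<n. l2_inner M v (g k) * (cc k i * b i x))"
      unfolding w_def using cc by (auto simp: sum_distrib_left intro!: sum.cong)
    also have "\<dots> = (\<Sum>i<n. \<Sum>k<r. l2_inner M v (g k) * (cc k i * b i x))"
      by (rule sum.swap)
    finally show ?thesis by (simp add: sum_distrib_right mult.assoc)
  qed
  ultimately show ?thesis by (intro exI[of _ "\<lambda>i. \<Sum>k<r. l2_inner M v (g k) * cc k i"]) simp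
qed

lemma L2_projection_finite:
  assumes J: "finite J" and b: "\<And>i. i \<in> J \<Longrightarrow> b i \<in> L2 M" and v: "v \<in> L2 M"
  shows "\<exists>c. \<forall>i\<in>J. l2_inner M (\<lambda>x. v x - (\<Sum>k\<in>J. c k * b k x)) (b i) = 0"
proof -
  obtain e where e: "bij_betw e {..<card J} J" using ex_bij_betw_nat_finite[OF J] by (auto simp: atLeast0LessThan)
  then have "b (e i) \<in> L2 M" if "i < card J" for i using b that by (auto simp: bij_betw_def)
  from L2_projection_exists[of "card J" "\<lambda>i. b (e i)", OF this v]
  obtain c where c: "\<forall>i<card J. l2_inner M (\<lambda>x. v x - (\<Sum>k<card J. c k * b (e k) x)) (b (e i)) = 0" by blast
  define d where "d j = c (the_inv_into {..<card J} e j)" for j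
  have d: "d (e k) = c k" if "k < card J" for k
    using e that by (simp add: d_def bij_betw_def the_inv_into_f_f)
  have S: "(\<Sum>k\<in>J. d k * b k x) = (\<Sum>k<card J. c k * b (e k) x)" for x
    unfolding sum.reindex_bij_betw[OF e, symmetric] using d by (intro sum.cong) auto
  have "l2_inner M (\<lambda>x. v x - (\<Sum>k\<in>J. d k * b k x)) (b j) = 0" if j: "j \<in> J" for j
  proof -
    have "j \<in> e ` {..<card J}" using e j by (simp add: bij_betw_def)
    then obtain i where "i < card J" "j = e i" by blast
    then show ?thesis unfolding S using c by simp
  qed
  then show ?thesis by blast
qed

section \<open>Best approximation from finite-dimensional spaces\<close>

definition lincomb_closed :: "('u \<Rightarrow> real) set \<Rightarrow> bool" where
  "lincomb_closed L \<longleftrightarrow> (\<forall>l\<in>L. \<forall>m\<in>L. \<forall>a b. (\<lambda>u. a * l u + b * m u) \<in> L)"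

lemma lincomb_closed_add: "lincomb_closed L \<Longrightarrow> l \<in> L \<Longrightarrow> m \<in> L \<Longrightarrow> (\<lambda>u. l u + m u) \<in> L"
  unfolding lincomb_closed_def by (drule bspec[of _ _ l], simp, drule bspec[of _ _ m], simp)
    (drule spec[of _ 1], drule spec[of _ 1], simp)

lemma lincomb_closed_diff: "lincomb_closed L \<Longrightarrow> l \<in> L \<Longrightarrow> m \<in> L \<Longrightarrow> (\<lambda>u. l u - m u) \<in> L"
  unfolding lincomb_closed_def by (drule bspec[of _ _ l], simp, drule bspec[of _ _ m], simp)
    (drule spec[of _ 1], drule spec[of _ "-1"], simp)

lemma lincomb_closed_scale: "lincomb_closed L \<Longrightarrow> l \<in> L \<Longrightarrow> (\<lambda>u. a * l u) \<in> L"
  unfolding lincomb_closed_def by (drule bspec[of _ _ l], simp, drule bspec[of _ _ l], simp)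
    (drule spec[of _ a], drule spec[of _ 0], simp)

lemma lincomb_closed_sum:
  assumes "lincomb_closed L" "(\<lambda>u. 0) \<in> L" "\<And>i. i < k \<Longrightarrow> b i \<in> L"
  shows "(\<lambda>u. \<Sum>i<(k::nat). c i * b i u) \<in> L"
  using assms(3)
proof (induction k)
  case (Suc k)
  then show ?case
    using lincomb_closed_add[OF assms(1) Suc.IH lincomb_closed_scale[OF assms(1), of "b k" "c k"]] by simp
qed (use assms in simp)

text \<open>Induction on the dimension. Once the last coefficient \<open>t\<close> is fixed, the
  others have an optimal choice by induction, and the remaining distance \<open>f t\<close> is
  Lipschitz in \<open>t\<close>. Either it grows linearly at infinity, so that a compact interval
  suffices, or the last element is redundant. Linear dependence among the \<open>b i\<close> is
  allowed.\<close>

lemma finite_dim_minimizer: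
  fixes n :: "('u \<Rightarrow> real) \<Rightarrow> real" and b :: "nat \<Rightarrow> 'u \<Rightarrow> real"
  assumes L: "lincomb_closed L"
    and tri: "\<And>l m. l \<in> L \<Longrightarrow> m \<in> L \<Longrightarrow> n (\<lambda>u. l u + m u) \<le> n l + n m"
    and hom: "\<And>l a. l \<in> L \<Longrightarrow> n (\<lambda>u. a * l u) = \<bar>a\<bar> * n l"
    and nonneg: "\<And>l. l \<in> L \<Longrightarrow> 0 \<le> n l"
    and b: "\<And>i. i < k \<Longrightarrow> b i \<in> L" and l: "l \<in> L"
  shows "\<exists>c. \<forall>d. n (\<lambda>u. l u - (\<Sum>i<k. c i * b i u)) \<le> n (\<lambda>u. l u - (\<Sum>i<k. d i * b i u))"
  using b l
proof (induction k arbitrary: l)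
  case 0
  show ?case by simp
next
  case (Suc k)
  note add = lincomb_closed_add[OF L] and diff = lincomb_closed_diff[OF L] and sc = lincomb_closed_scale[OF L]
  have z: "(\<lambda>u. 0) \<in> L" using sc[OF Suc.prems(2), of 0] by simp
  have cmb: "(\<lambda>u. \<Sum>i<k. c i * b i u) \<in> L" for c
    using Suc.prems(1) by (intro lincomb_closed_sum[OF L z]) auto
  have v: "b k \<in> L" using Suc.prems by simp
  have shift: "(\<lambda>u. l u - t * b k u) \<in> L" for t using diff[OF Suc.prems(2) sc[OF v, of t]] by simp
  have "\<forall>m\<in>L. \<exists>c. \<forall>d. n (\<lambda>u. m u - (\<Sum>i<k. c i * b i u)) \<le> n (\<lambda>u. m u - (\<Sum>i<k. d i * b i u))"
    using Suc by auto
  from bchoice[OF this] obtain C where C: "\<And>m d. m \<in> L \<Longrightarrow>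
      n (\<lambda>u. m u - (\<Sum>i<k. C m i * b i u)) \<le> n (\<lambda>u. m u - (\<Sum>i<k. d i * b i u))"
    by auto
  define dist where "dist m = n (\<lambda>u. m u - (\<Sum>i<k. C m i * b i u))" for m
  have dist_le: "dist m \<le> n (\<lambda>u. m u - (\<Sum>i<k. d i * b i u))" if "m \<in> L" for m d
    using C that unfolding dist_def by blast
  have dist_tri: "dist (\<lambda>u. m u + m' u) \<le> dist m + n m'" if m: "m \<in> L" "m' \<in> L" for m m'
  proof -
    have "dist (\<lambda>u. m u + m' u) \<le> n (\<lambda>u. (m u + m' u) - (\<Sum>i<k. C m i * b i u))"
      using dist_le add m by blast
    also have "\<dots> = n (\<lambda>u. (m u - (\<Sum>i<k. C m i * b i u)) + m' u)" by (simp add: algebra_simps)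
    also have "\<dots> \<le> dist m + n m'" unfolding dist_def using m diff cmb by (intro tri) auto
    finally show ?thesis .
  qed
  define f where "f t = dist (\<lambda>u. l u - t * b k u)" for t
  have lip: "\<bar>f t - f s\<bar> \<le> n (b k) * \<bar>t - s\<bar>" for t s
  proof -
    have "f t \<le> f s + n (b k) * \<bar>t - s\<bar>" for t s
    proof -
      have "f t = dist (\<lambda>u. (l u - s * b k u) + (s - t) * b k u)"
        unfolding f_def by (simp add: algebra_simps)
      also have "\<dots> \<le> f s + n (\<lambda>u. (s - t) * b k u)"
        unfolding f_def using shift sc[OF v] by (intro dist_tri) auto
      finally show ?thesis using hom[OF v, of "s - t"] by (simp add: mult.commute abs_minus_commute)
    qed
    from this[of t s] this[of s t] show ?thesis unfolding abs_minus_commute[of s t] by linarith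
  qed
  have cont: "continuous_on UNIV f"
    using lip nonneg[OF v]
    by (intro lipschitz_on_continuous_on[of "n (b k)"]) (auto simp: lipschitz_on_def dist_real_def)
  have "\<exists>t0. \<forall>t. f t0 \<le> f t"
  proof (cases "dist (b k) = 0")
    \<comment> \<open>The last element is at distance 0 from the span of the others, so its
      coefficient can be absorbed by theirs without increasing the error: \<open>t = 0\<close> is
      optimal.\<close>
    case True
    have "f 0 \<le> f t" for t
    proof -
      let ?v = "\<lambda>u. b k u - (\<Sum>i<k. C (b k) i * b i u)"
      define e where "e = (\<lambda>u. l u - t * b k u - (\<Sum>i<k. C (\<lambda>u. l u - t * b k u) i * b i u))"
      have eL: "e \<in> L" unfolding e_def using diff[OF shift cmb] .
      have vL: "?v \<in> L" using diff[OF v cmb] .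
      have "f 0 \<le> n (\<lambda>u. l u - (\<Sum>i<k. (C (\<lambda>u. l u - t * b k u) i + t * C (b k) i) * b i u))"
        unfolding f_def using dist_le[OF Suc.prems(2)] by simp
      also have "\<dots> = n (\<lambda>u. e u + t * ?v u)"
        by (simp add: e_def algebra_simps sum.distrib sum_distrib_left)
      also have "\<dots> \<le> n e + \<bar>t\<bar> * n ?v" using tri[OF eL sc[OF vL]] hom[OF vL] by simp
      also have "\<dots> = f t" using True by (simp add: e_def f_def dist_def)
      finally show ?thesis .
    qed
    then show ?thesis by blast
  next
    case False
    have "0 \<le> dist (b k)" unfolding dist_def using diff[OF v cmb] by (rule nonneg)
    with False have D: "dist (b k) > 0" by simp
    \<comment> \<open>The residual \<open>e\<close> at \<open>t\<close>, subtracted from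
      \<open>l\<close> and divided by \<open>t\<close>, is \<open>b k\<close> minus a combination of
      the other elements; it therefore competes in the definition of
      \<open>dist (b k)\<close>.\<close>
    have grow: "\<bar>t\<bar> * dist (b k) \<le> f t + n l" for t
    proof (cases "t = 0")
      case True
      then show ?thesis using nonneg[OF Suc.prems(2)] nonneg[OF diff[OF Suc.prems(2) cmb[of "C l"]]]
        by (simp add: f_def dist_def)
    next
      case t: False
      define e where "e = (\<lambda>u. l u - t * b k u - (\<Sum>i<k. C (\<lambda>u. l u - t * b k u) i * b i u))"
      have eL: "e \<in> L" unfolding e_def using diff[OF shift cmb] .
      have gL: "(\<lambda>u. b k u - (\<Sum>i<k. (- C (\<lambda>u. l u - t * b k u) i / t) * b i u)) \<in> L"
        using diff[OF v cmb] .
      have "\<bar>t\<bar> * dist (b k) \<le> \<bar>t\<bar> * n (\<lambda>u. b k u - (\<Sum>i<k. (- C (\<lambda>u. l u - t * b k u) i / t) * b i u))"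
        by (rule mult_left_mono[OF dist_le[OF v] abs_ge_zero])
      also have "\<dots> = n (\<lambda>u. t * (b k u - (\<Sum>i<k. (- C (\<lambda>u. l u - t * b k u) i / t) * b i u)))"
        using hom[OF gL] by simp
      also have "\<dots> = n (\<lambda>u. l u + (-1) * e u)"
        using t by (simp add: e_def algebra_simps sum_distrib_left sum_negf)
      also have "\<dots> \<le> n l + n e" using tri[OF Suc.prems(2) sc[OF eL, of "-1"]] hom[OF eL, of "-1"] by simp
      finally show ?thesis by (simp add: e_def f_def dist_def)
    qed
    \<comment> \<open>For \<open>\<bar>t\<bar> > R\<close> the linear growth already forces
      \<open>f t > f 0\<close>.\<close>
    define R where "R = (f 0 + n l) / dist (b k)"
    have R: "R \<ge> 0" using D grow[of 0] by (simp add: R_def)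
    obtain t0 where t0: "t0 \<in> {-R..R}" "\<forall>t\<in>{-R..R}. f t0 \<le> f t"
      using continuous_attains_inf[of "{-R..R}" f] continuous_on_subset[OF cont subset_UNIV] R by auto
    have "f t0 \<le> f t" for t
    proof (cases "t \<in> {-R..R}")
      case False
      then have "\<bar>t\<bar> > R" by auto
      then have "f 0 + n l < \<bar>t\<bar> * dist (b k)" using D by (simp add: R_def field_simps)
      with grow[of t] have "f 0 < f t" by simp
      moreover have "f t0 \<le> f 0" using t0(2) R by auto
      ultimately show ?thesis by simp
    qed (use t0 in auto)
    then show ?thesis by blast
  qed
  then obtain t0 where t0: "\<And>t. f t0 \<le> f t" by blast
  define c where "c i = (if i = k then t0 else C (\<lambda>u. l u - t0 * b k u) i)" for i
  have "n (\<lambda>u. l u - (\<Sum>i<Suc k. c i * b i u)) \<le> n (\<lambda>u. l u - (\<Sum>i<Suc k. d i * b i u))" for d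
  proof -
    have "n (\<lambda>u. l u - (\<Sum>i<Suc k. c i * b i u)) = f t0"
      by (simp add: f_def dist_def c_def algebra_simps)
    also have "\<dots> \<le> f (d k)" by (rule t0)
    also have "\<dots> \<le> n (\<lambda>u. (l u - d k * b k u) - (\<Sum>i<k. d i * b i u))"
      unfolding f_def by (rule dist_le[OF shift])
    also have "\<dots> = n (\<lambda>u. l u - (\<Sum>i<Suc k. d i * b i u))" by (simp add: algebra_simps)
    finally show ?thesis .
  qed
  then show ?case by blast
qed

text \<open>In an inner product space \<open>d t\<close> would be \<open>2 * t\<close> times the
  inner product of \<open>l\<close> and \<open>v\<close>. The parallelogram law yields only that
  \<open>d\<close> is odd and satisfies \<open>d (2 * t) = 2 * d t\<close>. Minimality bounds
  \<open>d\<close> from below by a quadratic; after rescaling by \<open>2 ^ k\<close> this lower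
  bound tends to 0, and oddness turns \<open>0 \<le> d\<close> into \<open>d = 0\<close>.\<close>

lemma minimizer_Pythagoras:
  fixes n :: "('u \<Rightarrow> real) \<Rightarrow> real"
  assumes L: "lincomb_closed L" and l: "l \<in> L" and v: "v \<in> L"
    and hom: "\<And>l a. l \<in> L \<Longrightarrow> n (\<lambda>u. a * l u) = \<bar>a\<bar> * n l"
    and par: "\<And>l m. l \<in> L \<Longrightarrow> m \<in> L \<Longrightarrow>
      (n (\<lambda>u. l u + m u))\<^sup>2 + (n (\<lambda>u. l u - m u))\<^sup>2 = 2 * (n l)\<^sup>2 + 2 * (n m)\<^sup>2"
    and min: "\<And>t. (n l)\<^sup>2 \<le> (n (\<lambda>u. l u + t * v u))\<^sup>2"
  shows "(n (\<lambda>u. l u + v u))\<^sup>2 = (n l)\<^sup>2 + (n v)\<^sup>2" "(n (\<lambda>u. l u - v u))\<^sup>2 = (n l)\<^sup>2 + (n v)\<^sup>2"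
proof -
  note sc = lincomb_closed_scale[OF L v]
  define g where "g t = (n (\<lambda>u. l u + t * v u))\<^sup>2" for t
  define d where "d t = g t - (n l)\<^sup>2 - t\<^sup>2 * (n v)\<^sup>2" for t
  have g0: "g 0 = (n l)\<^sup>2" by (simp add: g_def)
  have g_par: "g (s + t) + g (s - t) = 2 * g s + 2 * t\<^sup>2 * (n v)\<^sup>2" for s t
  proof -
    have "g (s + t) + g (s - t) = (n (\<lambda>u. (l u + s * v u) + t * v u))\<^sup>2 + (n (\<lambda>u. (l u + s * v u) - t * v u))\<^sup>2"
      by (simp add: g_def algebra_simps)
    also have "\<dots> = 2 * g s + 2 * (n (\<lambda>u. t * v u))\<^sup>2"
      unfolding g_def using lincomb_closed_add[OF L l sc] sc by (intro par) auto
    finally show ?thesis by (simp add: hom[OF v] power_mult_distrib)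
  qed
  have odd: "d (- t) = - d t" for t using g_par[of 0 t] by (simp add: d_def g0)
  have dbl: "d (2 * t) = 2 * d t" for t using g_par[of t t]
    by (simp add: d_def g0 power2_eq_square algebra_simps)
  have dbln: "d (2 ^ k * t) = 2 ^ k * d t" for k t
    by (induction k) (simp_all add: dbl mult.assoc)
  have lower: "- (t\<^sup>2 * (n v)\<^sup>2) \<le> d t" for t using min[of t] by (simp add: d_def g_def)
  have nn: "0 \<le> d t" for t
  proof (rule tendsto_upperbound[of "\<lambda>k. - (t\<^sup>2 * (n v)\<^sup>2) / 2 ^ k" _ sequentially, THEN order.trans[rotated]])
    have "(\<lambda>k. - (t\<^sup>2 * (n v)\<^sup>2) * (1 / 2) ^ k) \<longlonglongrightarrow> - (t\<^sup>2 * (n v)\<^sup>2) * 0"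
      by (intro tendsto_mult tendsto_const LIMSEQ_power_zero) auto
    then show "(\<lambda>k. - (t\<^sup>2 * (n v)\<^sup>2) / 2 ^ k) \<longlonglongrightarrow> 0" by (simp add: power_one_over)
    show "\<forall>\<^sub>F k in sequentially. - (t\<^sup>2 * (n v)\<^sup>2) / 2 ^ k \<le> d t"
    proof (intro always_eventually allI)
      fix k
      have "- ((t / 2 ^ k)\<^sup>2 * (n v)\<^sup>2) * 2 ^ k \<le> d (t / 2 ^ k) * 2 ^ k"
        using lower[of "t / 2 ^ k"] by (intro mult_right_mono) auto
      also have "\<dots> = d t" using dbln[of k "t / 2 ^ k"] by (simp add: mult.commute)
      finally show "- (t\<^sup>2 * (n v)\<^sup>2) / 2 ^ k \<le> d t" by (simp add: power2_eq_square field_simps)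
    qed
  qed auto
  have z: "d t = 0" for t using nn[of t] nn[of "- t"] odd[of t] by simp
  show "(n (\<lambda>u. l u + v u))\<^sup>2 = (n l)\<^sup>2 + (n v)\<^sup>2" using z[of 1] by (simp add: d_def g_def)
  show "(n (\<lambda>u. l u - v u))\<^sup>2 = (n l)\<^sup>2 + (n v)\<^sup>2" using z[of "-1"] by (simp add: d_def g_def)
qed

section \<open>B-splines\<close>

text \<open>The shape left after the end knots are dropped, with \<open>q = p - 1\<close>: the first
  and the last \<open>q + 1\<close> entries are 0 and 1. It is phrased by index because the B-spline
  recursion addresses knots by position.\<close>

definition open_knots :: "nat \<Rightarrow> real list \<Rightarrow> bool" where
  "open_knots q T \<longleftrightarrow> sorted T \<and> 2 * q + 2 \<le> length T \<and> (\<forall>i\<le>q. T ! i = 0) \<and>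
     (\<forall>i<length T. length T \<le> i + q + 1 \<longrightarrow> T ! i = 1)"

lemma bspline_nonzero_imp:
  assumes "sorted T" "i + q + 1 < length T" "bspline T q i x \<noteq> 0"
  shows "T ! i \<le> x \<and> x < T ! (i + q + 1)"
  using assms(2,3)
proof (induction q arbitrary: i)
  case (Suc q)
  have mono: "T ! i \<le> T ! (i + 1)" "T ! (i + q + 1) \<le> T ! (i + q + 2)"
    using assms(1) Suc.prems by (auto intro!: sorted_nth_mono)
  from Suc.prems(2) consider "bspline T q i x \<noteq> 0" | "bspline T q (i + 1) x \<noteq> 0" by force
  then show ?case
  proof cases
    case 1
    then show ?thesis using Suc.IH[of i] Suc.prems mono by simp
  next
    case 2
    then show ?thesis using Suc.IH[of "i + 1"] Suc.prems mono by simp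
  qed
qed (auto split: if_splits)

lemma sum_degree_0:
  assumes "sorted T" "k < length T" "T ! 0 \<le> x" "x < T ! k"
  shows "(\<Sum>i<k. bspline T 0 i x) = 1"
  using assms(2-)
proof (induction k)
  case (Suc k)
  show ?case
  proof (cases "x < T ! k")
    case True
    then show ?thesis using Suc by simp
  next
    case False
    have "bspline T 0 i x = 0" if "i < k" for i
      using False sorted_nth_mono[OF assms(1), of "i + 1" k] that Suc.prems by auto
    then show ?thesis using Suc.prems False by simp
  qed
qed simp

text \<open>In the recursion the factors of two consecutive dual polynomials differ in
  one root only, so that the weights of the B-spline \<open>bspline T q i\<close> add up to \<open>t - x\<close>.\<close>

lemma Marsden:
  assumes "sorted T" "2 * q + 2 \<le> length T" "\<forall>i\<le>q. T ! i = a"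
    "\<forall>i<length T. length T \<le> i + q + 1 \<longrightarrow> T ! i = b" "a \<le> x" "x < b"
  shows "(\<Sum>i<length T - q - 1. (\<Prod>l=1..q. t - T ! (i + l)) * bspline T q i x) = (t - x) ^ q"
  using assms(2-)
proof (induction q)
  case 0
  have "T ! (length T - 1) = b" using 0 by auto
  then show ?case using sum_degree_0[OF assms(1), of "length T - 1" x] 0 by auto
next
  case (Suc q)
  define k where "k = length T - q - 1"
  have len: "k \<ge> 1" "length T = k + q + 1" "k + q + 1 > q + 3" using Suc.prems(1) by (auto simp: k_def)
  define \<psi> where "\<psi> i = (\<Prod>l=1..Suc q. t - T ! (i + l))" for i
  define \<phi> where "\<phi> i = (\<Prod>l=1..q. t - T ! (i + l))" for i
  define B where "B i = bspline T q i x" for i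
  have IH: "(\<Sum>i<k. \<phi> i * B i) = (t - x) ^ q"
    unfolding \<phi>_def B_def k_def using Suc by auto
  have \<psi>1: "\<psi> i = \<phi> i * (t - T ! (i + q + 1))" for i
    unfolding \<psi>_def \<phi>_def by simp
  have \<psi>2: "\<psi> i = (t - T ! (i + 1)) * \<phi> (i + 1)" for i
  proof -
    have "\<psi> i = (t - T ! (i + 1)) * (\<Prod>l=Suc 1..Suc q. t - T ! (i + l))"
      unfolding \<psi>_def by (subst prod.atLeast_Suc_atMost) auto
    also have "(\<Prod>l=Suc 1..Suc q. t - T ! (i + l)) = (\<Prod>l=1..q. t - T ! (i + Suc l))"
      by (rule prod.shift_bounds_cl_Suc_ivl)
    finally show ?thesis by (simp add: \<phi>_def)
  qed
  define u where "u i = (x - T ! i) / (T ! (i + q + 1) - T ! i)" for i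
  define v where "v i = (T ! (i + q + 1) - x) / (T ! (i + q + 1) - T ! i)" for i
  have rec: "bspline T (Suc q) i x = u i * B i + v (i + 1) * B (i + 1)" for i
    by (simp add: u_def v_def B_def)
  have T0: "T ! (q + 1) = a" using Suc.prems(2) by simp
  \<comment> \<open>Knots clamped for degree \<open>Suc q\<close> are clamped once too often for
    degree \<open>q\<close>: the first and the last B-spline of degree \<open>q\<close> have empty
    support. The two shifted sums below can therefore be extended to a common range.\<close>
  have B0: "B 0 = 0"
  proof (rule ccontr)
    assume "B 0 \<noteq> 0"
    then have "x < T ! (q + 1)"
      using bspline_nonzero_imp[OF assms(1), of 0 q x] len by (simp add: B_def)
    then show False using T0 Suc.prems(4) by simp
  qed
  have T_last: "T ! (k - 1) = b" "T ! (k + q) = b"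
    using Suc.prems(3) len by auto
  have Bl: "B (k - 1) = 0"
  proof (rule ccontr)
    assume "B (k - 1) \<noteq> 0"
    then have "T ! (k - 1) \<le> x"
      using bspline_nonzero_imp[OF assms(1), of "k - 1" q x] len by (simp add: B_def)
    then show False using T_last Suc.prems(5) by simp
  qed
  obtain k' where k': "k = Suc k'" using len by (cases k) auto
  have key: "(\<phi> i * (t - T ! (i + q + 1)) * u i + (t - T ! i) * \<phi> i * v i) * B i = (t - x) * (\<phi> i * B i)"
    if "i < k" for i
  proof (cases "B i = 0")
    case False
    then have "T ! i \<le> x \<and> x < T ! (i + q + 1)"
      using bspline_nonzero_imp[OF assms(1), of i q x] that len by (simp add: B_def)
    then have "T ! i < T ! (i + q + 1)" by linarith
    then have d: "T ! (i + q + 1) - T ! i \<noteq> 0" by simp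
    have "(t - T ! (i + q + 1)) * u i + (t - T ! i) * v i
      = ((t - T ! (i + q + 1)) * (x - T ! i) + (t - T ! i) * (T ! (i + q + 1) - x)) / (T ! (i + q + 1) - T ! i)"
      by (simp add: u_def v_def add_divide_distrib)
    also have "(t - T ! (i + q + 1)) * (x - T ! i) + (t - T ! i) * (T ! (i + q + 1) - x)
       = (t - x) * (T ! (i + q + 1) - T ! i)" by (simp add: algebra_simps)
    finally have "(t - T ! (i + q + 1)) * u i + (t - T ! i) * v i = t - x" using d by simp
    then have "\<phi> i * B i * ((t - T ! (i + q + 1)) * u i + (t - T ! i) * v i) = \<phi> i * B i * (t - x)" by simp
    then show ?thesis by (simp add: algebra_simps)
  qed simp
  have "(\<Sum>i<length T - Suc q - 1. \<psi> i * bspline T (Suc q) i x) = (\<Sum>i<k'. \<psi> i * bspline T (Suc q) i x)"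
    using k' by (simp add: k_def)
  also have "\<dots> = (\<Sum>i<k'. \<psi> i * u i * B i) + (\<Sum>i<k'. \<psi> i * v (i + 1) * B (i + 1))"
    by (simp only: rec sum.distrib[symmetric] distrib_left mult.assoc)
  also have "(\<Sum>i<k'. \<psi> i * u i * B i) = (\<Sum>i<k. \<phi> i * (t - T ! (i + q + 1)) * u i * B i)"
    using Bl by (simp add: k' \<psi>1)
  also have "(\<Sum>i<k'. \<psi> i * v (i + 1) * B (i + 1)) = (\<Sum>i<k. (t - T ! i) * \<phi> i * v i * B i)"
    unfolding k' sum.lessThan_Suc_shift using B0 by (simp add: \<psi>2)
  also have "(\<Sum>i<k. \<phi> i * (t - T ! (i + q + 1)) * u i * B i) + (\<Sum>i<k. (t - T ! i) * \<phi> i * v i * B i)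
      = (\<Sum>i<k. (t - x) * (\<phi> i * B i))"
    unfolding sum.distrib[symmetric] using key by (intro sum.cong) (auto simp: distrib_right)
  also have "\<dots> = (t - x) ^ Suc q" using IH by (simp add: sum_distrib_left[symmetric])
  finally show ?case by (simp add: \<psi>_def)
qed

text \<open>Truncated to the left of \<open>\<tau>\<close>, this is the kernel of Cauchy's formula
  for repeated integration up to \<open>\<tau>\<close>. The case distinction makes degree 0 an
  indicator function.\<close>

definition trunc_power :: "nat \<Rightarrow> real \<Rightarrow> real \<Rightarrow> real" where
  "trunc_power q \<tau> x = (if x < \<tau> then (\<tau> - x) ^ q else 0)"

text \<open>In Marsden's identity with \<open>t = T ! l\<close> only the B-splines supported to the
  left of that knot are kept. If \<open>i < l \<le> i + q\<close>, the dual product has a zero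
  factor; if \<open>i \<ge> l\<close>, the B-spline vanishes left of the knot. To the right of the
  knot the kept ones vanish.\<close>

lemma trunc_power_knot_in_span:
  assumes T: "open_knots q T" and l: "l < length T"
  shows "\<exists>c. \<forall>x. 0 \<le> x \<and> x < 1 \<longrightarrow> trunc_power q (T ! l) x = (\<Sum>i<length T - q - 1. c i * bspline T q i x)"
proof -
  have s: "sorted T" using T by (simp add: open_knots_def)
  define c where "c i = (if i + q + 1 \<le> l then (\<Prod>j=1..q. T ! l - T ! (i + j)) else 0)" for i
  have "trunc_power q (T ! l) x = (\<Sum>i<length T - q - 1. c i * bspline T q i x)"
    if x: "0 \<le> x" "x < 1" for x
  proof (cases "x < T ! l")
    case True
    have eq: "(\<Prod>j=1..q. T ! l - T ! (i + j)) * bspline T q i x = c i * bspline T q i x"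
      if i: "i < length T - q - 1" for i
    proof (cases "i + q + 1 \<le> l")
      case False
      show ?thesis
      proof (cases "i < l")
        case True
        then have "l - i \<in> {1..q}" "i + (l - i) = l" using False by auto
        then have "(\<Prod>j=1..q. T ! l - T ! (i + j)) = 0" by (intro prod_zero) (auto intro!: bexI[of _ "l - i"])
        then show ?thesis using False by (simp add: c_def)
      next
        case g: False
        then have li: "T ! l \<le> T ! i" using i by (intro sorted_nth_mono[OF s]) auto
        have "bspline T q i x = 0"
        proof (rule ccontr)
          assume "bspline T q i x \<noteq> 0"
          then have "T ! i \<le> x" using bspline_nonzero_imp[OF s, of i q x] i by simp
          then show False using li \<open>x < T ! l\<close> by simp
        qed
        then show ?thesis by simp
      qed
    qed (simp add: c_def)
    have "(T ! l - x) ^ q = (\<Sum>i<length T - q - 1. (\<Prod>j=1..q. T ! l - T ! (i + j)) * bspline T q i x)"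
      using T x by (intro Marsden[symmetric, of T q 0 1]) (auto simp: open_knots_def)
    also have "\<dots> = (\<Sum>i<length T - q - 1. c i * bspline T q i x)"
      using eq by (intro sum.cong) auto
    finally show ?thesis using True by (simp add: trunc_power_def)
  next
    case False
    have "c i * bspline T q i x = 0" if i: "i < length T - q - 1" for i
    proof (cases "i + q + 1 \<le> l")
      case True
      then have il: "T ! (i + q + 1) \<le> T ! l" using l by (intro sorted_nth_mono[OF s]) auto
      have "bspline T q i x = 0"
      proof (rule ccontr)
        assume "bspline T q i x \<noteq> 0"
        then have "x < T ! (i + q + 1)" using bspline_nonzero_imp[OF s, of i q x] i by simp
        then show False using il False by simp
      qed
      then show ?thesis by simp
    qed (simp add: c_def)
    then have "(\<Sum>i<length T - q - 1. c i * bspline T q i x) = 0" by (intro sum.neutral) auto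
    then show ?thesis using False by (simp add: trunc_power_def)
  qed
  then show ?thesis by blast
qed

lemma power_in_span:
  assumes T: "open_knots q T"
  shows "\<exists>c. \<forall>x. 0 \<le> x \<and> x < 1 \<longrightarrow> (t - x) ^ q = (\<Sum>i<length T - q - 1. c i * bspline T q i x)"
proof (intro exI allI impI)
  fix x :: real assume "0 \<le> x \<and> x < 1"
  then show "(t - x) ^ q = (\<Sum>i<length T - q - 1. (\<Prod>l=1..q. t - T ! (i + l)) * bspline T q i x)"
    using T by (intro Marsden[symmetric, of T q 0 1]) (auto simp: open_knots_def)
qed

section \<open>Bounds for B-splines and the shortened knot vectors\<close>

lemma bspline_measurable [measurable]: "bspline T q i \<in> borel_measurable borel"
  by (induction q arbitrary: i) (simp_all add: bspline.simps[abs_def])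

lemma bspline_bounded:
  assumes "sorted T" "i + q + 1 < length T"
  shows "\<exists>C. \<forall>x. \<bar>bspline T q i x\<bar> \<le> C"
  using assms(2)
proof (induction q arbitrary: i)
  case 0
  show ?case by (intro exI[of _ 1]) auto
next
  case (Suc q)
  obtain C D where C: "\<And>x. \<bar>bspline T q i x\<bar> \<le> C" and D: "\<And>x. \<bar>bspline T q (i + 1) x\<bar> \<le> D"
    using Suc.IH[of i] Suc.IH[of "i + 1"] Suc.prems by auto
  define R where "R = \<bar>T ! i\<bar> + \<bar>T ! (i + q + 2)\<bar>"
  let ?w = "\<lambda>x. (x - T ! i) / (T ! (i + q + 1) - T ! i)"
  let ?v = "\<lambda>x. (T ! (i + q + 2) - x) / (T ! (i + q + 2) - T ! (i + 1))"
  define E where "E = 2 * R / \<bar>T ! (i + q + 1) - T ! i\<bar>"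
  define G where "G = 2 * R / \<bar>T ! (i + q + 2) - T ! (i + 1)\<bar>"
  have nn: "0 \<le> C" "0 \<le> D" "0 \<le> E" "0 \<le> G"
    using order.trans[OF abs_ge_zero C[of 0]] order.trans[OF abs_ge_zero D[of 0]]
    by (auto simp: E_def G_def R_def)
  have "\<bar>bspline T (Suc q) i x\<bar> \<le> E * C + G * D" for x
  proof (cases "bspline T (Suc q) i x = 0")
    case False
    then have "T ! i \<le> x" "x < T ! (i + q + 2)"
      using bspline_nonzero_imp[OF assms(1), of i "Suc q" x] Suc.prems by auto
    then have x: "\<bar>x - T ! i\<bar> \<le> 2 * R" "\<bar>T ! (i + q + 2) - x\<bar> \<le> 2 * R" by (auto simp: R_def)
    have "\<bar>?w x\<bar> \<le> E" "\<bar>?v x\<bar> \<le> G"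
      unfolding E_def G_def using x by (auto simp: abs_divide intro!: divide_right_mono)
    then have "\<bar>?w x * bspline T q i x\<bar> \<le> E * C" "\<bar>?v x * bspline T q (i + 1) x\<bar> \<le> G * D"
      unfolding abs_mult using C[of x] D[of x] nn(3,4) by (intro mult_mono; simp)+
    then show ?thesis unfolding bspline.simps(2) by linarith
  qed (use nn in simp)
  then show ?case by blast
qed

text \<open>The mesh size is measured in the full knot vector, whereas antiderivatives vanish at the
  knots of the shortened one. The second claim connects them: the knot at or before \<open>x\<close>
  survives, and its successor in the full vector lies beyond \<open>x\<close>.\<close>

lemma open_knot_vector_drop_end:
  assumes "open_knot_vector p \<Xi>"
  shows "open_knots (p - 1) (drop_end_knots \<Xi>)"
    and "\<And>x. 0 < x \<Longrightarrow> x < 1 \<Longrightarrow> \<exists>m. m + 1 < length \<Xi> \<and> \<Xi> ! m \<in> set (drop_end_knots \<Xi>) \<and>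
      \<Xi> ! m \<le> x \<and> x < \<Xi> ! (m + 1)"
proof -
  obtain k where k: "1 \<le> p" "p < k" "length \<Xi> = k + p + 1" "sorted \<Xi>" "\<forall>i\<le>p. \<Xi> ! i = 0"
    "\<Xi> ! p < \<Xi> ! (p + 1)" "\<Xi> ! (k - 1) < \<Xi> ! k" "\<forall>i\<in>{k..k + p}. \<Xi> ! i = 1"
    using assms unfolding open_knot_vector_def by blast
  let ?T = "drop_end_knots \<Xi>"
  have len: "length ?T = k + p - 1" using k by (simp add: drop_end_knots_def)
  have nth: "?T ! i = \<Xi> ! (i + 1)" if "i < k + p - 1" for i
    using that k len by (simp add: drop_end_knots_def nth_butlast nth_tl)
  have "sorted ?T" unfolding sorted_iff_nth_mono len
    using nth k by (auto intro!: sorted_nth_mono)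
  moreover have "2 * (p - 1) + 2 \<le> length ?T" using k len by auto
  moreover have "?T ! i = 0" if "i \<le> p - 1" for i using nth[of i] k that by auto
  moreover have "?T ! i = 1" if "i < length ?T" "length ?T \<le> i + (p - 1) + 1" for i
  proof -
    have "i + 1 \<in> {k..k + p}" using k that len by auto
    then show ?thesis using k(8) nth[of i] that len by auto
  qed
  ultimately show "open_knots (p - 1) ?T" by (simp add: open_knots_def)
  fix x :: real assume x: "0 < x" "x < 1"
  have ex: "\<exists>m. m \<le> k \<and> x < \<Xi> ! m" using k x by (intro exI[of _ k]) auto
  define n where "n = (LEAST m. x < \<Xi> ! m)"
  have n: "x < \<Xi> ! n" "n \<le> k" unfolding n_def using ex LeastI_ex[of "\<lambda>m. x < \<Xi> ! m"]
    by (auto intro: Least_le order.trans)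
  have n0: "n > p" using n k x by (metis not_le order.asym)
  have "\<not> x < \<Xi> ! (n - 1)" using n0 not_less_Least[of "n - 1" "\<lambda>m. x < \<Xi> ! m"] by (auto simp: n_def)
  \<comment> \<open>The first \<open>p + 1\<close> knots are 0, so \<open>n > p \<ge> 1\<close> and
    position \<open>n - 1\<close> is not the removed first entry; in the shortened list it has index
    \<open>n - 2\<close>.\<close>
  moreover have "\<Xi> ! (n - 1) \<in> set ?T"
  proof -
    have n2: "n - 2 < k + p - 1" "n - 2 + 1 = n - 1" using n0 n k by auto
    then have "\<Xi> ! (n - 1) = ?T ! (n - 2)" using nth[of "n - 2"] by simp
    then show ?thesis using n2 len by simp
  qed
  ultimately show "\<exists>m. m + 1 < length \<Xi> \<and> \<Xi> ! m \<in> set ?T \<and> \<Xi> ! m \<le> x \<and> x < \<Xi> ! (m + 1)"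
    using n n0 k by (intro exI[of _ "n - 1"]) auto
qed

section \<open>Antiderivatives on the unit interval\<close>

definition unit_measure :: "real measure" where
  "unit_measure = restrict_space lborel {0<..<1}"

lemma space_unit_measure [simp]: "space unit_measure = {0<..<1}"
  by (simp add: unit_measure_def space_restrict_space)

lemma measurable_unit_measure:
  "f \<in> borel_measurable borel \<Longrightarrow> f \<in> borel_measurable unit_measure"
  unfolding unit_measure_def by (intro measurable_restrict_space1) simp

lemma measurable_ident_unit_measure [measurable]: "(\<lambda>x. x) \<in> borel_measurable unit_measure"
  by (rule measurable_unit_measure) simp

interpretation unit: finite_measure unit_measure
  by standard (simp add: unit_measure_def emeasure_restrict_space space_restrict_space)

interpretation unit2: pair_sigma_finite unit_measure unit_measure ..

interpretation unit2': finite_measure "unit_measure \<Otimes>\<^sub>M unit_measure"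
  by (rule finite_measure_pair_measure) unfold_locales

lemma measure_unit_measure: "measure unit_measure {0<..<1} = 1"
  by (simp add: unit_measure_def measure_restrict_space)

lemma AE_unit_neq: "AE t in unit_measure. t \<noteq> x"
  unfolding unit_measure_def using AE_lborel_singleton[of x]
  by (subst AE_restrict_space_iff) auto

lemma AE_unitI: "(\<And>x. 0 < x \<Longrightarrow> x < 1 \<Longrightarrow> P x) \<Longrightarrow> AE x in unit_measure. P x"
  by (rule AE_I2) simp

lemma (in finite_measure) L2_integrable:
  assumes "u \<in> L2 M" shows "integrable M u"
proof -
  have "(\<lambda>x. 1) \<in> L2 M" by (simp add: L2_def)
  from L2_integrable_mult[OF assms this] show ?thesis by simp
qed

lemma (in finite_measure) L2_boundedI:
  assumes "u \<in> borel_measurable M" "AE x in M. \<bar>u x\<bar> \<le> C"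
  shows "u \<in> L2 M"
proof (rule L2_dominated)
  show "(\<lambda>x. 1) \<in> L2 M" by (simp add: L2_def)
  show "AE x in M. \<bar>u x\<bar> \<le> C * \<bar>1\<bar>" using assms by simp
qed (use assms in simp)

text \<open>A cutoff inside an integral over a fixed space makes the function total in
  \<open>x\<close>: 0 to the left of the interval and the full integral from 1 on. Vanishing at 1 is
  thus vanishing of the mean, and measurability in parameters is immediate.\<close>

definition antider :: "(real \<Rightarrow> real) \<Rightarrow> real \<Rightarrow> real" where
  "antider g x = (LINT t|unit_measure. (if t < x then g t else 0))"

lemma integrable_cut:
  assumes "integrable unit_measure (g :: real \<Rightarrow> real)" 
  shows "integrable unit_measure (\<lambda>t. if t < x then g t else 0)"
proof (rule Bochner_Integration.integrable_bound[OF assms])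
  have [measurable]: "g \<in> borel_measurable unit_measure" using assms by simp
  show "(\<lambda>t. if t < x then g t else 0) \<in> borel_measurable unit_measure" by measurable
qed auto

lemma antider_1: "1 \<le> x \<Longrightarrow> antider g x = (LINT t|unit_measure. g t)"
  unfolding antider_def by (intro Bochner_Integration.integral_cong) auto

lemma antider_cong: "(\<And>t. 0 < t \<Longrightarrow> t < 1 \<Longrightarrow> f t = g t) \<Longrightarrow> antider f x = antider g x"
  unfolding antider_def by (intro Bochner_Integration.integral_cong) auto

lemma antider_add:
  "integrable unit_measure f \<Longrightarrow> integrable unit_measure g \<Longrightarrow>
    antider (\<lambda>t. f t + g t) x = antider f x + antider g x"
  unfolding antider_def
  by (subst Bochner_Integration.integral_add[symmetric])
    (auto intro!: integrable_cut Bochner_Integration.integral_cong)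

lemma antider_cmult: "antider (\<lambda>t. c * g t) x = c * antider g x"
  unfolding antider_def integral_mult_right_zero[symmetric]
  by (intro Bochner_Integration.integral_cong) auto

lemma antider_abs_le:
  assumes "integrable unit_measure g"
  shows "\<bar>antider g x\<bar> \<le> (LINT t|unit_measure. \<bar>g t\<bar>)"
proof -
  have "\<bar>antider g x\<bar> \<le> (LINT t|unit_measure. \<bar>if t < x then g t else 0\<bar>)"
    unfolding antider_def by (rule integral_abs_bound)
  also have "\<dots> \<le> (LINT t|unit_measure. \<bar>g t\<bar>)"
    using assms integrable_cut[OF assms, of x] by (intro integral_mono) (auto intro!: integrable_abs)
  finally show ?thesis .
qed

lemma antider_measurable2:
  assumes [measurable]: "(\<lambda>(t, y). f t y) \<in> borel_measurable (unit_measure \<Otimes>\<^sub>M N)"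
    and [measurable]: "\<xi> \<in> borel_measurable N"
  shows "(\<lambda>y. antider (\<lambda>t. f t y) (\<xi> y)) \<in> borel_measurable N"
  unfolding antider_def by measurable

lemma antider_measurable:
  assumes [measurable]: "g \<in> borel_measurable unit_measure"
  shows "antider g \<in> borel_measurable borel"
proof -
  have "(\<lambda>x. antider (\<lambda>t. g t) ((\<lambda>x. x) x)) \<in> borel_measurable borel"
    by (rule antider_measurable2) measurable
  then show ?thesis by simp
qed

lemma measurable_antider:
  "integrable unit_measure g \<Longrightarrow> antider g \<in> borel_measurable unit_measure"
  by (rule measurable_unit_measure[OF antider_measurable[OF borel_measurable_integrable]])

lemma antider_L2:
  assumes "integrable unit_measure g" shows "antider g \<in> L2 unit_measure"
proof (rule unit.L2_boundedI)
  show "antider g \<in> borel_measurable unit_measure"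
    using assms by (rule measurable_antider)
  show "AE x in unit_measure. \<bar>antider g x\<bar> \<le> (LINT t|unit_measure. \<bar>g t\<bar>)"
    using antider_abs_le[OF assms] by simp
qed

lemma antider_iter_L2: "g \<in> L2 unit_measure \<Longrightarrow> (antider ^^ j) g \<in> L2 unit_measure"
  by (induction j) (auto intro!: antider_L2 unit.L2_integrable)

lemma integrable_mult_antider:
  assumes f: "integrable unit_measure f" and g: "integrable unit_measure g"
  shows "integrable unit_measure (\<lambda>x. f x * antider g x)"
proof (rule Bochner_Integration.integrable_bound)
  show "integrable unit_measure (\<lambda>x. f x * (LINT t|unit_measure. \<bar>g t\<bar>))" using f by simp
  show "(\<lambda>x. f x * antider g x) \<in> borel_measurable unit_measure"
    using borel_measurable_integrable[OF f] measurable_antider[OF g] by (rule borel_measurable_times)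
  show "AE x in unit_measure. norm (f x * antider g x) \<le> norm (f x * (LINT t|unit_measure. \<bar>g t\<bar>))"
  proof (rule AE_I2)
    fix x
    have "\<bar>antider g x\<bar> \<le> \<bar>LINT t|unit_measure. \<bar>g t\<bar>\<bar>" using antider_abs_le[OF g, of x] by linarith
    then show "norm (f x * antider g x) \<le> norm (f x * (LINT t|unit_measure. \<bar>g t\<bar>))"
      by (simp add: abs_mult mult_left_mono)
  qed
qed

text \<open>Fubini on the triangle \<open>x < t\<close>, so integrability is enough and no
  derivative of an antiderivative is ever formed. The two triangles exhaust the square up to the
  diagonal, a null set on each line.\<close>

lemma integral_by_parts_unit:
  assumes f: "integrable unit_measure f" and g: "integrable unit_measure g"
  shows "(LINT x|unit_measure. f x * antider g x) + (LINT x|unit_measure. antider f x * g x)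
    = (LINT x|unit_measure. f x) * (LINT x|unit_measure. g x)"
proof -
  have [measurable]: "f \<in> borel_measurable unit_measure" "g \<in> borel_measurable unit_measure"
    using f g by auto
  have I: "integrable (unit_measure \<Otimes>\<^sub>M unit_measure) (\<lambda>(x, t). if x < t then f x * g t else 0)"
  proof (rule Bochner_Integration.integrable_bound)
    show "integrable (unit_measure \<Otimes>\<^sub>M unit_measure) (\<lambda>(x, t). f x * g t)"
      using f g by (intro unit2.Fubini_integrable) (auto simp: abs_mult)
  qed auto
  have "(LINT x|unit_measure. antider f x * g x)
      = (LINT t|unit_measure. LINT x|unit_measure. (if x < t then f x * g t else 0))"
    unfolding antider_def integral_mult_left_zero[symmetric]
    by (intro Bochner_Integration.integral_cong) auto
  also have "\<dots> = (LINT x|unit_measure. LINT t|unit_measure. (if x < t then f x * g t else 0))"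
    by (rule unit2.Fubini_integral[OF I])
  also have "\<dots> = (LINT x|unit_measure. f x * (LINT t|unit_measure. (if x < t then g t else 0)))"
    unfolding integral_mult_right_zero[symmetric]
    by (intro Bochner_Integration.integral_cong) auto
  also have "\<dots> = (LINT x|unit_measure. f x * ((LINT t|unit_measure. g t) - antider g x))"
  proof (intro Bochner_Integration.integral_cong refl)
    fix x
    have c: "integrable unit_measure (\<lambda>t. if x < t then g t else 0)"
      by (rule Bochner_Integration.integrable_bound[OF g]) auto
    have "(LINT t|unit_measure. g t) = (LINT t|unit_measure. (if x < t then g t else 0) + (if t < x then g t else 0))"
      using AE_unit_neq[of x] by (intro integral_cong_AE) (auto elim!: eventually_mono)
    also have "\<dots> = (LINT t|unit_measure. (if x < t then g t else 0)) + antider g x"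
      unfolding antider_def using c integrable_cut[OF g] by simp
    finally show "f x * (LINT t|unit_measure. (if x < t then g t else 0)) = f x * ((LINT t|unit_measure. g t) - antider g x)"
      by simp
  qed
  also have "\<dots> = (LINT x|unit_measure. f x * (LINT t|unit_measure. g t) - f x * antider g x)"
    by (simp add: algebra_simps)
  also have "\<dots> = (LINT x|unit_measure. f x) * (LINT t|unit_measure. g t) - (LINT x|unit_measure. f x * antider g x)"
    using f integrable_mult_antider[OF f g] by simp
  finally show ?thesis by simp
qed

text \<open>Integration by parts applied to both functions cut off at \<open>x\<close>; the cutoff
  does not change their antiderivatives to the left of \<open>x\<close>.\<close>

lemma antider_mult:
  assumes f: "integrable unit_measure f" and g: "integrable unit_measure g"
  shows "antider f x * antider g x = antider (\<lambda>t. f t * antider g t + antider f t * g t) x"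
proof -
  let ?f = "\<lambda>t. if t < x then f t else 0" and ?g = "\<lambda>t. if t < x then g t else 0"
  have cut: "antider (\<lambda>t. if t < x then h t else 0) t = antider h t" if "t < x" for h t
    unfolding antider_def using that by (intro Bochner_Integration.integral_cong) auto
  have fg: "integrable unit_measure (\<lambda>t. f t * antider g t)" "integrable unit_measure (\<lambda>t. antider f t * g t)"
    using integrable_mult_antider[OF f g] integrable_mult_antider[OF g f] by (simp_all add: mult.commute)
  have "antider (\<lambda>t. f t * antider g t + antider f t * g t) x
      = antider (\<lambda>t. f t * antider g t) x + antider (\<lambda>t. antider f t * g t) x"
    using fg by (rule antider_add)
  also have "antider (\<lambda>t. f t * antider g t) x = (LINT t|unit_measure. ?f t * antider ?g t)"
    unfolding antider_def[of "\<lambda>t. f t * antider g t"]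
    by (intro Bochner_Integration.integral_cong) (auto simp: cut)
  also have "antider (\<lambda>t. antider f t * g t) x = (LINT t|unit_measure. antider ?f t * ?g t)"
    unfolding antider_def[of "\<lambda>t. antider f t * g t"]
    by (intro Bochner_Integration.integral_cong) (auto simp: cut)
  finally show ?thesis
    using integral_by_parts_unit[OF integrable_cut[OF f, of x] integrable_cut[OF g, of x]]
    by (simp add: antider_def)
qed

lemma continuous_integrable_unit:
  fixes f :: "real \<Rightarrow> real"
  assumes "continuous_on {0..1} f"
  shows "integrable unit_measure f"
proof -
  have "set_integrable lborel {0<..<1} f"
    by (rule set_integrable_subset[OF borel_integrable_atLeastAtMost'[OF assms]]) auto
  then show ?thesis
    unfolding unit_measure_def set_integrable_def by (subst integrable_restrict_space) auto
qed

lemma antider_FTC: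
  assumes F: "\<And>x. 0 \<le> x \<Longrightarrow> x \<le> 1 \<Longrightarrow> (F has_real_derivative f x) (at x within {0..1})"
    and f: "continuous_on {0..1} f" and x: "0 \<le> x" "x \<le> 1"
  shows "antider f x = F x - F 0"
proof -
  have "antider f x = (LINT t|lborel. indicator {0<..<1} t *\<^sub>R (if t < x then f t else 0))"
    unfolding antider_def unit_measure_def by (subst integral_restrict_space) auto
  also have "\<dots> = (LINT t|lborel. indicator {0..x} t *\<^sub>R f t)"
  proof -
    have S: "set_integrable lborel {0..1} f" by (rule borel_integrable_atLeastAtMost'[OF f])
    have m: "(\<lambda>t. indicator A t *\<^sub>R f t) \<in> borel_measurable lborel"
      if "A \<subseteq> {0..1}" "A \<in> sets borel" for A
      using set_integrable_subset[OF S, of A] that by (auto simp: set_integrable_def)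
    have eq: "indicator {0<..<1} t *\<^sub>R (if t < x then f t else 0) = indicator {0<..<x} t *\<^sub>R f t" for t
      using x by (auto simp: indicator_def)
    show ?thesis unfolding eq
      using AE_lborel_singleton[of 0] AE_lborel_singleton[of x] x
      by (intro integral_cong_AE m) (auto simp: indicator_def elim!: eventually_elim2)
  qed
  also have "\<dots> = F x - F 0"
  proof (rule integral_FTC_atLeastAtMost[OF x(1)])
    have sub: "{0..x} \<subseteq> {0..1}" using x by simp
    show "continuous_on {0..x} f" by (rule continuous_on_subset[OF f sub])
    fix t assume "0 \<le> t" "t \<le> x"
    then have "(F has_vector_derivative f t) (at t within {0..1})"
      using F[of t] x unfolding has_real_derivative_iff_has_vector_derivative by simp
    then show "(F has_vector_derivative f t) (at t within {0..x})"
      by (rule has_vector_derivative_within_subset[OF _ sub])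
  qed
  finally show ?thesis .
qed

text \<open>A continuously differentiable \<open>\<eta>\<close> is a constant plus an
  antiderivative, which reduces the claim to the product rule above. It is what differentiates the
  weight in the integration by parts along lines.\<close>

lemma antider_mult_smooth:
  assumes F: "\<And>x. 0 \<le> x \<Longrightarrow> x \<le> 1 \<Longrightarrow> (\<eta> has_real_derivative \<eta>' x) (at x within {0..1})"
    and c: "continuous_on {0..1} \<eta>'" and x: "0 \<le> x" "x \<le> 1" and g: "integrable unit_measure g"
  shows "\<eta> x * antider g x = antider (\<lambda>t. \<eta>' t * antider g t + \<eta> t * g t) x"
proof -
  have e: "\<eta> t = \<eta> 0 + antider \<eta>' t" if "0 \<le> t" "t \<le> 1" for t
    using antider_FTC[OF F c that] by simp
  note i = continuous_integrable_unit[OF c]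
  have "\<eta> x * antider g x = antider (\<lambda>t. \<eta> 0 * g t) x + antider \<eta>' x * antider g x"
    using e[OF x] by (simp add: antider_cmult algebra_simps)
  also have "\<dots> = antider (\<lambda>t. \<eta> 0 * g t) x + antider (\<lambda>t. \<eta>' t * antider g t + antider \<eta>' t * g t) x"
    by (simp add: antider_mult[OF i g])
  also have "\<dots> = antider (\<lambda>t. \<eta> 0 * g t + (\<eta>' t * antider g t + antider \<eta>' t * g t)) x"
    using g integrable_mult_antider[OF i g] integrable_mult_antider[OF g i]
    by (intro antider_add[symmetric]) (auto simp: mult.commute)
  also have "\<dots> = antider (\<lambda>t. \<eta>' t * antider g t + \<eta> t * g t) x"
  proof (rule antider_cong)
    fix t :: real assume "0 < t" "t < 1"
    then show "\<eta> 0 * g t + (\<eta>' t * antider g t + antider \<eta>' t * g t) = \<eta>' t * antider g t + \<eta> t * g t"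
      using e[of t] by (simp add: distrib_right)
  qed
  finally show ?thesis .
qed

text \<open>Cauchy's formula for repeated integration. Each step peels off one antiderivative by the
  product rule: the power of \<open>\<tau> - t\<close> vanishes at \<open>\<tau>\<close> and leaves
  no boundary term, while its exponent contributes one factor of the factorial.\<close>

lemma antider_iter_trunc_power:
  assumes e: "e \<in> L2 unit_measure" and \<tau>: "0 \<le> \<tau>" "\<tau> \<le> 1"
  shows "(antider ^^ Suc j) e \<tau> = (LINT t|unit_measure. e t * trunc_power j \<tau> t) / fact j"
proof -
  have step: "antider (\<lambda>t. (\<tau> - t) ^ Suc i * g t) \<tau> = real (Suc i) * antider (\<lambda>t. (\<tau> - t) ^ i * antider g t) \<tau>"
    if g: "g \<in> L2 unit_measure" for g i
  proof -
    let ?\<eta> = "\<lambda>t. (\<tau> - t) ^ Suc i" and ?\<eta>' = "\<lambda>t. - (real (Suc i) * (\<tau> - t) ^ i)"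
    have gi: "integrable unit_measure g" using g by (rule unit.L2_integrable)
    have c: "continuous_on {0..1} ?\<eta>'" "continuous_on {0..1} ?\<eta>" by (intro continuous_intros)+
    have bdd: "\<bar>(\<tau> - t) ^ k\<bar> \<le> 1" if "t \<in> space unit_measure" for t k
    proof -
      have "\<bar>\<tau> - t\<bar> \<le> 1" using that \<tau> by (auto simp: abs_le_iff)
      then show ?thesis by (simp add: power_abs power_le_one)
    qed
    have int: "integrable unit_measure (\<lambda>t. ?\<eta> t * g t)"
      by (intro unit.L2_integrable L2_bounded_mult[OF g, of _ 1] bdd measurable_unit_measure) measurable
    have int': "integrable unit_measure (\<lambda>t. ?\<eta>' t * antider g t)"
      by (intro integrable_mult_antider continuous_integrable_unit c gi)
    have "0 = ?\<eta> \<tau> * antider g \<tau>" by simp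
    also have "\<dots> = antider (\<lambda>t. ?\<eta>' t * antider g t + ?\<eta> t * g t) \<tau>"
    proof (rule antider_mult_smooth[OF _ c(1) \<tau> gi])
      fix x :: real
      have "((\<lambda>t. \<tau> - t) has_real_derivative -1) (at x within {0..1})"
        by (auto intro!: derivative_eq_intros)
      from DERIV_power_Suc[OF this, of i]
      show "(?\<eta> has_real_derivative ?\<eta>' x) (at x within {0..1})" by simp
    qed
    also have "\<dots> = antider (\<lambda>t. ?\<eta>' t * antider g t) \<tau> + antider (\<lambda>t. ?\<eta> t * g t) \<tau>"
      by (rule antider_add[OF int' int])
    also have "antider (\<lambda>t. ?\<eta>' t * antider g t) \<tau> = - real (Suc i) * antider (\<lambda>t. (\<tau> - t) ^ i * antider g t) \<tau>"
      using antider_cmult[of "- real (Suc i)" "\<lambda>t. (\<tau> - t) ^ i * antider g t" \<tau>]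
      by (simp only: mult.assoc mult_minus_left)
    finally show ?thesis by (simp add: algebra_simps)
  qed
  have "antider (\<lambda>t. (\<tau> - t) ^ j * g t) \<tau> = fact j * (antider ^^ Suc j) g \<tau>" if "g \<in> L2 unit_measure" for g
    using that
  proof (induction j arbitrary: g)
    case (Suc j)
    have "antider (\<lambda>t. (\<tau> - t) ^ Suc j * g t) \<tau> = real (Suc j) * (fact j * (antider ^^ Suc j) (antider g) \<tau>)"
      using step[OF Suc.prems] Suc.IH[of "antider g"] antider_L2 unit.L2_integrable Suc.prems by auto
    then show ?case by (simp add: funpow_swap1)
  qed simp
  from this[OF e] have "fact j * (antider ^^ Suc j) e \<tau> = antider (\<lambda>t. (\<tau> - t) ^ j * e t) \<tau>" ..
  also have "\<dots> = (LINT t|unit_measure. e t * trunc_power j \<tau> t)"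
    unfolding antider_def by (intro Bochner_Integration.integral_cong) (auto simp: trunc_power_def)
  finally show ?thesis by (simp add: field_simps)
qed

section \<open>Smooth functions\<close>

lemma partial_eq:
  "(f has_derivative D) (at x) \<Longrightarrow> partial i f x = D (axis i 1)"
  unfolding partial_def by (simp add: frechet_derivative_at[symmetric])

lemma partial_cong_open:
  assumes "open U" "x \<in> U" "\<And>y. y \<in> U \<Longrightarrow> f y = g y"
  shows "partial i f x = partial i g x"
proof -
  have "(f has_derivative D) (at x) \<longleftrightarrow> (g has_derivative D) (at x)" for D
    using assms has_derivative_transform_within_open[of f D x UNIV U g]
      has_derivative_transform_within_open[of g D x UNIV U f] by auto
  then show ?thesis unfolding partial_def frechet_derivative_def by simp
qed

lemma Ck_on_cong:
  assumes "open U" "\<And>y. y \<in> U \<Longrightarrow> f y = g y" "Ck_on k U f"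
  shows "Ck_on k U g"
  using assms(2,3)
proof (induction k arbitrary: f g)
  case 0
  then show ?case using continuous_on_cong[of U U f g] by simp
next
  case (Suc k)
  have "g differentiable (at x)" if "x \<in> U" for x
  proof -
    have "(f has_derivative frechet_derivative f (at x)) (at x)"
      using Suc.prems(2) that by (simp add: frechet_derivative_works)
    then have "(g has_derivative frechet_derivative f (at x)) (at x)"
      by (rule has_derivative_transform_within_open[OF _ assms(1) that]) (rule Suc.prems(1))
    then show ?thesis by (rule differentiableI)
  qed
  moreover have "Ck_on k U (partial i g)" for i
    using Suc.IH[of "partial i f" "partial i g"] Suc.prems partial_cong_open[OF assms(1), of _ f g i] by auto
  ultimately show ?case by simp
qed

lemma Ck_on_SucD: "Ck_on (Suc k) U f \<Longrightarrow> Ck_on k U f"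
proof (induction k arbitrary: f)
  case 0
  then show ?case
    by (auto intro!: continuous_at_imp_continuous_on differentiable_imp_continuous_within)
next
  case (Suc k)
  then show ?case by (metis Ck_on.simps(2))
qed

lemma Ck_on_subset: "Ck_on k U f \<Longrightarrow> V \<subseteq> U \<Longrightarrow> Ck_on k V f"
  by (induction k arbitrary: f) (auto intro: continuous_on_subset)

lemma Ck_on_continuous: "Ck_on k U f \<Longrightarrow> continuous_on U f"
  by (induction k) (use Ck_on_SucD in auto)

lemma Ck_on_add:
  assumes "open U" "Ck_on k U f" "Ck_on k U g"
  shows "Ck_on k U (\<lambda>x. f x + g x)"
  using assms(2,3)
proof (induction k arbitrary: f g)
  case (Suc k)
  have d: "f differentiable (at x)" "g differentiable (at x)" if "x \<in> U" for x using Suc.prems that by auto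
  have "Ck_on k U (partial i (\<lambda>x. f x + g x))" for i
  proof (rule Ck_on_cong[OF assms(1)])
    show "Ck_on k U (\<lambda>x. partial i f x + partial i g x)" using Suc by auto
    fix x assume "x \<in> U"
    then have "((\<lambda>x. f x + g x) has_derivative
        (\<lambda>h. frechet_derivative f (at x) h + frechet_derivative g (at x) h)) (at x)"
      using d unfolding frechet_derivative_works by (intro has_derivative_add) auto
    from partial_eq[OF this, of i] show "partial i f x + partial i g x = partial i (\<lambda>x. f x + g x) x"
      by (simp add: partial_def)
  qed
  then show ?case using d by auto
qed (auto intro: continuous_on_add)

lemma Ck_on_bilinear:
  assumes "open U" and b: "bounded_bilinear bop" and "Ck_on k U f" "Ck_on k U g"
  shows "Ck_on k U (\<lambda>x. bop (f x) (g x))"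
  using assms(3,4)
proof (induction k arbitrary: f g)
  case 0
  then show ?case using bounded_bilinear.continuous_on[OF b] by auto
next
  case (Suc k)
  have hd: "((\<lambda>x. bop (f x) (g x)) has_derivative
      (\<lambda>h. bop (f x) (frechet_derivative g (at x) h) + bop (frechet_derivative f (at x) h) (g x))) (at x)"
    if "x \<in> U" for x
    using Suc.prems that unfolding Ck_on.simps frechet_derivative_works
    by (intro bounded_bilinear.FDERIV[OF b]) auto
  have "Ck_on k U (partial i (\<lambda>x. bop (f x) (g x)))" for i
  proof (rule Ck_on_cong[OF assms(1)])
    show "Ck_on k U (\<lambda>x. bop (f x) (partial i g x) + bop (partial i f x) (g x))"
      using Suc.prems Ck_on_SucD[OF Suc.prems(1)] Ck_on_SucD[OF Suc.prems(2)]
      by (intro Ck_on_add assms(1) Suc.IH) simp_all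
    show "bop (f x) (partial i g x) + bop (partial i f x) (g x) = partial i (\<lambda>x. bop (f x) (g x)) x"
      if "x \<in> U" for x
      using partial_eq[OF hd[OF that], of i] by (simp add: partial_def)
  qed
  then show ?case using hd by (auto simp: differentiable_def)
qed

lemma Ck_on_const: "Ck_on k U (\<lambda>x. c)"
proof (induction k arbitrary: c)
  case (Suc k)
  have "partial i (\<lambda>x :: real^'a. c) = (\<lambda>x. 0)" for i
    by (rule ext, subst partial_eq[OF has_derivative_const]) simp
  then show ?case using Suc[of 0] by simp
qed simp

text \<open>The reciprocal root suits the induction better than the root: its derivative is
  \<open>-1/2\<close> times the derivative of \<open>g\<close> times the cube of the function
  itself. The root is recovered as \<open>g * (1 / sqrt g)\<close>.\<close>

lemma Ck_on_rsqrt: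
  fixes g :: "real^'n \<Rightarrow> real"
  assumes "open U" "Ck_on k U g" "\<And>x. x \<in> U \<Longrightarrow> 0 < g x"
  shows "Ck_on k U (\<lambda>x. 1 / sqrt (g x))"
  using assms(2)
proof (induction k)
  case 0
  have "sqrt (g x) \<noteq> 0" if "x \<in> U" for x using assms(3)[OF that] by simp
  then show ?case using 0 by (auto intro!: continuous_intros simp del: real_sqrt_eq_0_iff)
next
  case (Suc k)
  let ?r = "\<lambda>x. 1 / sqrt (g x)"
  have r: "Ck_on k U ?r" by (rule Suc.IH[OF Ck_on_SucD[OF Suc.prems]])
  have hd: "(?r has_derivative (\<lambda>h. - 1 / 2 * frechet_derivative g (at x) h * (?r x * (?r x * ?r x)))) (at x)"
    if x: "x \<in> U" for x
  proof -
    have g: "(g has_derivative frechet_derivative g (at x)) (at x)"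
      using Suc.prems x by (simp add: frechet_derivative_works)
    have eq: "- (inverse s * (inverse s / 2) * inverse s) = - 1 / 2 * (1 / s * (1 / s * (1 / s)))" for s :: real
      by (simp add: inverse_eq_divide)
    have "sqrt (g x) \<noteq> 0" using assms(3)[OF x] by simp
    from DERIV_inverse'[OF DERIV_real_sqrt[OF assms(3)[OF x]] this]
    have "((\<lambda>y. 1 / sqrt y) has_real_derivative (- 1 / 2 * (?r x * (?r x * ?r x)))) (at (g x))"
      unfolding eq unfolding inverse_eq_divide .
    from has_derivative_compose[OF g this[unfolded has_field_derivative_def]]
    show ?thesis by (simp add: algebra_simps)
  qed
  have "Ck_on k U (partial i ?r)" for i
  proof (rule Ck_on_cong[OF assms(1)])
    note m = Ck_on_bilinear[OF assms(1) bounded_bilinear_mult]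
    show "Ck_on k U (\<lambda>x. - 1 / 2 * partial i g x * (?r x * (?r x * ?r x)))"
      using Suc.prems r by (intro m Ck_on_const) auto
    show "- 1 / 2 * partial i g x * (?r x * (?r x * ?r x)) = partial i ?r x" if "x \<in> U" for x
      using partial_eq[OF hd[OF that], of i] by (simp add: partial_def)
  qed
  then show ?case using hd by (auto simp: differentiable_def)
qed

text \<open>A norm is smooth only away from zero. By Lagrange's identity its square is a polynomial
  in inner products of the partial derivatives, and regularity makes this square positive on an open
  neighbourhood of the closed square.\<close>

lemma jac_smooth:
  assumes "regular_patch F"
  shows "\<exists>U. open U \<and> closed_square \<subseteq> U \<and> (\<forall>k. Ck_on k U F \<and> Ck_on k U (jac F))"
proof -
  obtain U where U: "open U" "closed_square \<subseteq> U" "\<And>k. Ck_on k U F"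
    using assms by (auto simp: regular_patch_def smooth_on_def)
  let ?a = "partial 1 F" and ?b = "partial 2 F"
  define g where "g x = (?a x \<bullet> ?a x) * (?b x \<bullet> ?b x) + (- 1) * ((?a x \<bullet> ?b x) * (?a x \<bullet> ?b x))" for x
  have ab: "Ck_on k U ?a" "Ck_on k U ?b" for k using U(3)[of "Suc k"] by auto
  have g: "Ck_on k U g" for k unfolding g_def
    by (intro Ck_on_add Ck_on_bilinear[OF U(1) bounded_bilinear_mult] U(1) Ck_on_const
        Ck_on_bilinear[OF U(1) bounded_bilinear_inner] ab)
  have jac2: "(jac F x)\<^sup>2 = g x" for x
    unfolding jac_def g_def using norm_cross_dot[of "?a x" "?b x"]
    by (simp add: power_mult_distrib dot_square_norm power2_eq_square[of "?a x \<bullet> ?b x", symmetric])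
  define V where "V = {x \<in> U. g x > 0}"
  have "V = U \<inter> g -` {0<..}" by (auto simp: V_def)
  then have V: "open V"
    using continuous_open_preimage[OF Ck_on_continuous[OF g[of 0]] U(1) open_greaterThan] by simp
  have VU: "V \<subseteq> U" by (auto simp: V_def)
  have "closed_square \<subseteq> V"
  proof
    fix x assume x: "x \<in> closed_square"
    then have "jac F x \<noteq> 0" using assms by (auto simp: regular_patch_def)
    then have "0 < (jac F x)\<^sup>2" by simp
    then show "x \<in> V" using x U(2) jac2[of x] by (auto simp: V_def)
  qed
  moreover have "Ck_on k V (jac F)" for k
  proof (rule Ck_on_cong[OF V])
    show "Ck_on k V (\<lambda>x. g x * (1 / sqrt (g x)))"
      using Ck_on_subset[OF g VU] by (intro Ck_on_bilinear[OF V bounded_bilinear_mult] Ck_on_rsqrt[OF V]) (auto simp: V_def)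
    show "g x * (1 / sqrt (g x)) = jac F x" if "x \<in> V" for x
    proof -
      have "sqrt (g x) = jac F x" using jac2[of x] by (metis jac_def norm_ge_zero real_sqrt_unique)
      moreover have "g x > 0" using that by (simp add: V_def)
      ultimately show ?thesis using real_div_sqrt[of "g x"] by simp
    qed
  qed
  ultimately show ?thesis using V Ck_on_subset[OF U(3) VU] by blast
qed

lemma Ck_on_partial_iter: "Ck_on (k + l) U f \<Longrightarrow> Ck_on k U ((partial i ^^ l) f)"
proof (induction l arbitrary: k)
  case (Suc l)
  from Suc.IH[of "Suc k"] Suc.prems show ?case by simp
qed simp

section \<open>Coordinates of the square and derivatives along its lines\<close>

lemma other_index: "(k :: 2) \<noteq> i \<longleftrightarrow> k = i + 1"
proof -
  have "i + 1 \<noteq> i" by simp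
  then show ?thesis using exhaust_2[of i] exhaust_2[of k] exhaust_2[of "i + 1"] by metis
qed

lemma edge_pt_nth [simp]: "edge_pt i x y $ i = x" "edge_pt i x y $ (i + 1) = y"
  by (simp_all add: edge_pt_def)

lemma edge_pt_eta: "edge_pt i (z $ i) (z $ (i + 1)) = z"
proof -
  have "edge_pt i (z $ i) (z $ (i + 1)) $ k = z $ k" for k
    using other_index[of k i] by (cases "k = i") (auto simp: edge_pt_def)
  then show ?thesis by (simp only: vec_eq_iff simp_thms)
qed

lemma has_derivative_edge_pt:
  "((\<lambda>t. edge_pt i t y) has_derivative (\<lambda>h. h *\<^sub>R axis i 1)) (at x within S)"
proof -
  have "(\<lambda>t. edge_pt i t y) = (\<lambda>t. t *\<^sub>R axis i 1 + edge_pt i 0 y)"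
    by (simp add: fun_eq_iff edge_pt_def vec_eq_iff axis_def)
  moreover have "((\<lambda>t. t *\<^sub>R axis i 1 + edge_pt i 0 y) has_derivative (\<lambda>h. h *\<^sub>R axis i 1)) (at x within S)"
    by (auto intro!: derivative_eq_intros)
  ultimately show ?thesis by simp
qed

lemma partial_edge_pt:
  fixes f :: "real^2 \<Rightarrow> real"
  assumes "f differentiable (at (edge_pt i x y))"
  shows "((\<lambda>t. f (edge_pt i t y)) has_real_derivative partial i f (edge_pt i x y)) (at x within S)"
proof -
  let ?D = "frechet_derivative f (at (edge_pt i x y))"
  have f: "(f has_derivative ?D) (at (edge_pt i x y))" using assms by (simp add: frechet_derivative_works)
  have "((\<lambda>t. f (edge_pt i t y)) has_derivative (\<lambda>h. ?D (h *\<^sub>R axis i 1))) (at x within S)"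
    by (rule has_derivative_compose[OF has_derivative_edge_pt f])
  moreover have "?D (h *\<^sub>R axis i 1) = partial i f (edge_pt i x y) * h" for h
    using linear_scale[OF has_derivative_linear[OF f], of h "axis i 1"] by (simp add: partial_def)
  ultimately show ?thesis by (simp add: has_field_derivative_def)
qed

section \<open>Smooth functions of one real variable\<close>

definition smooth_real :: "(real \<Rightarrow> real) set" where
  "smooth_real = {f. \<exists>D. D 0 = f \<and> (\<forall>n x. (D n has_real_derivative D (Suc n) x) (at x))}"

text \<open>Any set of functions closed under some choice of derivative consists of smooth
  functions. Closure properties then require only a first derivative and no formula for the n-th
  one.\<close>

lemma smooth_real_coinduct:
  assumes "f \<in> S" and "\<And>f. f \<in> S \<Longrightarrow> \<exists>f'\<in>S. \<forall>x. (f has_real_derivative f' x) (at x)"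
  shows "f \<in> smooth_real"
proof -
  obtain d where d: "\<And>f. f \<in> S \<Longrightarrow> d f \<in> S \<and> (\<forall>x. (f has_real_derivative d f x) (at x))"
    using assms(2) by metis
  have "(d ^^ n) f \<in> S" for n using assms(1) d by (induction n) auto
  then show ?thesis unfolding smooth_real_def using d
    by (intro CollectI exI[of _ "\<lambda>n. (d ^^ n) f"]) auto
qed

lemma smooth_real_deriv:
  assumes "f \<in> smooth_real"
  shows "\<exists>f'\<in>smooth_real. \<forall>x. (f has_real_derivative f' x) (at x)"
proof -
  obtain D where "D 0 = f" "\<forall>n x. (D n has_real_derivative D (Suc n) x) (at x)"
    using assms by (auto simp: smooth_real_def)
  then show ?thesis
    by (intro bexI[of _ "D 1"]) (auto simp: smooth_real_def intro!: exI[of _ "\<lambda>n. D (Suc n)"])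
qed

lemma smooth_real_continuous: "f \<in> smooth_real \<Longrightarrow> continuous_on S f"
  using smooth_real_deriv by (meson DERIV_isCont continuous_at_imp_continuous_on)

lemma smooth_real_antideriv:
  assumes "f' \<in> smooth_real" "\<And>x. (f has_real_derivative f' x) (at x)"
  shows "f \<in> smooth_real"
  by (rule smooth_real_coinduct[of f "insert f smooth_real"]) (use assms smooth_real_deriv in auto)

lemma smooth_real_add:
  assumes "f \<in> smooth_real" "g \<in> smooth_real" shows "(\<lambda>x. f x + g x) \<in> smooth_real"
proof (rule smooth_real_coinduct[of _ "{\<lambda>x. f x + g x | f g. f \<in> smooth_real \<and> g \<in> smooth_real}"])
  fix h assume "h \<in> {\<lambda>x. f x + g x | f g. f \<in> smooth_real \<and> g \<in> smooth_real}"
  then obtain f g where h: "h = (\<lambda>x. f x + g x)" "f \<in> smooth_real" "g \<in> smooth_real" by blast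
  then obtain f' g' where "f' \<in> smooth_real" "\<forall>x. (f has_real_derivative f' x) (at x)"
    "g' \<in> smooth_real" "\<forall>x. (g has_real_derivative g' x) (at x)"
    using smooth_real_deriv by meson
  then show "\<exists>h'\<in>{\<lambda>x. f x + g x | f g. f \<in> smooth_real \<and> g \<in> smooth_real}. \<forall>x. (h has_real_derivative h' x) (at x)"
    unfolding h by (intro bexI[of _ "\<lambda>x. f' x + g' x"]) (auto intro!: derivative_eq_intros)
qed (use assms in blast)

text \<open>The derivative of a product is a sum of products, so products alone are not invariant
  under differentiation; closing them under sums gives an invariant set.\<close>

inductive_set product_sums :: "(real \<Rightarrow> real) set" where
  product: "f \<in> smooth_real \<Longrightarrow> g \<in> smooth_real \<Longrightarrow> (\<lambda>x. f x * g x) \<in> product_sums"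
| sum: "f \<in> product_sums \<Longrightarrow> g \<in> product_sums \<Longrightarrow> (\<lambda>x. f x + g x) \<in> product_sums"

lemma smooth_real_mult:
  assumes "f \<in> smooth_real" "g \<in> smooth_real" shows "(\<lambda>x. f x * g x) \<in> smooth_real"
proof (rule smooth_real_coinduct[of _ product_sums])
  fix h assume "h \<in> product_sums"
  then show "\<exists>h'\<in>product_sums. \<forall>x. (h has_real_derivative h' x) (at x)"
  proof induction
    case (product f g)
    then obtain f' g' where "f' \<in> smooth_real" "\<forall>x. (f has_real_derivative f' x) (at x)"
      "g' \<in> smooth_real" "\<forall>x. (g has_real_derivative g' x) (at x)"
      using smooth_real_deriv by meson
    then show ?case using product
      by (intro bexI[of _ "\<lambda>x. f' x * g x + f x * g' x"])
        (auto intro!: derivative_eq_intros product_sums.intros)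
  next
    case (sum f g)
    then obtain f' g' where "f' \<in> product_sums" "\<forall>x. (f has_real_derivative f' x) (at x)"
      "g' \<in> product_sums" "\<forall>x. (g has_real_derivative g' x) (at x)" by blast
    then show ?case
      by (intro bexI[of _ "\<lambda>x. f' x + g' x"]) (auto intro!: derivative_eq_intros product_sums.intros)
  qed
qed (use assms in \<open>rule product_sums.product\<close>)

lemma smooth_real_affine:
  assumes "f \<in> smooth_real" shows "(\<lambda>x. c * f (a * x + b)) \<in> smooth_real"
proof -
  obtain D where D: "D 0 = f" "\<And>n x. (D n has_real_derivative D (Suc n) x) (at x)"
    using assms by (auto simp: smooth_real_def)
  have "((\<lambda>x. c * (a ^ n * D n (a * x + b))) has_real_derivative c * (a ^ Suc n * D (Suc n) (a * x + b))) (at x)" for n x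
    by (rule derivative_eq_intros DERIV_chain2[OF D(2)] refl | simp)+
  then show ?thesis unfolding smooth_real_def using D(1)
    by (intro CollectI exI[of _ "\<lambda>n x. c * (a ^ n * D n (a * x + b))"]) auto
qed

lemma smooth_real_cmult: "f \<in> smooth_real \<Longrightarrow> (\<lambda>x. c * f x) \<in> smooth_real"
  using smooth_real_affine[of f c 1 0] by simp

definition bump :: "real \<Rightarrow> real" where
  "bump x = (if 0 < x then exp (- (1 / x)) else 0)"

lemma bump_bounds: "0 \<le> bump x" "bump x \<le> 1"
  by (auto simp: bump_def)

lemma poly_div_exp_tendsto_0:
  fixes p :: "real poly"
  shows "((\<lambda>y. poly p y / exp y) \<longlongrightarrow> 0) at_top"
proof -
  have "((\<lambda>y. \<Sum>i\<le>degree p. coeff p i * (y ^ i / exp y)) \<longlongrightarrow> (\<Sum>i\<le>degree p. coeff p i * 0)) at_top"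
    by (intro tendsto_sum tendsto_mult tendsto_const tendsto_power_div_exp_0)
  then show ?thesis by (simp add: poly_altdef sum_divide_distrib)
qed

lemma bump_smooth: "bump \<in> smooth_real"
proof -
  \<comment> \<open>The n-th derivative for positive \<open>x\<close> is \<open>P n\<close> at
    \<open>1 / x\<close> times \<open>exp (- (1 / x))\<close>. Differentiating this form produces
    the factor \<open>1 / x\<close> squared and the difference
    \<open>P n - pderiv (P n)\<close>.\<close>
  define P :: "nat \<Rightarrow> real poly" where "P n = ((\<lambda>p. monom 1 2 * (p - pderiv p)) ^^ n) 1" for n
  define D where "D n x = (if 0 < x then poly (P n) (1 / x) * exp (- (1 / x)) else 0)" for n x
  have P: "P (Suc n) = monom 1 2 * (P n - pderiv (P n))" for n by (simp add: P_def)
  have "(D n has_real_derivative D (Suc n) x) (at x)" for n x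
  proof (cases "x = 0")
    case False
    show ?thesis
    proof (cases "x > 0")
      case True
      have "((\<lambda>x. poly (P n) (1 / x) * exp (- (1 / x))) has_real_derivative
          (poly (pderiv (P n)) (1 / x) * (- 1 / x\<^sup>2)) * exp (- (1 / x)) + poly (P n) (1 / x) * (exp (- (1 / x)) * (1 / x\<^sup>2))) (at x)"
        using True
        by (auto intro!: derivative_eq_intros DERIV_chain2[OF poly_DERIV] simp: power2_eq_square field_simps)
      moreover have "(poly (pderiv (P n)) (1 / x) * (- 1 / x\<^sup>2)) * exp (- (1 / x)) + poly (P n) (1 / x) * (exp (- (1 / x)) * (1 / x\<^sup>2))
         = D (Suc n) x"
        using True by (simp add: D_def P poly_monom algebra_simps power_divide)
      ultimately have "((\<lambda>x. poly (P n) (1 / x) * exp (- (1 / x))) has_real_derivative D (Suc n) x) (at x)" by simp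
      then show ?thesis
        by (rule has_field_derivative_transform_within_open[of _ _ _ "{0<..}"]) (use True in \<open>auto simp: D_def\<close>)
    next
      case neg: False
      have "((\<lambda>x. 0) has_real_derivative D (Suc n) x) (at x)" using neg by (simp add: D_def)
      then show ?thesis
        by (rule has_field_derivative_transform_within_open[of _ _ _ "{..<0}"]) (use neg False in \<open>auto simp: D_def\<close>)
    qed
  next
    case True
    have "((\<lambda>h. (D n (0 + h) - D n 0) / h) \<longlongrightarrow> 0) (at 0)"
    proof (rule filterlim_split_at)
      have "\<forall>\<^sub>F h in at_left 0. (D n (0 + h) - D n 0) / h = 0"
        by (auto simp: eventually_at_filter D_def)
      then show "((\<lambda>h. (D n (0 + h) - D n 0) / h) \<longlongrightarrow> 0) (at_left 0)"
        by (rule tendsto_eventually)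
      \<comment> \<open>With \<open>y = inverse h\<close> the difference quotient at 0 is a
        polynomial in \<open>y\<close> divided by \<open>exp y\<close>; the extra factor
        \<open>[:0, 1:]\<close> is the division by \<open>h\<close>.\<close>
      have "((\<lambda>h. poly (P n * [:0, 1:]) (inverse h) / exp (inverse h)) \<longlongrightarrow> 0) (at_right 0)"
        by (rule filterlim_compose[OF poly_div_exp_tendsto_0 filterlim_inverse_at_top_right])
      moreover have "\<forall>\<^sub>F h in at_right 0. poly (P n * [:0, 1:]) (inverse h) / exp (inverse h) = (D n (0 + h) - D n 0) / h"
        by (auto simp: eventually_at_filter D_def exp_minus field_simps)
      ultimately show "((\<lambda>h. (D n (0 + h) - D n 0) / h) \<longlongrightarrow> 0) (at_right 0)"
        by (rule Lim_transform_eventually)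
    qed
    moreover have "D (Suc n) 0 = 0" by (simp add: D_def)
    ultimately show ?thesis using True by (simp add: DERIV_def)
  qed
  moreover have "D 0 = bump" by (auto simp: D_def bump_def P_def)
  ultimately show ?thesis unfolding smooth_real_def by blast
qed

text \<open>The shift by 1 keeps the support at distance at least \<open>1 / n\<close> from both
  ends, and the growing slope \<open>n\<close> drives the values to the indicator of the open
  interval. For \<open>n = 0\<close> the function vanishes.\<close>

definition interval_bump :: "real \<Rightarrow> real \<Rightarrow> nat \<Rightarrow> real \<Rightarrow> real" where
  "interval_bump c d n x = bump (real n * (x - c) - 1) * bump (real n * (d - x) - 1)"

lemma interval_bump_smooth: "interval_bump c d n \<in> smooth_real"
proof -
  have "(\<lambda>x. (1 * bump (real n * x + (- real n * c - 1))) * (1 * bump (- real n * x + (real n * d - 1)))) \<in> smooth_real"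
    by (intro smooth_real_mult smooth_real_affine bump_smooth)
  then show ?thesis by (simp add: interval_bump_def[abs_def] algebra_simps)
qed

lemma interval_bump_bounds: "0 \<le> interval_bump c d n x" "interval_bump c d n x \<le> 1"
  by (simp_all add: interval_bump_def bump_bounds mult_le_one)

lemma interval_bump_support:
  assumes "interval_bump c d n x \<noteq> 0"
  shows "n > 0" "c + 1 / real n \<le> x" "x \<le> d - 1 / real n"
proof -
  have *: "real n * (x - c) > 1" "real n * (d - x) > 1"
    using assms by (auto simp: interval_bump_def bump_def split: if_splits)
  then show n: "n > 0" by (cases n) auto
  show "c + 1 / real n \<le> x" "x \<le> d - 1 / real n" using * n by (simp_all add: field_simps)
qed

lemma interval_bump_tendsto: "(\<lambda>n. interval_bump c d n x) \<longlonglongrightarrow> indicator {c<..<d} x"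
proof -
  have lim: "(\<lambda>n. bump (real n * a - 1)) \<longlonglongrightarrow> (if 0 < a then 1 else 0)" for a
  proof (cases "0 < a")
    case True
    have t: "filterlim (\<lambda>n. a * real n) at_top sequentially"
      by (rule filterlim_tendsto_pos_mult_at_top[OF tendsto_const True filterlim_real_sequentially])
    have "filterlim (\<lambda>n. (-1) + a * real n) at_top sequentially"
      by (rule filterlim_tendsto_add_at_top[OF tendsto_const t])
    then have t: "filterlim (\<lambda>n. real n * a - 1) at_top sequentially" by (simp add: algebra_simps)
    have "(\<lambda>n. exp (- inverse (real n * a - 1))) \<longlonglongrightarrow> exp (- 0)"
      by (intro tendsto_exp tendsto_minus filterlim_compose[OF tendsto_inverse_0_at_top t] filterlim_ident)
    moreover have "\<forall>\<^sub>F n in sequentially. exp (- inverse (real n * a - 1)) = bump (real n * a - 1)"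
      using t unfolding filterlim_at_top_dense
      by (auto simp: bump_def inverse_eq_divide elim!: allE[of _ 0] eventually_mono)
    ultimately have "(\<lambda>n. bump (real n * a - 1)) \<longlonglongrightarrow> exp (- 0)" by (rule Lim_transform_eventually)
    then show ?thesis using True by simp
  next
    case False
    have "bump (real n * a - 1) = 0" for n
    proof -
      have "real n * a \<le> 0" using False by (simp add: mult_nonneg_nonpos)
      then show ?thesis by (simp add: bump_def)
    qed
    then show ?thesis using False by simp
  qed
  have "(\<lambda>n. interval_bump c d n x) \<longlonglongrightarrow> (if 0 < x - c then 1 else 0) * (if 0 < d - x then 1 else 0)"
    unfolding interval_bump_def by (intro tendsto_mult lim)
  then show ?thesis by (simp add: indicator_def split: if_splits)
qed

section \<open>Products of one-variable functions as test functions\<close>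

lemma has_derivative_smooth_product:
  fixes z :: "real^2"
  assumes "\<And>x. (f has_real_derivative f' x) (at x)" "\<And>x. (g has_real_derivative g' x) (at x)"
  shows "((\<lambda>z. f (z $ i) * g (z $ j)) has_derivative
    (\<lambda>h. f (z $ i) * (g' (z $ j) * h $ j) + (f' (z $ i) * h $ i) * g (z $ j))) (at z)"
proof -
  have nth: "((\<lambda>z. z $ k) has_derivative (\<lambda>h. h $ k)) (at z)" for k
    by (rule bounded_linear_imp_has_derivative[OF bounded_linear_vec_nth])
  show ?thesis
    by (intro has_derivative_mult has_derivative_compose[OF nth, of f "\<lambda>h. f' (z $ i) * h"]
        has_derivative_compose[OF nth, of g "\<lambda>h. g' (z $ j) * h"])
      (use assms in \<open>simp_all add: has_field_derivative_def\<close>)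
qed

lemma Ck_on_smooth_product:
  "f \<in> smooth_real \<Longrightarrow> g \<in> smooth_real \<Longrightarrow> Ck_on k UNIV (\<lambda>z :: real^2. f (z $ i) * g (z $ j))"
proof (induction k arbitrary: f g)
  case 0
  then show ?case
    by (auto intro!: continuous_intros continuous_on_compose2[OF smooth_real_continuous[of f UNIV]]
        continuous_on_compose2[OF smooth_real_continuous[of g UNIV]])
next
  case (Suc k)
  obtain f' g' where d: "f' \<in> smooth_real" "\<And>x. (f has_real_derivative f' x) (at x)"
    "g' \<in> smooth_real" "\<And>x. (g has_real_derivative g' x) (at x)"
    using smooth_real_deriv Suc.prems by meson
  note hd = has_derivative_smooth_product[of f f' g g', OF d(2,4)]
  have "Ck_on k UNIV (partial m (\<lambda>z :: real^2. f (z $ i) * g (z $ j)))" for m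
  proof -
    have "partial m (\<lambda>z :: real^2. f (z $ i) * g (z $ j)) =
      (\<lambda>z. f (z $ i) * (axis m 1 $ j * g' (z $ j)) + (axis m 1 $ i * f' (z $ i)) * g (z $ j))"
      by (rule ext, subst partial_eq[OF hd]) (simp add: mult.commute)
    then show ?thesis using d Suc
      by (auto intro!: Ck_on_add Suc.IH smooth_real_cmult)
  qed
  then show ?case using differentiableI[OF hd] by simp
qed

lemma smooth_product_test_fun:
  assumes "f \<in> smooth_real" "g \<in> smooth_real" and cd: "0 < c" "d < 1"
    and supp: "\<And>x. f x \<noteq> 0 \<Longrightarrow> c \<le> x \<and> x \<le> d" "\<And>x. g x \<noteq> 0 \<Longrightarrow> c \<le> x \<and> x \<le> d"
  shows "(\<lambda>z. f (z $ i) * g (z $ (i + 1))) \<in> test_fun"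
proof -
  let ?\<phi> = "\<lambda>z :: real^2. f (z $ i) * g (z $ (i + 1))"
  have "{z. ?\<phi> z \<noteq> 0} \<subseteq> cbox (\<chi> k. c) (\<chi> k. d)"
  proof
    fix z :: "real^2" assume "z \<in> {z. ?\<phi> z \<noteq> 0}"
    then have z: "c \<le> z $ i \<and> z $ i \<le> d" "c \<le> z $ (i + 1) \<and> z $ (i + 1) \<le> d" using supp by auto
    have "k = i \<or> k = i + 1" for k :: 2 using other_index by blast
    then show "z \<in> cbox (\<chi> k. c) (\<chi> k. d)" using z by (auto simp: mem_box_cart) metis+
  qed
  then have cl: "closure {z. ?\<phi> z \<noteq> 0} \<subseteq> cbox (\<chi> k. c) (\<chi> k. d)"
    by (rule closure_minimal) (rule closed_cbox)
  then have "bounded (closure {z. ?\<phi> z \<noteq> 0})" using bounded_cbox bounded_subset by blast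
  then have "compact (closure {z. ?\<phi> z \<noteq> 0})" by (simp add: compact_eq_bounded_closed)
  moreover have "cbox (\<chi> k. c) (\<chi> k. d) \<subseteq> open_square"
    using cd by (auto simp: mem_box_cart) (meson less_le_trans le_less_trans)+
  ultimately show ?thesis unfolding test_fun_def smooth_on_def
    using Ck_on_smooth_product[OF assms(1,2)] cl by auto
qed

lemma partial_smooth_product:
  fixes i :: 2
  assumes "f \<in> smooth_real" "g \<in> smooth_real" "\<And>x. (f has_real_derivative f' x) (at x)"
  shows "partial i (\<lambda>z. f (z $ i) * g (z $ (i + 1))) = (\<lambda>z. f' (z $ i) * g (z $ (i + 1)))"
proof -
  obtain g' where g': "\<And>x. (g has_real_derivative g' x) (at x)" using smooth_real_deriv[OF assms(2)] by blast
  show ?thesis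
    using partial_eq[OF has_derivative_smooth_product[OF assms(3) g', where i=i and j="i + 1"], of i]
    by (intro ext) (simp add: axis_def)
qed

section \<open>Lines in the unit square\<close>

abbreviation unit2_measure :: "(real \<times> real) measure" where
  "unit2_measure \<equiv> unit_measure \<Otimes>\<^sub>M unit_measure"

text \<open>The slice variable \<open>x\<close>, which runs along coordinate \<open>i\<close>, is the second component, so that
  iterated integrals have the integration along coordinate \<open>i\<close> inside.\<close>

definition sq_pt :: "2 \<Rightarrow> real \<times> real \<Rightarrow> real^2" where
  "sq_pt i = (\<lambda>(y, x). edge_pt i x y)"

lemma sq_pt_Pair [simp]: "sq_pt i (y, x) = edge_pt i x y"
  by (simp add: sq_pt_def)

lemma edge_pt_alt: "edge_pt i x y = x *\<^sub>R axis i 1 + y *\<^sub>R axis (i + 1) 1"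
  using other_index[of _ i] by (auto simp: vec_eq_iff edge_pt_def axis_def)

lemma sq_pt_measurable_borel [measurable]: "sq_pt i \<in> borel_measurable (borel \<Otimes>\<^sub>M borel)"
  unfolding sq_pt_def edge_pt_alt by measurable

lemma mem_box_edge_pt: "edge_pt i x y \<in> box l u \<longleftrightarrow> l $ i < x \<and> x < u $ i \<and> l $ (i + 1) < y \<and> y < u $ (i + 1)"
proof
  assume "edge_pt i x y \<in> box l u"
  then have "l $ k < edge_pt i x y $ k \<and> edge_pt i x y $ k < u $ k" for k by (simp add: mem_box_cart)
  from this[of i] this[of "i + 1"] show "l $ i < x \<and> x < u $ i \<and> l $ (i + 1) < y \<and> y < u $ (i + 1)" by simp
next
  assume a: "l $ i < x \<and> x < u $ i \<and> l $ (i + 1) < y \<and> y < u $ (i + 1)"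
  have "l $ k < edge_pt i x y $ k \<and> edge_pt i x y $ k < u $ k" for k
    using a other_index[of k i] by (cases "k = i") auto
  then show "edge_pt i x y \<in> box l u" by (simp add: mem_box_cart)
qed

lemma lborel_sq_pt: "distr (lborel \<Otimes>\<^sub>M lborel) borel (sq_pt i) = (lborel :: (real^2) measure)"
proof (rule lborel_eqI[symmetric])
  fix l u :: "real^2" assume lu: "\<And>b. b \<in> Basis \<Longrightarrow> l \<bullet> b \<le> u \<bullet> b"
  have le: "l $ k \<le> u $ k" for k using lu[of "axis k 1"] by (simp add: inner_axis axis_in_Basis_iff)
  have "emeasure (distr (lborel \<Otimes>\<^sub>M lborel) borel (sq_pt i)) (box l u)
      = emeasure (lborel \<Otimes>\<^sub>M lborel) ({l $ (i + 1)<..<u $ (i + 1)} \<times> {l $ i<..<u $ i})"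
    by (subst emeasure_distr) (auto intro!: arg_cong2[where f=emeasure] simp: mem_box_edge_pt space_pair_measure)
  also have "\<dots> = ennreal (u $ (i + 1) - l $ (i + 1)) * ennreal (u $ i - l $ i)"
    using le by (subst lborel.emeasure_pair_measure_Times) auto
  also have "\<dots> = ennreal ((u $ i - l $ i) * (u $ (i + 1) - l $ (i + 1)))"
    using le by (simp add: ennreal_mult[symmetric] mult.commute)
  also have "(u $ i - l $ i) * (u $ (i + 1) - l $ (i + 1)) = (\<Prod>k\<in>UNIV. u $ k - l $ k)"
  proof -
    have U: "(UNIV :: 2 set) = {i, i + 1}" using other_index by blast
    show ?thesis unfolding U by simp
  qed
  also have "\<dots> = (\<Prod>b\<in>Basis. (u - l) \<bullet> b)"
  proof -
    have B: "(Basis :: (real^2) set) = range (\<lambda>k. axis k 1)" by (auto simp: Basis_vec_def)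
    have "inj (\<lambda>k. axis k 1 :: real^2)" by (auto simp: inj_on_def axis_eq_axis)
    then show ?thesis unfolding B by (subst prod.reindex) (simp_all add: inner_axis)
  qed
  finally show "emeasure (distr (lborel \<Otimes>\<^sub>M lborel) borel (sq_pt i)) (box l u) = ennreal (\<Prod>b\<in>Basis. (u - l) \<bullet> b)" .
qed simp

lemma space_square_measure [simp]: "space square_measure = open_square"
  by (simp add: square_measure_def space_restrict_space)

lemma measurable_square_measure: "f \<in> borel_measurable borel \<Longrightarrow> f \<in> borel_measurable square_measure"
  unfolding square_measure_def by (intro measurable_restrict_space1) simp

lemma edge_pt_in_open_square: "edge_pt i x y \<in> open_square \<longleftrightarrow> 0 < x \<and> x < 1 \<and> 0 < y \<and> y < 1"
  by (auto simp: mem_box_edge_pt)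

lemma space_unit2 [simp]: "space unit2_measure = {0<..<1} \<times> {0<..<1}"
  by (simp add: space_pair_measure)

lemma measurable_unit2: "f \<in> measurable (borel \<Otimes>\<^sub>M borel) M \<Longrightarrow> f \<in> measurable unit2_measure M"
proof -
  have id: "(\<lambda>x. x) \<in> measurable unit_measure (borel :: real measure)" by (rule measurable_unit_measure) simp
  have "(\<lambda>z. (fst z, snd z)) \<in> measurable unit2_measure (borel \<Otimes>\<^sub>M borel)"
    by (intro measurable_Pair measurable_compose[OF measurable_fst id] measurable_compose[OF measurable_snd id])
  then have "(\<lambda>z. z) \<in> measurable unit2_measure (borel \<Otimes>\<^sub>M borel)" by simp
  then show "f \<in> measurable (borel \<Otimes>\<^sub>M borel) M \<Longrightarrow> f \<in> measurable unit2_measure M"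
    by (rule measurable_compose)
qed

lemma sq_pt_measurable [measurable]: "sq_pt i \<in> measurable unit2_measure square_measure"
  unfolding square_measure_def
proof (rule measurable_restrict_space2)
  show "sq_pt i \<in> space unit2_measure \<rightarrow> open_square"
    by (auto simp: edge_pt_in_open_square)
  have "sq_pt i \<in> borel_measurable unit2_measure" by (rule measurable_unit2) (rule sq_pt_measurable_borel)
  then show "sq_pt i \<in> measurable unit2_measure lborel" by simp
qed

text \<open>Both directions \<open>i\<close> yield the same measure on the square, so any integral
  over it may be iterated with either coordinate inside. All arguments along lines are transferred
  through this identity.\<close>

lemma distr_sq_pt: "distr unit2_measure square_measure (sq_pt i) = square_measure"
proof (rule measure_eqI)
  fix A assume "A \<in> sets (distr unit2_measure square_measure (sq_pt i))"
  then have A: "A \<in> sets square_measure" by simp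
  then have Ab: "A \<in> sets borel" "A \<subseteq> open_square"
    unfolding square_measure_def by (auto simp: sets_restrict_space)
  have S: "sq_pt i -` A \<inter> space unit2_measure \<in> sets unit2_measure"
    using measurable_sets[OF sq_pt_measurable A] .
  have S': "sq_pt i -` A \<in> sets (lborel \<Otimes>\<^sub>M lborel)"
    using measurable_sets[OF sq_pt_measurable_borel Ab(1), of i]
    by (simp add: space_pair_measure cong: sets_pair_measure_cong)
  have "emeasure (distr unit2_measure square_measure (sq_pt i)) A
      = emeasure unit2_measure (sq_pt i -` A \<inter> space unit2_measure)"
    using A by (simp add: emeasure_distr)
  also have "\<dots> = (\<integral>\<^sup>+y. \<integral>\<^sup>+x. indicator (sq_pt i -` A \<inter> space unit2_measure) (y, x) \<partial>unit_measure \<partial>unit_measure)"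
    by (rule unit.emeasure_pair_measure[OF S])
  also have "\<dots> = (\<integral>\<^sup>+y. (\<integral>\<^sup>+x. indicator (sq_pt i -` A \<inter> space unit2_measure) (y, x) * indicator {0<..<1} x \<partial>lborel) * indicator {0<..<1} y \<partial>lborel)"
    unfolding unit_measure_def by (simp add: nn_integral_restrict_space)
  also have "\<dots> = (\<integral>\<^sup>+y. \<integral>\<^sup>+x. indicator (sq_pt i -` A) (y, x) \<partial>lborel \<partial>lborel)"
    unfolding nn_integral_multc[symmetric]
  proof (intro nn_integral_cong, goal_cases)
    case (1 y)
    have "(\<integral>\<^sup>+x. indicator (sq_pt i -` A \<inter> space unit2_measure) (y, x) * indicator {0<..<1} x \<partial>lborel) * indicator {0<..<1} y
      = (\<integral>\<^sup>+x. (if 0 < y \<and> y < 1 then indicator (sq_pt i -` A \<inter> space unit2_measure) (y, x) * indicator {0<..<1} x else 0) \<partial>lborel)"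
      by (auto simp: indicator_def)
    also have "\<dots> = (\<integral>\<^sup>+x. indicator (sq_pt i -` A) (y, x) \<partial>lborel)"
      using Ab(2) edge_pt_in_open_square[of i _ y] by (intro nn_integral_cong) (auto simp: indicator_def)
    finally show ?case .
  qed
  also have "\<dots> = emeasure (lborel \<Otimes>\<^sub>M lborel) (sq_pt i -` A)"
    by (rule lborel.emeasure_pair_measure[OF S', symmetric])
  also have "\<dots> = emeasure (distr (lborel \<Otimes>\<^sub>M lborel) borel (sq_pt i)) A"
    using Ab by (subst emeasure_distr) (auto simp: space_pair_measure)
  also have "\<dots> = emeasure square_measure A"
    using A Ab unfolding lborel_sq_pt square_measure_def by (subst emeasure_restrict_space) auto
  finally show "emeasure (distr unit2_measure square_measure (sq_pt i)) A = emeasure square_measure A" .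
qed simp

interpretation square: finite_measure square_measure
  using unit2'.finite_measure_distr[OF sq_pt_measurable, of 1] by (simp add: distr_sq_pt)

lemma square_integral_pair:
  fixes f :: "real^2 \<Rightarrow> real"
  assumes "f \<in> borel_measurable square_measure"
  shows "(LINT z|square_measure. f z) = (LINT z|unit2_measure. f (sq_pt i z))"
  using assms by (subst distr_sq_pt[of i, symmetric], subst integral_distr) auto

lemma square_integrable_pair:
  fixes f :: "real^2 \<Rightarrow> real"
  assumes "f \<in> borel_measurable square_measure"
  shows "integrable square_measure f \<longleftrightarrow> integrable unit2_measure (\<lambda>z. f (sq_pt i z))"
  using assms by (subst distr_sq_pt[of i, symmetric], subst integrable_distr_eq) auto

lemma square_AE_pair:
  assumes "AE z in square_measure. P z" shows "AE y in unit_measure. AE x in unit_measure. P (edge_pt i x y)"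
proof -
  have "AE z in distr unit2_measure square_measure (sq_pt i). P z" using assms unfolding distr_sq_pt .
  then have "AE z in unit2_measure. P (sq_pt i z)" by (rule AE_distrD[OF sq_pt_measurable])
  from unit2.AE_pair[OF this] show ?thesis by simp
qed

lemma L2_square_pair: "u \<in> L2 square_measure \<Longrightarrow> (\<lambda>z. u (sq_pt i z)) \<in> L2 unit2_measure"
  unfolding L2_def using square_integrable_pair[of "\<lambda>z. (u z)\<^sup>2" i]
  by (auto intro: measurable_compose[OF sq_pt_measurable])

lemma l2_inner_square_pair:
  assumes "u \<in> L2 square_measure" "v \<in> L2 square_measure"
  shows "l2_inner square_measure u v = l2_inner unit2_measure (\<lambda>z. u (sq_pt i z)) (\<lambda>z. v (sq_pt i z))"
  unfolding l2_inner_def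
  by (rule square_integral_pair) (use assms in \<open>auto intro!: borel_measurable_times L2_measurable\<close>)

lemma l2_norm_square_pair:
  assumes "u \<in> L2 square_measure"
  shows "l2_norm square_measure u = l2_norm unit2_measure (\<lambda>z. u (sq_pt i z))"
  unfolding l2_norm_def using l2_inner_square_pair[OF assms assms] by simp

lemma coord_pair_measurable: "(\<lambda>z. (z $ (i + 1), z $ i)) \<in> measurable square_measure unit2_measure"
proof (rule measurable_Pair)
  have "(\<lambda>z. z $ k) \<in> measurable square_measure unit_measure" for k :: 2
    unfolding unit_measure_def
  proof (rule measurable_restrict_space2)
    show "(\<lambda>z. z $ k) \<in> space square_measure \<rightarrow> {0<..<1}" by (auto simp: mem_box_cart)
    have "(\<lambda>z :: real^2. z $ k) \<in> borel_measurable borel"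
      by (intro borel_measurable_continuous_onI continuous_intros)
    then have "(\<lambda>z :: real^2. z $ k) \<in> borel_measurable square_measure" by (rule measurable_square_measure)
    then show "(\<lambda>z. z $ k) \<in> measurable square_measure lborel" by simp
  qed
  then show "(\<lambda>z. z $ (i + 1)) \<in> measurable square_measure unit_measure"
    "(\<lambda>z. z $ i) \<in> measurable square_measure unit_measure" by auto
qed

lemma L2_pair_square:
  assumes "U \<in> L2 unit2_measure" shows "(\<lambda>z. U (z $ (i + 1), z $ i)) \<in> L2 square_measure"
proof -
  let ?u = "\<lambda>z :: real^2. U (z $ (i + 1), z $ i)"
  have m: "?u \<in> borel_measurable square_measure"
    using measurable_compose[OF coord_pair_measurable, of U borel i] assms by (auto simp: L2_def)
  have "(\<lambda>z. (?u z)\<^sup>2) \<in> borel_measurable square_measure" using m by simp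
  from square_integrable_pair[OF this, of i] assms m show ?thesis
    by (auto simp: L2_def case_prod_beta' sq_pt_def)
qed

text \<open>Since \<open>ennreal\<close> truncates negative values, the densities \<open>f\<close>
  and \<open>- f\<close> are the positive and the negative part. The two measures agree on boxes, a
  generator stable under intersection; hence they coincide, and so do their densities almost
  everywhere.\<close>

lemma AE_eq_0_if_box_integrals_0:
  fixes f :: "'a::euclidean_space \<Rightarrow> real"
  assumes f: "integrable lborel f" and zero: "\<And>l u. (LINT x|lborel. indicator (box l u) x * f x) = 0"
  shows "AE x in lborel. f x = 0"
proof -
  have [measurable]: "f \<in> borel_measurable borel" using f by simp
  let ?p = "density lborel (\<lambda>x. ennreal (f x))" and ?m = "density lborel (\<lambda>x. ennreal (- f x))"
  have "?p = ?m"
  proof (rule measure_eqI_generator_eq)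
    let ?E = "range (\<lambda>(a, b). box a b::'a set)"
    show "Int_stable ?E" by (auto simp: Int_stable_def box_Int_box)
    show "?E \<subseteq> Pow UNIV" "sets ?p = sigma_sets UNIV ?E" "sets ?m = sigma_sets UNIV ?E"
      by (simp_all add: borel_eq_box)
    let ?A = "\<lambda>n::nat. box (- (real n *\<^sub>R One)) (real n *\<^sub>R One) :: 'a set"
    show "range ?A \<subseteq> ?E" "(\<Union>i. ?A i) = UNIV" unfolding UN_box_eq_UNIV by auto
    have e: "emeasure ?p X = ennreal (LINT x|lborel. max 0 (indicator X x * f x))"
      "emeasure ?m X = ennreal (LINT x|lborel. max 0 (- (indicator X x * f x)))"
      and i: "integrable lborel (\<lambda>x. indicator X x * f x)" if [measurable]: "X \<in> sets borel" for X
    proof -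
      show i: "integrable lborel (\<lambda>x. indicator X x * f x)"
        using integrable_mult_indicator[of X lborel f] f that by (simp add: mult.commute)
      have "emeasure ?p X = (\<integral>\<^sup>+x. ennreal (max 0 (indicator X x * f x)) \<partial>lborel)"
        by (subst emeasure_density) (auto intro!: nn_integral_cong simp: indicator_def max_def ennreal_neg)
      then show "emeasure ?p X = ennreal (LINT x|lborel. max 0 (indicator X x * f x))"
        using i by (subst (asm) nn_integral_eq_integral) auto
      have "emeasure ?m X = (\<integral>\<^sup>+x. ennreal (max 0 (- (indicator X x * f x))) \<partial>lborel)"
        by (subst emeasure_density) (auto intro!: nn_integral_cong simp: indicator_def max_def ennreal_neg)
      then show "emeasure ?m X = ennreal (LINT x|lborel. max 0 (- (indicator X x * f x)))"
        using i by (subst (asm) nn_integral_eq_integral) auto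
    qed
    show "emeasure ?p (?A j) \<noteq> \<infinity>" for j using e(1)[of "?A j"] by simp
    fix X assume "X \<in> ?E"
    then obtain l u where X: "X = box l u" by auto
    have "(LINT x|lborel. max 0 (indicator X x * f x)) - (LINT x|lborel. max 0 (- (indicator X x * f x)))
       = (LINT x|lborel. max 0 (indicator X x * f x) - max 0 (- (indicator X x * f x)))"
      using i[of X] X by (intro Bochner_Integration.integral_diff[symmetric]) auto
    also have "\<dots> = (LINT x|lborel. indicator X x * f x)"
      by (intro Bochner_Integration.integral_cong) (auto simp: max_def)
    finally show "emeasure ?p X = emeasure ?m X"
      using e[of X] zero[of l u] X by simp
  qed
  then have "AE x in lborel. ennreal (f x) = ennreal (- f x)"
    by (subst (asm) sigma_finite_measure.density_unique_iff[OF sigma_finite_lborel]) auto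
  then show ?thesis
  proof eventually_elim
    case (elim x)
    then show ?case by (cases "f x \<ge> 0") (auto simp: ennreal_neg ennreal_eq_0_iff)
  qed
qed

lemma AE_unit2_eq_0:
  fixes Z :: "real \<times> real \<Rightarrow> real"
  assumes Z: "integrable unit2_measure Z"
    and zero: "\<And>a b c d. 0 \<le> a \<Longrightarrow> b \<le> 1 \<Longrightarrow> 0 \<le> c \<Longrightarrow> d \<le> 1 \<Longrightarrow>
      (LINT (y, x)|unit2_measure. indicator {c<..<d} y * indicator {a<..<b} x * Z (y, x)) = 0"
  shows "AE y in unit_measure. AE x in unit_measure. Z (y, x) = 0"
proof -
  let ?u = "\<lambda>z :: real^2. Z (z $ (1 + 1), z $ 1)"
  define f where "f z = indicator open_square z * ?u z" for z :: "real^2"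
  have m: "?u \<in> borel_measurable square_measure"
    using measurable_compose[OF coord_pair_measurable, of Z borel 1] Z by auto
  have "integrable square_measure ?u"
    using square_integrable_pair[OF m, of 1] Z
    by (simp add: case_prod_beta' sq_pt_def edge_pt_nth[of 1, simplified])
  then have f: "integrable lborel f"
    unfolding f_def square_measure_def by (subst (asm) integrable_restrict_space) (auto simp: mult.commute)
  have "AE z in lborel. f z = 0"
  proof (rule AE_eq_0_if_box_integrals_0[OF f])
    fix l u :: "real^2"
    have "(LINT z|lborel. indicator (box l u) z * f z) = (LINT z|square_measure. indicator (box l u) z * ?u z)"
      unfolding square_measure_def f_def
      by (subst integral_restrict_space) (auto simp: mult_ac intro!: Bochner_Integration.integral_cong)
    also have "\<dots> = (LINT z|unit2_measure. indicator (box l u) (sq_pt 1 z) * ?u (sq_pt 1 z))"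
    proof (rule square_integral_pair)
      show "(\<lambda>z. indicator (box l u) z * ?u z) \<in> borel_measurable square_measure"
        by (intro borel_measurable_times m measurable_square_measure borel_measurable_indicator) simp
    qed
    also have "\<dots> = (LINT (y, x)|unit2_measure.
        indicator {max 0 (l $ (1 + 1))<..<min 1 (u $ (1 + 1))} y * indicator {max 0 (l $ 1)<..<min 1 (u $ 1)} x * Z (y, x))"
      by (intro Bochner_Integration.integral_cong)
        (auto simp: indicator_def mem_box_edge_pt edge_pt_nth[of 1, simplified])
    also have "\<dots> = 0" by (rule zero) auto
    finally show "(LINT z|lborel. indicator (box l u) z * f z) = 0" .
  qed
  then have "AE z in lborel. z \<in> open_square \<longrightarrow> ?u z = 0"
    by eventually_elim (auto simp: f_def)
  then have "AE z in square_measure. ?u z = 0"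
    unfolding square_measure_def by (subst AE_restrict_space_iff) auto
  from square_AE_pair[OF this, of 1] show ?thesis by (simp add: edge_pt_nth[of 1, simplified])
qed

section \<open>Functions orthogonal to splines\<close>

lemma bspline_L2_unit:
  assumes "open_knots q T" "i < length T - q - 1"
  shows "bspline T q i \<in> L2 unit_measure"
proof -
  have "i + q + 1 < length T" "sorted T" using assms by (auto simp: open_knots_def)
  then obtain C where "\<And>x. \<bar>bspline T q i x\<bar> \<le> C"
    using bspline_bounded[of T i q] by blast
  then show ?thesis
    by (intro unit.L2_boundedI[of _ C] measurable_unit_measure bspline_measurable) auto
qed

lemma open_knots_range:
  assumes "open_knots q T" "l < length T" shows "0 \<le> T ! l" "T ! l \<le> 1"
proof -
  have "T ! 0 \<le> T ! l" "T ! l \<le> T ! (length T - 1)"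
    using assms unfolding open_knots_def by (intro sorted_nth_mono; simp)+
  moreover have "T ! 0 = 0" using assms by (simp add: open_knots_def)
  moreover have "T ! (length T - 1) = 1"
    using assms unfolding open_knots_def by (elim conjE allE[of _ "length T - 1"]) auto
  ultimately show "0 \<le> T ! l" "T ! l \<le> 1" by simp_all
qed

context
  fixes q T e
  assumes T: "open_knots q T" and e: "e \<in> L2 unit_measure"
    and orth: "\<And>i. i < length T - q - 1 \<Longrightarrow> l2_inner unit_measure e (bspline T q i) = 0"
begin

lemma orthogonal_to_span:
  assumes "\<exists>c. \<forall>x. 0 \<le> x \<and> x < 1 \<longrightarrow> w x = (\<Sum>i<length T - q - 1. c i * bspline T q i x)"
  shows "(LINT t|unit_measure. e t * w t) = 0"
proof -
  obtain c where c: "\<And>x. 0 \<le> x \<and> x < 1 \<Longrightarrow> w x = (\<Sum>i<length T - q - 1. c i * bspline T q i x)"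
    using assms by blast
  have "(LINT t|unit_measure. e t * w t) = l2_inner unit_measure (\<lambda>x. \<Sum>i<length T - q - 1. c i * bspline T q i x) e"
    unfolding l2_inner_def using c by (intro Bochner_Integration.integral_cong) (auto simp: mult.commute)
  also have "\<dots> = (\<Sum>i<length T - q - 1. l2_inner unit_measure (\<lambda>x. c i * bspline T q i x) e)"
    using bspline_L2_unit[OF T] e by (intro l2_inner_sum_left L2_cmult) auto
  also have "\<dots> = 0"
    using orth by (intro sum.neutral) (auto simp: l2_inner_cmult_left l2_inner_commute[of _ _ e])
  finally show ?thesis .
qed

lemma orthogonal_antider_knot:
  assumes "l < length T" shows "(antider ^^ Suc q) e (T ! l) = 0"
  using antider_iter_trunc_power[OF e open_knots_range[OF T assms], of q]
    orthogonal_to_span[OF trunc_power_knot_in_span[OF T assms]] by simp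

text \<open>Marsden's identity puts only powers of the full degree \<open>q\<close> into the span,
  but with an arbitrary shift \<open>s\<close>. Expanding \<open>(s - t) ^ q\<close> in
  \<open>s\<close> and comparing coefficients shows that all moments of \<open>e\<close> up to order
  \<open>q\<close> vanish, which gives the lower powers as well.\<close>

lemma orthogonal_antider_1:
  assumes "j \<le> q" shows "(antider ^^ Suc j) e 1 = 0"
proof -
  define m where "m k = (LINT t|unit_measure. e t * (- t) ^ k)" for k :: nat
  have int: "integrable unit_measure (\<lambda>t. e t * (- t) ^ k)" for k
  proof -
    have "(\<lambda>t. (- t) ^ k * e t) \<in> L2 unit_measure"
      by (intro L2_bounded_mult[OF e, of _ 1] measurable_unit_measure)
        (auto simp: power_abs power_le_one)
    then show ?thesis by (simp add: unit.L2_integrable mult.commute)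
  qed
  have binom: "(LINT t|unit_measure. e t * (s - t) ^ r) = (\<Sum>k\<le>r. (real (r choose k) * m (r - k)) * s ^ k)" for s r
  proof -
    have "(LINT t|unit_measure. e t * (s - t) ^ r)
        = (LINT t|unit_measure. (\<Sum>k\<le>r. (real (r choose k) * s ^ k) * (e t * (- t) ^ (r - k))))"
    proof (intro Bochner_Integration.integral_cong refl)
      fix t
      have "e t * (s + (- t)) ^ r = (\<Sum>k\<le>r. e t * (real (r choose k) * s ^ k * (- t) ^ (r - k)))"
        unfolding binomial_ring sum_distrib_left ..
      then show "e t * (s - t) ^ r = (\<Sum>k\<le>r. (real (r choose k) * s ^ k) * (e t * (- t) ^ (r - k)))"
        by (simp add: mult_ac)
    qed
    also have "\<dots> = (\<Sum>k\<le>r. (real (r choose k) * s ^ k) * m (r - k))"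
      unfolding m_def using int by (subst Bochner_Integration.integral_sum) auto
    finally show ?thesis by (simp add: mult_ac)
  qed
  have "(\<Sum>k\<le>q. (real (q choose k) * m (q - k)) * s ^ k) = 0" for s
    using binom[of s q] orthogonal_to_span[OF power_in_span[OF T, of s]] by simp
  then have z: "\<forall>k\<le>q. real (q choose k) * m (q - k) = 0"
    using polyfun_eq_0[of "\<lambda>k. real (q choose k) * m (q - k)" q] by auto
  have m0: "m k = 0" if "k \<le> q" for k
    using z[rule_format, of "q - k"] that by (auto simp: binomial_eq_0_iff)
  have "(LINT t|unit_measure. e t * trunc_power j 1 t) = (LINT t|unit_measure. e t * (1 - t) ^ j)"
    by (intro Bochner_Integration.integral_cong) (auto simp: trunc_power_def)
  also have "\<dots> = 0" unfolding binom using m0 assms by (intro sum.neutral) auto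
  finally show ?thesis using antider_iter_trunc_power[OF e, of 1 j] by simp
qed

end

lemma measure_unit_le:
  assumes "S \<subseteq> {a..b}" "a \<le> b" "S \<in> sets borel"
  shows "(LINT t|unit_measure. indicator S t) \<le> b - a"
proof -
  have "(LINT t|unit_measure. indicator S t) = measure unit_measure (S \<inter> {0<..<1})"
    by simp
  also have "\<dots> = measure lborel (S \<inter> {0<..<1})"
    unfolding unit_measure_def by (subst measure_restrict_space) auto
  also have "\<dots> \<le> measure lborel {a..b}"
    using assms by (intro measure_mono_fmeasurable fmeasurableI) auto
  finally show ?thesis using assms by simp
qed

text \<open>A zero within distance \<open>h\<close> to the left and Cauchy-Schwarz bound the square
  at \<open>x\<close> by \<open>h\<close> times the energy of \<open>g\<close> on a window of length
  \<open>h\<close>. After exchanging the integrals every \<open>t\<close> is counted for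
  \<open>x\<close> in \<open>{t<..t + h}\<close> only, which supplies the second factor
  \<open>h\<close>.\<close>

lemma antider_Poincare:
  assumes g: "g \<in> L2 unit_measure" and h: "0 < h"
    and zero: "\<And>x. 0 < x \<Longrightarrow> x < 1 \<Longrightarrow> \<exists>\<tau>. x - h \<le> \<tau> \<and> \<tau> \<le> x \<and> antider g \<tau> = 0"
  shows "l2_norm unit_measure (antider g) \<le> h * l2_norm unit_measure g"
proof -
  let ?I = unit_measure
  note gi = unit.L2_integrable[OF g]
  have gm [measurable]: "g \<in> borel_measurable ?I" using g by (rule L2_measurable)
  have [measurable]: "(\<lambda>x. x) \<in> borel_measurable ?I" by (rule measurable_unit_measure) simp
  have g2: "integrable ?I (\<lambda>t. (g t)\<^sup>2)" using g by (rule L2_integrable_square)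
  define K where "K x t = (if x - h \<le> t \<and> t < x then (g t)\<^sup>2 else 0)" for x t
  have Kint: "integrable (?I \<Otimes>\<^sub>M ?I) (\<lambda>(x, t). K x t)"
  proof (rule Bochner_Integration.integrable_bound)
    show "integrable (?I \<Otimes>\<^sub>M ?I) (\<lambda>(x, t). (g t)\<^sup>2)"
      using g2 by (intro unit2.Fubini_integrable) auto
    show "(\<lambda>(x, t). K x t) \<in> borel_measurable (?I \<Otimes>\<^sub>M ?I)" unfolding K_def by measurable
  qed (auto simp: K_def)
  have Kt: "integrable ?I (K x)" for x
    unfolding K_def by (rule Bochner_Integration.integrable_bound[OF g2]) auto
  have pw: "(antider g x)\<^sup>2 \<le> h * (LINT t|?I. K x t)" if x: "0 < x" "x < 1" for x
  proof -
    obtain \<tau> where \<tau>: "x - h \<le> \<tau>" "\<tau> \<le> x" "antider g \<tau> = 0" using zero[OF x] by blast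
    let ?u = "indicator {\<tau>..<x} :: real \<Rightarrow> real" and ?v = "\<lambda>t. indicator {\<tau>..<x} t * g t"
    have u: "?u \<in> L2 ?I" by (intro unit.L2_boundedI[of _ 1] measurable_unit_measure) (auto simp: indicator_def)
    have v: "?v \<in> L2 ?I" by (intro L2_bounded_mult[OF g, of _ 1] measurable_unit_measure) (auto simp: indicator_def)
    have "antider g x = antider g x - antider g \<tau>" using \<tau> by simp
    also have "\<dots> = (LINT t|?I. (if t < x then g t else 0) - (if t < \<tau> then g t else 0))"
      unfolding antider_def using integrable_cut[OF gi] by simp
    also have "\<dots> = l2_inner ?I ?u ?v"
      unfolding l2_inner_def using \<tau>(2) by (intro Bochner_Integration.integral_cong) (auto simp: indicator_def)
    finally have a: "\<bar>antider g x\<bar> \<le> l2_norm ?I ?u * l2_norm ?I ?v"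
      using l2_Cauchy_Schwarz[OF u v] by simp
    have "(antider g x)\<^sup>2 \<le> (l2_norm ?I ?u * l2_norm ?I ?v)\<^sup>2"
      using power_mono[OF a, of 2] by simp
    also have "\<dots> = l2_inner ?I ?u ?u * l2_inner ?I ?v ?v" by (simp add: power_mult_distrib l2_norm_square)
    also have "\<dots> \<le> h * (LINT t|?I. K x t)"
    proof (intro mult_mono)
      have "l2_inner ?I ?u ?u = (LINT t|?I. indicator {\<tau>..<x} t)"
        unfolding l2_inner_def by (intro Bochner_Integration.integral_cong) (auto simp: indicator_def)
      also have "\<dots> \<le> x - \<tau>" using \<tau> by (intro measure_unit_le) auto
      finally show "l2_inner ?I ?u ?u \<le> h" using \<tau> by simp
      show "l2_inner ?I ?v ?v \<le> (LINT t|?I. K x t)"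
        unfolding l2_inner_def
      proof (rule integral_mono[OF L2_integrable_mult[OF v v] Kt])
        fix t show "?v t * ?v t \<le> K x t"
          using \<tau> by (auto simp: K_def indicator_def power2_eq_square)
      qed
    qed (use h in \<open>auto simp: l2_inner_self_nonneg\<close>)
    finally show ?thesis .
  qed
  have "l2_inner ?I (antider g) (antider g) = (LINT x|?I. (antider g x)\<^sup>2)"
    by (simp add: l2_inner_def power2_eq_square)
  also have "\<dots> \<le> (LINT x|?I. h * (LINT t|?I. K x t))"
    using L2_integrable_square[OF antider_L2[OF gi]] unit2.integrable_fst[OF Kint] pw
    by (intro integral_mono) auto
  also have "\<dots> = h * (LINT t|?I. LINT x|?I. K x t)"
    using unit2.Fubini_integral[OF Kint] by simp
  also have "(LINT t|?I. LINT x|?I. K x t) \<le> (LINT t|?I. h * (g t)\<^sup>2)"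
  proof (rule integral_mono)
    show "integrable ?I (\<lambda>t. LINT x|?I. K x t)" by (rule unit2.integrable_snd[OF Kint])
    show "integrable ?I (\<lambda>t. h * (g t)\<^sup>2)" using g2 by simp
    fix t
    have "(LINT x|?I. K x t) = (g t)\<^sup>2 * (LINT x|?I. indicator {t<..t+h} x)"
      unfolding integral_mult_right_zero[symmetric] K_def
      by (intro Bochner_Integration.integral_cong) (auto simp: indicator_def)
    also have "\<dots> \<le> (g t)\<^sup>2 * (t + h - t)"
      using h by (intro mult_left_mono measure_unit_le) auto
    finally show "(LINT x|?I. K x t) \<le> h * (g t)\<^sup>2" by (simp add: mult.commute)
  qed
  also have "h * (LINT t|?I. h * (g t)\<^sup>2) = (h * l2_norm ?I g)\<^sup>2"
    by (simp add: l2_norm_square power_mult_distrib power2_eq_square[of h])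
      (simp add: l2_inner_def power2_eq_square)
  finally have "(l2_norm ?I (antider g))\<^sup>2 \<le> (h * l2_norm ?I g)\<^sup>2"
    using h by (simp add: l2_norm_square)
  then show ?thesis using h l2_norm_nonneg[of ?I g] by (intro power2_le_imp_le[of "l2_norm ?I (antider g)"]) auto
qed

text \<open>The boundary conditions give \<open>|E j|^2 = - (E (j - 1), E (j + 1))\<close>, so that the norms of the
  iterated antiderivatives \<open>E j\<close> are log-convex in \<open>j\<close> and the bound for the last quotient of
  consecutive norms, which holds by the Poincare inequality, holds for all of them.\<close>

lemma orthogonal_antider_norm:
  assumes T: "open_knots q T" and e: "e \<in> L2 unit_measure"
    and orth: "\<And>i. i < length T - q - 1 \<Longrightarrow> l2_inner unit_measure e (bspline T q i) = 0"
    and h: "0 < h" "\<And>x. 0 < x \<Longrightarrow> x < 1 \<Longrightarrow> \<exists>\<tau>\<in>set T. x - h \<le> \<tau> \<and> \<tau> \<le> x"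
    and j: "j \<le> q"
  shows "l2_norm unit_measure ((antider ^^ Suc j) e) \<le> h * l2_norm unit_measure ((antider ^^ j) e)"
proof -
  let ?I = unit_measure
  define E where "E j = (antider ^^ j) e" for j
  have E: "E j \<in> L2 ?I" for j unfolding E_def by (rule antider_iter_L2[OF e])
  have ES: "E (Suc j) = antider (E j)" for j by (simp add: E_def)
  have E1: "(LINT x|?I. E j x) = 0" if "j \<le> q" for j
    using orthogonal_antider_1[OF T e orth that] antider_1[of 1 "E j"] by (simp add: E_def)
  show ?thesis
    unfolding E_def[symmetric] using j
  proof (induction j rule: inc_induct)
    case base
    show ?case unfolding ES
    proof (rule antider_Poincare[OF E h(1)])
      fix x :: real assume "0 < x" "x < 1"
      then obtain \<tau> where "\<tau> \<in> set T" "x - h \<le> \<tau>" "\<tau> \<le> x" using h(2) by blast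
      moreover have "antider (E q) \<tau> = 0" if "\<tau> \<in> set T"
        using that orthogonal_antider_knot[OF T e orth] by (auto simp: in_set_conv_nth E_def)
      ultimately show "\<exists>\<tau>\<ge>x - h. \<tau> \<le> x \<and> antider (E q) \<tau> = 0" by blast
    qed
  next
    case (step j)
    define a where "a j = l2_norm ?I (E j)" for j
    have a0: "0 \<le> a j" for j by (simp add: a_def l2_norm_nonneg)
    have "l2_inner ?I (E (Suc j)) (E (Suc j)) = (LINT x|?I. antider (E j) x * E (Suc j) x)"
      by (simp add: l2_inner_def ES)
    also have "\<dots> = - (LINT x|?I. E j x * antider (E (Suc j)) x)"
      using integral_by_parts_unit[OF unit.L2_integrable[OF E] unit.L2_integrable[OF E], of j "Suc j"] E1[of j] step
      by simp
    also have "\<dots> = - l2_inner ?I (E j) (E (Suc (Suc j)))" by (simp add: l2_inner_def ES)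
    also have "\<dots> \<le> a j * a (Suc (Suc j))"
      using l2_Cauchy_Schwarz[OF E E, of j "Suc (Suc j)"] by (simp add: a_def)
    also have "\<dots> \<le> a j * (h * a (Suc j))" using step a0 by (intro mult_left_mono) (auto simp: a_def)
    finally have "a (Suc j) * a (Suc j) \<le> (h * a j) * a (Suc j)"
      using l2_norm_square[of ?I "E (Suc j)"] by (simp add: a_def power2_eq_square mult_ac)
    then have "a (Suc j) \<le> h * a j"
      using a0[of "Suc j"] a0[of j] h by (cases "a (Suc j) = 0") auto
    then show ?case by (simp add: a_def)
  qed
qed

section \<open>Line sections and the antiderivative along one coordinate\<close>

lemma integrable_mult_bounded:
  fixes f w :: "'a \<Rightarrow> real"
  assumes f: "integrable M f" and w: "w \<in> borel_measurable M" "\<And>x. x \<in> space M \<Longrightarrow> \<bar>w x\<bar> \<le> C"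
  shows "integrable M (\<lambda>x. w x * f x)"
proof (rule Bochner_Integration.integrable_bound)
  show "integrable M (\<lambda>x. C * f x)" using f by simp
  show "(\<lambda>x. w x * f x) \<in> borel_measurable M" using f w by auto
  show "AE x in M. norm (w x * f x) \<le> norm (C * f x)"
  proof (rule AE_I2)
    fix x assume "x \<in> space M"
    from w(2)[OF this] show "norm (w x * f x) \<le> norm (C * f x)"
      by (simp add: abs_mult mult_right_mono)
  qed
qed

lemma L2_section:
  assumes "U \<in> L2 unit2_measure" shows "AE y in unit_measure. (\<lambda>x. U (y, x)) \<in> L2 unit_measure"
proof -
  have "AE y in unit_measure. integrable unit_measure (\<lambda>x. (U (y, x))\<^sup>2)"
    using unit2.AE_integrable_fst'[OF L2_integrable_square[OF assms]] .
  moreover have "AE y in unit_measure. y \<in> space unit_measure" by (rule AE_I2)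
  ultimately show ?thesis
  proof eventually_elim
    case (elim y)
    moreover have "(\<lambda>x. U (y, x)) \<in> borel_measurable unit_measure"
      using measurable_Pair2[OF L2_measurable[OF assms] elim(2)] .
    ultimately show ?case by (simp add: L2_def)
  qed
qed

definition pantider :: "(real \<times> real \<Rightarrow> real) \<Rightarrow> real \<times> real \<Rightarrow> real" where
  "pantider U = (\<lambda>(y, x). antider (\<lambda>t. U (y, t)) x)"

lemma pantider_Pair [simp]: "pantider U (y, x) = antider (\<lambda>t. U (y, t)) x"
  by (simp add: pantider_def)

lemma pantider_measurable:
  assumes "U \<in> borel_measurable unit2_measure"
  shows "pantider U \<in> borel_measurable unit2_measure"
proof -
  have "(\<lambda>z. antider (\<lambda>t. U (fst z, t)) (snd z)) \<in> borel_measurable unit2_measure"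
  proof (rule antider_measurable2)
    have "(\<lambda>w :: real \<times> real \<times> real. (fst (snd w), fst w)) \<in> measurable (unit_measure \<Otimes>\<^sub>M unit2_measure) unit2_measure"
      by (intro measurable_Pair measurable_fst measurable_compose[OF measurable_snd measurable_fst])
    from measurable_compose[OF this assms]
    show "(\<lambda>(t, z). U (fst z, t)) \<in> borel_measurable (unit_measure \<Otimes>\<^sub>M unit2_measure)"
      by (simp add: case_prod_beta')
    show "snd \<in> borel_measurable unit2_measure" by (rule measurable_unit2) measurable
  qed
  then show ?thesis by (simp add: pantider_def case_prod_beta')
qed

lemma antider_square_le:
  assumes "g \<in> L2 unit_measure"
  shows "(antider g x)\<^sup>2 \<le> (LINT t|unit_measure. (g t)\<^sup>2)"
proof -
  have a: "(\<lambda>t. \<bar>g t\<bar>) \<in> L2 unit_measure" using assms by (auto simp: L2_def)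
  have one: "(\<lambda>t. 1) \<in> L2 unit_measure" by (auto simp: L2_def)
  have "\<bar>antider g x\<bar> \<le> l2_inner unit_measure (\<lambda>t. \<bar>g t\<bar>) (\<lambda>t. 1)"
    using antider_abs_le[OF unit.L2_integrable[OF assms]] by (simp add: l2_inner_def)
  also have "\<dots> \<le> l2_norm unit_measure (\<lambda>t. \<bar>g t\<bar>) * l2_norm unit_measure (\<lambda>t. 1)"
    using l2_Cauchy_Schwarz[OF a one] by simp
  also have "\<dots> = l2_norm unit_measure g"
    using measure_unit_measure by (simp add: l2_norm_eq)
  finally have "\<bar>antider g x\<bar>\<^sup>2 \<le> (l2_norm unit_measure g)\<^sup>2" by (intro power_mono) auto
  then show ?thesis unfolding l2_norm_square by (simp add: l2_inner_def power2_eq_square)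
qed

lemma integrable_fst_const:
  assumes "integrable unit_measure (c :: real \<Rightarrow> real)"
  shows "integrable unit2_measure (\<lambda>z. c (fst z))"
proof (rule unit2.Fubini_integrable)
  show "(\<lambda>z. c (fst z)) \<in> borel_measurable unit2_measure"
    by (rule measurable_compose[OF measurable_fst]) (use assms in simp)
  show "integrable unit_measure (\<lambda>x. LINT y|unit_measure. norm (c (fst (x, y))))"
    using integrable_abs[OF assms] by simp
  show "AE x in unit_measure. integrable unit_measure (\<lambda>y. c (fst (x, y)))" by simp
qed

lemma pantider_L2:
  assumes U: "U \<in> L2 unit2_measure" shows "pantider U \<in> L2 unit2_measure"
proof -
  have m: "pantider U \<in> borel_measurable unit2_measure"
    by (rule pantider_measurable[OF L2_measurable[OF U]])
  define c where "c y = (LINT x|unit_measure. (U (y, x))\<^sup>2)" for y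
  have c: "integrable unit_measure c"
    using unit2.integrable_fst'[OF L2_integrable_square[OF U]] by (simp add: c_def[abs_def])
  note ci = integrable_fst_const[OF c]
  have m2: "(\<lambda>z. (pantider U z)\<^sup>2) \<in> borel_measurable unit2_measure" using m by simp
  have mc: "(\<lambda>z. c (fst z)) \<in> borel_measurable unit2_measure" using ci by simp
  have "integrable unit2_measure (\<lambda>z. (pantider U z)\<^sup>2)"
  proof (rule Bochner_Integration.integrable_bound[OF ci m2])
    show "AE z in unit2_measure. norm ((pantider U z)\<^sup>2) \<le> norm (c (fst z))"
    proof (rule unit2.AE_pair_measure)
      show "{z \<in> space unit2_measure. norm ((pantider U z)\<^sup>2) \<le> norm (c (fst z))} \<in> sets unit2_measure"
        by (rule borel_measurable_le[OF measurable_compose[OF m2 borel_measurable_norm]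
              measurable_compose[OF mc borel_measurable_norm]])
      show "AE y in unit_measure. AE x in unit_measure. norm ((pantider U (y, x))\<^sup>2) \<le> norm (c (fst (y, x)))"
        using L2_section[OF U]
      proof eventually_elim
        case (elim y)
        show ?case using antider_square_le[OF elim] by (intro AE_I2) (simp add: c_def)
      qed
    qed
  qed
  with m show ?thesis by (simp add: L2_def)
qed

section \<open>Absolute continuity along lines\<close>

text \<open>Absolute continuity on almost every line, expressed by its integral representation. The
  constant \<open>c y\<close> is arbitrary on each line: it is paired only with functions whose mean
  on the line is zero.\<close>

definition line_ac :: "2 \<Rightarrow> (real^2 \<Rightarrow> real) \<Rightarrow> (real^2 \<Rightarrow> real) \<Rightarrow> bool" where
  "line_ac i v v1 \<longleftrightarrow> v \<in> L2 square_measure \<and> v1 \<in> L2 square_measure \<and>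
     (\<exists>c. AE y in unit_measure. AE x in unit_measure.
        v (edge_pt i x y) = c y + antider (\<lambda>t. v1 (edge_pt i t y)) x)"

text \<open>The mean zero condition kills both the constant on the line and the boundary term at 1;
  the boundary term at 0 is absent because antiderivatives start there.\<close>

lemma line_ac_parts:
  assumes ac: "line_ac i v v1" and g: "g \<in> L2 unit2_measure"
    and zero: "AE y in unit_measure. (LINT x|unit_measure. g (y, x)) = 0"
  shows "(LINT z|unit2_measure. v (sq_pt i z) * g z) = - (LINT z|unit2_measure. v1 (sq_pt i z) * pantider g z)"
proof -
  define V where "V z = v (sq_pt i z)" for z
  define V1 where "V1 z = v1 (sq_pt i z)" for z
  have V: "V \<in> L2 unit2_measure" "V1 \<in> L2 unit2_measure"
    using ac unfolding line_ac_def V_def V1_def by (auto intro: L2_square_pair)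
  obtain c where c: "AE y in unit_measure. AE x in unit_measure. V (y, x) = c y + antider (\<lambda>t. V1 (y, t)) x"
    using ac unfolding line_ac_def V_def V1_def by auto
  have "(LINT z|unit2_measure. V z * g z) = (LINT y|unit_measure. LINT x|unit_measure. V (y, x) * g (y, x))"
    by (rule unit2.integral_fst'[OF L2_integrable_mult[OF V(1) g], symmetric])
  also have "\<dots> = (LINT y|unit_measure. - (LINT x|unit_measure. V1 (y, x) * pantider g (y, x)))"
  proof (rule integral_cong_AE)
    show "(\<lambda>y. LINT x|unit_measure. V (y, x) * g (y, x)) \<in> borel_measurable unit_measure"
      using unit2.integrable_fst'[OF L2_integrable_mult[OF V(1) g]] by simp
    show "(\<lambda>y. - (LINT x|unit_measure. V1 (y, x) * pantider g (y, x))) \<in> borel_measurable unit_measure"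
      using unit2.integrable_fst'[OF L2_integrable_mult[OF V(2) pantider_L2[OF g]]] by simp
    show "AE y in unit_measure. (LINT x|unit_measure. V (y, x) * g (y, x))
        = - (LINT x|unit_measure. V1 (y, x) * pantider g (y, x))"
      using c zero L2_section[OF g] L2_section[OF V(2)] L2_section[OF V(1)]
    proof eventually_elim
      case (elim y)
      let ?g = "\<lambda>x. g (y, x)" and ?V1 = "\<lambda>x. V1 (y, x)"
      have gi: "integrable unit_measure ?g" "integrable unit_measure ?V1"
        using elim by (auto intro: unit.L2_integrable)
      have a: "integrable unit_measure (\<lambda>x. antider ?V1 x * ?g x)"
        using integrable_mult_antider[OF gi] by (simp add: mult.commute)
      have "(LINT x|unit_measure. V (y, x) * ?g x) = (LINT x|unit_measure. c y * ?g x + antider ?V1 x * ?g x)"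
      proof (rule integral_cong_AE)
        show "(\<lambda>x. V (y, x) * ?g x) \<in> borel_measurable unit_measure"
          using elim(5,3) by (auto simp: L2_def)
        show "(\<lambda>x. c y * ?g x + antider ?V1 x * ?g x) \<in> borel_measurable unit_measure"
          using a gi by auto
        show "AE x in unit_measure. V (y, x) * ?g x = c y * ?g x + antider ?V1 x * ?g x"
          using elim(1) by eventually_elim (simp add: distrib_right)
      qed
      also have "\<dots> = c y * (LINT x|unit_measure. ?g x) + (LINT x|unit_measure. antider ?V1 x * ?g x)"
        using gi a by simp
      also have "\<dots> = - (LINT x|unit_measure. ?V1 x * antider ?g x)"
        using integral_by_parts_unit[OF gi(2,1)] elim(2) by simp
      finally show ?case by simp
    qed
  qed
  also have "\<dots> = - (LINT z|unit2_measure. V1 z * pantider g z)"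
    using unit2.integral_fst'[OF L2_integrable_mult[OF V(2) pantider_L2[OF g]]] by simp
  finally show ?thesis by (simp add: V_def V1_def)
qed

section \<open>Smooth weights and test functions on the square\<close>

lemma smooth_real_bounded:
  assumes "a \<in> smooth_real" shows "\<exists>C. \<forall>x\<in>{0..1}. \<bar>a x\<bar> \<le> C"
proof -
  have "compact (a ` {0..1})" using smooth_real_continuous[OF assms] by (intro compact_continuous_image) auto
  then have "bounded (a ` {0..1})" by (rule compact_imp_bounded)
  then show ?thesis unfolding bounded_iff by auto
qed

lemma smooth_real_measurable: "a \<in> smooth_real \<Longrightarrow> a \<in> borel_measurable borel"
  by (intro borel_measurable_continuous_onI smooth_real_continuous)

lemma smooth_real_L2: "a \<in> smooth_real \<Longrightarrow> a \<in> L2 unit_measure"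
proof -
  assume a: "a \<in> smooth_real"
  then obtain C where "\<forall>x\<in>{0..1}. \<bar>a x\<bar> \<le> C" using smooth_real_bounded by blast
  then show "a \<in> L2 unit_measure"
    by (intro unit.L2_boundedI[of _ C] measurable_unit_measure smooth_real_measurable a AE_I2) auto
qed

lemma smooth_weight:
  assumes "a \<in> smooth_real" "b \<in> smooth_real"
  shows "\<exists>C. (\<lambda>z. b (fst z) * a (snd z)) \<in> borel_measurable unit2_measure \<and>
    (\<forall>z\<in>space unit2_measure. \<bar>b (fst z) * a (snd z)\<bar> \<le> C)"
proof -
  obtain C D where C: "\<forall>x\<in>{0..1}. \<bar>a x\<bar> \<le> C" "\<forall>x\<in>{0..1}. \<bar>b x\<bar> \<le> D"
    using smooth_real_bounded assms by meson
  have [measurable]: "a \<in> borel_measurable borel" "b \<in> borel_measurable borel"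
    using assms smooth_real_measurable by auto
  have "(\<lambda>z. b (fst z) * a (snd z)) \<in> borel_measurable unit2_measure"
    by (rule measurable_unit2) measurable
  moreover have "\<bar>b (fst z) * a (snd z)\<bar> \<le> D * C" if "z \<in> space unit2_measure" for z
    using that C order.trans[OF abs_ge_zero, of "b 0" D] unfolding abs_mult
    by (intro mult_mono) (auto simp: less_imp_le)
  ultimately show ?thesis by blast
qed

lemma integrable_smooth_weight:
  assumes "integrable unit2_measure (f :: real \<times> real \<Rightarrow> real)" "a \<in> smooth_real" "b \<in> smooth_real"
  shows "integrable unit2_measure (\<lambda>z. (b (fst z) * a (snd z)) * f z)"
  using smooth_weight[OF assms(2,3)] integrable_mult_bounded[OF assms(1)] by blast

text \<open>Products of interval bumps converge boundedly to indicators of rectangles, so dominated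
  convergence turns the tests into integrals over rectangles.\<close>

lemma AE_unit2_eq_0_test:
  fixes Z :: "real \<times> real \<Rightarrow> real"
  assumes Zi: "integrable unit2_measure Z"
    and Ztest: "\<And>a b c d. a \<in> smooth_real \<Longrightarrow> b \<in> smooth_real \<Longrightarrow> 0 < c \<Longrightarrow> d < 1 \<Longrightarrow>
      (\<And>x. a x \<noteq> 0 \<Longrightarrow> c \<le> x \<and> x \<le> d) \<Longrightarrow> (\<And>x. b x \<noteq> 0 \<Longrightarrow> c \<le> x \<and> x \<le> d) \<Longrightarrow>
      (LINT z|unit2_measure. (b (fst z) * a (snd z)) * Z z) = 0"
  shows "AE y in unit_measure. AE x in unit_measure. Z (y, x) = 0"
proof (rule AE_unit2_eq_0[OF Zi])
  fix a b c d :: real assume abcd: "0 \<le> a" "b \<le> 1" "0 \<le> c" "d \<le> 1"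
  let ?f = "\<lambda>n z. (interval_bump c d n (fst z) * interval_bump a b n (snd z)) * Z z"
  have f0: "(LINT z|unit2_measure. ?f n z) = 0" for n
  proof (cases "n = 0")
    case True
    then have "?f n = (\<lambda>z. 0)" using interval_bump_support(1)[of a b n] by (intro ext) auto
    then show ?thesis by simp
  next
    case False
    show ?thesis
    proof (rule Ztest[of _ _ "1 / real n" "1 - 1 / real n"])
      show "interval_bump a b n x \<noteq> 0 \<Longrightarrow> 1 / real n \<le> x \<and> x \<le> 1 - 1 / real n"
        "interval_bump c d n x \<noteq> 0 \<Longrightarrow> 1 / real n \<le> x \<and> x \<le> 1 - 1 / real n" for x
        using interval_bump_support[of a b n x] interval_bump_support[of c d n x] abcd by auto
    qed (use False in \<open>auto intro: interval_bump_smooth\<close>)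
  qed
  have lim: "(\<lambda>n. LINT z|unit2_measure. ?f n z) \<longlonglongrightarrow> (LINT z|unit2_measure. (indicator {c<..<d} (fst z) * indicator {a<..<b} (snd z)) * Z z)"
  proof (rule integral_dominated_convergence[where w="\<lambda>z. \<bar>Z z\<bar>"])
    show "integrable unit2_measure (\<lambda>z. \<bar>Z z\<bar>)" using Zi by simp
    show "?f n \<in> borel_measurable unit2_measure" for n
      using integrable_smooth_weight[OF Zi interval_bump_smooth[of a b n] interval_bump_smooth[of c d n]] by simp
    have "(\<lambda>z. indicator {c<..<d} (fst z) * indicator {a<..<b} (snd z) :: real) \<in> borel_measurable unit2_measure"
      by (rule measurable_unit2) measurable
    then show "(\<lambda>z. (indicator {c<..<d} (fst z) * indicator {a<..<b} (snd z)) * Z z) \<in> borel_measurable unit2_measure"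
      using Zi by (intro borel_measurable_times) auto
    show "AE z in unit2_measure. (\<lambda>n. ?f n z) \<longlonglongrightarrow> (indicator {c<..<d} (fst z) * indicator {a<..<b} (snd z)) * Z z"
      by (intro AE_I2 tendsto_mult tendsto_const interval_bump_tendsto)
    show "AE z in unit2_measure. norm (?f n z) \<le> \<bar>Z z\<bar>" for n
    proof (rule AE_I2)
      fix z
      have "interval_bump c d n (fst z) * interval_bump a b n (snd z) \<le> 1"
        by (intro mult_le_one interval_bump_bounds)
      then have "\<bar>interval_bump c d n (fst z) * interval_bump a b n (snd z)\<bar> * \<bar>Z z\<bar> \<le> 1 * \<bar>Z z\<bar>"
        by (intro mult_right_mono) (auto simp: interval_bump_bounds)
      then show "norm (?f n z) \<le> \<bar>Z z\<bar>" by (simp add: abs_mult)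
    qed
  qed
  have "(\<lambda>n. LINT z|unit2_measure. ?f n z) \<longlonglongrightarrow> 0" by (simp only: f0 tendsto_const)
  from LIMSEQ_unique[OF lim this]
  have "(LINT z|unit2_measure. (indicator {c<..<d} (fst z) * indicator {a<..<b} (snd z)) * Z z) = 0" .
  then show "(LINT (y, x)|unit2_measure. indicator {c<..<d} y * indicator {a<..<b} x * Z (y, x)) = 0"
    by (simp add: case_prod_beta')
qed

text \<open>The integrals of the bumps for \<open>{0<..<1}\<close> converge to 1, so one of them is
  nonzero and can be normalised; its value is never computed.\<close>

lemma exists_unit_bump:
  "\<exists>\<rho>\<in>smooth_real. (LINT x|unit_measure. \<rho> x) = 1 \<and> (\<exists>c d. 0 < c \<and> d < 1 \<and> (\<forall>x. \<rho> x \<noteq> 0 \<longrightarrow> c \<le> x \<and> x \<le> d))"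
proof -
  let ?B = "interval_bump 0 1"
  have "(\<lambda>n. LINT x|unit_measure. ?B n x) \<longlonglongrightarrow> (LINT x|unit_measure. indicator {0<..<1} x)"
    by (rule integral_dominated_convergence[where w="\<lambda>_. 1"])
      (auto intro!: measurable_unit_measure smooth_real_measurable interval_bump_smooth AE_I2
        interval_bump_tendsto simp: interval_bump_bounds)
  also have "(LINT x|unit_measure. indicator {0<..<1} x) = (LINT x|unit_measure. 1)"
    by (intro Bochner_Integration.integral_cong) auto
  finally have lim: "(\<lambda>n. LINT x|unit_measure. ?B n x) \<longlonglongrightarrow> 1" by (simp add: measure_unit_measure)
  have "\<exists>n. (LINT x|unit_measure. ?B n x) \<noteq> 0"
  proof (rule ccontr)
    assume "\<not> ?thesis"
    then have "(\<lambda>n. LINT x|unit_measure. ?B n x) \<longlonglongrightarrow> 0" by simp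
    from LIMSEQ_unique[OF this lim] show False by simp
  qed
  then obtain n where n: "(LINT x|unit_measure. ?B n x) \<noteq> 0" by blast
  let ?\<rho> = "\<lambda>x. (1 / (LINT x|unit_measure. ?B n x)) * ?B n x"
  have n0: "n > 0"
  proof (rule ccontr)
    assume "\<not> n > 0"
    then have "?B n x = 0" for x using interval_bump_support(1) by blast
    then show False using n by simp
  qed
  have s: "?\<rho> \<in> smooth_real" by (rule smooth_real_cmult[OF interval_bump_smooth])
  have i: "(LINT x|unit_measure. ?\<rho> x) = 1" using n by (subst integral_mult_right_zero) simp
  have supp: "0 + 1 / real n \<le> x \<and> x \<le> 1 - 1 / real n" if "?\<rho> x \<noteq> 0" for x
    using that interval_bump_support(2,3)[of 0 1 n x] by auto
  show ?thesis
    using s i supp n0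
    by (intro bexI[of _ ?\<rho>] conjI exI[of _ "1 / real n"] exI[of _ "1 - 1 / real n"]) auto
qed

text \<open>Zero mean is exactly what makes the primitive vanish to the right of the support as
  well. It is then admissible in a test function.\<close>

lemma smooth_primitive:
  assumes a: "a \<in> smooth_real" and cd: "0 < c" "d < 1"
    and supp: "\<And>x. a x \<noteq> 0 \<Longrightarrow> c \<le> x \<and> x \<le> d" and zero: "(LINT x|unit_measure. a x) = 0"
  shows "\<exists>A\<in>smooth_real. (\<forall>x. (A has_real_derivative a x) (at x)) \<and> (\<forall>x. A x \<noteq> 0 \<longrightarrow> c \<le> x \<and> x \<le> d) \<and>
    (\<forall>x. 0 \<le> x \<and> x \<le> 1 \<longrightarrow> antider a x = A x)"
proof -
  have "\<exists>F. \<forall>x :: real. - \<infinity> < ereal x \<longrightarrow> ereal x < \<infinity> \<longrightarrow> (F has_vector_derivative a x) (at x)"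
    using smooth_real_continuous[OF a, of UNIV]
    by (intro einterval_antiderivative) (auto simp: continuous_on_eq_continuous_at)
  then obtain F where F: "\<And>x. (F has_real_derivative a x) (at x)"
    by (auto simp: has_real_derivative_iff_has_vector_derivative)
  define A where "A x = F x - F 0" for x
  have A: "(A has_real_derivative a x) (at x)" for x
    unfolding A_def using F by (auto intro!: derivative_eq_intros)
  have ant: "antider a x = A x" if "0 \<le> x" "x \<le> 1" for x
    using antider_FTC[of F a x, OF has_field_derivative_at_within[OF F] smooth_real_continuous[OF a] that]
    by (simp add: A_def)
  have A0: "A 0 = 0" by (simp add: A_def)
  have A1: "A 1 = 0" using ant[of 1] zero by (simp add: antider_1)
  have const: "A x = A y" if "convex S" "\<And>t. t \<in> S \<Longrightarrow> a t = 0" "x \<in> S" "y \<in> S" for S x y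
  proof -
    have "(A has_field_derivative 0) (at t within S)" if "t \<in> S" for t
      using has_field_derivative_at_within[OF A, of t S] \<open>\<And>t. t \<in> S \<Longrightarrow> a t = 0\<close>[OF that] by simp
    from has_field_derivative_zero_constant[OF that(1) this] that(3,4) show ?thesis by auto
  qed
  have "c \<le> x \<and> x \<le> d" if "A x \<noteq> 0" for x
  proof -
    have "\<not> x < c"
    proof
      assume "x < c"
      then have "A x = A 0" using supp cd by (intro const[of "{..<c}"]) force+
      then show False using A0 that by simp
    qed
    moreover have "\<not> x > d"
    proof
      assume "x > d"
      then have "A x = A 1" using supp cd by (intro const[of "{d<..}"]) force+
      then show False using A1 that by simp
    qed
    ultimately show ?thesis by simp
  qed
  then show ?thesis using A ant smooth_real_antideriv[OF a A] by blast
qed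

text \<open>The du Bois-Reymond lemma: a test function along the lines is split into a derivative and a
  multiple of a fixed bump \<open>\<rho>\<close>, which determines the constant on each line.\<close>

lemma weak_imp_line_ac:
  assumes v: "v \<in> L2 square_measure" and v1: "v1 \<in> L2 square_measure"
    and weak: "\<And>\<phi>. \<phi> \<in> test_fun \<Longrightarrow>
      (LINT z|square_measure. v z * partial i \<phi> z) = - (LINT z|square_measure. v1 z * \<phi> z)"
  shows "line_ac i v v1"
proof -
  let ?I = unit_measure and ?Q = unit2_measure
  define V where "V z = v (sq_pt i z)" for z
  define V1 where "V1 z = v1 (sq_pt i z)" for z
  have V: "V \<in> L2 ?Q" "V1 \<in> L2 ?Q"
    using v v1 unfolding V_def V1_def by (auto intro: L2_square_pair)
  define P where "P = pantider V1"
  have P: "P \<in> L2 ?Q" unfolding P_def by (rule pantider_L2[OF V(2)])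
  define W where "W z = V z - P z" for z
  have W: "W \<in> L2 ?Q" unfolding W_def using V(1) P by (rule L2_diff)
  obtain \<rho> c0 d0 where \<rho>: "\<rho> \<in> smooth_real" "(LINT x|?I. \<rho> x) = 1" "0 < c0" "d0 < 1"
    "\<And>x. \<rho> x \<noteq> 0 \<Longrightarrow> c0 \<le> x \<and> x \<le> d0"
    using exists_unit_bump by blast
  \<comment> \<open>If \<open>W\<close> is constant along a line, testing with \<open>\<rho>\<close>
    returns that constant, because \<open>\<rho>\<close> has integral 1. It remains to show that
    \<open>Z\<close>, the deviation from it, vanishes.\<close>
  define c where "c y = (LINT x|?I. \<rho> x * W (y, x))" for y
  define Z where "Z z = W z - c (fst z)" for z
  note wint = integrable_smooth_weight
  have one: "(\<lambda>x. 1) \<in> smooth_real"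
    unfolding smooth_real_def by (intro CollectI exI[of _ "\<lambda>n x. if n = 0 then 1 else 0"]) auto
  have Wi: "integrable ?Q W" by (rule unit2'.L2_integrable[OF W])
  have ci: "integrable ?I c"
    using unit2.integrable_fst'[OF wint[OF Wi \<rho>(1) one]] by (simp add: c_def[abs_def])
  have cQ: "integrable ?Q (\<lambda>z. c (fst z))" by (rule integrable_fst_const[OF ci])
  have Zi: "integrable ?Q Z" unfolding Z_def using Wi cQ by simp
  have Ztest: "(LINT z|?Q. (b (fst z) * a (snd z)) * Z z) = 0"
    if a: "a \<in> smooth_real" and b: "b \<in> smooth_real" and cd: "0 < c1" "d1 < 1"
      and supp: "\<And>x. a x \<noteq> 0 \<Longrightarrow> c1 \<le> x \<and> x \<le> d1" "\<And>x. b x \<noteq> 0 \<Longrightarrow> c1 \<le> x \<and> x \<le> d1" for a b c1 d1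
  proof -
    define m where "m = (LINT x|?I. a x)"
    define a' where "a' x = a x + (- m) * \<rho> x" for x
    have a': "a' \<in> smooth_real" unfolding a'_def using a \<rho>(1) by (intro smooth_real_add smooth_real_cmult)
    have ai: "integrable ?I a" "integrable ?I \<rho>" "integrable ?I a'"
      using a \<rho> a' by (auto intro!: unit.L2_integrable smooth_real_L2)
    have a'0: "(LINT x|?I. a' x) = 0" unfolding a'_def using ai \<rho>(2) by (simp add: m_def)
    define c2 where "c2 = min c0 c1"
    define d2 where "d2 = max d0 d1"
    have cd2: "0 < c2" "d2 < 1" using cd \<rho> by (auto simp: c2_def d2_def)
    have supp': "c2 \<le> x \<and> x \<le> d2" if "a' x \<noteq> 0" for x
    proof -
      have "a x \<noteq> 0 \<or> \<rho> x \<noteq> 0" using that by (auto simp: a'_def)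
      then show ?thesis using supp(1)[of x] \<rho>(5)[of x] by (auto simp: c2_def d2_def)
    qed
    obtain A where A: "A \<in> smooth_real" "\<And>x. (A has_real_derivative a' x) (at x)"
      "\<And>x. A x \<noteq> 0 \<Longrightarrow> c2 \<le> x \<and> x \<le> d2" "\<And>x. 0 \<le> x \<and> x \<le> 1 \<Longrightarrow> antider a' x = A x"
      using smooth_primitive[OF a' cd2 supp' a'0] by blast
    have suppb: "c2 \<le> x \<and> x \<le> d2" if "b x \<noteq> 0" for x
      using supp(2)[OF that] by (auto simp: c2_def d2_def)
    let ?\<phi> = "\<lambda>z :: real^2. A (z $ i) * b (z $ (i + 1))"
    have "?\<phi> \<in> test_fun" by (rule smooth_product_test_fun[OF A(1) b cd2 A(3) suppb])
    from weak[OF this] have weak':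
      "(LINT z|square_measure. v z * (a' (z $ i) * b (z $ (i + 1)))) = - (LINT z|square_measure. v1 z * (A (z $ i) * b (z $ (i + 1))))"
      by (simp add: partial_smooth_product[OF A(1) b A(2)])
    have pair: "(LINT z|square_measure. w z * (f (z $ i) * b (z $ (i + 1)))) = (LINT z|?Q. (b (fst z) * f (snd z)) * w (sq_pt i z))"
      if "f \<in> smooth_real" "w \<in> L2 square_measure" for f w
    proof -
      have "(\<lambda>z :: real^2. f (z $ i) * b (z $ (i + 1))) \<in> borel_measurable borel"
        using Ck_on_continuous[OF Ck_on_smooth_product[OF that(1) b, of 0 i "i + 1"]]
        by (rule borel_measurable_continuous_onI)
      from borel_measurable_times[OF L2_measurable[OF that(2)] measurable_square_measure[OF this]]
      have "(\<lambda>z. w z * (f (z $ i) * b (z $ (i + 1)))) \<in> borel_measurable square_measure" .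
      from square_integral_pair[OF this, of i] show ?thesis
        by (simp add: sq_pt_def case_prod_beta' mult_ac)
    qed
    have K1: "(LINT z|?Q. (b (fst z) * a' (snd z)) * V z) = - (LINT z|?Q. (b (fst z) * A (snd z)) * V1 z)"
      using weak' unfolding pair[OF a' v] pair[OF A(1) v1] V_def V1_def .
    have "(LINT z|?Q. (b (fst z) * a' (snd z)) * P z) = (LINT y|?I. LINT x|?I. (b y * a' x) * P (y, x))"
      using unit2.integral_fst'[OF wint[OF unit2'.L2_integrable[OF P] a' b]] by simp
    also have "\<dots> = (LINT y|?I. - (LINT x|?I. (b y * A x) * V1 (y, x)))"
    proof (rule integral_cong_AE)
      show "(\<lambda>y. LINT x|?I. (b y * a' x) * P (y, x)) \<in> borel_measurable ?I"
        using unit2.integrable_fst'[OF wint[OF unit2'.L2_integrable[OF P] a' b]] by simp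
      show "(\<lambda>y. - (LINT x|?I. (b y * A x) * V1 (y, x))) \<in> borel_measurable ?I"
        using unit2.integrable_fst'[OF wint[OF unit2'.L2_integrable[OF V(2)] A(1) b]] by simp
      show "AE y in ?I. (LINT x|?I. (b y * a' x) * P (y, x)) = - (LINT x|?I. (b y * A x) * V1 (y, x))"
        using L2_section[OF V(2)]
      proof eventually_elim
        case (elim y)
        have "(LINT x|?I. a' x * antider (\<lambda>t. V1 (y, t)) x) = - (LINT x|?I. antider a' x * V1 (y, x))"
          using integral_by_parts_unit[OF ai(3) unit.L2_integrable[OF elim]] a'0 by simp
        also have "(LINT x|?I. antider a' x * V1 (y, x)) = (LINT x|?I. A x * V1 (y, x))"
          using A(4) by (intro Bochner_Integration.integral_cong) auto
        finally have "b y * (LINT x|?I. a' x * antider (\<lambda>t. V1 (y, t)) x) = b y * - (LINT x|?I. A x * V1 (y, x))"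
          by simp
        then show ?case by (simp add: P_def mult.assoc)
      qed
    qed
    also have "\<dots> = - (LINT z|?Q. (b (fst z) * A (snd z)) * V1 z)"
      using unit2.integral_fst'[OF wint[OF unit2'.L2_integrable[OF V(2)] A(1) b]] by simp
    finally have K2: "(LINT z|?Q. (b (fst z) * a' (snd z)) * P z) = - (LINT z|?Q. (b (fst z) * A (snd z)) * V1 z)" .
    have K3: "(LINT z|?Q. (b (fst z) * a' (snd z)) * W z) = 0"
      using K1 K2 wint[OF unit2'.L2_integrable[OF V(1)] a' b] wint[OF unit2'.L2_integrable[OF P] a' b]
      by (simp add: W_def right_diff_distrib)
    have "(LINT z|?Q. (b (fst z) * a (snd z)) * W z)
       = (LINT z|?Q. (b (fst z) * a' (snd z)) * W z + m * ((b (fst z) * \<rho> (snd z)) * W z))"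
      by (intro Bochner_Integration.integral_cong) (auto simp: a'_def algebra_simps)
    also have "\<dots> = m * (LINT z|?Q. (b (fst z) * \<rho> (snd z)) * W z)"
      using K3 wint[OF Wi a' b] wint[OF Wi \<rho>(1) b] by simp
    also have "(LINT z|?Q. (b (fst z) * \<rho> (snd z)) * W z) = (LINT y|?I. b y * c y)"
      using unit2.integral_fst'[OF wint[OF Wi \<rho>(1) b]] by (simp add: c_def mult.assoc)
    also have "m * (LINT y|?I. b y * c y) = (LINT y|?I. LINT x|?I. (b y * a x) * c y)"
    proof -
      have "(LINT x|?I. (b y * a x) * c y) = m * (b y * c y)" for y
        using integral_mult_right_zero[of ?I "b y * c y" a] by (simp add: m_def mult_ac)
      then show ?thesis by (simp only: integral_mult_right_zero)
    qed
    also have "\<dots> = (LINT z|?Q. (b (fst z) * a (snd z)) * c (fst z))"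
      using unit2.integral_fst'[OF wint[OF cQ a b]] by simp
    finally show ?thesis
      using wint[OF Wi a b] wint[OF cQ a b] by (simp add: Z_def right_diff_distrib)
  qed
  have "AE y in ?I. AE x in ?I. Z (y, x) = 0"
    using Ztest by (rule AE_unit2_eq_0_test[OF Zi])
  then have "AE y in ?I. AE x in ?I. v (edge_pt i x y) = c y + antider (\<lambda>t. v1 (edge_pt i t y)) x"
    by eventually_elim (auto simp: Z_def W_def P_def V_def V1_def elim!: eventually_mono)
  then show ?thesis unfolding line_ac_def using v v1 by blast
qed

interpretation unit4: pair_sigma_finite unit2_measure unit2_measure
  by unfold_locales

section \<open>Smoothing along lines\<close>

lemma L2_if_nn_integral_le:
  assumes D: "D \<in> borel_measurable M" and "0 \<le> B" "(\<integral>\<^sup>+z. ennreal ((D z)\<^sup>2) \<partial>M) \<le> ennreal (B\<^sup>2)"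
  shows "D \<in> L2 M" "l2_norm M D \<le> B"
proof -
  have i: "integrable M (\<lambda>z. (D z)\<^sup>2)"
  proof (rule integrableI_nonneg)
    show "(\<integral>\<^sup>+z. ennreal ((D z)\<^sup>2) \<partial>M) < \<infinity>"
      using assms(3) by (rule order.strict_trans1) simp
  qed (use D in auto)
  then show "D \<in> L2 M" using D by (simp add: L2_def)
  have "ennreal (LINT z|M. (D z)\<^sup>2) \<le> ennreal (B\<^sup>2)"
    using assms(3) i by (subst (asm) nn_integral_eq_integral) auto
  then have "(LINT z|M. (D z)\<^sup>2) \<le> B\<^sup>2" by (simp add: ennreal_le_iff)
  then show "l2_norm M D \<le> B" unfolding l2_norm_eq using assms(2) by (intro real_le_lsqrt) auto
qed

lemma norm_sq_pt_diff_le: "norm (sq_pt i (y, x) - sq_pt i (y', x')) \<le> \<bar>x - x'\<bar> + \<bar>y - y'\<bar>"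
proof -
  have "sq_pt i (y, x) - sq_pt i (y', x') = (x - x') *\<^sub>R axis i 1 + (y - y') *\<^sub>R axis (i + 1) 1"
    by (simp add: edge_pt_alt algebra_simps)
  also have "norm \<dots> \<le> \<bar>x - x'\<bar> + \<bar>y - y'\<bar>"
    by (rule norm_triangle_le) (simp add: norm_axis_1)
  finally show ?thesis .
qed

lemma window_measure_le:
  assumes "0 \<le> h"
  shows "(LINT z|unit2_measure. indicator ({b - h..b + h} \<times> {a - h..a + h}) z) \<le> (2 * h)\<^sup>2"
proof -
  let ?A = "{a - h..a + h}" and ?B = "{b - h..b + h}"
  have i: "integrable unit2_measure (\<lambda>z. indicator (?B \<times> ?A) z :: real)"
  proof (rule unit2'.L2_integrable, rule unit2'.L2_boundedI[of _ 1])
    have "?B \<times> ?A \<in> sets (borel \<Otimes>\<^sub>M borel)" by (rule pair_measureI) auto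
    then show "(\<lambda>z. indicator (?B \<times> ?A) z :: real) \<in> borel_measurable unit2_measure"
      by (intro measurable_unit2 borel_measurable_indicator)
  qed (auto simp: indicator_def)
  have "(LINT z|unit2_measure. indicator (?B \<times> ?A) z)
      = (LINT y|unit_measure. LINT x|unit_measure. indicator ?B y * (indicator ?A x :: real))"
    unfolding unit2.integral_fst'[OF i, symmetric] by (simp add: indicator_times)
  also have "\<dots> = (LINT y|unit_measure. indicator ?B y * (LINT x|unit_measure. (indicator ?A x :: real)))"
    by (simp only: integral_mult_right_zero)
  also have "\<dots> = (LINT y|unit_measure. indicator ?B y) * (LINT x|unit_measure. (indicator ?A x :: real))"
    by (simp only: integral_mult_left_zero)
  also have "\<dots> \<le> (2 * h) * (2 * h)"
    using measure_unit_le[of ?B "b - h" "b + h"] measure_unit_le[of ?A "a - h" "a + h"] assms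
    by (intro mult_mono) (auto intro!: integral_nonneg_AE simp del: integral_indicator)
  finally show ?thesis by (simp add: power2_eq_square)
qed

lemma slobodeckij_square_pair:
  assumes v: "v \<in> borel_measurable square_measure"
  shows "slobodeckij square_measure \<mu> v = (\<integral>\<^sup>+z. \<integral>\<^sup>+z'. ennreal ((v (sq_pt i z) - v (sq_pt i z'))\<^sup>2 /
      norm (sq_pt i z - sq_pt i z') powr (2 + 2 * \<mu>)) \<partial>unit2_measure \<partial>unit2_measure)"
proof -
  define q where "q x y = ennreal ((v x - v y)\<^sup>2 / norm (x - y) powr (2 + 2 * \<mu>))" for x y :: "real^2"
  have [measurable]: "v \<in> borel_measurable square_measure" by (rule v)
  have [measurable]: "(\<lambda>x. x) \<in> borel_measurable square_measure" by (rule measurable_square_measure) simp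
  have q [measurable]: "(\<lambda>(x, y). q x y) \<in> borel_measurable (square_measure \<Otimes>\<^sub>M square_measure)"
    unfolding q_def by measurable
  have inner: "(\<integral>\<^sup>+y. q x y \<partial>square_measure) = (\<integral>\<^sup>+z'. q x (sq_pt i z') \<partial>unit2_measure)" if x: "x \<in> open_square" for x
  proof -
    have "(\<lambda>y. q x y) \<in> borel_measurable square_measure" using measurable_Pair2[OF q, of x] x by simp
    then show ?thesis
      by (subst distr_sq_pt[of i, symmetric], subst nn_integral_distr) auto
  qed
  have "slobodeckij square_measure \<mu> v = (\<integral>\<^sup>+x. \<integral>\<^sup>+y. q x y \<partial>square_measure \<partial>square_measure)"
    by (simp add: slobodeckij_def q_def)
  also have "\<dots> = (\<integral>\<^sup>+z. \<integral>\<^sup>+y. q (sq_pt i z) y \<partial>square_measure \<partial>unit2_measure)"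
  proof -
    have "(\<lambda>x. \<integral>\<^sup>+y. q x y \<partial>square_measure) \<in> borel_measurable square_measure"
      by (rule square.borel_measurable_nn_integral) (use q in simp)
    then show ?thesis
      by (subst (1) distr_sq_pt[of i, symmetric], subst nn_integral_distr) auto
  qed
  also have "\<dots> = (\<integral>\<^sup>+z. \<integral>\<^sup>+z'. q (sq_pt i z) (sq_pt i z') \<partial>unit2_measure \<partial>unit2_measure)"
    by (intro nn_integral_cong inner) (auto simp: edge_pt_in_open_square)
  finally show ?thesis by (simp add: q_def)
qed

text \<open>Cauchy-Schwarz on the window where the kernel lives, followed by insertion of the
  Slobodeckij weight: points of the window are at distance at most \<open>2 * h\<close>, so the
  missing denominator costs a power of \<open>2 * h\<close>. This power is the gain in
  \<open>h\<close>.\<close>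

lemma kernel_difference_bound:
  fixes K :: "real \<times> real \<Rightarrow> real \<times> real \<Rightarrow> real" and i :: 2
  assumes v: "v \<in> L2 square_measure" and S: "slobodeckij square_measure \<mu> v = ennreal (S\<^sup>2)" "0 \<le> S"
    and K: "(\<lambda>(z, z'). K z z') \<in> borel_measurable (unit2_measure \<Otimes>\<^sub>M unit2_measure)"
      "\<And>z z'. \<bar>K z z'\<bar> \<le> M"
      "\<And>y x y' x'. K (y, x) (y', x') \<noteq> 0 \<Longrightarrow> \<bar>y' - y\<bar> \<le> h \<and> \<bar>x' - x\<bar> \<le> h"
    and h: "0 < h" and \<mu>: "0 < \<mu>"
  defines "D \<equiv> \<lambda>z. LINT z'|unit2_measure. K z z' * (v (sq_pt i z) - v (sq_pt i z'))"
  shows "D \<in> L2 unit2_measure" "l2_norm unit2_measure D \<le> M * (2 * h) * (2 * h) powr (1 + \<mu>) * S"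
proof -
  define V where "V z = v (sq_pt i z)" for z
  define q where "q z z' = (V z - V z')\<^sup>2 / norm (sq_pt i z - sq_pt i z') powr (2 + 2 * \<mu>)" for z z'
  have V: "V \<in> L2 unit2_measure" unfolding V_def by (rule L2_square_pair[OF v])
  have [measurable]: "V \<in> borel_measurable unit2_measure" using V by (rule L2_measurable)
  note K(1) [measurable]
  have [measurable]: "sq_pt i \<in> borel_measurable unit2_measure"
    by (rule measurable_unit2[OF sq_pt_measurable_borel])
  have qm [measurable]: "(\<lambda>(z, z'). q z z') \<in> borel_measurable (unit2_measure \<Otimes>\<^sub>M unit2_measure)"
    unfolding q_def by measurable
  have M: "0 \<le> M" using order.trans[OF abs_ge_zero K(2)] .
  have Dm: "D \<in> borel_measurable unit2_measure"
    unfolding D_def V_def[symmetric] by measurable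
  \<comment> \<open>Area of the window, square of the kernel bound, and the largest value of the
    Slobodeckij denominator on the window.\<close>
  let ?c = "(2 * h)\<^sup>2 * (M\<^sup>2 * (2 * h) powr (2 + 2 * \<mu>))"
  have pw: "ennreal ((D z)\<^sup>2) \<le> ennreal ?c * (\<integral>\<^sup>+z'. ennreal (q z z') \<partial>unit2_measure)"
    if z: "z \<in> space unit2_measure" for z
  proof -
    obtain y x where zyx: "z = (y, x)" by (cases z)
    let ?W = "{y - h..y + h} \<times> {x - h..x + h}"
    let ?u = "indicator ?W :: real \<times> real \<Rightarrow> real" and ?f = "\<lambda>z'. K z z' * (V z - V z')"
    have Kz [measurable]: "K z \<in> borel_measurable unit2_measure" using measurable_Pair2[OF K(1) z] by simp
    have qz: "q z \<in> borel_measurable unit2_measure" using measurable_Pair2[OF qm z] by simp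
    have c: "(\<lambda>z'. V z) \<in> L2 unit2_measure" by (rule unit2'.L2_boundedI[of _ "\<bar>V z\<bar>"]) auto
    have f: "?f \<in> L2 unit2_measure"
      by (rule L2_bounded_mult[OF L2_diff[OF c V] Kz]) (rule K(2))
    have W: "?W \<in> sets (borel \<Otimes>\<^sub>M borel)" by (rule pair_measureI) auto
    have u: "?u \<in> L2 unit2_measure"
    proof (rule unit2'.L2_boundedI[of _ 1])
      show "?u \<in> borel_measurable unit2_measure"
        by (rule measurable_unit2) (rule borel_measurable_indicator[OF W])
    qed (auto simp: indicator_def)
    have supp: "z' \<in> ?W" if "K z z' \<noteq> 0" for z'
      using K(3)[of y x "fst z'" "snd z'"] that zyx by (cases z') (auto simp: abs_le_iff)
    have "D z = l2_inner unit2_measure ?u ?f"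
      unfolding D_def l2_inner_def V_def[symmetric]
      using supp by (intro Bochner_Integration.integral_cong) (auto simp: indicator_def)
    then have "\<bar>D z\<bar> \<le> l2_norm unit2_measure ?u * l2_norm unit2_measure ?f"
      using l2_Cauchy_Schwarz[OF u f] by simp
    then have "\<bar>D z\<bar>\<^sup>2 \<le> (l2_norm unit2_measure ?u * l2_norm unit2_measure ?f)\<^sup>2" by (intro power_mono) auto
    also have "\<dots> = l2_inner unit2_measure ?u ?u * l2_inner unit2_measure ?f ?f"
      by (simp add: power_mult_distrib l2_norm_square)
    also have "l2_inner unit2_measure ?u ?u = (LINT z'|unit2_measure. ?u z')"
      unfolding l2_inner_def by (intro Bochner_Integration.integral_cong) (auto simp: indicator_def)
    also have "(LINT z'|unit2_measure. ?u z') * l2_inner unit2_measure ?f ?f \<le> (2 * h)\<^sup>2 * l2_inner unit2_measure ?f ?f"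
      using h by (intro mult_right_mono window_measure_le l2_inner_self_nonneg) auto
    finally have "ennreal ((D z)\<^sup>2) \<le> ennreal ((2 * h)\<^sup>2) * ennreal (l2_inner unit2_measure ?f ?f)"
      by (simp add: ennreal_mult[symmetric] l2_inner_self_nonneg)
    also have "ennreal (l2_inner unit2_measure ?f ?f) = (\<integral>\<^sup>+z'. ennreal (?f z' * ?f z') \<partial>unit2_measure)"
      unfolding l2_inner_def by (rule nn_integral_eq_integral[symmetric, OF L2_integrable_mult[OF f f]]) simp
    also have "\<dots> \<le> (\<integral>\<^sup>+z'. ennreal (M\<^sup>2 * (2 * h) powr (2 + 2 * \<mu>)) * ennreal (q z z') \<partial>unit2_measure)"
    proof (rule nn_integral_mono)
      fix z' :: "real \<times> real"
      have "?f z' * ?f z' \<le> M\<^sup>2 * (2 * h) powr (2 + 2 * \<mu>) * q z z'"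
      \<comment> \<open>Coinciding points are set apart since the quotient in \<open>q\<close> has
        denominator 0 there; the difference of the values vanishes anyway.\<close>
      proof (cases "K z z' = 0 \<or> sq_pt i z = sq_pt i z'")
        case True
        then show ?thesis by (auto simp: q_def V_def)
      next
        case False
        obtain y' x' where z': "z' = (y', x')" by (cases z')
        have "norm (sq_pt i z - sq_pt i z') \<le> \<bar>x - x'\<bar> + \<bar>y - y'\<bar>"
          unfolding zyx z' by (rule norm_sq_pt_diff_le)
        also have "\<dots> \<le> 2 * h" using K(3)[of y x y' x'] False zyx z' by (auto simp: abs_minus_commute)
        finally have "norm (sq_pt i z - sq_pt i z') powr (2 + 2 * \<mu>) \<le> (2 * h) powr (2 + 2 * \<mu>)"
          using \<mu> by (intro powr_mono2) auto
        then have "q z z' * norm (sq_pt i z - sq_pt i z') powr (2 + 2 * \<mu>) \<le> q z z' * (2 * h) powr (2 + 2 * \<mu>)"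
          by (intro mult_left_mono) (auto simp: q_def)
        then have "(V z - V z')\<^sup>2 \<le> (2 * h) powr (2 + 2 * \<mu>) * q z z'"
          using False by (simp add: q_def mult.commute)
        moreover have "(K z z')\<^sup>2 \<le> M\<^sup>2" using power_mono[OF K(2)[of z z'], of 2] by simp
        ultimately have "(K z z')\<^sup>2 * (V z - V z')\<^sup>2 \<le> M\<^sup>2 * ((2 * h) powr (2 + 2 * \<mu>) * q z z')"
          by (intro mult_mono) auto
        then show ?thesis by (simp add: power2_eq_square mult_ac)
      qed
      then show "ennreal (?f z' * ?f z') \<le> ennreal (M\<^sup>2 * (2 * h) powr (2 + 2 * \<mu>)) * ennreal (q z z')"
        by (subst ennreal_mult[symmetric]) (auto simp: q_def intro!: ennreal_leI)
    qed
    also have "\<dots> = ennreal (M\<^sup>2 * (2 * h) powr (2 + 2 * \<mu>)) * (\<integral>\<^sup>+z'. ennreal (q z z') \<partial>unit2_measure)"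
      using qz by (intro nn_integral_cmult) auto
    finally show ?thesis by (simp add: ennreal_mult mult.assoc mult_left_mono)
  qed
  have B: "(M * (2 * h) * (2 * h) powr (1 + \<mu>) * S)\<^sup>2 = ?c * S\<^sup>2"
  proof -
    have "((2 * h) powr (1 + \<mu>))\<^sup>2 = (2 * h) powr (2 + 2 * \<mu>)"
      unfolding power2_eq_square powr_add[symmetric] by (simp add: algebra_simps)
    then show ?thesis by (simp add: power_mult_distrib)
  qed
  have "(\<integral>\<^sup>+z. ennreal ((D z)\<^sup>2) \<partial>unit2_measure)
      \<le> (\<integral>\<^sup>+z. ennreal ?c * (\<integral>\<^sup>+z'. ennreal (q z z') \<partial>unit2_measure) \<partial>unit2_measure)"
    by (rule nn_integral_mono) (rule pw)
  also have "\<dots> = ennreal ?c * (\<integral>\<^sup>+z. \<integral>\<^sup>+z'. ennreal (q z z') \<partial>unit2_measure \<partial>unit2_measure)"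
    by (intro nn_integral_cmult) measurable
  also have "(\<integral>\<^sup>+z. \<integral>\<^sup>+z'. ennreal (q z z') \<partial>unit2_measure \<partial>unit2_measure) = ennreal (S\<^sup>2)"
    using slobodeckij_square_pair[OF L2_measurable[OF v], of \<mu> i] S(1) by (simp add: q_def V_def)
  also have "ennreal ?c * ennreal (S\<^sup>2) = ennreal ((M * (2 * h) * (2 * h) powr (1 + \<mu>) * S)\<^sup>2)"
    unfolding B by (simp add: ennreal_mult)
  finally have *: "(\<integral>\<^sup>+z. ennreal ((D z)\<^sup>2) \<partial>unit2_measure) \<le> ennreal ((M * (2 * h) * (2 * h) powr (1 + \<mu>) * S)\<^sup>2)" .
  have nn: "0 \<le> M * (2 * h) * (2 * h) powr (1 + \<mu>) * S" using M h S by simp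
  show "D \<in> L2 unit2_measure" "l2_norm unit2_measure D \<le> M * (2 * h) * (2 * h) powr (1 + \<mu>) * S"
    using L2_if_nn_integral_le[OF Dm nn *] by auto
qed

text \<open>On the unit interval this is \<open>30 * s^2 * (1 - s)^2\<close>. The square makes it
  continuously differentiable across 0 and 1, and 30 normalises the integral. Since
  \<open>s - s^2\<close> is at most \<open>1/4\<close>, the value is at most \<open>30/16\<close>
  and the derivative at most \<open>60/4\<close> in modulus, hence the bounds 2 and 15.\<close>

definition hat :: "real \<Rightarrow> real" where "hat s = 30 * (max 0 (s - s\<^sup>2))\<^sup>2"

definition hat' :: "real \<Rightarrow> real" where "hat' s = 60 * max 0 (s - s\<^sup>2) * (1 - 2 * s)"

lemma hat_outside: "s \<le> 0 \<or> 1 \<le> s \<Longrightarrow> hat s = 0" "s \<le> 0 \<or> 1 \<le> s \<Longrightarrow> hat' s = 0"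
proof -
  assume "s \<le> 0 \<or> 1 \<le> s"
  then have "s * (1 - s) \<le> 0" by (auto simp: mult_nonpos_nonneg mult_nonneg_nonpos)
  then have "max 0 (s - s\<^sup>2) = 0" by (simp add: power2_eq_square algebra_simps)
  then show "hat s = 0" "hat' s = 0" by (simp_all add: hat_def hat'_def)
qed

lemma hat_bounds: "\<bar>hat s\<bar> \<le> 2" "\<bar>hat' s\<bar> \<le> 15"
proof -
  have "0 \<le> (s - 1/2)\<^sup>2" by simp
  then have m: "max 0 (s - s\<^sup>2) \<le> 1/4" by (auto simp: max_def power2_eq_square algebra_simps)
  have "(max 0 (s - s\<^sup>2))\<^sup>2 \<le> (1/4)\<^sup>2" using m by (intro power_mono) auto
  then show "\<bar>hat s\<bar> \<le> 2" by (simp add: hat_def power2_eq_square)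
  show "\<bar>hat' s\<bar> \<le> 15"
  proof (cases "s \<le> 0 \<or> 1 \<le> s")
    case False
    then have "\<bar>1 - 2 * s\<bar> \<le> 1" by (auto simp: abs_le_iff)
    then have "max 0 (s - s\<^sup>2) * \<bar>1 - 2 * s\<bar> \<le> 1/4 * 1" using m by (intro mult_mono) auto
    then show ?thesis by (simp add: hat'_def abs_mult mult_ac)
  qed (simp add: hat_outside)
qed

lemma hat_deriv: "(hat has_real_derivative hat' s) (at s)"
proof -
  have sq: "((\<lambda>t. (max 0 t)\<^sup>2) has_real_derivative 2 * max 0 t) (at t)" for t :: real
  proof -
    consider "t < 0" | "t > 0" | "t = 0" by linarith
    then show ?thesis
    proof cases
      case 1
      have "((\<lambda>t. 0) has_real_derivative 2 * max 0 t) (at t)" using 1 by simp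
      then show ?thesis
        by (rule has_field_derivative_transform_within_open[of _ _ _ "{..<0}"]) (use 1 in auto)
    next
      case 2
      have "((\<lambda>t. t\<^sup>2) has_real_derivative 2 * max 0 t) (at t)" using 2 by (auto intro!: derivative_eq_intros)
      then show ?thesis
        by (rule has_field_derivative_transform_within_open[of _ _ _ "{0<..}"]) (use 2 in auto)
    next
      case 3
      have "((\<lambda>h :: real. ((max 0 (0 + h))\<^sup>2 - (max 0 0)\<^sup>2) / h) \<longlongrightarrow> 0) (at 0)"
      proof (rule Lim_null_comparison)
        show "\<forall>\<^sub>F h in at 0. norm (((max 0 (0 + h))\<^sup>2 - (max 0 0)\<^sup>2) / h) \<le> \<bar>h :: real\<bar>"
          by (intro always_eventually allI) (auto simp: power2_eq_square max_def)
        show "((\<lambda>h :: real. \<bar>h\<bar>) \<longlongrightarrow> 0) (at 0)" by (intro tendsto_rabs_zero tendsto_ident_at)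
      qed
      then show ?thesis using 3 by (simp add: DERIV_def)
    qed
  qed
  have "((\<lambda>s. s - s\<^sup>2) has_real_derivative 1 - 2 * s) (at s)" by (auto intro!: derivative_eq_intros)
  from DERIV_cmult[OF DERIV_chain2[OF sq this], of 30]
  show ?thesis unfolding hat_def[abs_def] hat'_def by (simp add: mult_ac)
qed

lemma hat_continuous: "continuous_on A hat" "continuous_on A hat'"
  unfolding hat_def[abs_def] hat'_def[abs_def] by (intro continuous_intros)+

lemma integral_rescaled:
  fixes f :: "real \<Rightarrow> real"
  assumes f0: "\<And>s. s \<le> 0 \<or> 1 \<le> s \<Longrightarrow> f s = 0" and a: "0 \<le> a" "0 < h" "a + h \<le> 1"
  shows "(LINT t|unit_measure. f ((t - a) / h)) = h * (LINT s|lborel. f s)"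
proof -
  have "(LINT t|unit_measure. f ((t - a) / h)) = (LINT t|lborel. f ((t - a) / h))"
    unfolding unit_measure_def
  proof (subst integral_restrict_space)
    show "(LINT t|lborel. indicator {0<..<1} t *\<^sub>R f ((t - a) / h)) = (LINT t|lborel. f ((t - a) / h))"
    proof (intro Bochner_Integration.integral_cong refl)
      fix t
      have "(t - a) / h \<le> 0 \<or> 1 \<le> (t - a) / h" if "t \<le> 0 \<or> 1 \<le> t"
        using that a by (auto simp: divide_le_0_iff field_simps)
      then show "indicator {0<..<1} t *\<^sub>R f ((t - a) / h) = f ((t - a) / h)"
        using f0 by (cases "t \<le> 0 \<or> 1 \<le> t") (auto simp: indicator_def)
    qed
  qed auto
  also have "\<dots> = (LINT t|lborel. f (- a / h + (1 / h) * t))" by (simp add: diff_divide_distrib)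
  also have "\<dots> = h * (LINT s|lborel. f s)"
    using lborel_integral_real_affine[of "1 / h" f "- a / h"] a by (simp add: field_simps)
  finally show ?thesis .
qed

lemma hat_integral: "(LINT s|lborel. hat s) = 1" "(LINT s|lborel. hat' s) = 0"
proof -
  have "(LINT s|lborel. hat s) = (LINT s|lborel. (30 * (s - s\<^sup>2)\<^sup>2) * indicator {0..1} s)"
  proof (intro Bochner_Integration.integral_cong refl)
    fix s :: real
    show "hat s = (30 * (s - s\<^sup>2)\<^sup>2) * indicator {0..1} s"
    proof (cases "0 \<le> s \<and> s \<le> 1")
      case True
      then have "0 \<le> s * (1 - s)" by simp
      then have "max 0 (s - s\<^sup>2) = s - s\<^sup>2" by (simp add: power2_eq_square algebra_simps)
      then show ?thesis using True by (simp add: hat_def)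
    qed (auto simp: hat_outside indicator_def)
  qed
  also have "\<dots> = (10 * 1 ^ 3 - 15 * 1 ^ 4 + 6 * 1 ^ 5) - (10 * 0 ^ 3 - 15 * 0 ^ 4 + 6 * 0 ^ 5)"
    by (rule integral_FTC_Icc_real[where F="\<lambda>s. 10 * s ^ 3 - 15 * s ^ 4 + 6 * s ^ 5"])
      (auto intro!: derivative_eq_intros continuous_intros simp: eval_nat_numeral algebra_simps)
  finally show "(LINT s|lborel. hat s) = 1" by simp
  have "(LINT s|lborel. hat' s) = (LINT s|lborel. hat' s * indicator {0..1} s)"
  proof (intro Bochner_Integration.integral_cong refl)
    fix s :: real
    show "hat' s = hat' s * indicator {0..1} s"
      using hat_outside(2)[of s] by (cases "0 \<le> s \<and> s \<le> 1") (auto simp: indicator_def)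
  qed
  also have "\<dots> = hat 1 - hat 0"
    using hat_continuous(2)[of UNIV] hat_deriv
    by (intro integral_FTC_Icc_real) (auto simp: continuous_on_eq_continuous_at)
  finally show "(LINT s|lborel. hat' s) = 0" by (simp add: hat_outside)
qed

text \<open>The smoothing kernel averages \<open>v\<close> over a window of length \<open>h\<close> around each point. For the point
  \<open>x\<close> the window is \<open>[(1 - h) * x, (1 - h) * x + h]\<close>, which stays inside the unit interval, so that
  no extension of \<open>v\<close> is needed. The derivative of the kernel has integral zero, hence \<open>w1\<close> is an
  average of differences of \<open>v\<close>, too.\<close>

lemma line_smoothing:
  assumes v: "v \<in> L2 square_measure" and S: "slobodeckij square_measure \<mu> v = ennreal (S\<^sup>2)" "0 \<le> S"
    and h: "0 < h" "h \<le> 1" and \<mu>: "0 < \<mu>" "\<mu> \<le> 1"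
  shows "\<exists>w w1. line_ac i w w1 \<and> l2_norm square_measure (\<lambda>z. v z - w z) \<le> 16 * h powr \<mu> * S \<and>
    l2_norm square_measure w1 \<le> 120 * h powr (\<mu> - 1) * S"
proof -
  let ?I = unit_measure and ?Q = unit2_measure
  \<comment> \<open>The average also runs over the transverse variable, because the seminorm is a
    double integral over the square and pairs on a common line form a null set of it. Only the
    derivative along the line is taken, so a sharp window serves here.\<close>
  define win where "win y y' = (if (1 - h) * y \<le> y' \<and> y' \<le> (1 - h) * y + h then 1 else 0 :: real)" for y y'
  define k where "k z z' = (1 / h\<^sup>2) * hat ((snd z' - (1 - h) * snd z) / h) * win (fst z) (fst z')" for z z'
  \<comment> \<open>The derivative of \<open>k\<close> in the coordinate along the line. The factor
    \<open>1 / h^2\<close> in \<open>k\<close> normalises two windows of length \<open>h\<close>;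
    the inner function of \<open>hat\<close> adds \<open>- (1 - h) / h\<close>.\<close>
  define k1 where "k1 z z' = (- (1 - h) / h ^ 3) * hat' ((snd z' - (1 - h) * snd z) / h) * win (fst z) (fst z')" for z z'
  have range: "0 \<le> (1 - h) * x" "(1 - h) * x + h \<le> 1" if "0 \<le> x" "x \<le> 1" for x
  proof -
    show "0 \<le> (1 - h) * x" using h that by simp
    have "(1 - h) * x \<le> (1 - h) * 1" using h that by (intro mult_left_mono) auto
    then show "(1 - h) * x + h \<le> 1" by simp
  qed
  have near: "\<bar>x' - x\<bar> \<le> h" if "0 \<le> x" "x \<le> 1" "(1 - h) * x \<le> x'" "x' \<le> (1 - h) * x + h" for x x'
  proof -
    have "0 \<le> h * x" "h * x \<le> h * 1" using h that by (auto intro!: mult_left_mono)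
    then show ?thesis using that(3,4) by (auto simp: abs_le_iff algebra_simps)
  qed
  have [measurable]: "hat \<in> borel_measurable borel" "hat' \<in> borel_measurable borel"
    by (auto intro!: borel_measurable_continuous_onI hat_continuous)
  have km': "(\<lambda>(z, z'). k z z') \<in> borel_measurable ((borel \<Otimes>\<^sub>M borel) \<Otimes>\<^sub>M (borel \<Otimes>\<^sub>M borel))"
    "(\<lambda>(z, z'). k1 z z') \<in> borel_measurable ((borel \<Otimes>\<^sub>M borel) \<Otimes>\<^sub>M (borel \<Otimes>\<^sub>M borel))"
    unfolding k_def k1_def win_def by measurable
  have id4: "(\<lambda>w. w) \<in> measurable (?Q \<Otimes>\<^sub>M ?Q) ((borel \<Otimes>\<^sub>M borel) \<Otimes>\<^sub>M (borel \<Otimes>\<^sub>M borel))"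
  proof -
    have id: "(\<lambda>z. z) \<in> measurable ?Q (borel \<Otimes>\<^sub>M borel)" by (rule measurable_unit2) simp
    have "(\<lambda>w. (fst w, snd w)) \<in> measurable (?Q \<Otimes>\<^sub>M ?Q) ((borel \<Otimes>\<^sub>M borel) \<Otimes>\<^sub>M (borel \<Otimes>\<^sub>M borel))"
      by (intro measurable_Pair measurable_compose[OF measurable_fst id] measurable_compose[OF measurable_snd id])
    then show ?thesis by simp
  qed
  have km: "(\<lambda>(z, z'). k z z') \<in> borel_measurable (?Q \<Otimes>\<^sub>M ?Q)" "(\<lambda>(z, z'). k1 z z') \<in> borel_measurable (?Q \<Otimes>\<^sub>M ?Q)"
    using measurable_compose[OF id4 km'(1)] measurable_compose[OF id4 km'(2)] by simp_all
  have kb: "\<bar>k z z'\<bar> \<le> 2 / h\<^sup>2" "\<bar>k1 z z'\<bar> \<le> 15 / h ^ 3" for z z'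
  proof -
    have win: "\<bar>win y y'\<bar> \<le> 1" for y y' by (simp add: win_def)
    have "\<bar>k z z'\<bar> \<le> (1 / h\<^sup>2) * 2 * 1"
      unfolding k_def abs_mult using h by (intro mult_mono hat_bounds win) auto
    then show "\<bar>k z z'\<bar> \<le> 2 / h\<^sup>2" by simp
    have "\<bar>k1 z z'\<bar> \<le> (1 / h ^ 3) * 15 * 1"
      unfolding k1_def abs_mult using h by (intro mult_mono hat_bounds win) (auto simp: divide_right_mono)
    then show "\<bar>k1 z z'\<bar> \<le> 15 / h ^ 3" by simp
  qed
  text \<open>Outside the square the kernels are cut off, so that the support condition holds everywhere.\<close>
  define c where "c z = (if 0 < fst z \<and> fst z < 1 \<and> 0 < snd z \<and> snd z < 1 then 1 else 0 :: real)" for z :: "real \<times> real"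
  have c1: "c z = 1" if "z \<in> space ?Q" for z using that by (cases z) (auto simp: c_def)
  have cm: "(\<lambda>(z, z'). c z * f z z') \<in> borel_measurable (?Q \<Otimes>\<^sub>M ?Q)"
    if "(\<lambda>(z, z'). f z z') \<in> borel_measurable (?Q \<Otimes>\<^sub>M ?Q)" for f
  proof -
    have "(\<lambda>w. c (fst w) * (case w of (z, z') \<Rightarrow> f z z')) \<in> borel_measurable (?Q \<Otimes>\<^sub>M ?Q)"
      unfolding c_def by (intro borel_measurable_times that measurable_compose[OF id4]) measurable
    then show ?thesis by (simp add: case_prod_beta')
  qed
  have cb: "\<bar>c z * f\<bar> \<le> B" if "\<bar>f\<bar> \<le> B" for z f B using that by (auto simp: c_def)
  have hat_near: "(1 - h) * x \<le> x' \<and> x' \<le> (1 - h) * x + h"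
    if "hat ((x' - (1 - h) * x) / h) \<noteq> 0 \<or> hat' ((x' - (1 - h) * x) / h) \<noteq> 0" for x x'
  proof -
    have "0 < (x' - (1 - h) * x) / h \<and> (x' - (1 - h) * x) / h < 1"
      using that hat_outside[of "(x' - (1 - h) * x) / h"] by (meson not_le)
    then show ?thesis using h by (auto simp: zero_less_divide_iff divide_less_eq_1)
  qed
  have supp: "\<bar>y' - y\<bar> \<le> h \<and> \<bar>x' - x\<bar> \<le> h"
    if "c (y, x) * k (y, x) (y', x') \<noteq> 0 \<or> c (y, x) * k1 (y, x) (y', x') \<noteq> 0" for y x y' x'
  proof -
    have "0 \<le> y" "y \<le> 1" "0 \<le> x" "x \<le> 1" using that by (auto simp: c_def split: if_splits)
    moreover have "(1 - h) * y \<le> y' \<and> y' \<le> (1 - h) * y + h"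
      using that by (auto simp: k_def k1_def win_def split: if_splits)
    moreover have "(1 - h) * x \<le> x' \<and> x' \<le> (1 - h) * x + h"
      using that by (intro hat_near) (auto simp: k_def k1_def)
    ultimately show ?thesis using near by blast
  qed
  have kint: "integrable ?Q (k z)" "integrable ?Q (k1 z)" for z
  proof -
    have "k z \<in> borel_measurable ?Q" "k1 z \<in> borel_measurable ?Q"
      using measurable_Pair2[OF km'(1), of z] measurable_Pair2[OF km'(2), of z]
      by (auto intro!: measurable_unit2 simp: space_pair_measure)
    then show "integrable ?Q (k z)" "integrable ?Q (k1 z)"
      by (auto intro!: unit2'.L2_integrable unit2'.L2_boundedI[OF _ AE_I2, OF _ kb(1)]
          unit2'.L2_boundedI[OF _ AE_I2, OF _ kb(2)] simp del: split_paired_All)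
  qed
  have win_int: "(LINT y'|?I. win y y') = h" if y: "0 < y" "y < 1" for y
  proof -
    have "(LINT y'|?I. win y y') = (LINT y'|?I. indicator {(1 - h) * y..(1 - h) * y + h} y')"
      by (intro Bochner_Integration.integral_cong) (auto simp: win_def indicator_def)
    also have "\<dots> = measure lborel ({(1 - h) * y..(1 - h) * y + h} \<inter> {0<..<1})"
      unfolding unit_measure_def by (simp add: measure_restrict_space)
    also have "\<dots> = measure lborel {(1 - h) * y..(1 - h) * y + h}"
    proof (rule measure_eq_AE)
      show "AE x in lborel. (x \<in> {(1 - h) * y..(1 - h) * y + h} \<inter> {0<..<1}) = (x \<in> {(1 - h) * y..(1 - h) * y + h})"
        using AE_lborel_singleton[of 0] AE_lborel_singleton[of 1]
      proof eventually_elim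
        case (elim x)
        then show ?case using range[of y] y by auto
      qed
    qed auto
    finally show ?thesis using h by simp
  qed
  have k_one: "(LINT z'|?Q. k z z') = 1" "(LINT z'|?Q. k1 z z') = 0" if z: "z \<in> space ?Q" for z
  proof -
    obtain y x where zyx: "z = (y, x)" and yx: "0 < y" "y < 1" "0 < x" "x < 1" using z by (cases z) auto
    have "(LINT z'|?Q. k z z') = (LINT y'|?I. LINT x'|?I. k z (y', x'))"
      by (rule unit2.integral_fst'[OF kint(1), symmetric])
    also have "\<dots> = (LINT y'|?I. (1 / h\<^sup>2) * (LINT x'|?I. hat ((x' - (1 - h) * x) / h)) * win y y')"
      unfolding k_def zyx by simp
    also have "\<dots> = (LINT y'|?I. (1 / h) * win y y')"
      using integral_rescaled[of hat "(1 - h) * x" h] hat_outside range[of x] yx h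
      by (simp add: hat_integral power2_eq_square)
    also have "\<dots> = 1" using win_int[OF yx(1,2)] h by (subst integral_mult_right_zero) simp
    finally show "(LINT z'|?Q. k z z') = 1" .
    have "(LINT z'|?Q. k1 z z') = (LINT y'|?I. LINT x'|?I. k1 z (y', x'))"
      by (rule unit2.integral_fst'[OF kint(2), symmetric])
    also have "\<dots> = (LINT y'|?I. (- (1 - h) / h ^ 3) * (LINT x'|?I. hat' ((x' - (1 - h) * x) / h)) * win y y')"
      unfolding k1_def zyx by simp
    also have "\<dots> = 0"
      using integral_rescaled[of hat' "(1 - h) * x" h] hat_outside range[of x] yx h
      by (simp add: hat_integral)
    finally show "(LINT z'|?Q. k1 z z') = 0" .
  qed
  define V where "V z = v (sq_pt i z)" for z
  have V: "V \<in> L2 ?Q" unfolding V_def by (rule L2_square_pair[OF v])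
  have Vi: "integrable ?Q V" by (rule unit2'.L2_integrable[OF V])
  have kV: "integrable ?Q (\<lambda>z'. k z z' * V z')" "integrable ?Q (\<lambda>z'. k1 z z' * V z')" for z
    using integrable_mult_bounded[OF Vi borel_measurable_integrable[OF kint(1)] kb(1)]
      integrable_mult_bounded[OF Vi borel_measurable_integrable[OF kint(2)] kb(2)] by auto
  define W where "W z = (LINT z'|?Q. k z z' * V z')" for z
  define W1 where "W1 z = (LINT z'|?Q. k1 z z' * V z')" for z
  have D: "(LINT z'|?Q. (c z * k z z') * (V z - V z')) = V z - W z"
    "(LINT z'|?Q. (c z * k1 z z') * (V z - V z')) = - W1 z" if z: "z \<in> space ?Q" for z
    using k_one[OF z] kV kint c1[OF z]
    by (simp_all add: W_def W1_def right_diff_distrib mult.commute[of _ "V z"])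
  note bound = kernel_difference_bound[OF v S cm[OF km(1)] cb[OF kb(1)] supp[OF disjI1] h(1) \<mu>(1), where i=i, folded V_def]
    and bound1 = kernel_difference_bound[OF v S cm[OF km(2)] cb[OF kb(2)] supp[OF disjI2] h(1) \<mu>(1), where i=i, folded V_def]
  have L2_cong: "f \<in> L2 ?Q \<and> l2_norm ?Q f = l2_norm ?Q g" if "g \<in> L2 ?Q" "\<And>z. z \<in> space ?Q \<Longrightarrow> g z = f z" for f g
  proof -
    have "f \<in> borel_measurable ?Q" using measurable_cong[of ?Q g f borel] that by (auto simp: L2_def)
    moreover have "integrable ?Q (\<lambda>z. (f z)\<^sup>2)"
      using that Bochner_Integration.integrable_cong[of ?Q ?Q "\<lambda>z. (g z)\<^sup>2" "\<lambda>z. (f z)\<^sup>2"] by (auto simp: L2_def)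
    moreover have "l2_norm ?Q f = l2_norm ?Q g" unfolding l2_norm_eq
      using that by (auto intro!: arg_cong[where f=sqrt] Bochner_Integration.integral_cong)
    ultimately show ?thesis by (simp add: L2_def)
  qed
  have VW: "(\<lambda>z. V z - W z) \<in> L2 ?Q" "l2_norm ?Q (\<lambda>z. V z - W z) \<le> 2 / h\<^sup>2 * (2 * h) * (2 * h) powr (1 + \<mu>) * S"
    using L2_cong[OF bound(1) D(1)] bound(2) by auto
  have mW1: "(\<lambda>z. - W1 z) \<in> L2 ?Q" "l2_norm ?Q (\<lambda>z. - W1 z) \<le> 15 / h ^ 3 * (2 * h) * (2 * h) powr (1 + \<mu>) * S"
    using L2_cong[OF bound1(1) D(2)] bound1(2) by auto
  have W: "W \<in> L2 ?Q" using L2_diff[OF V VW(1)] by simp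
  have W1: "W1 \<in> L2 ?Q" using L2_cmult[OF mW1(1), of "-1"] by simp
  \<comment> \<open>The factor 4 is \<open>2 powr 2\<close>, using \<open>\<mu> \<le> 1\<close>.
    With the kernel bounds 2 and 15 and the side \<open>2 * h\<close> of the window, the constants
    become \<open>2 * 2 * 4 = 16\<close> and \<open>15 * 2 * 4 = 120\<close>.\<close>
  have p: "(2 * h) powr (1 + \<mu>) \<le> 4 * h * h powr \<mu>"
  proof -
    have "2 powr (1 + \<mu>) \<le> 2 powr 2" using \<mu> by (intro powr_mono) auto
    then have "2 powr (1 + \<mu>) * (h powr (1 + \<mu>)) \<le> 4 * h powr (1 + \<mu>)" by (intro mult_right_mono) auto
    then show ?thesis using h by (simp add: powr_mult powr_add mult_ac)
  qed
  define w where "w z = W (z $ (i + 1), z $ i)" for z :: "real^2"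
  define w1 where "w1 z = W1 (z $ (i + 1), z $ i)" for z :: "real^2"
  have w: "w \<in> L2 square_measure" "w1 \<in> L2 square_measure"
    unfolding w_def w1_def using W W1 by (auto intro: L2_pair_square)
  have wp: "w (sq_pt i z) = W z" "w1 (sq_pt i z) = W1 z" for z
    by (cases z; simp add: w_def w1_def)+
  have "l2_norm square_measure (\<lambda>z. v z - w z) = l2_norm ?Q (\<lambda>z. V z - W z)"
    using l2_norm_square_pair[OF L2_diff[OF v w(1)], of i] by (simp add: wp V_def)
  also have "\<dots> \<le> 2 / h\<^sup>2 * (2 * h) * (4 * h * h powr \<mu>) * S"
    by (rule order.trans[OF VW(2)], intro mult_right_mono mult_left_mono p) (use h S in auto)
  also have "\<dots> = 16 * h powr \<mu> * S" using h by (simp add: power2_eq_square)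
  finally have b1: "l2_norm square_measure (\<lambda>z. v z - w z) \<le> 16 * h powr \<mu> * S" .
  have "l2_norm square_measure w1 = l2_norm ?Q W1" using l2_norm_square_pair[OF w(2), of i] by (simp add: wp)
  also have "\<dots> = l2_norm ?Q (\<lambda>z. - W1 z)" using l2_norm_cmult[of ?Q "-1" W1] by simp
  also have "\<dots> \<le> 15 / h ^ 3 * (2 * h) * (4 * h * h powr \<mu>) * S"
    by (rule order.trans[OF mW1(2)], intro mult_right_mono mult_left_mono p) (use h S in auto)
  also have "\<dots> = 120 * h powr (\<mu> - 1) * S" using h by (simp add: power3_eq_cube powr_diff)
  finally have b2: "l2_norm square_measure w1 \<le> 120 * h powr (\<mu> - 1) * S" .
  \<comment> \<open>The fundamental theorem for the kernel in its first point and Fubini. The kernel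
    is defined at \<open>x = 0\<close> too, so \<open>W (y, 0)\<close> can serve as the constant on
    the line although that point is outside the open square.\<close>
  have "W (y, x) = W (y, 0) + antider (\<lambda>t. W1 (y, t)) x" if yx: "0 < y" "y < 1" "0 < x" "x < 1" for y x
  proof -
    have kd: "k (y, x) z' - k (y, 0) z' = antider (\<lambda>t. k1 (y, t) z') x" for z'
    proof (rule antider_FTC[symmetric])
      fix t :: real
      have "((\<lambda>t. (snd z' - (1 - h) * t) / h) has_real_derivative - (1 - h) / h) (at t within {0..1})"
        using h by (auto intro!: derivative_eq_intros)
      from DERIV_cmult[OF DERIV_chain2[OF hat_deriv this], of "1 / h\<^sup>2 * win y (fst z')"]
      show "((\<lambda>t. k (y, t) z') has_real_derivative k1 (y, t) z') (at t within {0..1})"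
        using h by (simp add: k_def k1_def power2_eq_square power3_eq_cube mult_ac)
    next
      show "continuous_on {0..1} (\<lambda>t. k1 (y, t) z')" unfolding k1_def fst_conv snd_conv
        using h by (intro continuous_intros continuous_on_compose2[OF hat_continuous(2)[of UNIV]]) auto
    qed (use yx in auto)
    have cut: "integrable (?I \<Otimes>\<^sub>M ?Q) (\<lambda>(t, z'). if t < x then k1 (y, t) z' * V z' else 0)"
    proof -
      interpret IQ: pair_sigma_finite unit_measure unit2_measure ..
      interpret IQ': finite_measure "unit_measure \<Otimes>\<^sub>M unit2_measure"
        by (rule finite_measure_pair_measure) unfold_locales
      have i: "integrable (?I \<Otimes>\<^sub>M ?Q) (\<lambda>w. V (snd w))"
      proof (rule IQ.Fubini_integrable)
        show "(\<lambda>w. V (snd w)) \<in> borel_measurable (?I \<Otimes>\<^sub>M ?Q)"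
          by (rule measurable_compose[OF measurable_snd]) (use Vi in simp)
      qed (use Vi in auto)
      have idm: "(\<lambda>w. w) \<in> measurable (?I \<Otimes>\<^sub>M ?Q) (borel \<Otimes>\<^sub>M (borel \<Otimes>\<^sub>M borel))"
      proof -
        have "(\<lambda>w. (fst w, snd w)) \<in> measurable (?I \<Otimes>\<^sub>M ?Q) (borel \<Otimes>\<^sub>M (borel \<Otimes>\<^sub>M borel))"
          by (intro measurable_Pair measurable_compose[OF measurable_fst measurable_unit_measure]
              measurable_compose[OF measurable_snd measurable_unit2]) auto
        then show ?thesis by simp
      qed
      have "(\<lambda>w. if fst w < x then k1 (y, fst w) (snd w) else 0)
          \<in> borel_measurable (borel \<Otimes>\<^sub>M (borel \<Otimes>\<^sub>M borel))"
        unfolding k1_def win_def fst_conv snd_conv by measurable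
      from measurable_compose[OF idm this]
      have "(\<lambda>w. if fst w < x then k1 (y, fst w) (snd w) else 0) \<in> borel_measurable (?I \<Otimes>\<^sub>M ?Q)" .
      from integrable_mult_bounded[OF i this, of "15 / h ^ 3"] kb(2) h
      have "integrable (?I \<Otimes>\<^sub>M ?Q) (\<lambda>w. (if fst w < x then k1 (y, fst w) (snd w) else 0) * V (snd w))"
        by auto
      then show ?thesis by (rule back_subst[of "integrable _"]) (auto simp: fun_eq_iff)
    qed
    interpret IQ: pair_sigma_finite unit_measure unit2_measure ..
    have "W (y, x) - W (y, 0) = (LINT z'|?Q. (k (y, x) z' - k (y, 0) z') * V z')"
      unfolding W_def using kV by (simp add: left_diff_distrib)
    also have "\<dots> = (LINT z'|?Q. LINT t|?I. (if t < x then k1 (y, t) z' * V z' else 0))"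
      unfolding kd antider_def integral_mult_left_zero[symmetric]
      by (intro Bochner_Integration.integral_cong) auto
    also have "\<dots> = (LINT t|?I. LINT z'|?Q. (if t < x then k1 (y, t) z' * V z' else 0))"
      by (rule IQ.Fubini_integral[OF cut])
    also have "\<dots> = antider (\<lambda>t. W1 (y, t)) x"
      unfolding antider_def W1_def by (intro Bochner_Integration.integral_cong) auto
    finally show ?thesis by simp
  qed
  then have "line_ac i w w1"
    unfolding line_ac_def using w
    by (auto intro!: exI[of _ "\<lambda>y. W (y, 0)"] AE_I2 simp: w_def w1_def)
  then show ?thesis using b1 b2 by blast
qed

section \<open>Pairings with spline-orthogonal functions\<close>

definition line_orthogonal :: "2 \<Rightarrow> nat \<Rightarrow> real list \<Rightarrow> (real^2 \<Rightarrow> real) \<Rightarrow> bool" where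
  "line_orthogonal i q T e \<longleftrightarrow> (AE y in unit_measure. \<forall>l<length T - q - 1.
     l2_inner unit_measure (\<lambda>x. e (edge_pt i x y)) (bspline T q l) = 0)"

definition knots_within :: "real \<Rightarrow> real list \<Rightarrow> bool" where
  "knots_within h T \<longleftrightarrow> (\<forall>x. 0 < x \<longrightarrow> x < 1 \<longrightarrow> (\<exists>\<tau>\<in>set T. x - h \<le> \<tau> \<and> \<tau> \<le> x))"

text \<open>A weight with its successive derivatives along direction \<open>i\<close>: integration
  by parts differentiates the weight as well as the function. The bound \<open>B\<close> is common
  to all orders.\<close>

definition line_weights :: "2 \<Rightarrow> nat \<Rightarrow> real \<Rightarrow> (nat \<Rightarrow> real^2 \<Rightarrow> real) \<Rightarrow> bool" where
  "line_weights i n B \<eta> \<longleftrightarrow> 0 \<le> B \<and>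
     (\<forall>l\<le>n. \<eta> l \<in> borel_measurable square_measure \<and> (\<forall>z\<in>open_square. \<bar>\<eta> l z\<bar> \<le> B)) \<and>
     (\<forall>l<n. \<forall>y. 0 < y \<longrightarrow> y < 1 \<longrightarrow> continuous_on {0..1} (\<lambda>t. \<eta> (Suc l) (edge_pt i t y)) \<and>
        (\<forall>x\<in>{0..1}. ((\<lambda>t. \<eta> l (edge_pt i t y)) has_real_derivative \<eta> (Suc l) (edge_pt i x y)) (at x within {0..1})))"

locale line_orthogonal_function =
  fixes i :: 2 and q :: nat and T :: "real list" and h :: real and e :: "real^2 \<Rightarrow> real"
  assumes T: "open_knots q T" and h: "0 < h" "h \<le> 1" and knots: "knots_within h T"
    and e: "e \<in> L2 square_measure" and orth: "line_orthogonal i q T e"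
begin

definition E :: "nat \<Rightarrow> real \<times> real \<Rightarrow> real" where
  "E j = (pantider ^^ j) (\<lambda>z. e (sq_pt i z))"

lemma E_L2: "E j \<in> L2 unit2_measure"
  unfolding E_def by (induction j) (auto intro: pantider_L2 L2_square_pair[OF e])

lemma E_Suc: "E (Suc j) = pantider (E j)"
  by (simp add: E_def)

lemma E_section: "(\<lambda>x. E j (y, x)) = (antider ^^ j) (\<lambda>x. e (edge_pt i x y))"
  unfolding E_def by (induction j) (simp_all add: fun_eq_iff)

lemma AE_section:
  "AE y in unit_measure. (\<lambda>x. e (edge_pt i x y)) \<in> L2 unit_measure \<and>
    (\<forall>l<length T - q - 1. l2_inner unit_measure (\<lambda>x. e (edge_pt i x y)) (bspline T q l) = 0)"
  using L2_section[OF L2_square_pair[OF e, of i]] orth unfolding line_orthogonal_def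
  by eventually_elim simp

lemma E_integral_0:
  assumes "j \<le> q" shows "AE y in unit_measure. (LINT x|unit_measure. E j (y, x)) = 0"
  using AE_section
proof eventually_elim
  case (elim y)
  have "(antider ^^ Suc j) (\<lambda>x. e (edge_pt i x y)) 1 = 0"
    by (rule orthogonal_antider_1[OF T _ _ assms]) (use elim in auto)
  then show ?case using antider_1[of 1 "\<lambda>x. E j (y, x)"] by (simp add: E_section)
qed

lemma E_norm_Suc:
  assumes "j \<le> q" shows "l2_norm unit2_measure (E (Suc j)) \<le> h * l2_norm unit2_measure (E j)"
proof -
  have sq: "l2_inner unit2_measure (E j) (E j) = (LINT y|unit_measure. l2_inner unit_measure (\<lambda>x. E j (y, x)) (\<lambda>x. E j (y, x)))"
    and sqi: "integrable unit_measure (\<lambda>y. l2_inner unit_measure (\<lambda>x. E j (y, x)) (\<lambda>x. E j (y, x)))" for j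
    unfolding l2_inner_def
    using unit2.integral_fst'[OF L2_integrable_mult[OF E_L2 E_L2], of j j]
      unit2.integrable_fst'[OF L2_integrable_mult[OF E_L2 E_L2], of j j] by auto
  have "l2_inner unit2_measure (E (Suc j)) (E (Suc j))
      \<le> (LINT y|unit_measure. h\<^sup>2 * l2_inner unit_measure (\<lambda>x. E j (y, x)) (\<lambda>x. E j (y, x)))"
    unfolding sq
  proof (rule integral_mono_AE[OF sqi])
    show "integrable unit_measure (\<lambda>y. h\<^sup>2 * l2_inner unit_measure (\<lambda>x. E j (y, x)) (\<lambda>x. E j (y, x)))"
      using sqi by simp
    show "AE y in unit_measure. l2_inner unit_measure (\<lambda>x. E (Suc j) (y, x)) (\<lambda>x. E (Suc j) (y, x))
        \<le> h\<^sup>2 * l2_inner unit_measure (\<lambda>x. E j (y, x)) (\<lambda>x. E j (y, x))"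
      using AE_section
    proof eventually_elim
      case (elim y)
      have "l2_norm unit_measure ((antider ^^ Suc j) (\<lambda>x. e (edge_pt i x y)))
          \<le> h * l2_norm unit_measure ((antider ^^ j) (\<lambda>x. e (edge_pt i x y)))"
        using knots unfolding knots_within_def
        by (intro orthogonal_antider_norm[OF T _ _ h(1) _ assms]) (use elim in auto)
      from power_mono[OF this l2_norm_nonneg, of 2] show ?case
        unfolding E_section l2_norm_square by (simp add: power_mult_distrib l2_norm_square)
    qed
  qed
  also have "\<dots> = (h * l2_norm unit2_measure (E j))\<^sup>2"
    by (simp add: power_mult_distrib l2_norm_square sq)
  finally show ?thesis
    using h l2_norm_nonneg[of unit2_measure "E j"]
    by (intro power2_le_imp_le[of "l2_norm unit2_measure (E (Suc j))"]) (auto simp: l2_norm_square)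
qed

text \<open>The range extends to \<open>Suc q\<close>, one more than the degree: the last gain comes
  from the zeros at the knots. This is what admits \<open>s = q + 1\<close>.\<close>

lemma E_norm:
  assumes "j \<le> Suc q" shows "l2_norm unit2_measure (E j) \<le> h ^ j * l2_norm square_measure e"
  using assms
proof (induction j)
  case 0
  show ?case using l2_norm_square_pair[OF e, of i] by (simp add: E_def)
next
  case (Suc j)
  have "l2_norm unit2_measure (E (Suc j)) \<le> h * l2_norm unit2_measure (E j)" using Suc by (intro E_norm_Suc) auto
  also have "\<dots> \<le> h * (h ^ j * l2_norm square_measure e)" using Suc h by (intro mult_left_mono) auto
  finally show ?case by (simp add: mult.assoc)
qed

context
  fixes n B \<eta>
  assumes \<eta>: "line_weights i n B \<eta>"
begin

lemma weight_measurable: "l \<le> n \<Longrightarrow> (\<lambda>z. \<eta> l (sq_pt i z)) \<in> borel_measurable unit2_measure"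
  using \<eta> measurable_compose[OF sq_pt_measurable, of "\<eta> l" borel i] by (auto simp: line_weights_def)

lemma weight_bound: "l \<le> n \<Longrightarrow> z \<in> space unit2_measure \<Longrightarrow> \<bar>\<eta> l (sq_pt i z)\<bar> \<le> B"
  using \<eta> by (cases z) (auto simp: line_weights_def edge_pt_in_open_square)

lemma weight_B: "0 \<le> B" using \<eta> by (simp add: line_weights_def)

lemma weight_L2: "l \<le> n \<Longrightarrow> U \<in> L2 unit2_measure \<Longrightarrow> (\<lambda>z. \<eta> l (sq_pt i z) * U z) \<in> L2 unit2_measure"
  by (rule L2_bounded_mult[OF _ weight_measurable weight_bound])

text \<open>The index \<open>j\<close> counts the antiderivatives taken of \<open>e\<close>, hence
  the powers of \<open>h\<close> gained, and \<open>l\<close> the derivatives that have fallen on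
  the weight.\<close>

definition form :: "(real^2 \<Rightarrow> real) \<Rightarrow> nat \<Rightarrow> nat \<Rightarrow> real" where
  "form v j l = (LINT z|unit2_measure. v (sq_pt i z) * (\<eta> l (sq_pt i z) * E j z))"

lemma form_bound:
  assumes "v \<in> L2 square_measure" "l \<le> n" "j \<le> Suc q"
  shows "\<bar>form v j l\<bar> \<le> B * l2_norm square_measure v * (h ^ j * l2_norm square_measure e)"
proof -
  have "\<bar>form v j l\<bar> \<le> l2_norm unit2_measure (\<lambda>z. v (sq_pt i z)) * l2_norm unit2_measure (\<lambda>z. \<eta> l (sq_pt i z) * E j z)"
    unfolding form_def l2_inner_def[symmetric]
    using assms by (intro l2_Cauchy_Schwarz L2_square_pair weight_L2 E_L2)
  also have "\<dots> \<le> l2_norm square_measure v * (B * (h ^ j * l2_norm square_measure e))"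
  proof (intro mult_mono)
    have "l2_norm unit2_measure (\<lambda>z. \<eta> l (sq_pt i z) * E j z) \<le> B * l2_norm unit2_measure (E j)"
      using assms by (intro l2_norm_mult_le E_L2 weight_measurable weight_B weight_bound)
    also have "\<dots> \<le> B * (h ^ j * l2_norm square_measure e)"
      using E_norm[OF assms(3)] weight_B by (intro mult_left_mono)
    finally show "l2_norm unit2_measure (\<lambda>z. \<eta> l (sq_pt i z) * E j z) \<le> B * (h ^ j * l2_norm square_measure e)" .
    show "l2_norm unit2_measure (\<lambda>z. v (sq_pt i z)) \<le> l2_norm square_measure v"
      using l2_norm_square_pair[OF assms(1), of i] by simp
  qed (auto simp: l2_norm_nonneg)
  finally show ?thesis by (simp add: mult_ac)
qed

lemma form_diff:
  assumes "v \<in> L2 square_measure" "w \<in> L2 square_measure" "l \<le> n"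
  shows "form (\<lambda>z. v z - w z) j l = form v j l - form w j l"
  unfolding form_def
  using L2_integrable_mult[OF L2_square_pair[OF assms(1)] weight_L2[OF assms(3) E_L2]]
    L2_integrable_mult[OF L2_square_pair[OF assms(2)] weight_L2[OF assms(3) E_L2]]
  by (simp add: left_diff_distrib)

text \<open>The auxiliary \<open>g\<close> is the derivative, by the product rule, of the weight
  times the next antiderivative of \<open>e\<close>. This product vanishes at both ends of almost
  every line as long as \<open>j \<le> q\<close>, so one antiderivative is gained and the derivative
  falls on \<open>v\<close> or on the weight.\<close>

lemma form_parts:
  assumes ac: "line_ac i v v1" and l: "l < n" and j: "j \<le> q"
  shows "form v j l = - form v1 (Suc j) l - form v (Suc j) (Suc l)"
proof -
  have v: "v \<in> L2 square_measure" "v1 \<in> L2 square_measure" using ac by (auto simp: line_ac_def)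
  define g where "g z = \<eta> (Suc l) (sq_pt i z) * E (Suc j) z + \<eta> l (sq_pt i z) * E j z" for z
  have w: "(\<lambda>z. \<eta> (Suc l) (sq_pt i z) * E (Suc j) z) \<in> L2 unit2_measure"
    "(\<lambda>z. \<eta> l (sq_pt i z) * E j z) \<in> L2 unit2_measure" "(\<lambda>z. \<eta> l (sq_pt i z) * E (Suc j) z) \<in> L2 unit2_measure"
    using l by (auto intro!: weight_L2 E_L2)
  have g: "g \<in> L2 unit2_measure" unfolding g_def using w by (intro L2_add)
  have ant: "antider (\<lambda>t. g (y, t)) x = \<eta> l (edge_pt i x y) * E (Suc j) (y, x)"
    if "0 < y" "y < 1" "integrable unit_measure (\<lambda>x. E j (y, x))" "0 \<le> x" "x \<le> 1" for x y
    using antider_mult_smooth[of "\<lambda>t. \<eta> l (edge_pt i t y)" "\<lambda>t. \<eta> (Suc l) (edge_pt i t y)" x "\<lambda>t. E j (y, t)"] \<eta> l that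
    by (simp add: line_weights_def g_def E_Suc)
  have sect: "AE y in unit_measure. 0 < y \<and> y < 1 \<and> integrable unit_measure (\<lambda>x. E j (y, x))"
    using L2_section[OF E_L2[of j]] AE_space[of unit_measure]
    by eventually_elim (auto intro: unit.L2_integrable)
  have zero: "AE y in unit_measure. (LINT x|unit_measure. g (y, x)) = 0"
    using sect E_integral_0[OF j]
  proof eventually_elim
    case (elim y)
    have "(LINT x|unit_measure. g (y, x)) = antider (\<lambda>t. g (y, t)) 1" by (simp add: antider_1)
    also have "\<dots> = \<eta> l (edge_pt i 1 y) * E (Suc j) (y, 1)" using elim by (intro ant) auto
    also have "E (Suc j) (y, 1) = 0" using elim by (simp add: E_Suc antider_1)
    finally show ?case by simp
  qed
  have "form v j l + form v (Suc j) (Suc l) = (LINT z|unit2_measure. v (sq_pt i z) * g z)"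
    unfolding form_def g_def
    using L2_integrable_mult[OF L2_square_pair[OF v(1)] w(1)] L2_integrable_mult[OF L2_square_pair[OF v(1)] w(2)]
    by (simp add: distrib_left)
  also have "\<dots> = - (LINT z|unit2_measure. v1 (sq_pt i z) * pantider g z)"
    by (rule line_ac_parts[OF ac g zero])
  also have "(LINT z|unit2_measure. v1 (sq_pt i z) * pantider g z) = form v1 (Suc j) l"
    unfolding form_def
  proof (rule integral_cong_AE)
    have m: "pantider g \<in> borel_measurable unit2_measure" "(\<lambda>z. \<eta> l (sq_pt i z) * E (Suc j) z) \<in> borel_measurable unit2_measure"
      "(\<lambda>z. v1 (sq_pt i z)) \<in> borel_measurable unit2_measure"
      using pantider_L2[OF g] w(3) L2_square_pair[OF v(2), of i] by (auto intro: L2_measurable)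
    then show "(\<lambda>z. v1 (sq_pt i z) * pantider g z) \<in> borel_measurable unit2_measure"
      "(\<lambda>z. v1 (sq_pt i z) * (\<eta> l (sq_pt i z) * E (Suc j) z)) \<in> borel_measurable unit2_measure" by auto
    have "AE z in unit2_measure. pantider g z = \<eta> l (sq_pt i z) * E (Suc j) z"
    proof (rule unit2.AE_pair_measure)
      show "{z \<in> space unit2_measure. pantider g z = \<eta> l (sq_pt i z) * E (Suc j) z} \<in> sets unit2_measure"
        using m by (intro borel_measurable_eq)
      show "AE y in unit_measure. AE x in unit_measure. pantider g (y, x) = \<eta> l (sq_pt i (y, x)) * E (Suc j) (y, x)"
        using sect
      proof eventually_elim
        case (elim y)
        show ?case using elim by (intro AE_unitI) (auto intro: ant)
      qed
    qed
    then show "AE z in unit2_measure. v1 (sq_pt i z) * pantider g z = v1 (sq_pt i z) * (\<eta> l (sq_pt i z) * E (Suc j) z)"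
      by eventually_elim simp
  qed
  finally show ?thesis by simp
qed

text \<open>Every integration by parts yields two terms, so \<open>m\<close> of them yield at most
  \<open>2 ^ m\<close> terms of level \<open>m\<close>.\<close>

lemma form_descend:
  assumes v: "\<And>k. k < m \<Longrightarrow> line_ac i (v k) (v (Suc k))" and m: "m \<le> Suc q" "m \<le> n"
    and R: "\<And>k l. k \<le> m \<Longrightarrow> l \<le> m \<Longrightarrow> \<bar>form (v k) m l\<bar> \<le> R"
  shows "\<bar>form (v 0) 0 0\<bar> \<le> 2 ^ m * R"
proof -
  have "\<forall>k l. k \<le> j \<longrightarrow> l \<le> j \<longrightarrow> \<bar>form (v k) j l\<bar> \<le> 2 ^ (m - j) * R" if "j \<le> m" for j
    using that
  proof (induction j rule: inc_induct)
    case base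
    then show ?case using R by simp
  next
    case (step j)
    show ?case
    proof (intro allI impI)
      fix k l assume kl: "k \<le> j" "l \<le> j"
      have "\<bar>form (v k) j l\<bar> \<le> \<bar>form (v (Suc k)) (Suc j) l\<bar> + \<bar>form (v k) (Suc j) (Suc l)\<bar>"
        using form_parts[OF v[of k], of l j] kl step m by simp
      also have "\<dots> \<le> 2 ^ (m - Suc j) * R + 2 ^ (m - Suc j) * R"
        using step.IH kl by (intro add_mono) auto
      also have "\<dots> = 2 ^ (m - j) * R" using step by (simp add: Suc_diff_Suc[symmetric] del: diff_Suc_Suc)
      finally show "\<bar>form (v k) j l\<bar> \<le> 2 ^ (m - j) * R" .
    qed
  qed
  from this[of 0] show ?thesis by simp
qed

text \<open>After \<open>m\<close> steps the terms with \<open>k < m\<close> admit one further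
  derivative and gain a full \<open>h\<close>. For \<open>k = m\<close> the function is split by
  smoothing at scale \<open>h\<close>: the difference is already of size
  \<open>h powr \<mu>\<close>, and the smooth part takes one more integration by parts, where the
  gain \<open>h\<close> meets a derivative of size \<open>h powr (\<mu> - 1)\<close>. This extra
  step needs \<open>m \<le> q\<close> and a weight derivative of order \<open>Suc m\<close>.\<close>

lemma line_estimate:
  assumes v: "\<And>k. k < m \<Longrightarrow> line_ac i (v k) (v (Suc k))" and vm: "\<And>k. k \<le> m \<Longrightarrow> v k \<in> L2 square_measure"
    and A: "\<And>k. k \<le> m \<Longrightarrow> l2_norm square_measure (v k) \<le> A"
    and n: "Suc m \<le> n"
    and \<mu>: "\<mu> = 0 \<and> m \<le> Suc q \<or> 0 < \<mu> \<and> \<mu> \<le> 1 \<and> m \<le> q \<and> 0 \<le> S \<and> S \<le> A \<and>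
        slobodeckij square_measure \<mu> (v m) = ennreal (S\<^sup>2)"
  shows "\<bar>l2_inner square_measure (\<lambda>z. \<eta> 0 z * v 0 z) e\<bar>
    \<le> 2 ^ m * 160 * B * h powr (real m + \<mu>) * A * l2_norm square_measure e"
proof -
  define N where "N = l2_norm square_measure e"
  have N: "0 \<le> N" by (simp add: N_def l2_norm_nonneg)
  have A0: "0 \<le> A" using order.trans[OF l2_norm_nonneg A[of 0]] by simp
  note B = weight_B
  have fb: "\<bar>form w j l\<bar> \<le> B * D * (h ^ j * N)"
    if "w \<in> L2 square_measure" "l \<le> n" "j \<le> Suc q" "l2_norm square_measure w \<le> D" for w j l D
  proof -
    have "\<bar>form w j l\<bar> \<le> B * l2_norm square_measure w * (h ^ j * N)"
      using form_bound[OF that(1-3)] by (simp add: N_def)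
    also have "\<dots> \<le> B * D * (h ^ j * N)" using that(4) B N h by (intro mult_right_mono mult_left_mono) auto
    finally show ?thesis .
  qed
  define X where "X = B * A * (h powr (real m + \<mu>)) * N"
  have X0: "0 \<le> X" using B A0 N by (simp add: X_def)
  \<comment> \<open>The worst case below gives \<open>16 + 120 + 17 = 153\<close>, rounded up to
    160; 17 bounds the norm of the smoothed function by its own norm \<open>A\<close> plus the
    smoothing error \<open>16 * A\<close>.\<close>
  have R: "\<bar>form (v k) m l\<bar> \<le> 160 * X" if kl: "k \<le> m" "l \<le> m" for k l
  proof (cases "\<mu> = 0")
    case True
    have "\<bar>form (v k) m l\<bar> \<le> B * A * (h ^ m * N)"
      using kl n True \<mu> by (intro fb vm A) auto
    then have "\<bar>form (v k) m l\<bar> \<le> X" using True h by (simp add: X_def powr_realpow mult_ac)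
    then show ?thesis using X0 by simp
  next
    case False
    then have \<mu>': "0 < \<mu>" "\<mu> \<le> 1" "m \<le> q" "0 \<le> S" "S \<le> A" "slobodeckij square_measure \<mu> (v m) = ennreal (S\<^sup>2)"
      using \<mu> by auto
    have hm: "h ^ Suc m \<le> h powr (real m + \<mu>)"
    proof -
      have "h powr (real m + 1) \<le> h powr (real m + \<mu>)" using h \<mu>' by (intro powr_mono') auto
      then show ?thesis using h by (simp add: powr_add powr_realpow mult.commute)
    qed
    have Suc_bound: "\<bar>form (v k) (Suc m) l\<bar> \<le> X" if "k \<le> m" "l \<le> Suc m" for k l
    proof -
      have "\<bar>form (v k) (Suc m) l\<bar> \<le> B * A * (h ^ Suc m * N)" using that n \<mu>' by (intro fb vm A) auto
      also have "\<dots> \<le> B * A * (h powr (real m + \<mu>) * N)"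
        using hm B A0 N by (intro mult_left_mono mult_right_mono) auto
      finally show ?thesis by (simp add: X_def mult_ac)
    qed
    show ?thesis
    proof (cases "k = m")
      case False
      then have "\<bar>form (v k) m l\<bar> \<le> \<bar>form (v (Suc k)) (Suc m) l\<bar> + \<bar>form (v k) (Suc m) (Suc l)\<bar>"
        using form_parts[OF v[of k], of l m] kl n \<mu>' by simp
      also have "\<dots> \<le> X + X" using kl False by (intro add_mono Suc_bound) auto
      finally show ?thesis using X0 by simp
    next
      case True
      obtain w w1 where w: "line_ac i w w1"
        "l2_norm square_measure (\<lambda>z. v m z - w z) \<le> 16 * h powr \<mu> * S"
        "l2_norm square_measure w1 \<le> 120 * h powr (\<mu> - 1) * S"
        using line_smoothing[OF vm[OF order.refl] \<mu>'(6,4) h \<mu>'(1,2), of i] by blast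
      have wL: "w \<in> L2 square_measure" "w1 \<in> L2 square_measure" using w(1) by (auto simp: line_ac_def)
      note vmL = vm[OF order.refl]
      have hmu1: "h powr \<mu> \<le> 1" using h \<mu>' powr_le1 by simp
      have "16 * h powr \<mu> * S \<le> 16 * h powr \<mu> * A" using \<mu>' by (intro mult_left_mono) auto
      with w(2) have d: "l2_norm square_measure (\<lambda>z. v m z - w z) \<le> 16 * h powr \<mu> * A" by simp
      have "120 * h powr (\<mu> - 1) * S \<le> 120 * h powr (\<mu> - 1) * A" using \<mu>' by (intro mult_left_mono) auto
      with w(3) have d1: "l2_norm square_measure w1 \<le> 120 * h powr (\<mu> - 1) * A" by simp
      have "l2_norm square_measure w = l2_norm square_measure (\<lambda>z. v m z + (-1) * (v m z - w z))"
        by simp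
      also have "\<dots> \<le> l2_norm square_measure (v m) + l2_norm square_measure (\<lambda>z. (-1) * (v m z - w z))"
        using vmL wL by (intro l2_norm_triangle L2_cmult L2_diff)
      also have "l2_norm square_measure (\<lambda>z. (-1) * (v m z - w z)) = l2_norm square_measure (\<lambda>z. v m z - w z)"
        unfolding l2_norm_cmult by simp
      also have "l2_norm square_measure (v m) + l2_norm square_measure (\<lambda>z. v m z - w z) \<le> A + 16 * A"
      proof (intro add_mono A order.refl order.trans[OF d])
        have "h powr \<mu> * (16 * A) \<le> 1 * (16 * A)" using hmu1 A0 by (intro mult_right_mono) auto
        then show "16 * h powr \<mu> * A \<le> 16 * A" by simp
      qed
      finally have d2: "l2_norm square_measure w \<le> 17 * A" by simp
      have ln: "l \<le> n" "Suc l \<le> n" using kl n by auto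
      have "form (v m) m l = form (\<lambda>z. v m z - w z) m l + form w m l"
        using form_diff[OF vmL wL(1) ln(1)] by simp
      also have "form w m l = - form w1 (Suc m) l - form w (Suc m) (Suc l)"
        using ln \<mu>' by (intro form_parts[OF w(1)]) auto
      finally have "\<bar>form (v m) m l\<bar> \<le> \<bar>form (\<lambda>z. v m z - w z) m l\<bar> + \<bar>form w1 (Suc m) l\<bar> + \<bar>form w (Suc m) (Suc l)\<bar>"
        by linarith
      also have "\<dots> \<le> 16 * X + 120 * X + 17 * X"
      proof (intro add_mono)
        have "\<bar>form (\<lambda>z. v m z - w z) m l\<bar> \<le> B * (16 * h powr \<mu> * A) * (h ^ m * N)"
          using ln \<mu>' d vmL wL by (intro fb L2_diff) auto
        then show "\<bar>form (\<lambda>z. v m z - w z) m l\<bar> \<le> 16 * X"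
          using h by (simp add: X_def powr_add powr_realpow mult_ac)
        have "\<bar>form w1 (Suc m) l\<bar> \<le> B * (120 * h powr (\<mu> - 1) * A) * (h ^ Suc m * N)"
          using ln \<mu>' d1 wL by (intro fb) auto
        then show "\<bar>form w1 (Suc m) l\<bar> \<le> 120 * X"
          using h by (simp add: X_def powr_add powr_diff powr_realpow mult_ac)
        have "\<bar>form w (Suc m) (Suc l)\<bar> \<le> B * (17 * A) * (h ^ Suc m * N)"
          using ln \<mu>' d2 wL by (intro fb) auto
        also have "\<dots> \<le> B * (17 * A) * (h powr (real m + \<mu>) * N)"
          using hm B A0 N by (intro mult_left_mono mult_right_mono) auto
        finally show "\<bar>form w (Suc m) (Suc l)\<bar> \<le> 17 * X" by (simp add: X_def mult_ac)
      qed
      finally show ?thesis using X0 True by simp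
    qed
  qed
  have m: "m \<le> Suc q" "m \<le> n" using \<mu> n by auto
  have "\<bar>form (v 0) 0 0\<bar> \<le> 2 ^ m * (160 * X)"
    by (rule form_descend[of m v, OF v m R])
  moreover have "l2_inner square_measure (\<lambda>z. \<eta> 0 z * v 0 z) e = form (v 0) 0 0"
  proof -
    have "(\<lambda>z. \<eta> 0 z * v 0 z) \<in> L2 square_measure"
      using \<eta> vm[of 0] by (intro L2_bounded_mult[of _ _ _ B]) (auto simp: line_weights_def)
    from l2_inner_square_pair[OF this e, of i] show ?thesis
      by (simp add: l2_inner_def form_def E_def mult_ac)
  qed
  ultimately show ?thesis by (simp add: X_def N_def mult_ac)
qed

end

end

section \<open>Splitting functions that are orthogonal to tensor-product splines\<close>

lemma L2_fst:
  assumes "f \<in> L2 unit_measure" shows "(\<lambda>z. f (fst z)) \<in> L2 unit2_measure"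
proof -
  have "integrable unit2_measure (\<lambda>z. (f (fst z))\<^sup>2)"
    using integrable_fst_const[OF L2_integrable_square[OF assms]] .
  moreover have "(\<lambda>z. f (fst z)) \<in> borel_measurable unit2_measure"
    by (rule measurable_compose[OF measurable_fst L2_measurable[OF assms]])
  ultimately show ?thesis by (simp add: L2_def)
qed

lemma bounded_snd:
  assumes "f \<in> borel_measurable borel"
  shows "(\<lambda>z. f (snd z)) \<in> borel_measurable unit2_measure"
  by (rule measurable_compose[OF measurable_snd measurable_unit_measure[OF assms]])

text \<open>Removing from \<open>e\<close> the projection onto the first spline space on each line leaves a part that
  is orthogonal to the first space on the lines of direction 1, and the projection itself is
  orthogonal to the second space on the lines of direction 2.\<close>

lemma tensor_orthogonal_split:
  assumes T1: "open_knots q1 T1" and T2: "open_knots q2 T2" and e: "e \<in> L2 square_measure"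
    and orth: "\<And>i j. i < length T1 - q1 - 1 \<Longrightarrow> j < length T2 - q2 - 1 \<Longrightarrow>
      l2_inner square_measure e (\<lambda>z. bspline T1 q1 i (z $ 1) * bspline T2 q2 j (z $ 2)) = 0"
  shows "\<exists>e1 e2. e1 \<in> L2 square_measure \<and> e2 \<in> L2 square_measure \<and> (\<forall>z. e z = e1 z + e2 z) \<and>
    l2_norm square_measure e1 \<le> l2_norm square_measure e \<and> l2_norm square_measure e2 \<le> l2_norm square_measure e \<and>
    line_orthogonal 1 q1 T1 e1 \<and> line_orthogonal 2 q2 T2 e2"
proof -
  let ?I = unit_measure and ?Q = unit2_measure
  define n1 where "n1 = length T1 - q1 - 1"
  have edge1: "edge_pt 1 x y $ 1 = x" "edge_pt 1 x y $ 2 = y" for x y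
    using edge_pt_nth[of 1 x y] by simp_all
  have edge2: "edge_pt 2 x y = edge_pt 1 y x" for x y
    by (simp add: edge_pt_def vec_eq_iff forall_2)
  define U where "U z = e (sq_pt 1 z)" for z
  have U: "U \<in> L2 ?Q" unfolding U_def by (rule L2_square_pair[OF e])
  have Ui: "integrable ?Q U" by (rule unit2'.L2_integrable[OF U])
  obtain r :: nat and g where
    span: "\<forall>k<r. \<exists>c. g k = (\<lambda>x. \<Sum>i<n1. c i * bspline T1 q1 i x)" and
    orthn0: "\<forall>k<r. \<forall>l<r. l2_inner ?I (g k) (g l) = (if k = l then 1 else 0)" and
    compl: "\<forall>v\<in>L2 ?I. (\<forall>k<r. l2_inner ?I v (g k) = 0) \<longrightarrow> (\<forall>i<n1. l2_inner ?I v (bspline T1 q1 i) = 0)"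
    using L2_orthonormal_basis[of n1 "bspline T1 q1" ?I, OF bspline_L2_unit[OF T1, folded n1_def]] by blast
  note orthn = orthn0[rule_format]
  obtain cc where cc: "\<And>k. k < r \<Longrightarrow> g k = (\<lambda>x. \<Sum>i<n1. cc k i * bspline T1 q1 i x)" using span by metis
  have gm: "g k \<in> borel_measurable borel" if "k < r" for k
    unfolding cc[OF that] by measurable
  have "\<exists>C. \<forall>x. \<bar>bspline T1 q1 i x\<bar> \<le> C" if "i < n1" for i
    using bspline_bounded[of T1 i q1] T1 that by (auto simp: open_knots_def n1_def)
  then obtain C where C: "\<And>i x. i < n1 \<Longrightarrow> \<bar>bspline T1 q1 i x\<bar> \<le> C i" by metis
  define G where "G k = (\<Sum>i<n1. \<bar>cc k i\<bar> * C i)" for k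
  have gb: "\<bar>g k x\<bar> \<le> G k" if "k < r" for k x
  proof -
    have "\<bar>g k x\<bar> \<le> (\<Sum>i<n1. \<bar>cc k i * bspline T1 q1 i x\<bar>)" unfolding cc[OF that] by (rule sum_abs)
    also have "\<dots> \<le> G k" unfolding G_def abs_mult using C by (intro sum_mono mult_left_mono) auto
    finally show ?thesis .
  qed
  have gL: "g k \<in> L2 ?I" if "k < r" for k
    using gb[OF that] gm[OF that] by (intro unit.L2_boundedI[of _ "G k"] measurable_unit_measure AE_I2) auto
  \<comment> \<open>The coefficient of the line section of \<open>e\<close> along
    \<open>g k\<close>. As a function of the transverse variable it carries the orthogonality in the
    second direction.\<close>
  define \<epsilon> where "\<epsilon> k y = (LINT x|?I. g k x * U (y, x))" for k y
  have gU: "integrable ?Q (\<lambda>z. g k (snd z) * U z)" if "k < r" for k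
    using integrable_mult_bounded[OF Ui bounded_snd[OF gm[OF that]], of "G k"] gb[OF that] by blast
  have \<epsilon>i: "integrable ?I (\<epsilon> k)" if "k < r" for k
    using unit2.integrable_fst'[OF gU[OF that]] by (simp add: \<epsilon>_def[abs_def])
  have \<epsilon>2: "integrable ?I (\<lambda>y. (\<epsilon> k y)\<^sup>2)" if "k < r" for k
  proof (rule Bochner_Integration.integrable_bound)
    show "integrable ?I (\<lambda>y. LINT x|?I. (U (y, x))\<^sup>2)"
      by (rule unit2.integrable_fst'[OF L2_integrable_square[OF U]])
    show "(\<lambda>y. (\<epsilon> k y)\<^sup>2) \<in> borel_measurable ?I" using \<epsilon>i[OF that] by auto
    show "AE y in ?I. norm ((\<epsilon> k y)\<^sup>2) \<le> norm (LINT x|?I. (U (y, x))\<^sup>2)"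
      using L2_section[OF U]
    proof eventually_elim
      case (elim y)
      have "\<bar>\<epsilon> k y\<bar> \<le> l2_norm ?I (g k) * l2_norm ?I (\<lambda>x. U (y, x))"
        unfolding \<epsilon>_def l2_inner_def[symmetric] by (rule l2_Cauchy_Schwarz[OF gL[OF that] elim])
      also have "l2_norm ?I (g k) = 1" using orthn[of k k] that by (simp add: l2_norm_def)
      finally have "\<bar>\<epsilon> k y\<bar>\<^sup>2 \<le> (l2_norm ?I (\<lambda>x. U (y, x)))\<^sup>2" by (intro power_mono) auto
      then show ?case unfolding l2_norm_square by (simp add: l2_inner_def power2_eq_square)
    qed
  qed
  have \<epsilon>L: "\<epsilon> k \<in> L2 ?I" if "k < r" for k
    using \<epsilon>i[OF that] \<epsilon>2[OF that] by (auto simp: L2_def)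
  define U2 where "U2 z = (\<Sum>k<r. g k (snd z) * \<epsilon> k (fst z))" for z
  have U2: "U2 \<in> L2 ?Q" unfolding U2_def
  proof (rule L2_sum)
    fix k assume "k \<in> {..<r}"
    then have k: "k < r" by simp
    show "(\<lambda>z. g k (snd z) * \<epsilon> k (fst z)) \<in> L2 ?Q"
      using gb[OF k] by (intro L2_bounded_mult[OF L2_fst[OF \<epsilon>L[OF k]] bounded_snd[OF gm[OF k]]])
  qed
  define U1 where "U1 z = U z - U2 z" for z
  have U1: "U1 \<in> L2 ?Q" unfolding U1_def using U U2 by (rule L2_diff)
  have U2_sec: "(\<lambda>x. U2 (y, x)) = (\<lambda>x. \<Sum>k<r. \<epsilon> k y * g k x)" for y
    by (simp add: U2_def mult.commute)
  have U2_g: "l2_inner ?I (\<lambda>x. U2 (y, x)) (g l) = \<epsilon> l y" if l: "l < r" for y l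
  proof -
    have "l2_inner ?I (\<lambda>x. U2 (y, x)) (g l) = (\<Sum>k<r. \<epsilon> k y * (if k = l then 1 else 0))"
      unfolding U2_sec using gL l
      by (subst l2_inner_sum_left) (auto intro!: L2_cmult sum.cong simp: l2_inner_cmult_left orthn)
    also have "\<dots> = \<epsilon> l y" using l by (simp add: if_distrib cong: if_cong)
    finally show ?thesis .
  qed
  have U1_g: "AE y in ?I. (\<lambda>x. U1 (y, x)) \<in> L2 ?I \<and> (\<forall>l<r. l2_inner ?I (\<lambda>x. U1 (y, x)) (g l) = 0)"
    using L2_section[OF U] L2_section[OF U2]
  proof eventually_elim
    case (elim y)
    have "l2_inner ?I (\<lambda>x. U (y, x)) (g l) = \<epsilon> l y" for l by (simp add: \<epsilon>_def l2_inner_def mult.commute)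
    then show ?case unfolding U1_def using elim U2_g gL by (auto simp: l2_inner_diff_left intro: L2_diff)
  qed
  have orthU: "l2_inner ?Q U1 U2 = 0"
  proof -
    have "l2_inner ?Q U1 U2 = (LINT y|?I. l2_inner ?I (\<lambda>x. U1 (y, x)) (\<lambda>x. U2 (y, x)))"
      unfolding l2_inner_def by (rule unit2.integral_fst'[OF L2_integrable_mult[OF U1 U2], symmetric])
    also have "\<dots> = (LINT y|?I. 0)"
    proof (rule integral_cong_AE)
      show "(\<lambda>y. l2_inner ?I (\<lambda>x. U1 (y, x)) (\<lambda>x. U2 (y, x))) \<in> borel_measurable ?I"
        unfolding l2_inner_def using unit2.integrable_fst'[OF L2_integrable_mult[OF U1 U2]] by simp
      show "AE y in ?I. l2_inner ?I (\<lambda>x. U1 (y, x)) (\<lambda>x. U2 (y, x)) = 0"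
        using U1_g
      proof eventually_elim
        case (elim y)
        have "l2_inner ?I (\<lambda>x. U1 (y, x)) (\<lambda>x. U2 (y, x)) = (\<Sum>k<r. l2_inner ?I (\<lambda>x. \<epsilon> k y * g k x) (\<lambda>x. U1 (y, x)))"
          unfolding U2_sec using gL elim
          by (subst l2_inner_commute, subst l2_inner_sum_left) (auto intro!: L2_cmult)
        also have "\<dots> = 0" using elim
          by (intro sum.neutral) (auto simp: l2_inner_cmult_left l2_inner_commute[of _ "g _"])
        finally show ?case .
      qed
    qed simp
    finally show ?thesis by simp
  qed
  have Pyth: "l2_inner ?Q U U = l2_inner ?Q U1 U1 + l2_inner ?Q U2 U2"
  proof -
    have "U = (\<lambda>z. U1 z + U2 z)" by (simp add: U1_def fun_eq_iff)
    then show ?thesis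
      using orthU U1 U2 by (simp add: l2_inner_add_left l2_inner_add_right L2_add l2_inner_commute[of ?Q U2 U1])
  qed
  define e1 where "e1 z = U1 (z $ 2, z $ 1)" for z :: "real^2"
  define e2 where "e2 z = U2 (z $ 2, z $ 1)" for z :: "real^2"
  have e12: "e1 \<in> L2 square_measure" "e2 \<in> L2 square_measure"
    using L2_pair_square[OF U1, of 1] L2_pair_square[OF U2, of 1] by (simp_all add: e1_def[abs_def] e2_def[abs_def])
  have e12_pair: "e1 (sq_pt 1 z) = U1 z" "e2 (sq_pt 1 z) = U2 z" for z
    by (cases z; simp add: e1_def e2_def edge1)+
  have sum: "e z = e1 z + e2 z" for z
  proof -
    have "e (edge_pt 1 (z $ 1) (z $ 2)) = e1 z + e2 z" by (simp add: e1_def e2_def U1_def U_def)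
    then show ?thesis using edge_pt_eta[of 1 z] by simp
  qed
  have "l2_norm square_measure e1 \<le> l2_norm square_measure e" "l2_norm square_measure e2 \<le> l2_norm square_measure e"
    using Pyth l2_inner_self_nonneg[of ?Q U1] l2_inner_self_nonneg[of ?Q U2]
      l2_norm_square_pair[OF e, of 1] l2_norm_square_pair[OF e12(1), of 1] l2_norm_square_pair[OF e12(2), of 1]
    by (simp_all add: e12_pair U_def[symmetric] l2_norm_def)
  moreover have "line_orthogonal 1 q1 T1 e1"
    unfolding line_orthogonal_def using U1_g
  proof eventually_elim
    case (elim y)
    then show ?case using compl by (simp add: e1_def edge1 n1_def)
  qed
  moreover have "line_orthogonal 2 q2 T2 e2"
    unfolding line_orthogonal_def
  proof (intro AE_I2 allI impI)
    fix y j assume j: "j < length T2 - q2 - 1"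
    let ?b = "bspline T2 q2 j"
    have bL: "?b \<in> L2 ?I" by (rule bspline_L2_unit[OF T2 j])
    have "j + q2 + 1 < length T2" "sorted T2" using T2 j by (auto simp: open_knots_def)
    then obtain D where D: "\<And>x. \<bar>?b x\<bar> \<le> D" using bspline_bounded[of T2 j q2] by blast
    \<comment> \<open>Expanding \<open>g k\<close> in B-splines turns this pairing into a
      combination of pairings of \<open>e\<close> with tensor products, which vanish by
      assumption.\<close>
    have z: "l2_inner ?I (\<epsilon> k) ?b = 0" if k: "k < r" for k
    proof -
      have bm: "(\<lambda>z. ?b (fst z)) \<in> borel_measurable ?Q" by (rule measurable_unit2) measurable
      have bg: "integrable ?Q (\<lambda>z. ?b (fst z) * (g k (snd z) * U z))"
        by (rule integrable_mult_bounded[OF gU[OF k] bm D])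
      have tens: "(\<lambda>z. bspline T1 q1 i (z $ 1) * ?b (z $ 2)) \<in> L2 square_measure" if i: "i < n1" for i
      proof -
        have "(\<lambda>z. bspline T1 q1 i (snd z) * ?b (fst z)) \<in> L2 ?Q"
          using C[OF i] by (intro L2_bounded_mult[OF L2_fst[OF bL] bounded_snd]) auto
        from L2_pair_square[OF this, of 1] show ?thesis by simp
      qed
      have "l2_inner ?I (\<epsilon> k) ?b = (LINT y|?I. LINT x|?I. ?b y * (g k x * U (y, x)))"
        unfolding l2_inner_def \<epsilon>_def by (simp add: mult.commute)
      also have "\<dots> = (LINT z|?Q. ?b (fst z) * (g k (snd z) * U z))"
        using unit2.integral_fst'[OF bg] by simp
      also have "\<dots> = l2_inner ?Q (\<lambda>z. \<Sum>i<n1. cc k i * (bspline T1 q1 i (sq_pt 1 z $ 1) * ?b (sq_pt 1 z $ 2))) U"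
        unfolding l2_inner_def cc[OF k]
        by (intro Bochner_Integration.integral_cong)
          (auto simp: edge1 sum_distrib_left sum_distrib_right mult_ac intro!: sum.cong)
      also have "\<dots> = (\<Sum>i<n1. cc k i * l2_inner ?Q (\<lambda>z. bspline T1 q1 i (sq_pt 1 z $ 1) * ?b (sq_pt 1 z $ 2)) U)"
        using L2_square_pair[OF tens, of _ 1] U
        by (subst l2_inner_sum_left) (auto intro!: L2_cmult simp: l2_inner_cmult_left)
      also have "\<dots> = 0"
      proof (intro sum.neutral ballI)
        fix i assume "i \<in> {..<n1}"
        then have i: "i < n1" by simp
        have "l2_inner ?Q (\<lambda>z. bspline T1 q1 i (sq_pt 1 z $ 1) * ?b (sq_pt 1 z $ 2)) U
            = l2_inner square_measure e (\<lambda>z. bspline T1 q1 i (z $ 1) * ?b (z $ 2))"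
          using l2_inner_square_pair[OF e tens[OF i], of 1] by (simp add: U_def[abs_def] l2_inner_commute)
        then show "cc k i * l2_inner ?Q (\<lambda>z. bspline T1 q1 i (sq_pt 1 z $ 1) * ?b (sq_pt 1 z $ 2)) U = 0"
          using orth[of i j] i j by (simp add: n1_def)
      qed
      finally show ?thesis .
    qed
    have "(\<lambda>x. e2 (edge_pt 2 x y)) = (\<lambda>x. \<Sum>k<r. g k y * \<epsilon> k x)"
      by (simp add: e2_def edge2 edge1 U2_def)
    then have "l2_inner ?I (\<lambda>x. e2 (edge_pt 2 x y)) ?b = (\<Sum>k<r. g k y * l2_inner ?I (\<epsilon> k) ?b)"
      using \<epsilon>L bL by (simp only:, subst l2_inner_sum_left) (auto intro!: L2_cmult simp: l2_inner_cmult_left)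
    also have "\<dots> = 0" using z by simp
    finally show "l2_inner ?I (\<lambda>x. e2 (edge_pt 2 x y)) ?b = 0" .
  qed
  ultimately show ?thesis using e12 sum by blast
qed

text \<open>Each part of the split is estimated along its own direction, hence
  \<open>320 = 2 * 160\<close>. The chains of derivatives depend on the direction but start from a
  common weight and a common function, so the two pairings add up to the one with
  \<open>e\<close>.\<close>

lemma square_estimate:
  assumes T: "\<And>i :: 2. open_knots (q i) (T i)" "\<And>i. knots_within h (T i)" and h: "0 < h" "h \<le> 1"
    and e: "e \<in> L2 square_measure"
    and orth: "\<And>i j. i < length (T 1) - q 1 - 1 \<Longrightarrow> j < length (T 2) - q 2 - 1 \<Longrightarrow>
      l2_inner square_measure e (\<lambda>z. bspline (T 1) (q 1) i (z $ 1) * bspline (T 2) (q 2) j (z $ 2)) = 0"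
    and \<eta>: "\<And>i. line_weights i n B (\<eta> i)" "\<And>i. \<eta> i 0 = \<eta>0"
    and v: "\<And>i k. k < m \<Longrightarrow> line_ac i (v i k) (v i (Suc k))" "\<And>i k. k \<le> m \<Longrightarrow> v i k \<in> L2 square_measure"
      "\<And>i. v i 0 = v0"
    and A: "\<And>i k. k \<le> m \<Longrightarrow> l2_norm square_measure (v i k) \<le> A"
    and n: "Suc m \<le> n"
    and \<mu>: "\<And>i. \<mu> = 0 \<and> m \<le> Suc (q i) \<or> 0 < \<mu> \<and> \<mu> \<le> 1 \<and> m \<le> q i \<and> 0 \<le> S i \<and> S i \<le> A \<and>
        slobodeckij square_measure \<mu> (v i m) = ennreal ((S i)\<^sup>2)"
  shows "\<bar>l2_inner square_measure (\<lambda>z. \<eta>0 z * v0 z) e\<bar>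
    \<le> 2 ^ m * 320 * B * h powr (real m + \<mu>) * A * l2_norm square_measure e"
proof -
  obtain e1 e2 where e12: "e1 \<in> L2 square_measure" "e2 \<in> L2 square_measure" "\<And>z. e z = e1 z + e2 z"
    "l2_norm square_measure e1 \<le> l2_norm square_measure e" "l2_norm square_measure e2 \<le> l2_norm square_measure e"
    "line_orthogonal 1 (q 1) (T 1) e1" "line_orthogonal 2 (q 2) (T 2) e2"
    using tensor_orthogonal_split[OF T(1) T(1) e orth] by blast
  let ?X = "2 ^ m * 160 * B * h powr (real m + \<mu>) * A"
  have "0 \<le> A" using order.trans[OF l2_norm_nonneg A[of 0]] by simp
  moreover have B: "0 \<le> B" using \<eta>(1) by (auto simp: line_weights_def)
  ultimately have X: "0 \<le> ?X" by simp
  have est: "\<bar>l2_inner square_measure (\<lambda>z. \<eta>0 z * v0 z) f\<bar> \<le> ?X * l2_norm square_measure e"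
    if f: "f \<in> L2 square_measure" "line_orthogonal i (q i) (T i) f" "l2_norm square_measure f \<le> l2_norm square_measure e" for f i
  proof -
    interpret line_orthogonal_function i "q i" "T i" h f
      using T h f by unfold_locales auto
    have "\<bar>l2_inner square_measure (\<lambda>z. \<eta> i 0 z * v i 0 z) f\<bar> \<le> ?X * l2_norm square_measure f"
      by (rule line_estimate[OF \<eta>(1) v(1) v(2) A n \<mu>])
    also have "\<dots> \<le> ?X * l2_norm square_measure e" using f(3) X by (rule mult_left_mono)
    finally show ?thesis by (simp add: \<eta>(2) v(3))
  qed
  have w: "(\<lambda>z. \<eta>0 z * v0 z) \<in> L2 square_measure"
    using \<eta>(1)[of 1] v(2)[of 0 1]
    by (intro L2_bounded_mult[of _ _ _ B]) (auto simp: line_weights_def \<eta>(2)[symmetric, of 1] v(3)[symmetric, of 1])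
  have "e = (\<lambda>z. e1 z + e2 z)" using e12(3) by auto
  then have "l2_inner square_measure (\<lambda>z. \<eta>0 z * v0 z) e
      = l2_inner square_measure (\<lambda>z. \<eta>0 z * v0 z) e1 + l2_inner square_measure (\<lambda>z. \<eta>0 z * v0 z) e2"
    using l2_inner_add_right[OF e12(1,2) w] by simp
  then have "\<bar>l2_inner square_measure (\<lambda>z. \<eta>0 z * v0 z) e\<bar> \<le> ?X * l2_norm square_measure e + ?X * l2_norm square_measure e"
    using est[OF e12(1,6,4)] est[OF e12(2,7,5)] by linarith
  then show ?thesis by (simp add: mult_ac)
qed

section \<open>Sobolev functions on the square\<close>

lemma test_fun_partial:
  assumes "\<phi> \<in> test_fun" shows "partial i \<phi> \<in> test_fun"
proof -
  let ?K = "closure {x. \<phi> x \<noteq> 0}"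
  have "\<And>k. Ck_on k UNIV (partial i \<phi>)" using assms Ck_on.simps(2) unfolding test_fun_def smooth_on_def by blast
  moreover have "{x. partial i \<phi> x \<noteq> 0} \<subseteq> ?K"
  proof (rule ccontr)
    assume "\<not> ?thesis"
    then obtain x where x: "partial i \<phi> x \<noteq> 0" "x \<notin> ?K" by auto
    have "partial i \<phi> x = partial i (\<lambda>x. 0) x"
      using closure_subset[of "{x. \<phi> x \<noteq> 0}"] x(2)
      by (intro partial_cong_open[of "- ?K"]) auto
    also have "\<dots> = 0" by (simp add: partial_eq[OF has_derivative_const])
    finally show False using x by simp
  qed
  then have sub: "closure {x. partial i \<phi> x \<noteq> 0} \<subseteq> ?K" by (rule closure_minimal) simp
  have "compact ?K" "?K \<subseteq> open_square" using assms by (auto simp: test_fun_def)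
  moreover have "compact (closure {x. partial i \<phi> x \<noteq> 0})"
    using compact_Int_closed[OF \<open>compact ?K\<close> closed_closure, of "{x. partial i \<phi> x \<noteq> 0}"] sub
    by (simp add: inf.absorb2)
  ultimately show ?thesis using sub unfolding test_fun_def smooth_on_def by blast
qed

text \<open>Since each part of \<open>e\<close> is treated along a single direction, only unmixed
  derivatives of a Sobolev function are used.\<close>

definition pure_index :: "2 \<Rightarrow> nat \<Rightarrow> nat \<times> nat" where
  "pure_index i k = (if i = 1 then (k, 0) else (0, k))"

lemma mixed_partial_pure: "mixed_partial (pure_index i k) \<phi> = (partial i ^^ k) \<phi>"
  using exhaust_2[of i] by (auto simp: mixed_partial_def pure_index_def)

lemma pure_index_order: "fst (pure_index i k) + snd (pure_index i k) = k"
  by (simp add: pure_index_def)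

text \<open>Testing \<open>u\<close> with derivatives of test functions shows that consecutive weak
  derivatives of \<open>u\<close> are weak derivatives of one another; the du Bois-Reymond argument
  then applies on the lines.\<close>

lemma weak_deriv_line_ac:
  assumes "weak_deriv (pure_index i k) u g" "weak_deriv (pure_index i (Suc k)) u g'"
  shows "line_ac i g g'"
proof (rule weak_imp_line_ac)
  show "g \<in> L2 square_measure" "g' \<in> L2 square_measure" using assms by (auto simp: weak_deriv_def)
  fix \<phi> assume \<phi>: "\<phi> \<in> test_fun"
  have "(LINT z|square_measure. u z * (partial i ^^ k) (partial i \<phi>) z) = (-1) ^ k * (LINT z|square_measure. g z * partial i \<phi> z)"
    using assms(1) test_fun_partial[OF \<phi>] by (simp add: weak_deriv_def mixed_partial_pure pure_index_order)
  moreover have "(LINT z|square_measure. u z * (partial i ^^ Suc k) \<phi> z) = (-1) ^ Suc k * (LINT z|square_measure. g' z * \<phi> z)"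
    using assms(2) \<phi> unfolding weak_deriv_def mixed_partial_pure pure_index_order by blast
  moreover have "(partial i ^^ Suc k) \<phi> = (partial i ^^ k) (partial i \<phi>)" by (simp add: funpow_swap1)
  ultimately have "(-1) ^ k * (LINT z|square_measure. g z * partial i \<phi> z) = (-1) ^ k * (- (LINT z|square_measure. g' z * \<phi> z))"
    by simp
  moreover have "((-1) ^ k :: real) \<noteq> 0" by simp
  ultimately show "(LINT z|square_measure. g z * partial i \<phi> z) = - (LINT z|square_measure. g' z * \<phi> z)"
    unfolding mult_left_cancel[OF \<open>((-1) ^ k :: real) \<noteq> 0\<close>] by blast
qed

lemma square_AE_pairI:
  assumes "AE y in unit_measure. AE x in unit_measure. P (edge_pt i x y)" "{z \<in> space square_measure. P z} \<in> sets square_measure"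
  shows "AE z in square_measure. P z"
proof -
  have "AE z in unit2_measure. P (sq_pt i z)"
  proof (rule unit2.AE_pair_measure)
    have "sq_pt i -` {z \<in> space square_measure. P z} \<inter> space unit2_measure \<in> sets unit2_measure"
      by (rule measurable_sets[OF sq_pt_measurable assms(2)])
    also have "sq_pt i -` {z \<in> space square_measure. P z} \<inter> space unit2_measure = {z \<in> space unit2_measure. P (sq_pt i z)}"
      by (auto simp: edge_pt_in_open_square)
    finally show "{z \<in> space unit2_measure. P (sq_pt i z)} \<in> sets unit2_measure" .
  qed (use assms(1) in simp)
  then have "AE z in distr unit2_measure square_measure (sq_pt i). P z"
    by (subst AE_distr_iff[OF sq_pt_measurable assms(2)])
  then show ?thesis unfolding distr_sq_pt .
qed

text \<open>Weak derivatives are picked by choice, so even the one of order 0 is only almost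
  everywhere equal to \<open>u\<close>. The chain of derivatives starts there and has to be linked
  back to \<open>u\<close>.\<close>

lemma weak_deriv_0_AE:
  assumes "weak_deriv (0, 0) u g" shows "AE z in square_measure. u z = g z"
proof -
  have ug: "u \<in> L2 square_measure" "g \<in> L2 square_measure" using assms by (auto simp: weak_deriv_def)
  have eq: "(LINT z|square_measure. u z * \<phi> z) = (LINT z|square_measure. g z * \<phi> z)" if "\<phi> \<in> test_fun" for \<phi>
    using assms that by (auto simp: weak_deriv_def mixed_partial_def)
  define Z where "Z z = u (sq_pt 1 z) - g (sq_pt 1 z)" for z
  have Z: "Z \<in> L2 unit2_measure" unfolding Z_def using ug by (intro L2_diff L2_square_pair)
  have "AE y in unit_measure. AE x in unit_measure. Z (y, x) = 0"
  proof (rule AE_unit2_eq_0_test[OF unit2'.L2_integrable[OF Z]])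
    fix a b :: "real \<Rightarrow> real" and c d :: real
    assume ab: "a \<in> smooth_real" "b \<in> smooth_real" "0 < c" "d < 1"
      "\<And>x. a x \<noteq> 0 \<Longrightarrow> c \<le> x \<and> x \<le> d" "\<And>x. b x \<noteq> 0 \<Longrightarrow> c \<le> x \<and> x \<le> d"
    let ?\<phi> = "\<lambda>z :: real^2. a (z $ 1) * b (z $ (1 + 1))"
    have \<phi>: "?\<phi> \<in> test_fun" by (rule smooth_product_test_fun[OF ab])
    have "?\<phi> \<in> borel_measurable borel"
      using Ck_on_continuous[OF Ck_on_smooth_product[OF ab(1,2), of 0 1 "1 + 1"]] by (rule borel_measurable_continuous_onI)
    then have \<phi>m: "?\<phi> \<in> borel_measurable square_measure" by (rule measurable_square_measure)
    have \<phi>b: "\<exists>C. \<forall>z\<in>space square_measure. \<bar>?\<phi> z\<bar> \<le> C"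
    proof -
      obtain C D where C: "\<forall>x\<in>{0..1}. \<bar>a x\<bar> \<le> C" "\<forall>x\<in>{0..1}. \<bar>b x\<bar> \<le> D"
        using smooth_real_bounded ab(1,2) by meson
      have "\<bar>?\<phi> z\<bar> \<le> C * D" if "z \<in> space square_measure" for z
        using that C order.trans[OF abs_ge_zero, of "a 0" C] unfolding abs_mult
        by (intro mult_mono) (auto simp: mem_box_cart less_imp_le)
      then show ?thesis by blast
    qed
    then obtain C where C: "\<And>z. z \<in> space square_measure \<Longrightarrow> \<bar>?\<phi> z\<bar> \<le> C" by blast
    have i: "integrable square_measure (\<lambda>z. ?\<phi> z * w z)" if "w \<in> L2 square_measure" for w
      by (rule integrable_mult_bounded[OF square.L2_integrable[OF that] \<phi>m C])
    have "0 = (LINT z|square_measure. ?\<phi> z * u z - ?\<phi> z * g z)"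
      using eq[OF \<phi>] i[OF ug(1)] i[OF ug(2)] by (simp add: mult.commute)
    also have "\<dots> = (LINT z|unit2_measure. ?\<phi> (sq_pt 1 z) * u (sq_pt 1 z) - ?\<phi> (sq_pt 1 z) * g (sq_pt 1 z))"
      using i[OF ug(1)] i[OF ug(2)] by (intro square_integral_pair) auto
    also have "\<dots> = (LINT z|unit2_measure. (b (fst z) * a (snd z)) * Z z)"
      using edge_pt_nth[of 1]
      by (intro Bochner_Integration.integral_cong) (auto simp: Z_def algebra_simps)
    finally show "(LINT z|unit2_measure. (b (fst z) * a (snd z)) * Z z) = 0" by simp
  qed
  then have "AE y in unit_measure. AE x in unit_measure. u (edge_pt 1 x y) = g (edge_pt 1 x y)"
    by (simp add: Z_def)
  then show ?thesis
    by (rule square_AE_pairI) (rule borel_measurable_eq[OF L2_measurable[OF ug(1)] L2_measurable[OF ug(2)]])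
qed

text \<open>Extracts from the Sobolev norm what the lines see. Terms with mixed derivatives are
  non-negative summands of the squared norm and are dropped.\<close>

lemma Hs_square_properties:
  fixes i :: 2
  assumes u: "u \<in> Hs_square s" and s: "0 \<le> s"
  defines "m \<equiv> sobolev_int s" and "\<mu> \<equiv> sobolev_frac s" and "A \<equiv> Hs_square_norm s u"
  shows "k \<le> m \<Longrightarrow> weak_deriv (pure_index i k) u (wderiv (pure_index i k) u)"
    and "k \<le> m \<Longrightarrow> l2_norm square_measure (wderiv (pure_index i k) u) \<le> A"
    and "0 < \<mu> \<Longrightarrow> \<exists>S. 0 \<le> S \<and> S \<le> A \<and> slobodeckij square_measure \<mu> (wderiv (pure_index i m) u) = ennreal (S\<^sup>2)"
    and "s = real m + \<mu>" "0 \<le> \<mu>" "\<mu> < 1"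
proof -
  define I where "I \<alpha> = (LINT x|square_measure. (wderiv \<alpha> u x)\<^sup>2)" for \<alpha>
  define J where "J \<alpha> = enn2real (slobodeckij square_measure \<mu> (wderiv \<alpha> u))" for \<alpha>
  have I0: "0 \<le> I \<alpha>" and J0: "0 \<le> J \<alpha>" for \<alpha> by (auto simp: I_def J_def)
  let ?SI = "{\<alpha> :: nat \<times> nat. fst \<alpha> + snd \<alpha> \<le> m}" and ?SJ = "{\<alpha> :: nat \<times> nat. fst \<alpha> + snd \<alpha> = m}"
  have fin: "finite ?SI" "finite ?SJ"
    by (rule finite_subset[of _ "{..m} \<times> {..m}"]; force)+
  let ?J = "if \<mu> > 0 then sum J ?SJ else 0"
  have A2: "A\<^sup>2 = sum I ?SI + ?J" and A0: "0 \<le> A"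
  proof -
    have nn: "0 \<le> sum I ?SI + ?J" using I0 J0 by (auto intro!: add_nonneg_nonneg sum_nonneg)
    have "A = sqrt (sum I ?SI + ?J)"
      by (simp add: A_def Hs_square_norm_def I_def J_def m_def \<mu>_def)
    with nn show "A\<^sup>2 = sum I ?SI + ?J" "0 \<le> A" by auto
  qed
  show w: "k \<le> m \<Longrightarrow> weak_deriv (pure_index i k) u (wderiv (pure_index i k) u)" for k
  proof -
    assume "k \<le> m"
    have D: "\<forall>\<alpha>. fst \<alpha> + snd \<alpha> \<le> m \<longrightarrow> (\<exists>g. weak_deriv \<alpha> u g)"
      using u by (simp add: Hs_square_def m_def)
    have "\<exists>g. weak_deriv (pure_index i k) u g"
      by (rule D[rule_format]) (simp only: pure_index_order \<open>k \<le> m\<close>)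
    then show "weak_deriv (pure_index i k) u (wderiv (pure_index i k) u)"
      unfolding wderiv_def by (rule someI_ex)
  qed
  show "k \<le> m \<Longrightarrow> l2_norm square_measure (wderiv (pure_index i k) u) \<le> A"
  proof -
    assume "k \<le> m"
    then have "I (pure_index i k) \<le> sum I ?SI"
      using I0 fin pure_index_order[of i k] by (intro member_le_sum) auto
    also have "\<dots> \<le> A\<^sup>2" using A2 J0 by (auto intro: sum_nonneg)
    finally show "l2_norm square_measure (wderiv (pure_index i k) u) \<le> A"
      using A0 by (simp add: l2_norm_eq I_def real_le_lsqrt)
  qed
  show "0 < \<mu> \<Longrightarrow> \<exists>S. 0 \<le> S \<and> S \<le> A \<and> slobodeckij square_measure \<mu> (wderiv (pure_index i m) u) = ennreal (S\<^sup>2)"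
  proof -
    assume \<mu>: "0 < \<mu>"
    have D: "\<forall>\<alpha>. fst \<alpha> + snd \<alpha> = m \<longrightarrow> slobodeckij square_measure \<mu> (wderiv \<alpha> u) < \<infinity>"
      using u \<mu> by (simp add: Hs_square_def m_def \<mu>_def)
    have "slobodeckij square_measure \<mu> (wderiv (pure_index i m) u) < \<infinity>"
      by (intro D[rule_format] pure_index_order)
    then have "slobodeckij square_measure \<mu> (wderiv (pure_index i m) u) = ennreal ((sqrt (J (pure_index i m)))\<^sup>2)"
      using J0 by (simp add: J_def)
    moreover have "J (pure_index i m) \<le> sum J ?SJ"
      using J0 fin pure_index_order[of i m] by (intro member_le_sum) auto
    then have "J (pure_index i m) \<le> A\<^sup>2" using A2 I0 \<mu> sum_nonneg[of ?SI I] by simp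
    then have "sqrt (J (pure_index i m)) \<le> A" using A0 by (intro real_le_lsqrt) (auto simp: J0)
    ultimately show ?thesis using J0 by (intro exI[of _ "sqrt (J (pure_index i m))"]) auto
  qed
  show "s = real m + \<mu>" by (simp add: m_def \<mu>_def sobolev_frac_def)
  show "0 \<le> \<mu>" "\<mu> < 1" using s unfolding \<mu>_def sobolev_frac_def sobolev_int_def by linarith+
qed

lemma line_weights_one: "line_weights i n 1 (\<lambda>l z. if l = 0 then 1 else 0)"
  unfolding line_weights_def by (auto simp: continuous_on_const)

lemma jac_line_weights:
  assumes "regular_patch F"
  shows "\<exists>B. \<forall>i. line_weights i n B (\<lambda>l. (partial i ^^ l) (jac F))"
proof -
  obtain U where U: "open U" "closed_square \<subseteq> U" "\<And>k. Ck_on k U (jac F)"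
    using jac_smooth[OF assms] by blast
  have C: "Ck_on k U ((partial i ^^ l) (jac F))" for i k l by (rule Ck_on_partial_iter[OF U(3)])
  have cont: "continuous_on closed_square ((partial i ^^ l) (jac F))" for i l
    by (rule continuous_on_subset[OF Ck_on_continuous[OF C[of 0]] U(2)])
  have "\<exists>B. \<forall>z\<in>closed_square. \<bar>(partial i ^^ l) (jac F) z\<bar> \<le> B" for i l
  proof -
    have "bounded ((partial i ^^ l) (jac F) ` closed_square)"
      by (rule compact_imp_bounded[OF compact_continuous_image[OF cont compact_cbox]])
    then show ?thesis unfolding bounded_iff by auto
  qed
  then have "\<exists>b. \<forall>i l. \<forall>z\<in>closed_square. \<bar>(partial i ^^ l) (jac F) z\<bar> \<le> b i l"
    by (intro choice allI)
  then obtain b where b: "\<And>i l z. z \<in> closed_square \<Longrightarrow> \<bar>(partial i ^^ l) (jac F) z\<bar> \<le> b i l" by blast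
  define B where "B = (\<Sum>i\<in>UNIV. \<Sum>l\<le>n. \<bar>b i l\<bar>)"
  have B: "\<bar>b i l\<bar> \<le> B" if "l \<le> n" for i l
  proof -
    have "\<bar>b i l\<bar> \<le> (\<Sum>l\<le>n. \<bar>b i l\<bar>)" using that by (intro member_le_sum) auto
    also have "\<dots> \<le> B" unfolding B_def by (intro member_le_sum[of i UNIV "\<lambda>i. \<Sum>l\<le>n. \<bar>b i l\<bar>"] sum_nonneg) auto
    finally show ?thesis .
  qed
  have sub: "open_square \<subseteq> closed_square" by (rule box_subset_cbox)
  have edge: "edge_pt i x y \<in> closed_square" if "0 \<le> x" "x \<le> 1" "0 < y" "y < 1" for i x y
    using that by (auto simp: mem_box_cart edge_pt_def)
  have "line_weights i n B (\<lambda>l. (partial i ^^ l) (jac F))" for i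
    unfolding line_weights_def
  proof (intro conjI allI impI ballI)
    show "0 \<le> B" by (auto simp: B_def intro!: sum_nonneg)
    fix l assume "l \<le> n"
    have "(partial i ^^ l) (jac F) \<in> borel_measurable (restrict_space borel open_square)"
      by (rule borel_measurable_continuous_on_restrict[OF continuous_on_subset[OF cont sub]])
    then show "(partial i ^^ l) (jac F) \<in> borel_measurable square_measure"
      unfolding square_measure_def
      by (subst measurable_cong_sets[OF sets_restrict_space_cong[OF sets_lborel] refl])
    fix z :: "real^2" assume "z \<in> open_square"
    then show "\<bar>(partial i ^^ l) (jac F) z\<bar> \<le> B"
      using b[of z l i] B[OF \<open>l \<le> n\<close>, of i] sub by (meson abs_ge_self order.trans subsetD)
  next
    fix l y assume "l < n" "0 < y" "y < (1 :: real)"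
    then have im: "(\<lambda>t. edge_pt i t y) ` {0..1} \<subseteq> closed_square" using edge by auto
    have ce: "continuous_on {0..1} (\<lambda>t. edge_pt i t y)" unfolding edge_pt_alt by (intro continuous_intros)
    show "continuous_on {0..1} (\<lambda>t. (partial i ^^ Suc l) (jac F) (edge_pt i t y))"
      by (rule continuous_on_compose2[OF cont ce im])
    fix x :: real assume "x \<in> {0..1}"
    then have "edge_pt i x y \<in> U" using edge U(2) \<open>0 < y\<close> \<open>y < 1\<close> by auto
    then have "(partial i ^^ l) (jac F) differentiable (at (edge_pt i x y))"
      using C[where k="Suc 0" and l=l and i=i] by simp
    from partial_edge_pt[OF this]
    show "((\<lambda>t. (partial i ^^ l) (jac F) (edge_pt i t y)) has_real_derivative
        (partial i ^^ Suc l) (jac F) (edge_pt i x y)) (at x within {0..1})" by simp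
  qed
  then show ?thesis by blast
qed

text \<open>The order of quantifiers matters: \<open>C\<close> depends on \<open>s\<close> and the
  patch alone and is fixed before the degrees, knots, mesh size and functions.\<close>

lemma Hs_estimate:
  assumes "regular_patch F" and s: "0 \<le> s"
  shows "\<exists>C>0. \<forall>q T h e u. (\<forall>i :: 2. open_knots (q i) (T i) \<and> knots_within h (T i) \<and> s \<le> real (Suc (q i))) \<longrightarrow>
    0 < h \<longrightarrow> h \<le> 1 \<longrightarrow> e \<in> L2 square_measure \<longrightarrow>
    (\<forall>i<length (T 1) - q 1 - 1. \<forall>j<length (T 2) - q 2 - 1.
      l2_inner square_measure e (\<lambda>z. bspline (T 1) (q 1) i (z $ 1) * bspline (T 2) (q 2) j (z $ 2)) = 0) \<longrightarrow>
    u \<in> Hs_square s \<longrightarrow>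
    \<bar>l2_inner square_measure (\<lambda>z. jac F z * u z) e\<bar> \<le> C * h powr s * Hs_square_norm s u * l2_norm square_measure e"
proof -
  define m where "m = sobolev_int s"
  define \<mu> where "\<mu> = sobolev_frac s"
  obtain B where B: "\<And>i. line_weights i (Suc m) B (\<lambda>l. (partial i ^^ l) (jac F))"
    using jac_line_weights[OF assms(1)] by blast
  have B0: "0 \<le> B" using B by (auto simp: line_weights_def)
  define C where "C = 2 ^ m * 320 * (B + 1)"
  show ?thesis
  proof (intro exI[of _ C] conjI allI impI)
    show "0 < C" using B0 by (simp add: C_def)
    fix q :: "2 \<Rightarrow> nat" and T h e u
    assume T: "\<forall>i :: 2. open_knots (q i) (T i) \<and> knots_within h (T i) \<and> s \<le> real (Suc (q i))"
      and h: "0 < h" "h \<le> 1" and e: "e \<in> L2 square_measure"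
      and orth: "\<forall>i<length (T 1) - q 1 - 1. \<forall>j<length (T 2) - q 2 - 1.
        l2_inner square_measure e (\<lambda>z. bspline (T 1) (q 1) i (z $ 1) * bspline (T 2) (q 2) j (z $ 2)) = 0"
      and u: "u \<in> Hs_square s"
    note P = Hs_square_properties[OF u s, folded m_def \<mu>_def]
    let ?A = "Hs_square_norm s u"
    define v where "v i k = wderiv (pure_index i k) u" for i k
    have vL: "v i k \<in> L2 square_measure" if "k \<le> m" for i k
      using P(1)[OF that, of i] by (simp add: v_def weak_deriv_def)
    have p0: "pure_index i 0 = (0, 0)" for i by (simp add: pure_index_def)
    have A0: "0 \<le> ?A" using order.trans[OF l2_norm_nonneg P(2)[of 0]] by simp
    have "\<exists>S. \<forall>i. \<mu> = 0 \<and> m \<le> Suc (q i) \<or> 0 < \<mu> \<and> \<mu> \<le> 1 \<and> m \<le> q i \<and> 0 \<le> S i \<and> S i \<le> ?A \<and>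
        slobodeckij square_measure \<mu> (v i m) = ennreal ((S i)\<^sup>2)"
    proof (cases "\<mu> = 0")
      case True
      have "m \<le> Suc (q i)" for i using T[rule_format, of i] P(4) True by simp
      then show ?thesis using True by blast
    next
      case False
      then have \<mu>: "0 < \<mu>" using P(5) by simp
      \<comment> \<open>A positive fractional part leaves one order in reserve:
        \<open>m \<le> q i\<close>, as required for the additional integration by parts after
        smoothing.\<close>
      have "real m < real (Suc (q i))" for i using T[rule_format, of i] P(4) \<mu> by linarith
      then have "m \<le> q i" for i using less_Suc_eq_le[of m "q i"] of_nat_less_iff[where 'a=real] by blast
      moreover have "\<exists>S. \<forall>i. 0 \<le> S i \<and> S i \<le> ?A \<and> slobodeckij square_measure \<mu> (v i m) = ennreal ((S i)\<^sup>2)"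
        using P(3)[OF \<mu>] unfolding v_def by (intro choice allI) blast
      ultimately show ?thesis using \<mu> P(6) by (auto simp: less_imp_le)
    qed
    then obtain S where S: "\<And>i. \<mu> = 0 \<and> m \<le> Suc (q i) \<or> 0 < \<mu> \<and> \<mu> \<le> 1 \<and> m \<le> q i \<and> 0 \<le> S i \<and> S i \<le> ?A \<and>
        slobodeckij square_measure \<mu> (v i m) = ennreal ((S i)\<^sup>2)" by blast
    have "\<bar>l2_inner square_measure (\<lambda>z. jac F z * wderiv (0, 0) u z) e\<bar>
      \<le> 2 ^ m * 320 * B * h powr (real m + \<mu>) * ?A * l2_norm square_measure e"
    proof (rule square_estimate[where \<eta>="\<lambda>i l. (partial i ^^ l) (jac F)" and v=v and S=S and m=m and q=q and T=T
          and n="Suc m", OF _ _ h e _ B _ _ vL _ _ _ S])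
      show "line_ac i (v i k) (v i (Suc k))" if "k < m" for i k
        unfolding v_def by (rule weak_deriv_line_ac[OF P(1) P(1)]) (use that in auto)
      show "l2_norm square_measure (v i k) \<le> ?A" if "k \<le> m" for i k
        unfolding v_def by (rule P(2)[OF that])
    qed (use T orth in \<open>auto simp: v_def p0\<close>)
    also have "\<dots> \<le> C * h powr s * ?A * l2_norm square_measure e"
      unfolding C_def P(4)[symmetric] using A0 B0 by (intro mult_right_mono l2_norm_nonneg) auto
    also have "l2_inner square_measure (\<lambda>z. jac F z * wderiv (0, 0) u z) e = l2_inner square_measure (\<lambda>z. jac F z * u z) e"
    proof -
      have w: "weak_deriv (0, 0) u (wderiv (0, 0) u)" using P(1)[of 0 1] by (simp add: p0)
      then have uL: "u \<in> L2 square_measure" "wderiv (0, 0) u \<in> L2 square_measure" by (auto simp: weak_deriv_def)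
      have j: "jac F \<in> borel_measurable square_measure" using B[of 1] by (auto simp: line_weights_def)
      show ?thesis unfolding l2_inner_def
      proof (rule integral_cong_AE)
        show "AE z in square_measure. jac F z * wderiv (0, 0) u z * e z = jac F z * u z * e z"
          using weak_deriv_0_AE[OF w] by eventually_elim simp
      qed (use j uL e in \<open>auto intro!: borel_measurable_times L2_measurable\<close>)
    qed
    finally show "\<bar>l2_inner square_measure (\<lambda>z. jac F z * u z) e\<bar> \<le> C * h powr s * ?A * l2_norm square_measure e" .
  qed
qed

text \<open>The case of no derivatives, \<open>m = 0\<close> with \<open>\<mu> = 1/2\<close> and
  constant weight. Then \<open>m \<le> q i\<close> holds for every degree, so piecewise constants
  gain the half order as well.\<close>

lemma H_half_estimate:
  assumes T: "\<And>i :: 2. open_knots (q i) (T i)" "\<And>i. knots_within h (T i)" and h: "0 < h" "h \<le> 1"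
    and e: "e \<in> L2 square_measure"
    and orth: "\<And>i j. i < length (T 1) - q 1 - 1 \<Longrightarrow> j < length (T 2) - q 2 - 1 \<Longrightarrow>
      l2_inner square_measure e (\<lambda>z. bspline (T 1) (q 1) i (z $ 1) * bspline (T 2) (q 2) j (z $ 2)) = 0"
    and u: "u \<in> L2 square_measure" "l2_norm square_measure u \<le> A"
    and S: "slobodeckij square_measure (1/2) u = ennreal (S\<^sup>2)" "0 \<le> S" "S \<le> A"
  shows "\<bar>l2_inner square_measure u e\<bar> \<le> 320 * h powr (1/2) * A * l2_norm square_measure e"
proof -
  have "\<bar>l2_inner square_measure (\<lambda>z. 1 * u z) e\<bar> \<le> 2 ^ 0 * 320 * 1 * h powr (real 0 + 1/2) * A * l2_norm square_measure e"
    by (rule square_estimate[where \<eta>="\<lambda>i l z. if l = 0 then 1 else 0" and v="\<lambda>i k. u" and S="\<lambda>i. S" and n="Suc 0",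
          OF T h e orth line_weights_one]) (use u S in auto)
  then show ?thesis by simp
qed

section \<open>Dual norms\<close>

definition dual_space :: "('a \<Rightarrow> real) set \<Rightarrow> (('a \<Rightarrow> real) \<Rightarrow> real) \<Rightarrow> (('a \<Rightarrow> real) \<Rightarrow> real) set" where
  "dual_space X nrm = {l. (\<forall>u\<in>X. \<forall>v\<in>X. \<forall>a b. l (\<lambda>x. a * u x + b * v x) = a * l u + b * l v) \<and>
     (\<exists>C. \<forall>u\<in>X. \<bar>l u\<bar> \<le> C * nrm u) \<and> (\<forall>u. u \<notin> X \<longrightarrow> l u = 0)}"

definition dual_norm :: "('a \<Rightarrow> real) set \<Rightarrow> (('a \<Rightarrow> real) \<Rightarrow> real) \<Rightarrow> (('a \<Rightarrow> real) \<Rightarrow> real) \<Rightarrow> real" where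
  "dual_norm X nrm l = (SUP u \<in> {u \<in> X. nrm u \<le> 1}. \<bar>l u\<bar>)"

text \<open>Only a seminorm is available, since elements are representatives and null functions have
  norm 0. The dual norm is definite nevertheless, because functionals are set to 0 outside
  \<open>X\<close>.\<close>

locale parallelogram_seminorm =
  fixes X :: "('a \<Rightarrow> real) set" and nrm :: "('a \<Rightarrow> real) \<Rightarrow> real"
  assumes X0: "(\<lambda>x. 0) \<in> X"
    and X_lin: "\<And>u v a b. u \<in> X \<Longrightarrow> v \<in> X \<Longrightarrow> (\<lambda>x. a * u x + b * v x) \<in> X"
    and nn: "\<And>u. 0 \<le> nrm u"
    and hom: "\<And>u a. u \<in> X \<Longrightarrow> nrm (\<lambda>x. a * u x) = \<bar>a\<bar> * nrm u"
    and par: "\<And>u v. u \<in> X \<Longrightarrow> v \<in> X \<Longrightarrow>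
      (nrm (\<lambda>x. u x + v x))\<^sup>2 + (nrm (\<lambda>x. u x - v x))\<^sup>2 = 2 * (nrm u)\<^sup>2 + 2 * (nrm v)\<^sup>2"
begin

abbreviation "L \<equiv> dual_space X nrm"
abbreviation "dn \<equiv> dual_norm X nrm"

lemma X_scale: "u \<in> X \<Longrightarrow> (\<lambda>x. a * u x) \<in> X"
  using X_lin[of u u a 0] by simp

lemma nrm_0: "nrm (\<lambda>x. 0) = 0"
  using hom[OF X0, of 0] by simp

lemma functional_lin: "l \<in> L \<Longrightarrow> u \<in> X \<Longrightarrow> v \<in> X \<Longrightarrow> l (\<lambda>x. a * u x + b * v x) = a * l u + b * l v"
  by (simp add: dual_space_def)

lemma functional_scale: "l \<in> L \<Longrightarrow> u \<in> X \<Longrightarrow> l (\<lambda>x. a * u x) = a * l u"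
  using functional_lin[of l u u a 0] by simp

lemma functional_0: "l \<in> L \<Longrightarrow> l (\<lambda>x. 0) = 0"
  using functional_scale[OF _ X0, of l 0] by simp

lemma ball_bdd:
  assumes "l \<in> L" shows "bdd_above ((\<lambda>u. \<bar>l u\<bar>) ` {u \<in> X. nrm u \<le> 1})"
proof -
  obtain C where C: "\<forall>u\<in>X. \<bar>l u\<bar> \<le> C * nrm u" using assms by (auto simp: dual_space_def)
  have "\<bar>l u\<bar> \<le> \<bar>C\<bar>" if "u \<in> X" "nrm u \<le> 1" for u
  proof -
    have "\<bar>l u\<bar> \<le> C * nrm u" using C that by blast
    also have "\<dots> \<le> \<bar>C\<bar> * 1" using that nn by (intro mult_mono) auto
    finally show ?thesis by simp
  qed
  then show ?thesis by (intro bdd_aboveI2[of _ _ "\<bar>C\<bar>"]) auto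
qed

lemma dn_upper: "l \<in> L \<Longrightarrow> u \<in> X \<Longrightarrow> nrm u \<le> 1 \<Longrightarrow> \<bar>l u\<bar> \<le> dn l"
  unfolding dual_norm_def by (intro cSUP_upper[OF _ ball_bdd]) auto

lemma dn_least:
  assumes "\<And>u. u \<in> X \<Longrightarrow> nrm u \<le> 1 \<Longrightarrow> \<bar>l u\<bar> \<le> K" shows "dn l \<le> K"
  unfolding dual_norm_def
proof (rule cSUP_least)
  show "{u \<in> X. nrm u \<le> 1} \<noteq> {}" using X0 nrm_0 by auto
qed (use assms in auto)

lemma dn_nonneg: "l \<in> L \<Longrightarrow> 0 \<le> dn l"
  using dn_upper[OF _ X0] nrm_0 functional_0 by fastforce

lemma functional_bound:
  assumes l: "l \<in> L" and u: "u \<in> X" shows "\<bar>l u\<bar> \<le> dn l * nrm u"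
proof (cases "nrm u = 0")
  case True
  then show ?thesis using l u by (force simp: dual_space_def)
next
  case False
  then have p: "nrm u > 0" using nn[of u] by simp
  have "\<bar>l (\<lambda>x. (1 / nrm u) * u x)\<bar> \<le> dn l"
    by (rule dn_upper[OF l X_scale[OF u]]) (simp only: hom[OF u], use p in simp)
  then have "(1 / nrm u) * \<bar>l u\<bar> \<le> dn l"
    unfolding functional_scale[OF l u] using p by (simp add: abs_mult)
  then show ?thesis using p by (simp add: field_simps)
qed

lemma L_lincomb: "lincomb_closed L"
  unfolding lincomb_closed_def
proof (intro ballI allI)
  fix l m :: "('a \<Rightarrow> real) \<Rightarrow> real" and a b :: real assume lm: "l \<in> L" "m \<in> L"
  have "\<bar>a * l u + b * m u\<bar> \<le> (\<bar>a\<bar> * dn l + \<bar>b\<bar> * dn m) * nrm u" if "u \<in> X" for u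
  proof -
    have "\<bar>a * l u + b * m u\<bar> \<le> \<bar>a\<bar> * \<bar>l u\<bar> + \<bar>b\<bar> * \<bar>m u\<bar>" by (metis abs_mult abs_triangle_ineq)
    also have "\<dots> \<le> \<bar>a\<bar> * (dn l * nrm u) + \<bar>b\<bar> * (dn m * nrm u)"
      using lm that by (intro add_mono mult_left_mono functional_bound) auto
    finally show ?thesis by (simp add: algebra_simps)
  qed
  then have "\<exists>C. \<forall>u\<in>X. \<bar>a * l u + b * m u\<bar> \<le> C * nrm u" by blast
  then show "(\<lambda>u. a * l u + b * m u) \<in> L"
    using lm unfolding dual_space_def by (simp add: algebra_simps)
qed

lemma dn_hom: assumes l: "l \<in> L" shows "dn (\<lambda>u. a * l u) = \<bar>a\<bar> * dn l"
proof -
  have le: "dn (\<lambda>u. a * l u) \<le> \<bar>a\<bar> * dn l" if "l \<in> L" for l a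
    using dn_upper[OF that] by (intro dn_least) (auto simp: abs_mult intro!: mult_left_mono)
  show ?thesis
  proof (cases "a = 0")
    case True
    then show ?thesis using le[OF l, of 0] dn_nonneg[OF lincomb_closed_scale[OF L_lincomb l, of 0]] by simp
  next
    case False
    have "dn l = dn (\<lambda>u. (1 / a) * (a * l u))" using False by simp
    also have "\<dots> \<le> \<bar>1 / a\<bar> * dn (\<lambda>u. a * l u)" by (rule le[OF lincomb_closed_scale[OF L_lincomb l]])
    finally have "\<bar>a\<bar> * dn l \<le> dn (\<lambda>u. a * l u)" using False by (simp add: field_simps abs_divide)
    then show ?thesis using le[OF l, of a] by simp
  qed
qed

lemma dn_triangle:
  assumes l: "l \<in> L" "m \<in> L" shows "dn (\<lambda>u. l u + m u) \<le> dn l + dn m"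
proof (rule dn_least)
  fix u assume "u \<in> X" "nrm u \<le> 1"
  then show "\<bar>l u + m u\<bar> \<le> dn l + dn m" using dn_upper[OF l(1), of u] dn_upper[OF l(2), of u] by linarith
qed

lemma dn_scaled_least:
  assumes "0 \<le> a" "l \<in> L" "\<And>u. u \<in> X \<Longrightarrow> nrm u \<le> 1 \<Longrightarrow> a * \<bar>l u\<bar> \<le> K" shows "a * dn l \<le> K"
proof (cases "a = 0")
  case True
  then show ?thesis using assms(3)[OF X0] nrm_0 by simp
next
  case False
  then have "dn l \<le> K / a" using assms by (intro dn_least) (auto simp: field_simps)
  then show ?thesis using False assms(1) by (simp add: field_simps)
qed

text \<open>For \<open>u\<close> and \<open>v\<close> in the unit ball and weights \<open>a\<close> and \<open>b\<close>, the sum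
  \<open>a (l + m) u + b (l - m) v\<close> equals \<open>l (a u + b v) + m (a u - b v)\<close>; the parallelogram law bounds
  the arguments, and \<open>a\<close>, \<open>b\<close> are taken to be the dual norms on the left-hand side.\<close>

lemma dn_parallelogram_le:
  assumes l: "l \<in> L" "m \<in> L"
  shows "(dn (\<lambda>u. l u + m u))\<^sup>2 + (dn (\<lambda>u. l u - m u))\<^sup>2 \<le> 2 * (dn l)\<^sup>2 + 2 * (dn m)\<^sup>2"
proof -
  define a where "a = dn (\<lambda>u. l u + m u)"
  define b where "b = dn (\<lambda>u. l u - m u)"
  define K where "K = sqrt ((dn l)\<^sup>2 + (dn m)\<^sup>2) * sqrt (2 * (a\<^sup>2 + b\<^sup>2))"
  note sum = lincomb_closed_add[OF L_lincomb l] and dif = lincomb_closed_diff[OF L_lincomb l]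
  have a0: "0 \<le> a" "0 \<le> b" using dn_nonneg[OF sum] dn_nonneg[OF dif] by (auto simp: a_def b_def)
  have main: "a * \<bar>l u + m u\<bar> + b * \<bar>l v - m v\<bar> \<le> K"
    if u: "u \<in> X" "nrm u \<le> 1" and v: "v \<in> X" "nrm v \<le> 1" for u v
  proof -
    \<comment> \<open>The signs of \<open>a'\<close> and \<open>b'\<close> absorb the absolute
      values, so that the left-hand side becomes linear in \<open>u\<close> and
      \<open>v\<close>.\<close>
    define a' where "a' = (if l u + m u \<ge> 0 then a else - a)"
    define b' where "b' = (if l v - m v \<ge> 0 then b else - b)"
    let ?s = "\<lambda>x. a' * u x + b' * v x" and ?d = "\<lambda>x. a' * u x + (- b') * v x"
    have "a * \<bar>l u + m u\<bar> + b * \<bar>l v - m v\<bar> = a' * (l u + m u) + b' * (l v - m v)"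
      by (simp add: a'_def b'_def algebra_simps)
    also have "\<dots> = l ?s + m ?d"
      unfolding functional_lin[OF l(1) u(1) v(1)] functional_lin[OF l(2) u(1) v(1)] by (simp add: algebra_simps)
    also have "\<dots> \<le> dn l * nrm ?s + dn m * nrm ?d"
      using functional_bound[OF l(1) X_lin[OF u(1) v(1)], of a' b'] functional_bound[OF l(2) X_lin[OF u(1) v(1)], of a' "- b'"]
      by (simp add: abs_le_iff)
    also have "\<dots> \<le> sqrt ((dn l)\<^sup>2 + (dn m)\<^sup>2) * sqrt ((nrm ?s)\<^sup>2 + (nrm ?d)\<^sup>2)"
      unfolding real_sqrt_mult[symmetric]
    proof (rule real_le_rsqrt)
      have "0 \<le> (dn l * nrm ?d - dn m * nrm ?s)\<^sup>2" by simp
      then show "(dn l * nrm ?s + dn m * nrm ?d)\<^sup>2 \<le> ((dn l)\<^sup>2 + (dn m)\<^sup>2) * ((nrm ?s)\<^sup>2 + (nrm ?d)\<^sup>2)"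
        by (simp add: power2_eq_square algebra_simps)
    qed
    also have "(nrm ?s)\<^sup>2 + (nrm ?d)\<^sup>2 = 2 * (\<bar>a'\<bar> * nrm u)\<^sup>2 + 2 * (\<bar>b'\<bar> * nrm v)\<^sup>2"
      using par[OF X_scale[OF u(1), of a'] X_scale[OF v(1), of b']] by (simp add: hom[OF u(1)] hom[OF v(1)])
    also have "sqrt ((dn l)\<^sup>2 + (dn m)\<^sup>2) * sqrt \<dots> \<le> K"
      unfolding K_def
    proof (intro mult_left_mono real_sqrt_le_mono)
      have "(\<bar>a'\<bar> * nrm u)\<^sup>2 \<le> (\<bar>a'\<bar> * 1)\<^sup>2" "(\<bar>b'\<bar> * nrm v)\<^sup>2 \<le> (\<bar>b'\<bar> * 1)\<^sup>2"
        using u v nn by (intro power_mono mult_left_mono mult_nonneg_nonneg; simp)+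
      moreover have "\<bar>a'\<bar>\<^sup>2 = a\<^sup>2" "\<bar>b'\<bar>\<^sup>2 = b\<^sup>2" by (auto simp: a'_def b'_def)
      ultimately show "2 * (\<bar>a'\<bar> * nrm u)\<^sup>2 + 2 * (\<bar>b'\<bar> * nrm v)\<^sup>2 \<le> 2 * (a\<^sup>2 + b\<^sup>2)" by simp
    qed simp
    finally show ?thesis .
  qed
  \<comment> \<open>The supremum is taken over \<open>u\<close> with \<open>v\<close> fixed and
    afterwards over \<open>v\<close>; each time one dual norm replaces a value.\<close>
  have "a * a + b * b \<le> K"
  proof -
    have "a * a \<le> K - b * \<bar>l v - m v\<bar>" if "v \<in> X" "nrm v \<le> 1" for v
      unfolding a_def[symmetric] using main[OF _ _ that]
      by (subst (2) a_def, intro dn_scaled_least[OF a0(1) sum]) (auto simp: algebra_simps)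
    then have "b * \<bar>l v - m v\<bar> \<le> K - a * a" if "v \<in> X" "nrm v \<le> 1" for v using that by fastforce
    then have "b * b \<le> K - a * a"
      by (subst (2) b_def, intro dn_scaled_least[OF a0(2) dif]) auto
    then show ?thesis by simp
  qed
  then have "(a\<^sup>2 + b\<^sup>2)\<^sup>2 \<le> K\<^sup>2" using a0 by (intro power_mono) (auto simp: power2_eq_square)
  also have "K\<^sup>2 = (2 * (dn l)\<^sup>2 + 2 * (dn m)\<^sup>2) * (a\<^sup>2 + b\<^sup>2)"
    unfolding K_def power_mult_distrib by (simp add: algebra_simps)
  finally have "(a\<^sup>2 + b\<^sup>2) * (a\<^sup>2 + b\<^sup>2) \<le> (2 * (dn l)\<^sup>2 + 2 * (dn m)\<^sup>2) * (a\<^sup>2 + b\<^sup>2)"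
    by (simp add: power2_eq_square)
  then have "a\<^sup>2 + b\<^sup>2 \<le> 2 * (dn l)\<^sup>2 + 2 * (dn m)\<^sup>2"
    by (cases "a\<^sup>2 + b\<^sup>2 = 0") (auto simp: sum_power2_le_zero_iff mult_le_cancel_right not_sum_power2_lt_zero sum_power2_gt_zero_iff)
  then show ?thesis by (simp add: a_def b_def)
qed

text \<open>The reverse inequality is the same inequality for \<open>l + m\<close> and
  \<open>l - m\<close>, whose sum and difference are \<open>2 * l\<close> and
  \<open>2 * m\<close>.\<close>

lemma dn_parallelogram:
  assumes l: "l \<in> L" "m \<in> L"
  shows "(dn (\<lambda>u. l u + m u))\<^sup>2 + (dn (\<lambda>u. l u - m u))\<^sup>2 = 2 * (dn l)\<^sup>2 + 2 * (dn m)\<^sup>2"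
proof (rule antisym[OF dn_parallelogram_le[OF l]])
  have "(dn (\<lambda>u. 2 * l u))\<^sup>2 + (dn (\<lambda>u. 2 * m u))\<^sup>2 \<le> 2 * (dn (\<lambda>u. l u + m u))\<^sup>2 + 2 * (dn (\<lambda>u. l u - m u))\<^sup>2"
    using dn_parallelogram_le[OF lincomb_closed_add[OF L_lincomb l] lincomb_closed_diff[OF L_lincomb l]]
    by (simp add: algebra_simps)
  then show "2 * (dn l)\<^sup>2 + 2 * (dn m)\<^sup>2 \<le> (dn (\<lambda>u. l u + m u))\<^sup>2 + (dn (\<lambda>u. l u - m u))\<^sup>2"
    by (simp add: dn_hom[OF l(1)] dn_hom[OF l(2)] power_mult_distrib)
qed

lemma dn_eq_0: assumes "l \<in> L" "dn l = 0" shows "l = (\<lambda>u. 0)"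
proof
  fix u show "l u = 0"
    using functional_bound[OF assms(1), of u] assms by (cases "u \<in> X") (auto simp: dual_space_def)
qed

definition dinner where
  "dinner l m = ((dn (\<lambda>u. l u + m u))\<^sup>2 - (dn (\<lambda>u. l u - m u))\<^sup>2) / 4"

text \<open>A minimiser exists in the finite-dimensional span, and the Pythagorean identities say
  that its error is orthogonal to \<open>V\<close>. A second orthogonal candidate would give the
  Pythagorean identity in both directions, so their difference has dual norm 0 and is zero. The
  description therefore denotes the minimiser.\<close>

lemma dual_projection:
  fixes b :: "nat \<Rightarrow> ('a \<Rightarrow> real) \<Rightarrow> real"
  assumes b: "\<And>i. i < k \<Longrightarrow> b i \<in> L" and l: "l \<in> L"
    and V: "V = {\<lambda>u. \<Sum>i<k. c i * b i u | c. True}" and w: "w \<in> V"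
  shows "dn (\<lambda>u. l u - (THE q. q \<in> V \<and> (\<forall>v\<in>V. dinner (\<lambda>u. l u - q u) v = 0)) u) \<le> dn (\<lambda>u. l u - w u)"
proof -
  note add = lincomb_closed_add[OF L_lincomb] and diff = lincomb_closed_diff[OF L_lincomb]
    and sc = lincomb_closed_scale[OF L_lincomb]
  have z: "(\<lambda>u. 0) \<in> L" using sc[OF l, of 0] by simp
  have VL: "V \<subseteq> L" unfolding V using lincomb_closed_sum[OF L_lincomb z, of k b] b by auto
  have Vlin: "(\<lambda>u. q u + t * v u) \<in> V" if qv: "q \<in> V" "v \<in> V" for q v t
  proof -
    obtain c d where "q = (\<lambda>u. \<Sum>i<k. c i * b i u)" "v = (\<lambda>u. \<Sum>i<k. d i * b i u)" using qv unfolding V by blast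
    then have "(\<lambda>u. q u + t * v u) = (\<lambda>u. \<Sum>i<k. (c i + t * d i) * b i u)"
      by (simp add: algebra_simps sum.distrib sum_distrib_left)
    then show ?thesis unfolding V by (intro CollectI exI[of _ "\<lambda>i. c i + t * d i"]) simp
  qed
  obtain c where c: "\<And>d. dn (\<lambda>u. l u - (\<Sum>i<k. c i * b i u)) \<le> dn (\<lambda>u. l u - (\<Sum>i<k. d i * b i u))"
    using finite_dim_minimizer[where n=dn and L=L and b=b and k=k and l=l, OF L_lincomb dn_triangle dn_hom dn_nonneg b l] by blast
  define q where "q = (\<lambda>u. \<Sum>i<k. c i * b i u)"
  have qV: "q \<in> V" unfolding V q_def by blast
  have min: "dn (\<lambda>u. l u - q u) \<le> dn (\<lambda>u. l u - v u)" if "v \<in> V" for v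
    using that c unfolding V q_def by blast
  have lq: "(\<lambda>u. l u - q u) \<in> L" using diff[OF l] qV VL by blast
  have Pyth: "(dn (\<lambda>u. (l u - q u) + v u))\<^sup>2 = (dn (\<lambda>u. l u - q u))\<^sup>2 + (dn v)\<^sup>2"
    "(dn (\<lambda>u. (l u - q u) - v u))\<^sup>2 = (dn (\<lambda>u. l u - q u))\<^sup>2 + (dn v)\<^sup>2" if v: "v \<in> V" for v
  proof -
    have vL: "v \<in> L" using v VL by blast
    have m: "(dn (\<lambda>u. l u - q u))\<^sup>2 \<le> (dn (\<lambda>u. (l u - q u) + t * v u))\<^sup>2" for t
    proof (rule power_mono)
      have "(\<lambda>u. q u + (- t) * v u) \<in> V" by (rule Vlin[OF qV v])
      from min[OF this] show "dn (\<lambda>u. l u - q u) \<le> dn (\<lambda>u. (l u - q u) + t * v u)" by (simp add: algebra_simps)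
    qed (rule dn_nonneg[OF lq])
    note minimizer_Pythagoras[where n=dn, OF L_lincomb lq vL dn_hom dn_parallelogram m]
    then show "(dn (\<lambda>u. (l u - q u) + v u))\<^sup>2 = (dn (\<lambda>u. l u - q u))\<^sup>2 + (dn v)\<^sup>2"
      "(dn (\<lambda>u. (l u - q u) - v u))\<^sup>2 = (dn (\<lambda>u. l u - q u))\<^sup>2 + (dn v)\<^sup>2" by blast+
  qed
  have "(THE q. q \<in> V \<and> (\<forall>v\<in>V. dinner (\<lambda>u. l u - q u) v = 0)) = q"
  proof (rule the_equality)
    show "q \<in> V \<and> (\<forall>v\<in>V. dinner (\<lambda>u. l u - q u) v = 0)"
      using qV Pyth by (auto simp: dinner_def)
    fix q' assume q': "q' \<in> V \<and> (\<forall>v\<in>V. dinner (\<lambda>u. l u - q' u) v = 0)"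
    define v where "v = (\<lambda>u. q u + (- 1) * q' u)"
    have v: "v \<in> V" unfolding v_def using Vlin[OF qV] q' by blast
    then have vL: "v \<in> L" using VL by blast
    have lq': "(\<lambda>u. l u - q' u) \<in> L" using diff[OF l] q' VL by blast
    have 0: "dinner (\<lambda>u. l u - q' u) v = 0" using q' v by blast
    have "(dn (\<lambda>u. (l u - q' u) + v u))\<^sup>2 + (dn (\<lambda>u. (l u - q' u) - v u))\<^sup>2 = 2 * (dn (\<lambda>u. l u - q' u))\<^sup>2 + 2 * (dn v)\<^sup>2"
      by (rule dn_parallelogram[OF lq' vL])
    moreover have "(dn (\<lambda>u. (l u - q' u) + v u))\<^sup>2 = (dn (\<lambda>u. (l u - q' u) - v u))\<^sup>2"
      using 0 by (simp add: dinner_def)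
    moreover have "(\<lambda>u. (l u - q' u) - v u) = (\<lambda>u. l u - q u)" by (simp add: v_def)
    ultimately have 1: "(dn (\<lambda>u. l u - q u))\<^sup>2 = (dn (\<lambda>u. l u - q' u))\<^sup>2 + (dn v)\<^sup>2" by simp
    have "(\<lambda>u. (l u - q u) + v u) = (\<lambda>u. l u - q' u)" by (simp add: v_def)
    then have "(dn (\<lambda>u. l u - q' u))\<^sup>2 = (dn (\<lambda>u. l u - q u))\<^sup>2 + (dn v)\<^sup>2" using Pyth(1)[OF v] by simp
    with 1 have "dn v = 0" by simp
    from fun_cong[OF dn_eq_0[OF vL this]] show "q' = q" by (auto simp: v_def)
  qed
  then show ?thesis using min[OF w] by simp
qed

end

section \<open>Multipatch surfaces\<close>

lemma continuous_square_measurable: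
  assumes "continuous_on closed_square f" shows "f \<in> borel_measurable square_measure"
proof -
  have "f \<in> borel_measurable (restrict_space borel open_square)"
    by (rule borel_measurable_continuous_on_restrict[OF continuous_on_subset[OF assms box_subset_cbox]])
  then show ?thesis unfolding square_measure_def
    by (subst measurable_cong_sets[OF sets_restrict_space_cong[OF sets_lborel] refl])
qed

lemma open_closed_square: "x \<in> open_square \<Longrightarrow> x \<in> closed_square"
  using box_subset_cbox by blast

section \<open>The Slobodeckij seminorm as a quadratic form\<close>

context
  fixes M :: "'a::euclidean_space measure"
  assumes M: "finite_measure M" "sets M = sets borel"
begin

interpretation finite_measure M by (rule M)

lemma slobodeckij_integrand_measurable:
  assumes "u \<in> borel_measurable borel"
  shows "(\<lambda>(x, y). ennreal ((u x - u y)\<^sup>2 / norm (x - y) powr r)) \<in> borel_measurable (M \<Otimes>\<^sub>M M)"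
proof -
  have [measurable]: "u \<in> borel_measurable M" using assms M(2) by (simp cong: measurable_cong_sets)
  have [measurable]: "(\<lambda>x. x) \<in> borel_measurable M" using M(2) by (simp cong: measurable_cong_sets)
  show ?thesis by measurable
qed

lemma slobodeckij_section_measurable:
  assumes "u \<in> borel_measurable borel"
  shows "(\<lambda>y. ennreal ((u x - u y)\<^sup>2 / norm (x - y) powr r)) \<in> borel_measurable M"
  using measurable_Pair2[OF slobodeckij_integrand_measurable[OF assms, of r], of x] M(2)
  by (simp add: sets_eq_imp_space_eq[of M borel])

lemma slobodeckij_outer_measurable:
  assumes "u \<in> borel_measurable borel"
  shows "(\<lambda>x. \<integral>\<^sup>+y. ennreal ((u x - u y)\<^sup>2 / norm (x - y) powr r) \<partial>M) \<in> borel_measurable M"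
  by (rule borel_measurable_nn_integral[OF slobodeckij_integrand_measurable[OF assms]])

text \<open>The identity holds for the integrands and is stated in \<open>ennreal\<close>; it
  therefore also shows that sums of functions with finite seminorm have finite seminorm.\<close>

lemma slobodeckij_parallelogram:
  assumes u: "u \<in> borel_measurable borel" and v: "v \<in> borel_measurable borel"
  shows "slobodeckij M \<mu> (\<lambda>x. u x + v x) + slobodeckij M \<mu> (\<lambda>x. u x - v x)
    = 2 * slobodeckij M \<mu> u + 2 * slobodeckij M \<mu> v"
proof -
  define Q where "Q u x y = ennreal ((u x - u y)\<^sup>2 / norm (x - y) powr (2 + 2 * \<mu>))" for u :: "'a \<Rightarrow> real" and x y
  define I where "I u x = (\<integral>\<^sup>+y. Q u x y \<partial>M)" for u x
  have m: "Q w x \<in> borel_measurable M" "I w \<in> borel_measurable M" if "w \<in> borel_measurable borel" for w x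
    using slobodeckij_section_measurable[OF that] slobodeckij_outer_measurable[OF that]
    by (simp_all add: Q_def[abs_def] I_def[abs_def])
  have S: "slobodeckij M \<mu> w = (\<integral>\<^sup>+x. I w x \<partial>M)" for w by (simp add: slobodeckij_def I_def Q_def)
  have uv: "(\<lambda>x. u x + v x) \<in> borel_measurable borel" "(\<lambda>x. u x - v x) \<in> borel_measurable borel" using u v by auto
  have Q: "Q (\<lambda>x. u x + v x) x y + Q (\<lambda>x. u x - v x) x y = 2 * Q u x y + 2 * Q v x y" for x y
  proof -
    define n where "n = norm (x - y) powr (2 + 2 * \<mu>)"
    have n: "0 \<le> n" by (simp add: n_def)
    have "((u x + v x - (u y + v y))\<^sup>2 + (u x - v x - (u y - v y))\<^sup>2) / n = (2 * (u x - u y)\<^sup>2 + 2 * (v x - v y)\<^sup>2) / n"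
      by (rule arg_cong[where f="\<lambda>a. a / n"]) (simp add: power2_eq_square algebra_simps)
    then show ?thesis using n
      by (simp add: Q_def n_def[symmetric] add_divide_distrib ennreal_plus[symmetric] ennreal_mult[symmetric]
          ennreal_numeral[symmetric] del: ennreal_plus ennreal_numeral)
  qed
  have I: "I (\<lambda>x. u x + v x) x + I (\<lambda>x. u x - v x) x = 2 * I u x + 2 * I v x" for x
  proof -
    have "I (\<lambda>x. u x + v x) x + I (\<lambda>x. u x - v x) x = (\<integral>\<^sup>+y. 2 * Q u x y + 2 * Q v x y \<partial>M)"
      unfolding I_def Q[symmetric] by (rule nn_integral_add[OF m(1)[OF uv(1)] m(1)[OF uv(2)], symmetric])
    also have "\<dots> = 2 * I u x + 2 * I v x"
      unfolding I_def using m(1)[OF u] m(1)[OF v] by (simp add: nn_integral_add nn_integral_cmult)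
    finally show ?thesis .
  qed
  have "slobodeckij M \<mu> (\<lambda>x. u x + v x) + slobodeckij M \<mu> (\<lambda>x. u x - v x) = (\<integral>\<^sup>+x. 2 * I u x + 2 * I v x \<partial>M)"
    unfolding S I[symmetric] by (rule nn_integral_add[OF m(2)[OF uv(1)] m(2)[OF uv(2)], symmetric])
  also have "\<dots> = 2 * slobodeckij M \<mu> u + 2 * slobodeckij M \<mu> v"
    unfolding S using m(2)[OF u] m(2)[OF v] by (simp add: nn_integral_add nn_integral_cmult)
  finally show ?thesis .
qed

lemma slobodeckij_scale:
  assumes u: "u \<in> borel_measurable borel"
  shows "slobodeckij M \<mu> (\<lambda>x. a * u x) = ennreal (a\<^sup>2) * slobodeckij M \<mu> u"
proof -
  have "slobodeckij M \<mu> (\<lambda>x. a * u x) = (\<integral>\<^sup>+x. \<integral>\<^sup>+y. ennreal (a\<^sup>2) * ennreal ((u x - u y)\<^sup>2 / norm (x - y) powr (2 + 2 * \<mu>)) \<partial>M \<partial>M)"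
    unfolding slobodeckij_def
    by (intro nn_integral_cong) (simp add: ennreal_mult[symmetric] power_mult_distrib right_diff_distrib[symmetric])
  also have "\<dots> = (\<integral>\<^sup>+x. ennreal (a\<^sup>2) * (\<integral>\<^sup>+y. ennreal ((u x - u y)\<^sup>2 / norm (x - y) powr (2 + 2 * \<mu>)) \<partial>M) \<partial>M)"
    by (intro nn_integral_cong nn_integral_cmult slobodeckij_section_measurable u)
  also have "\<dots> = ennreal (a\<^sup>2) * slobodeckij M \<mu> u"
    unfolding slobodeckij_def by (intro nn_integral_cmult slobodeckij_outer_measurable u)
  finally show ?thesis .
qed

end

text \<open>The mean value inequality on the convex square. Pulling the seminorm back from the
  surface requires this upper bound on distances, because distances appear in the
  denominator.\<close>

lemma regular_patch_Lipschitz: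
  assumes "regular_patch F"
  shows "\<exists>K\<ge>1. \<forall>x\<in>closed_square. \<forall>y\<in>closed_square. norm (F x - F y) \<le> K * norm (x - y)"
proof -
  obtain U where U: "open U" "closed_square \<subseteq> U" "\<And>k. Ck_on k U F"
    using jac_smooth[OF assms] by blast
  have F: "(F has_derivative frechet_derivative F (at x)) (at x)" if "x \<in> closed_square" for x
    using U(3)[of 1] U(2) that by (auto simp: frechet_derivative_works)
  have cont: "continuous_on closed_square (partial i F)" for i
    using U(3)[of "Suc 0"] by (auto intro: continuous_on_subset[OF _ U(2)])
  have "\<exists>b. \<forall>x\<in>closed_square. norm (partial i F x) \<le> b" for i
    using compact_imp_bounded[OF compact_continuous_image[OF cont compact_cbox]] unfolding bounded_iff by auto
  then obtain b where b: "\<And>i x. x \<in> closed_square \<Longrightarrow> norm (partial i F x) \<le> b i" by metis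
  define K where "K = 1 + (\<Sum>i\<in>UNIV. \<bar>b i\<bar>)"
  have K: "1 \<le> K" by (simp add: K_def sum_nonneg)
  have on: "onorm (frechet_derivative F (at x)) \<le> K" if x: "x \<in> closed_square" for x
  proof (rule onorm_bound)
    fix h :: "real^2"
    interpret linear "frechet_derivative F (at x)" by (rule has_derivative_linear[OF F[OF x]])
    have "h = (\<Sum>i\<in>UNIV. h $ i *\<^sub>R axis i 1)" using basis_expansion[of h] by (simp add: scalar_mult_eq_scaleR)
    then have "frechet_derivative F (at x) h = (\<Sum>i\<in>UNIV. h $ i *\<^sub>R partial i F x)"
      by (metis (no_types, lifting) partial_def scale sum sum.cong)
    also have "norm \<dots> \<le> (\<Sum>i\<in>UNIV. \<bar>b i\<bar> * norm h)"
    proof (rule sum_norm_le)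
      fix i
      have "norm (h $ i *\<^sub>R partial i F x) = \<bar>h $ i\<bar> * norm (partial i F x)" by simp
      also have "\<dots> \<le> norm h * \<bar>b i\<bar>"
        using b[OF x, of i] component_le_norm_cart[of h i] by (intro mult_mono) auto
      finally show "norm (h $ i *\<^sub>R partial i F x) \<le> \<bar>b i\<bar> * norm h" by (simp add: mult.commute)
    qed
    also have "\<dots> \<le> K * norm h" by (simp add: K_def sum_distrib_right distrib_right)
    finally show "norm (frechet_derivative F (at x) h) \<le> K * norm h" .
  qed (use K in simp)
  have "norm (F x - F y) \<le> K * norm (x - y)" if "x \<in> closed_square" "y \<in> closed_square" for x y
    by (rule differentiable_bound[OF convex_box(1) has_derivative_at_withinI[OF F] on that])
  then show ?thesis using K by blast
qed

section \<open>Integration over the surface and pull-back to a patch\<close>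

locale multipatch =
  fixes N :: nat and F :: "nat \<Rightarrow> real^2 \<Rightarrow> real^3"
  assumes regular: "\<And>j. j < N \<Longrightarrow> regular_patch (F j)"
    and disjoint: "disjoint_family_on (\<lambda>j. F j ` open_square) {..<N}"
begin

abbreviation "\<sigma> \<equiv> surface_measure N F"

lemma patch_continuous: "j < N \<Longrightarrow> continuous_on closed_square (F j)"
  and jac_continuous: "j < N \<Longrightarrow> continuous_on closed_square (jac (F j))"
  using jac_smooth[OF regular, of j] by (meson Ck_on_continuous continuous_on_subset)+

lemma patch_measurable: "j < N \<Longrightarrow> F j \<in> borel_measurable square_measure"
  and jac_measurable: "j < N \<Longrightarrow> jac (F j) \<in> borel_measurable square_measure"
  using continuous_square_measurable patch_continuous jac_continuous by blast+

lemma jac_bounds: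
  "\<exists>c C. 0 < c \<and> 0 < C \<and> (\<forall>j<N. \<forall>x\<in>closed_square. c \<le> jac (F j) x \<and> jac (F j) x \<le> C)"
proof -
  have "\<exists>c C. 0 < c \<and> (\<forall>x\<in>closed_square. c \<le> jac (F j) x \<and> jac (F j) x \<le> C)" if j: "j < N" for j
  proof -
    have "0 \<in> closed_square" by (simp add: mem_box_cart)
    then have ne: "closed_square \<noteq> {}" by blast
    obtain a where a: "a \<in> closed_square" "\<forall>x\<in>closed_square. jac (F j) a \<le> jac (F j) x"
      using continuous_attains_inf[OF compact_cbox ne jac_continuous[OF j]] by blast
    obtain b where b: "\<forall>x\<in>closed_square. jac (F j) x \<le> jac (F j) b"
      using continuous_attains_sup[OF compact_cbox ne jac_continuous[OF j]] by blast
    have "jac (F j) a \<noteq> 0" using regular[OF j] a(1) by (auto simp: regular_patch_def)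
    moreover have "0 \<le> jac (F j) a" by (simp add: jac_def)
    ultimately have "0 < jac (F j) a" by simp
    then show ?thesis using a(2) b by blast
  qed
  then obtain c C where cC: "\<And>j. j < N \<Longrightarrow> 0 < c j \<and> (\<forall>x\<in>closed_square. c j \<le> jac (F j) x \<and> jac (F j) x \<le> C j)"
    by metis
  define c0 where "c0 = Min (insert 1 (c ` {..<N}))"
  define C0 where "C0 = 1 + (\<Sum>j<N. \<bar>C j\<bar>)"
  have c0: "0 < c0" unfolding c0_def using cC by (subst Min_gr_iff) auto
  have "0 < C0" by (simp add: C0_def add_pos_nonneg sum_nonneg)
  moreover have "c0 \<le> jac (F j) x \<and> jac (F j) x \<le> C0" if "j < N" "x \<in> closed_square" for j x
  proof -
    have "c0 \<le> c j" unfolding c0_def using that by (intro Min_le) auto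
    moreover have "\<bar>C j\<bar> \<le> (\<Sum>j<N. \<bar>C j\<bar>)" using that by (intro member_le_sum) auto
    ultimately show ?thesis using cC[OF that(1)] that(2) unfolding C0_def by fastforce
  qed
  ultimately show ?thesis using c0 by blast
qed

lemma surface_map_measurable:
  "(\<lambda>(j, x). F j x) \<in> borel_measurable (count_space {..<N} \<Otimes>\<^sub>M square_measure)"
  "(\<lambda>(j, x). jac (F j) x) \<in> borel_measurable (count_space {..<N} \<Otimes>\<^sub>M square_measure)"
  by (rule measurable_pair_measure_countable1; use patch_measurable jac_measurable in simp)+

lemma sets_surface [simp]: "sets \<sigma> = sets borel" and space_surface [simp]: "space \<sigma> = UNIV"
  by (simp_all add: surface_measure_def)

lemma surface_measurable_iff: "u \<in> borel_measurable \<sigma> \<longleftrightarrow> u \<in> borel_measurable borel"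
  by (rule measurable_cong_sets[THEN eq_reflection, THEN meta_eq_to_obj_eq, THEN arg_cong[where f="\<lambda>A. u \<in> A"]]) simp_all

lemma nn_integral_surface:
  assumes u: "u \<in> borel_measurable borel"
  shows "(\<integral>\<^sup>+y. u y \<partial>\<sigma>) = (\<Sum>j<N. \<integral>\<^sup>+x. ennreal (jac (F j) x) * u (F j x) \<partial>square_measure)"
proof -
  let ?P = "count_space {..<N} \<Otimes>\<^sub>M square_measure"
  note m [measurable] = surface_map_measurable
  have jm: "(\<lambda>(j, x). ennreal (jac (F j) x)) \<in> borel_measurable ?P"
    using measurable_compose[OF m(2) measurable_ennreal] by (simp add: case_prod_beta')
  have um: "(\<lambda>z. u (case z of (j, x) \<Rightarrow> F j x)) \<in> borel_measurable ?P"
    by (rule measurable_compose[OF m(1) u])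
  have "(\<integral>\<^sup>+y. u y \<partial>\<sigma>) = (\<integral>\<^sup>+z. u (case z of (j, x) \<Rightarrow> F j x) \<partial>density ?P (\<lambda>(j, x). ennreal (jac (F j) x)))"
    unfolding surface_measure_def using m(1) u by (subst nn_integral_distr) auto
  also have "\<dots> = (\<integral>\<^sup>+z. (case z of (j, x) \<Rightarrow> ennreal (jac (F j) x)) * u (case z of (j, x) \<Rightarrow> F j x) \<partial>?P)"
    by (rule nn_integral_density[OF jm um])
  also have "\<dots> = (\<integral>\<^sup>+j. \<integral>\<^sup>+x. ennreal (jac (F j) x) * u (F j x) \<partial>square_measure \<partial>count_space {..<N})"
    by (subst square.nn_integral_fst[symmetric]) (use jm um in auto)
  also have "\<dots> = (\<Sum>j<N. \<integral>\<^sup>+x. ennreal (jac (F j) x) * u (F j x) \<partial>square_measure)"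
    by (simp add: nn_integral_count_space_finite)
  finally show ?thesis .
qed

lemma surface_finite: "finite_measure \<sigma>"
proof
  obtain c C where C: "\<And>j x. j < N \<Longrightarrow> x \<in> closed_square \<Longrightarrow> jac (F j) x \<le> C" using jac_bounds by blast
  have "emeasure \<sigma> (space \<sigma>) = (\<integral>\<^sup>+y. 1 \<partial>\<sigma>)" by simp
  also have "\<dots> = (\<Sum>j<N. \<integral>\<^sup>+x. ennreal (jac (F j) x) * 1 \<partial>square_measure)" by (rule nn_integral_surface) simp
  also have "\<dots> \<le> (\<Sum>j<N. \<integral>\<^sup>+x. ennreal C \<partial>square_measure)"
    using C open_closed_square by (intro sum_mono nn_integral_mono) (auto intro!: ennreal_leI)
  also have "\<dots> < \<infinity>"
    by (simp add: ennreal_mult_eq_top_iff less_top[symmetric] ennreal_of_nat_eq_real_of_nat square.emeasure_eq_measure)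
  finally show "emeasure \<sigma> (space \<sigma>) \<noteq> \<infinity>" by simp
qed

lemma integral_surface:
  fixes g :: "real^3 \<Rightarrow> real"
  assumes g: "integrable \<sigma> g"
  shows "(LINT y|\<sigma>. g y) = (\<Sum>j<N. LINT x|square_measure. jac (F j) x * g (F j x))"
proof -
  let ?P = "count_space {..<N} \<Otimes>\<^sub>M square_measure"
  interpret cs: sigma_finite_measure "count_space {..<N}" by (rule sigma_finite_measure_count_space_finite) simp
  interpret cp: pair_sigma_finite "count_space {..<N}" square_measure ..
  note m = surface_map_measurable
  have gb: "g \<in> borel_measurable borel" using g surface_measurable_iff by blast
  have jm: "(\<lambda>z. case z of (j, x) \<Rightarrow> jac (F j) x) \<in> borel_measurable ?P" using m(2) by simp
  have gm: "(\<lambda>z. g (case z of (j, x) \<Rightarrow> F j x)) \<in> borel_measurable ?P" by (rule measurable_compose[OF m(1) gb])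
  have j0: "AE z in ?P. 0 \<le> (case z of (j, x) \<Rightarrow> jac (F j) x)" by (auto simp: jac_def)
  have ds: "density ?P (\<lambda>(j, x). ennreal (jac (F j) x)) = density ?P (\<lambda>z. ennreal (case z of (j, x) \<Rightarrow> jac (F j) x))"
    by (simp add: case_prod_beta')
  have Fm: "(\<lambda>(j, x). F j x) \<in> measurable (density ?P (\<lambda>z. ennreal (case z of (j, x) \<Rightarrow> jac (F j) x))) borel"
    using m(1) by simp
  have "integrable (density ?P (\<lambda>z. ennreal (case z of (j, x) \<Rightarrow> jac (F j) x))) (\<lambda>z. g (case z of (j, x) \<Rightarrow> F j x))"
    using g unfolding surface_measure_def ds integrable_distr_eq[OF Fm gb] .
  then have i: "integrable ?P (\<lambda>z. (case z of (j, x) \<Rightarrow> jac (F j) x) *\<^sub>R g (case z of (j, x) \<Rightarrow> F j x))"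
    by (subst (asm) integrable_density[OF gm jm j0])
  have "(LINT y|\<sigma>. g y) = (LINT z|?P. (case z of (j, x) \<Rightarrow> jac (F j) x) *\<^sub>R g (case z of (j, x) \<Rightarrow> F j x))"
    unfolding surface_measure_def ds integral_distr[OF Fm gb] by (rule integral_density[OF gm jm j0])
  also have "\<dots> = (LINT j|count_space {..<N}. LINT x|square_measure. jac (F j) x * g (F j x))"
    using cp.integral_fst'[OF i] by simp
  also have "\<dots> = (\<Sum>j<N. LINT x|square_measure. jac (F j) x * g (F j x))"
    by (rule lebesgue_integral_count_space_finite) simp
  finally show ?thesis .
qed

text \<open>All patches but one are discarded from the surface integral, and the surface density is
  replaced by its lower bound \<open>c\<close>.\<close>

lemma L2_pullback:
  assumes c: "0 < c" "\<And>j x. j < N \<Longrightarrow> x \<in> closed_square \<Longrightarrow> c \<le> jac (F j) x"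
    and u: "u \<in> L2 \<sigma>" and j: "j < N"
  shows "(\<lambda>x. u (F j x)) \<in> L2 square_measure" "l2_norm square_measure (\<lambda>x. u (F j x)) \<le> l2_norm \<sigma> u / sqrt c"
proof -
  have ub: "u \<in> borel_measurable borel" using u surface_measurable_iff by (auto simp: L2_def)
  have um: "(\<lambda>x. u (F j x)) \<in> borel_measurable square_measure"
    by (rule measurable_compose[OF patch_measurable[OF j] ub])
  have u2: "(\<lambda>y. ennreal ((u y)\<^sup>2)) \<in> borel_measurable borel" using ub by simp
  have "ennreal c * (\<integral>\<^sup>+x. ennreal ((u (F j x))\<^sup>2) \<partial>square_measure) = (\<integral>\<^sup>+x. ennreal c * ennreal ((u (F j x))\<^sup>2) \<partial>square_measure)"
    using um by (intro nn_integral_cmult[symmetric]) auto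
  also have "\<dots> \<le> (\<integral>\<^sup>+x. ennreal (jac (F j) x) * ennreal ((u (F j x))\<^sup>2) \<partial>square_measure)"
    using c(2)[OF j] open_closed_square by (intro nn_integral_mono mult_right_mono) (auto intro!: ennreal_leI)
  also have "\<dots> \<le> (\<Sum>j<N. \<integral>\<^sup>+x. ennreal (jac (F j) x) * ennreal ((u (F j x))\<^sup>2) \<partial>square_measure)"
    using j by (intro member_le_sum) auto
  also have "\<dots> = (\<integral>\<^sup>+y. ennreal ((u y)\<^sup>2) \<partial>\<sigma>)" by (rule nn_integral_surface[OF u2, symmetric])
  also have "\<dots> = ennreal ((l2_norm \<sigma> u)\<^sup>2)"
    using nn_integral_eq_integral[OF L2_integrable_square[OF u]]
    unfolding l2_norm_square by (simp add: l2_inner_def power2_eq_square)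
  finally have "ennreal (1 / c) * (ennreal c * (\<integral>\<^sup>+x. ennreal ((u (F j x))\<^sup>2) \<partial>square_measure))
      \<le> ennreal (1 / c) * ennreal ((l2_norm \<sigma> u)\<^sup>2)" by (rule mult_left_mono) simp
  then have le: "(\<integral>\<^sup>+x. ennreal ((u (F j x))\<^sup>2) \<partial>square_measure) \<le> ennreal ((l2_norm \<sigma> u / sqrt c)\<^sup>2)"
    using c(1) by (simp add: mult.assoc[symmetric] ennreal_mult[symmetric] power_divide)
  have nn: "0 \<le> l2_norm \<sigma> u / sqrt c" using c by (simp add: l2_norm_nonneg)
  show "(\<lambda>x. u (F j x)) \<in> L2 square_measure" "l2_norm square_measure (\<lambda>x. u (F j x)) \<le> l2_norm \<sigma> u / sqrt c"
    using L2_if_nn_integral_le[OF um nn le] by auto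
qed

text \<open>For order \<open>1/2\<close> the denominator is the third power of the distance, which
  gives \<open>K ^ 3\<close>. The lower bound \<open>c\<close> of the density enters once for each
  of the two integrations, and pairs involving other patches are discarded.\<close>

lemma slobodeckij_pullback:
  assumes c: "0 < c" "\<And>j x. j < N \<Longrightarrow> x \<in> closed_square \<Longrightarrow> c \<le> jac (F j) x"
    and K: "1 \<le> K" "\<And>x y. x \<in> closed_square \<Longrightarrow> y \<in> closed_square \<Longrightarrow> norm (F j x - F j y) \<le> K * norm (x - y)"
    and u: "u \<in> borel_measurable borel" and j: "j < N"
  shows "slobodeckij square_measure (1/2) (\<lambda>x. u (F j x)) \<le> ennreal (K ^ 3 / c\<^sup>2) * slobodeckij \<sigma> (1/2) u"
proof -
  define r :: real where "r = 2 + 2 * (1/2)"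
  define Q where "Q y y' = ennreal ((u y - u y')\<^sup>2 / norm (y - y') powr r)" for y y'
  have Qm: "Q y \<in> borel_measurable borel" for y
    using slobodeckij_section_measurable[OF surface_finite sets_surface u, of y r]
    by (simp add: Q_def[abs_def] surface_measurable_iff)
  have Im: "(\<lambda>y. \<integral>\<^sup>+y'. Q y y' \<partial>\<sigma>) \<in> borel_measurable borel"
    using slobodeckij_outer_measurable[OF surface_finite sets_surface u, of r] by (simp add: Q_def surface_measurable_iff)
  have patch: "ennreal c * (\<integral>\<^sup>+x. f (F j x) \<partial>square_measure) \<le> (\<integral>\<^sup>+y. f y \<partial>\<sigma>)"
    if f: "f \<in> borel_measurable borel" for f
  proof -
    have "ennreal c * (\<integral>\<^sup>+x. f (F j x) \<partial>square_measure) = (\<integral>\<^sup>+x. ennreal c * f (F j x) \<partial>square_measure)"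
      by (intro nn_integral_cmult[symmetric] measurable_compose[OF patch_measurable[OF j] f])
    also have "\<dots> \<le> (\<integral>\<^sup>+x. ennreal (jac (F j) x) * f (F j x) \<partial>square_measure)"
      using c(2)[OF j] open_closed_square by (intro nn_integral_mono mult_right_mono) (auto intro!: ennreal_leI)
    also have "\<dots> \<le> (\<Sum>j<N. \<integral>\<^sup>+x. ennreal (jac (F j) x) * f (F j x) \<partial>square_measure)"
      using j by (intro member_le_sum) auto
    also have "\<dots> = (\<integral>\<^sup>+y. f y \<partial>\<sigma>)" by (rule nn_integral_surface[OF f, symmetric])
    finally show ?thesis .
  qed
  have q: "ennreal ((u (F j x) - u (F j x'))\<^sup>2 / norm (x - x') powr (2 + 2 * (1/2))) \<le> ennreal (K ^ 3) * Q (F j x) (F j x')"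
    if x: "x \<in> open_square" "x' \<in> open_square" for x x'
  proof (cases "x = x'")
    case False
    have xc: "x \<in> closed_square" "x' \<in> closed_square" using x box_subset_cbox by blast+
    have "F j x \<noteq> F j x'" using regular[OF j] False xc by (auto simp: regular_patch_def inj_on_def)
    then have p: "0 < norm (F j x - F j x')" "0 < norm (x - x')" using False by auto
    have pw: "t powr (2 + 2 * (1/2)) = t ^ 3" if "0 < t" for t :: real using powr_realpow[OF that, of 3] by simp
    have "norm (F j x - F j x') ^ 3 \<le> (K * norm (x - x')) ^ 3" using K(2)[OF xc] by (intro power_mono) auto
    then have "1 / norm (x - x') ^ 3 \<le> K ^ 3 / norm (F j x - F j x') ^ 3"
      using p by (simp add: field_simps power_mult_distrib)
    then have "(u (F j x) - u (F j x'))\<^sup>2 * (1 / norm (x - x') ^ 3) \<le> (u (F j x) - u (F j x'))\<^sup>2 * (K ^ 3 / norm (F j x - F j x') ^ 3)"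
      by (intro mult_left_mono) auto
    then show ?thesis unfolding Q_def r_def pw[OF p(1)] pw[OF p(2)] using K(1)
      by (subst ennreal_mult[symmetric]) (auto intro!: ennreal_leI simp: mult.commute)
  qed simp
  have QmF: "(\<lambda>x'. Q y (F j x')) \<in> borel_measurable square_measure" for y
    by (rule measurable_compose[OF patch_measurable[OF j] Qm])
  have ImF: "(\<lambda>x. \<integral>\<^sup>+y'. Q (F j x) y' \<partial>\<sigma>) \<in> borel_measurable square_measure"
    by (rule measurable_compose[OF patch_measurable[OF j] Im])
  have inv: "ennreal (1 / c) * (ennreal c * t) = t" for t
    using c(1) by (simp add: mult.assoc[symmetric] ennreal_mult[symmetric])
  have "slobodeckij square_measure (1/2) (\<lambda>x. u (F j x))
      \<le> (\<integral>\<^sup>+x. \<integral>\<^sup>+x'. ennreal (K ^ 3) * Q (F j x) (F j x') \<partial>square_measure \<partial>square_measure)"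
    unfolding slobodeckij_def by (intro nn_integral_mono q) auto
  also have "\<dots> = (\<integral>\<^sup>+x. ennreal (K ^ 3) * (ennreal (1 / c) * (ennreal c * (\<integral>\<^sup>+x'. Q (F j x) (F j x') \<partial>square_measure))) \<partial>square_measure)"
    unfolding inv by (intro nn_integral_cong nn_integral_cmult QmF)
  also have "\<dots> \<le> (\<integral>\<^sup>+x. ennreal (K ^ 3) * (ennreal (1 / c) * (\<integral>\<^sup>+y'. Q (F j x) y' \<partial>\<sigma>)) \<partial>square_measure)"
    by (intro nn_integral_mono mult_left_mono patch Qm) auto
  also have "\<dots> = ennreal (K ^ 3) * (ennreal (1 / c) * (ennreal (1 / c) * (ennreal c * (\<integral>\<^sup>+x. \<integral>\<^sup>+y'. Q (F j x) y' \<partial>\<sigma> \<partial>square_measure))))"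
    unfolding inv using ImF by (simp add: nn_integral_cmult)
  also have "\<dots> \<le> ennreal (K ^ 3) * (ennreal (1 / c) * (ennreal (1 / c) * (\<integral>\<^sup>+y. \<integral>\<^sup>+y'. Q y y' \<partial>\<sigma> \<partial>\<sigma>)))"
    by (intro mult_left_mono patch[OF Im]) auto
  also have "\<dots> = ennreal (K ^ 3 / c\<^sup>2) * slobodeckij \<sigma> (1/2) u"
    using c(1) K(1) by (simp add: slobodeckij_def Q_def r_def mult.assoc[symmetric] ennreal_mult[symmetric] power2_eq_square)
  finally show ?thesis .
qed

section \<open>The space of order \<open>1/2\<close> on the surface and its dual\<close>

lemma H_half_measurable: "u \<in> H_half N F \<Longrightarrow> u \<in> borel_measurable borel"
  using surface_measurable_iff by (auto simp: H_half_def L2_def)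

lemma H_half_norm_square:
  "(H_half_norm N F u)\<^sup>2 = l2_inner \<sigma> u u + enn2real (slobodeckij \<sigma> (1/2) u)"
  unfolding H_half_norm_def by (simp add: l2_inner_def power2_eq_square)

sublocale H_half: parallelogram_seminorm "H_half N F" "H_half_norm N F"
proof
  note sp = slobodeckij_parallelogram[OF surface_finite sets_surface] and ss = slobodeckij_scale[OF surface_finite sets_surface]
  show "(\<lambda>x. 0) \<in> H_half N F" by (simp add: H_half_def L2_zero slobodeckij_def)
  have scale: "(\<lambda>x. a * u x) \<in> H_half N F" if "u \<in> H_half N F" for a u
    using that ss[OF H_half_measurable[OF that]] by (auto simp: H_half_def ennreal_mult_less_top intro: L2_cmult)
  have add: "(\<lambda>x. u x + v x) \<in> H_half N F" if uv: "u \<in> H_half N F" "v \<in> H_half N F" for u v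
  proof -
    have "slobodeckij \<sigma> (1/2) (\<lambda>x. u x + v x) \<le> slobodeckij \<sigma> (1/2) (\<lambda>x. u x + v x) + slobodeckij \<sigma> (1/2) (\<lambda>x. u x - v x)"
      by simp
    also have "\<dots> = 2 * slobodeckij \<sigma> (1/2) u + 2 * slobodeckij \<sigma> (1/2) v"
      by (rule sp[OF H_half_measurable[OF uv(1)] H_half_measurable[OF uv(2)]])
    also have "\<dots> < \<infinity>" using uv by (auto simp: H_half_def ennreal_mult_less_top)
    finally show ?thesis using uv by (auto simp: H_half_def L2_add)
  qed
  show "(\<lambda>x. a * u x + b * v x) \<in> H_half N F" if "u \<in> H_half N F" "v \<in> H_half N F" for u v a b
    using add[OF scale[OF that(1)] scale[OF that(2)]] .
  show nn: "0 \<le> H_half_norm N F u" for u by (simp add: H_half_norm_def)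
  show "H_half_norm N F (\<lambda>x. a * u x) = \<bar>a\<bar> * H_half_norm N F u" if "u \<in> H_half N F" for u a
  proof (rule power2_eq_imp_eq)
    show "(H_half_norm N F (\<lambda>x. a * u x))\<^sup>2 = (\<bar>a\<bar> * H_half_norm N F u)\<^sup>2"
      unfolding power_mult_distrib H_half_norm_square ss[OF H_half_measurable[OF that]]
      by (simp add: l2_inner_cmult_left l2_inner_cmult_right enn2real_mult power2_eq_square algebra_simps)
  qed (simp_all add: nn)
  show "(H_half_norm N F (\<lambda>x. u x + v x))\<^sup>2 + (H_half_norm N F (\<lambda>x. u x - v x))\<^sup>2
      = 2 * (H_half_norm N F u)\<^sup>2 + 2 * (H_half_norm N F v)\<^sup>2"
    if uv: "u \<in> H_half N F" "v \<in> H_half N F" for u v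
  proof -
    have L: "u \<in> L2 \<sigma>" "v \<in> L2 \<sigma>" using uv by (auto simp: H_half_def)
    have dif: "(\<lambda>x. u x - v x) \<in> H_half N F" using add[OF uv(1) scale[OF uv(2), of "-1"]] by simp
    have fin: "slobodeckij \<sigma> (1/2) w \<noteq> top" if "w \<in> H_half N F" for w
      using that by (auto simp: H_half_def less_top)
    have "enn2real (slobodeckij \<sigma> (1/2) (\<lambda>x. u x + v x)) + enn2real (slobodeckij \<sigma> (1/2) (\<lambda>x. u x - v x))
        = enn2real (2 * slobodeckij \<sigma> (1/2) u + 2 * slobodeckij \<sigma> (1/2) v)"
      using fin[OF add[OF uv]] fin[OF dif] sp[OF H_half_measurable[OF uv(1)] H_half_measurable[OF uv(2)], of "1/2"]
      by (simp add: enn2real_plus[symmetric] less_top)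
    also have "\<dots> = 2 * enn2real (slobodeckij \<sigma> (1/2) u) + 2 * enn2real (slobodeckij \<sigma> (1/2) v)"
      using fin[OF uv(1)] fin[OF uv(2)] by (simp add: enn2real_plus enn2real_mult ennreal_mult_less_top less_top)
    finally show ?thesis unfolding H_half_norm_square
      using L by (simp add: l2_inner_add_left l2_inner_add_right l2_inner_diff_left l2_inner_diff_right L2_add L2_diff)
  qed
qed

lemma H_mhalf_eq: "H_mhalf N F = dual_space (H_half N F) (H_half_norm N F)"
  by (simp add: H_mhalf_def dual_space_def)

lemma H_mhalf_norm_eq: "H_mhalf_norm N F = dual_norm (H_half N F) (H_half_norm N F)"
  by (simp add: H_mhalf_norm_def dual_norm_def fun_eq_iff)

lemma H_mhalf_inner_eq: "H_mhalf_inner N F = H_half.dinner"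
  by (simp add: H_mhalf_inner_def H_half.dinner_def fun_eq_iff H_mhalf_norm_eq)

lemma l2_norm_le_H_half_norm: "l2_norm \<sigma> u \<le> H_half_norm N F u"
  unfolding l2_norm_def H_half_norm_def by (auto simp: l2_inner_def power2_eq_square)

lemma L2_functional_in_H_mhalf:
  assumes g: "g \<in> L2 \<sigma>" shows "L2_functional N F g \<in> H_mhalf N F"
proof -
  have L: "u \<in> L2 \<sigma>" if "u \<in> H_half N F" for u using that by (simp add: H_half_def)
  have "L2_functional N F g (\<lambda>x. a * u x + b * v x) = a * L2_functional N F g u + b * L2_functional N F g v"
    if uv: "u \<in> H_half N F" "v \<in> H_half N F" for a b u v
    using L2_integrable_mult[OF g L[OF uv(1)]] L2_integrable_mult[OF g L[OF uv(2)]] H_half.X_lin[OF uv] uv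
    by (simp add: L2_functional_def algebra_simps)
  moreover have "\<bar>L2_functional N F g u\<bar> \<le> l2_norm \<sigma> g * H_half_norm N F u" if u: "u \<in> H_half N F" for u
  proof -
    have "\<bar>L2_functional N F g u\<bar> \<le> l2_norm \<sigma> g * l2_norm \<sigma> u"
      using l2_Cauchy_Schwarz[OF g L[OF u]] u by (simp add: L2_functional_def l2_inner_def)
    also have "\<dots> \<le> l2_norm \<sigma> g * H_half_norm N F u"
      by (intro mult_left_mono l2_norm_le_H_half_norm l2_norm_nonneg)
    finally show ?thesis .
  qed
  then have "\<exists>C. \<forall>u\<in>H_half N F. \<bar>L2_functional N F g u\<bar> \<le> C * H_half_norm N F u" by blast
  moreover have "\<forall>u. u \<notin> H_half N F \<longrightarrow> L2_functional N F g u = 0" by (simp add: L2_functional_def)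
  ultimately show ?thesis unfolding H_mhalf_def by blast
qed

end

section \<open>Splines on multipatch surfaces\<close>

lemma mesh_size_bounds:
  assumes N: "0 < N" and \<Xi>: "\<And>j i. j < N \<Longrightarrow> open_knot_vector (p j i) (\<Xi> j i)"
  shows "0 < mesh_size N \<Xi>" "mesh_size N \<Xi> \<le> 1"
    "\<And>j i m. j < N \<Longrightarrow> m + 1 < length (\<Xi> j i) \<Longrightarrow> \<Xi> j i ! (m + 1) - \<Xi> j i ! m \<le> mesh_size N \<Xi>"
proof -
  let ?D = "{\<Xi> j i ! (m + 1) - \<Xi> j i ! m | j i m. j < N \<and> m + 1 < length (\<Xi> j i)}"
  have "?D = (\<Union>j\<in>{..<N}. \<Union>i\<in>UNIV. (\<lambda>m. \<Xi> j i ! (m + 1) - \<Xi> j i ! m) ` {m. m + 1 < length (\<Xi> j i)})" by blast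
  moreover have "finite {m. m + 1 < l}" for l :: nat by (rule finite_subset[of _ "{..<l}"]) auto
  ultimately have fin: "finite ?D" by auto
  have le: "\<Xi> j i ! (m + 1) - \<Xi> j i ! m \<le> mesh_size N \<Xi>" if "j < N" "m + 1 < length (\<Xi> j i)" for j i m
    unfolding mesh_size_def using that by (intro Max_ge[OF fin]) blast
  obtain k where k: "1 \<le> p 0 1" "p 0 1 < k" "length (\<Xi> 0 1) = k + p 0 1 + 1" "\<Xi> 0 1 ! p 0 1 < \<Xi> 0 1 ! (p 0 1 + 1)"
    using \<Xi>[OF N, of 1] unfolding open_knot_vector_def by blast
  have "0 < \<Xi> 0 1 ! (p 0 1 + 1) - \<Xi> 0 1 ! p 0 1" using k by simp
  also have "\<dots> \<le> mesh_size N \<Xi>" using le[OF N, of "p 0 1" 1] k by simp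
  finally show "0 < mesh_size N \<Xi>" .
  have ne: "?D \<noteq> {}" using N k by (auto intro!: exI[of _ "0 :: nat"] exI[of _ "1 :: 2"])
  show "mesh_size N \<Xi> \<le> 1" unfolding mesh_size_def
  proof (subst Max_le_iff[OF fin ne], safe)
    fix j i m assume jm: "j < N" "m + 1 < length (\<Xi> j i)"
    obtain k where k: "length (\<Xi> j i) = k + p j i + 1" "sorted (\<Xi> j i)" "\<forall>l\<le>p j i. \<Xi> j i ! l = 0"
      "\<forall>l\<in>{k..k + p j i}. \<Xi> j i ! l = 1"
      using \<Xi>[OF jm(1), of i] unfolding open_knot_vector_def by blast
    have "\<Xi> j i ! 0 \<le> \<Xi> j i ! m" by (rule sorted_nth_mono[OF k(2)]) (use jm in simp_all)
    moreover have "\<Xi> j i ! (m + 1) \<le> \<Xi> j i ! (k + p j i)"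
      by (rule sorted_nth_mono[OF k(2)]) (use jm k(1) in simp_all)
    moreover have "\<Xi> j i ! 0 = 0" "\<Xi> j i ! (k + p j i) = 1" using k by auto
    ultimately show "\<Xi> j i ! (m + 1) - \<Xi> j i ! m \<le> 1" by linarith
  qed
  show "\<And>j i m. j < N \<Longrightarrow> m + 1 < length (\<Xi> j i) \<Longrightarrow> \<Xi> j i ! (m + 1) - \<Xi> j i ! m \<le> mesh_size N \<Xi>" by (rule le)
qed

section \<open>Tensor-product B-splines\<close>

definition tensor_bspline :: "(2 \<Rightarrow> nat) \<Rightarrow> (2 \<Rightarrow> real list) \<Rightarrow> nat \<times> nat \<Rightarrow> real^2 \<Rightarrow> real" where
  "tensor_bspline q T = (\<lambda>(a, b) z. bspline (T 1) (q 1) a (z $ 1) * bspline (T 2) (q 2) b (z $ 2))"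

definition tensor_index :: "(2 \<Rightarrow> nat) \<Rightarrow> (2 \<Rightarrow> real list) \<Rightarrow> (nat \<times> nat) set" where
  "tensor_index q T = {..<length (T 1) - q 1 - 1} \<times> {..<length (T 2) - q 2 - 1}"

lemma finite_tensor_index [simp]: "finite (tensor_index q T)"
  by (simp add: tensor_index_def)

lemma tensor_spline_space_iff:
  "w \<in> tensor_spline_space (q 1) (q 2) (T 1) (T 2) \<longleftrightarrow>
    (\<exists>c. w = (\<lambda>z. \<Sum>k\<in>tensor_index q T. c k * tensor_bspline q T k z))"
proof -
  have eq: "(\<Sum>k\<in>tensor_index q T. c k * tensor_bspline q T k z) =
      (\<Sum>i<spline_dim (q 1) (T 1). \<Sum>j<spline_dim (q 2) (T 2). c (i, j) * (bspline (T 1) (q 1) i (z $ 1) * bspline (T 2) (q 2) j (z $ 2)))" for c z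
    by (simp add: tensor_index_def tensor_bspline_def spline_dim_def sum.cartesian_product case_prod_beta')
  show ?thesis unfolding tensor_spline_space_def mem_Collect_eq eq
  proof safe
    fix c :: "nat \<Rightarrow> nat \<Rightarrow> real"
    show "\<exists>c'. (\<lambda>x. \<Sum>i<spline_dim (q 1) (T 1). \<Sum>j<spline_dim (q 2) (T 2). c i j * (bspline (T 1) (q 1) i (x $ 1) * bspline (T 2) (q 2) j (x $ 2)))
      = (\<lambda>z. \<Sum>i<spline_dim (q 1) (T 1). \<Sum>j<spline_dim (q 2) (T 2). c' (i, j) * (bspline (T 1) (q 1) i (z $ 1) * bspline (T 2) (q 2) j (z $ 2)))"
      by (rule exI[of _ "\<lambda>(i, j). c i j"]) simp
  next
    fix c :: "nat \<times> nat \<Rightarrow> real"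
    show "\<exists>c'. (\<lambda>z. \<Sum>i<spline_dim (q 1) (T 1). \<Sum>j<spline_dim (q 2) (T 2). c (i, j) * (bspline (T 1) (q 1) i (z $ 1) * bspline (T 2) (q 2) j (z $ 2)))
      = (\<lambda>x. \<Sum>i<spline_dim (q 1) (T 1). \<Sum>j<spline_dim (q 2) (T 2). c' i j * (bspline (T 1) (q 1) i (x $ 1) * bspline (T 2) (q 2) j (x $ 2)))"
      by (rule exI[of _ "\<lambda>i j. c (i, j)"]) simp
  qed
qed

lemma tensor_bspline_measurable: "tensor_bspline q T k \<in> borel_measurable borel"
proof -
  have nth: "(\<lambda>z :: real^2. z $ i) \<in> borel_measurable borel" for i
    by (intro borel_measurable_continuous_onI continuous_intros)
  show ?thesis unfolding tensor_bspline_def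
    using measurable_compose[OF nth bspline_measurable] by (cases k) auto
qed

lemma tensor_bspline_bounded:
  assumes "\<And>i. open_knots (q i) (T i)" "k \<in> tensor_index q T"
  shows "\<exists>C. \<forall>z. \<bar>tensor_bspline q T k z\<bar> \<le> C"
proof -
  obtain a b where k: "k = (a, b)" "a + q 1 + 1 < length (T 1)" "b + q 2 + 1 < length (T 2)"
    using assms by (cases k) (auto simp: tensor_index_def)
  have s: "sorted (T i)" for i using assms(1) by (simp add: open_knots_def)
  obtain C D where "\<And>x. \<bar>bspline (T 1) (q 1) a x\<bar> \<le> C" "\<And>x. \<bar>bspline (T 2) (q 2) b x\<bar> \<le> D"
    using bspline_bounded[OF s k(2)] bspline_bounded[OF s k(3)] by blast
  then have "\<bar>tensor_bspline q T k z\<bar> \<le> C * D" for z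
    unfolding tensor_bspline_def k abs_mult prod.case
    by (intro mult_mono order.trans[OF abs_ge_zero]) auto
  then show ?thesis by blast
qed

lemma tensor_bspline_L2:
  assumes "\<And>i. open_knots (q i) (T i)" "k \<in> tensor_index q T"
  shows "tensor_bspline q T k \<in> L2 square_measure"
proof -
  obtain C where "\<forall>z. \<bar>tensor_bspline q T k z\<bar> \<le> C" using tensor_bspline_bounded[OF assms] by blast
  then show ?thesis
    by (intro square.L2_boundedI[of _ C] measurable_square_measure tensor_bspline_measurable) auto
qed

section \<open>Functions on the surface assembled from patches\<close>

context multipatch
begin

text \<open>By injectivity the image of the open square is a difference of two compact images, that
  of the closed square and that of its boundary.\<close>

lemma patch_image_borel:
  assumes j: "j < N" shows "F j ` open_square \<in> sets borel"
proof -
  have inj: "inj_on (F j) closed_square" using regular[OF j] by (simp add: regular_patch_def)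
  have c: "compact (F j ` S)" if "S \<subseteq> closed_square" "closed S" for S
  proof (rule compact_continuous_image)
    show "continuous_on S (F j)" using patch_continuous[OF j] that(1) by (rule continuous_on_subset)
    show "compact S" using compact_Int_closed[OF compact_cbox that(2), of 0 "1 :: real^2"] that(1) by (simp add: inf.absorb2)
  qed
  have "open_square = closed_square - (closed_square - open_square)" using box_subset_cbox[of 0 "1 :: real^2"] by blast
  then have "F j ` open_square = F j ` closed_square - F j ` (closed_square - open_square)"
    using inj_on_image_set_diff[OF inj, of closed_square "closed_square - open_square"] by (metis Diff_subset order.refl)
  moreover have "compact (F j ` closed_square)" "compact (F j ` (closed_square - open_square))"
    using c closed_Diff[OF closed_cbox open_box] by auto
  ultimately show ?thesis by (auto intro: borel_closed compact_imp_closed)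
qed

text \<open>The images of the open squares are disjoint, so the values on different patches may be
  prescribed independently. Division by \<open>jac\<close> is harmless because of its positive lower
  bound.\<close>

lemma glue_patches:
  assumes w: "\<And>j. j < N \<Longrightarrow> w j \<in> borel_measurable borel" "\<And>j z. j < N \<Longrightarrow> \<bar>w j z\<bar> \<le> W j"
  shows "\<exists>g\<in>L2 \<sigma>. \<forall>j<N. \<forall>x\<in>open_square. jac (F j) x * g (F j x) = w j x"
proof -
  obtain c where c: "0 < c" "\<And>j x. j < N \<Longrightarrow> x \<in> closed_square \<Longrightarrow> c \<le> jac (F j) x" using jac_bounds by blast
  define \<psi> where "\<psi> j x = indicator open_square x * (w j x / jac (F j) x)" for j x
  define G where "G j = the_inv_into closed_square (F j)" for j
  \<comment> \<open>The inverse chart, extended by the default 0 off the open patch. The corner 0 is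
    not in the open square, so \<open>\<psi> j\<close> vanishes there and other patches contribute
    nothing to \<open>g\<close>.\<close>
  define \<gamma> where "\<gamma> j y = indicator (F j ` open_square) y *\<^sub>R G j y" for j y
  define g where "g y = (\<Sum>j<N. \<psi> j (\<gamma> j y))" for y
  have inj: "inj_on (F j) closed_square" if "j < N" for j using regular[OF that] by (simp add: regular_patch_def)
  have \<psi>m: "\<psi> j \<in> borel_measurable borel" if j: "j < N" for j
  proof -
    have "(\<lambda>x. w j x / jac (F j) x) \<in> borel_measurable square_measure"
      by (intro borel_measurable_divide measurable_square_measure w jac_measurable j)
    then have "(\<lambda>x. w j x / jac (F j) x) \<in> borel_measurable (restrict_space borel open_square)"
      unfolding square_measure_def
      by (subst (asm) measurable_cong_sets[OF sets_restrict_space_cong[OF sets_lborel] refl])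
    then show ?thesis unfolding \<psi>_def
      by (subst (asm) borel_measurable_restrict_space_iff) (simp_all add: mult.commute)
  qed
  have \<gamma>m: "\<gamma> j \<in> borel_measurable borel" if j: "j < N" for j
    unfolding \<gamma>_def
  proof (rule borel_measurable_continuous_on_indicator[OF patch_image_borel[OF j]])
    have "continuous_on (F j ` closed_square) (G j)"
      unfolding G_def by (rule continuous_on_inv_into[OF patch_continuous[OF j] compact_cbox inj[OF j]])
    then show "continuous_on (F j ` open_square) (G j)"
      by (rule continuous_on_subset) (use box_subset_cbox in blast)
  qed
  have \<psi>b: "\<bar>\<psi> j x\<bar> \<le> W j / c" if j: "j < N" for j x
  proof (cases "x \<in> open_square")
    case True
    have "\<bar>w j x\<bar> / jac (F j) x \<le> W j / c"
      using c(2)[OF j open_closed_square[OF True]] c(1) w(2)[OF j, of x] by (intro frac_le) auto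
    then show ?thesis using True by (simp add: \<psi>_def abs_divide jac_def)
  next
    case False
    then show ?thesis using c(1) order.trans[OF abs_ge_zero w(2)[OF j]] by (simp add: \<psi>_def)
  qed
  have gm: "g \<in> borel_measurable borel"
    unfolding g_def by (intro borel_measurable_sum) (use measurable_compose[OF \<gamma>m \<psi>m] in auto)
  interpret s: finite_measure \<sigma> by (rule surface_finite)
  have "g \<in> L2 \<sigma>"
  proof (rule s.L2_boundedI[of _ "\<Sum>j<N. W j / c"])
    show "g \<in> borel_measurable \<sigma>" using gm by (simp add: surface_measurable_iff)
    have "\<bar>g y\<bar> \<le> (\<Sum>j<N. W j / c)" for y
      unfolding g_def by (rule order.trans[OF sum_abs sum_mono]) (use \<psi>b in auto)
    then show "AE y in \<sigma>. \<bar>g y\<bar> \<le> (\<Sum>j<N. W j / c)" by simp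
  qed
  moreover have "jac (F j) x * g (F j x) = w j x" if j: "j < N" and x: "x \<in> open_square" for j x
  proof -
    have xc: "x \<in> closed_square" by (rule open_closed_square[OF x])
    have z: "\<psi> k 0 = 0" for k by (simp add: \<psi>_def mem_box_cart)
    have "\<psi> k (\<gamma> k (F j x)) = 0" if "k < N" "k \<noteq> j" for k
    proof -
      have "F j x \<notin> F k ` open_square"
        using disjoint j x that unfolding disjoint_family_on_def by blast
      then show ?thesis by (simp add: \<gamma>_def z)
    qed
    then have "g (F j x) = (\<Sum>k<N. if k = j then \<psi> j (\<gamma> j (F j x)) else 0)"
      unfolding g_def by (intro sum.cong) auto
    also have "\<dots> = \<psi> j (\<gamma> j (F j x))" using j by simp
    also have "\<gamma> j (F j x) = x" using x xc inj[OF j] by (simp add: \<gamma>_def G_def the_inv_into_f_f)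
    finally have "g (F j x) = w j x / jac (F j) x" using x by (simp add: \<psi>_def)
    moreover have "jac (F j) x \<noteq> 0" using c(1) c(2)[OF j xc] by auto
    ultimately show ?thesis by simp
  qed
  ultimately show ?thesis by blast
qed

text \<open>The surface density is precisely the weight in the definition of the spline space, so
  the pairing on the surface is the unweighted pairing of weighted pull-backs with pulled-back test
  functions.\<close>

lemma L2_functional_patches:
  assumes g: "g \<in> L2 \<sigma>" and u: "u \<in> H_half N F"
  shows "L2_functional N F g u = (\<Sum>j<N. l2_inner square_measure (\<lambda>x. jac (F j) x * g (F j x)) (\<lambda>x. u (F j x)))"
proof -
  have uL: "u \<in> L2 \<sigma>" using u by (simp add: H_half_def)
  show ?thesis
    using integral_surface[OF L2_integrable_mult[OF g uL]] u
    by (simp add: L2_functional_def l2_inner_def mult.assoc)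
qed

end

section \<open>The spline space as the span of finitely many functionals\<close>

locale multipatch_splines = multipatch +
  fixes p :: "nat \<Rightarrow> 2 \<Rightarrow> nat" and \<Xi> :: "nat \<Rightarrow> 2 \<Rightarrow> real list"
  assumes N: "0 < N" and knots: "\<And>j i. j < N \<Longrightarrow> open_knot_vector (p j i) (\<Xi> j i)"
begin

definition "q j i = p j i - 1"

definition "T j i = drop_end_knots (\<Xi> j i)"

abbreviation "index j \<equiv> tensor_index (q j) (T j)"
abbreviation "tens j \<equiv> tensor_bspline (q j) (T j)"

lemma T_open: "j < N \<Longrightarrow> open_knots (q j i) (T j i)"
  unfolding q_def T_def by (rule open_knot_vector_drop_end(1)[OF knots])

lemma T_within: "j < N \<Longrightarrow> knots_within (mesh_size N \<Xi>) (T j i)"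
  unfolding knots_within_def
proof (intro allI impI)
  fix x :: real assume j: "j < N" and x: "0 < x" "x < 1"
  obtain m where m: "m + 1 < length (\<Xi> j i)" "\<Xi> j i ! m \<in> set (drop_end_knots (\<Xi> j i))"
    "\<Xi> j i ! m \<le> x" "x < \<Xi> j i ! (m + 1)"
    using open_knot_vector_drop_end(2)[OF knots[OF j] x] by blast
  have "\<Xi> j i ! (m + 1) - \<Xi> j i ! m \<le> mesh_size N \<Xi>" by (rule mesh_size_bounds(3)[where p=p and \<Xi>=\<Xi> and N=N, OF N knots j m(1)])
  then show "\<exists>\<tau>\<in>set (T j i). x - mesh_size N \<Xi> \<le> \<tau> \<and> \<tau> \<le> x"
    using m by (intro bexI[of _ "\<Xi> j i ! m"]) (auto simp: T_def)
qed

text \<open>The functional of the surface function whose weighted pull-back is one tensor-product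
  B-spline on patch \<open>j\<close> and zero on the other patches; no surface density is left in
  it.\<close>

definition beta :: "nat \<times> nat \<times> nat \<Rightarrow> surface_functional" where
  "beta = (\<lambda>(j, k) u. if u \<in> H_half N F then l2_inner square_measure (tens j k) (\<lambda>x. u (F j x)) else 0)"

definition "all_index = Sigma {..<N} index"

lemma finite_all_index: "finite all_index"
  by (simp add: all_index_def)

lemma pullback_L2: "u \<in> H_half N F \<Longrightarrow> j < N \<Longrightarrow> (\<lambda>x. u (F j x)) \<in> L2 square_measure"
  using jac_bounds L2_pullback(1)[of _ u j] by (auto simp: H_half_def)

lemma beta_sum:
  assumes "u \<in> H_half N F"
  shows "(\<Sum>k\<in>all_index. c k * beta k u)
    = (\<Sum>j<N. l2_inner square_measure (\<lambda>x. \<Sum>k\<in>index j. c (j, k) * tens j k x) (\<lambda>x. u (F j x)))"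
proof -
  have "(\<Sum>k\<in>all_index. c k * beta k u) = (\<Sum>j<N. \<Sum>k\<in>index j. c (j, k) * beta (j, k) u)"
    unfolding all_index_def by (subst sum.Sigma) (auto simp: case_prod_beta')
  also have "\<dots> = (\<Sum>j<N. l2_inner square_measure (\<lambda>x. \<Sum>k\<in>index j. c (j, k) * tens j k x) (\<lambda>x. u (F j x)))"
  proof (intro sum.cong refl)
    fix j assume "j \<in> {..<N}"
    then have j: "j < N" by simp
    have "l2_inner square_measure (\<lambda>x. \<Sum>k\<in>index j. c (j, k) * tens j k x) (\<lambda>x. u (F j x))
      = (\<Sum>k\<in>index j. l2_inner square_measure (\<lambda>x. c (j, k) * tens j k x) (\<lambda>x. u (F j x)))"
      using tensor_bspline_L2[OF T_open[OF j]] pullback_L2[OF assms j] by (intro l2_inner_sum_left L2_cmult) auto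
    then show "(\<Sum>k\<in>index j. c (j, k) * beta (j, k) u) = l2_inner square_measure (\<lambda>x. \<Sum>k\<in>index j. c (j, k) * tens j k x) (\<lambda>x. u (F j x))"
      using assms by (simp add: beta_def l2_inner_cmult_left)
  qed
  finally show ?thesis .
qed

lemma spline_functional:
  "\<exists>g\<in>L2 \<sigma>. L2_functional N F g = (\<lambda>u. \<Sum>k\<in>all_index. c k * beta k u) \<and>
    (\<forall>j<N. \<forall>x\<in>open_square. jac (F j) x * g (F j x) = (\<Sum>k\<in>index j. c (j, k) * tens j k x))"
proof -
  define w where "w j x = (\<Sum>k\<in>index j. c (j, k) * tens j k x)" for j x
  have wm: "w j \<in> borel_measurable borel" for j
    unfolding w_def by (intro borel_measurable_sum borel_measurable_times borel_measurable_const tensor_bspline_measurable)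
  have "\<exists>C. \<forall>x. \<bar>w j x\<bar> \<le> C" if j: "j < N" for j
  proof -
    have "\<exists>C. \<forall>k\<in>index j. \<forall>z. \<bar>tens j k z\<bar> \<le> C k"
      using tensor_bspline_bounded[OF T_open[OF j]] by (intro bchoice ballI)
    then obtain C where C: "\<And>k z. k \<in> index j \<Longrightarrow> \<bar>tens j k z\<bar> \<le> C k" by blast
    have "\<bar>w j x\<bar> \<le> (\<Sum>k\<in>index j. \<bar>c (j, k)\<bar> * C k)" for x
      unfolding w_def by (rule order.trans[OF sum_abs sum_mono]) (use C in \<open>auto simp: abs_mult intro!: mult_left_mono\<close>)
    then show ?thesis by blast
  qed
  then obtain W where W: "\<And>j x. j < N \<Longrightarrow> \<bar>w j x\<bar> \<le> W j" by metis
  obtain g where g: "g \<in> L2 \<sigma>" "\<And>j x. j < N \<Longrightarrow> x \<in> open_square \<Longrightarrow> jac (F j) x * g (F j x) = w j x"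
    using glue_patches[where w=w and W=W, OF wm W] by blast
  have "L2_functional N F g u = (\<Sum>k\<in>all_index. c k * beta k u)" for u
  proof (cases "u \<in> H_half N F")
    case True
    show ?thesis unfolding L2_functional_patches[OF g(1) True] beta_sum[OF True] w_def[symmetric]
      unfolding l2_inner_def using g(2) by (intro sum.cong refl Bochner_Integration.integral_cong) auto
  next
    case False
    then show ?thesis by (simp add: L2_functional_def beta_def split_beta)
  qed
  then show ?thesis using g by (auto simp: w_def)
qed

text \<open>Brings the space into the form required by the projection argument. A functional in the
  space depends only on the weighted pull-backs on the open patches, which are splines; conversely,
  gluing realises every combination by a square integrable function.\<close>

lemma spline_space_eq:
  "spline_space_S2 N F p \<Xi> = {\<lambda>u. \<Sum>k\<in>all_index. c k * beta k u | c. True}"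
proof (intro equalityI subsetI)
  fix l assume "l \<in> spline_space_S2 N F p \<Xi>"
  then have "\<exists>g\<in>L2 \<sigma>. l = L2_functional N F g \<and>
    (\<forall>j<N. \<exists>w \<in> tensor_spline_space (q j 1) (q j 2) (T j 1) (T j 2). \<forall>x\<in>open_square. jac (F j) x * g (F j x) = w x)"
    unfolding spline_space_S2_def mem_Collect_eq q_def T_def by (rule conjunct2)
  then obtain g where g: "g \<in> L2 \<sigma>" "l = L2_functional N F g" and
    w: "\<forall>j<N. \<exists>w \<in> tensor_spline_space (q j 1) (q j 2) (T j 1) (T j 2). \<forall>x\<in>open_square. jac (F j) x * g (F j x) = w x"
    by (elim bexE conjE)
  have "\<exists>c. j < N \<longrightarrow> (\<forall>x\<in>open_square. jac (F j) x * g (F j x) = (\<Sum>k\<in>index j. c k * tens j k x))" for j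
  proof (cases "j < N")
    case True
    then obtain w where w: "w \<in> tensor_spline_space (q j 1) (q j 2) (T j 1) (T j 2)" "\<forall>x\<in>open_square. jac (F j) x * g (F j x) = w x"
      using w by blast
    from w(1)[unfolded tensor_spline_space_iff[of _ "q j" "T j"]] obtain c where "w = (\<lambda>z. \<Sum>k\<in>index j. c k * tens j k z)" ..
    then show ?thesis using w(2) by auto
  qed simp
  then have "\<forall>j. \<exists>c. j < N \<longrightarrow> (\<forall>x\<in>open_square. jac (F j) x * g (F j x) = (\<Sum>k\<in>index j. c k * tens j k x))" by (rule allI)
  from choice[OF this] obtain c where c: "\<And>j x. j < N \<Longrightarrow> x \<in> open_square \<Longrightarrow> jac (F j) x * g (F j x) = (\<Sum>k\<in>index j. c j k * tens j k x)"
    by blast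
  have "l u = (\<Sum>k\<in>all_index. (\<lambda>(j, k). c j k) k * beta k u)" for u
  proof (cases "u \<in> H_half N F")
    case True
    show ?thesis unfolding g(2) L2_functional_patches[OF g(1) True] beta_sum[OF True] prod.case
      unfolding l2_inner_def using c by (intro sum.cong refl Bochner_Integration.integral_cong) auto
  next
    case False
    then show ?thesis by (simp add: g(2) L2_functional_def beta_def split_beta)
  qed
  then have "l = (\<lambda>u. \<Sum>k\<in>all_index. (\<lambda>(j, k). c j k) k * beta k u)" by (rule ext)
  then show "l \<in> {\<lambda>u. \<Sum>k\<in>all_index. c k * beta k u | c. True}"
    by (intro CollectI exI[of _ "\<lambda>(j, k). c j k"] conjI TrueI)
next
  fix l assume "l \<in> {\<lambda>u. \<Sum>k\<in>all_index. c k * beta k u | c. True}"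
  then obtain c where l: "l = (\<lambda>u. \<Sum>k\<in>all_index. c k * beta k u)" by blast
  obtain g where g: "g \<in> L2 \<sigma>" "L2_functional N F g = l"
    "\<And>j x. j < N \<Longrightarrow> x \<in> open_square \<Longrightarrow> jac (F j) x * g (F j x) = (\<Sum>k\<in>index j. c (j, k) * tens j k x)"
    using spline_functional[of c] unfolding l by blast
  have "(\<lambda>x. \<Sum>k\<in>index j. c (j, k) * tens j k x) \<in> tensor_spline_space (q j 1) (q j 2) (T j 1) (T j 2)" for j
    unfolding tensor_spline_space_iff[of _ "q j" "T j"] by (rule exI[of _ "\<lambda>k. c (j, k)"]) simp
  then show "l \<in> spline_space_S2 N F p \<Xi>"
    unfolding spline_space_S2_def mem_Collect_eq q_def[symmetric] T_def[symmetric]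
    using g L2_functional_in_H_mhalf[OF g(1)] by (intro conjI bexI[of _ g] allI impI) auto
qed

lemma projection_quasi_optimal:
  assumes l: "l \<in> H_mhalf N F" and w: "w \<in> spline_space_S2 N F p \<Xi>"
  shows "H_mhalf_norm N F (\<lambda>u. l u - H_mhalf_projection N F (spline_space_S2 N F p \<Xi>) l u)
    \<le> H_mhalf_norm N F (\<lambda>u. l u - w u)"
proof -
  let ?K = "card all_index"
  obtain e where e: "bij_betw e {..<?K} all_index"
    using ex_bij_betw_nat_finite[OF finite_all_index] by (auto simp: atLeast0LessThan)
  have V: "spline_space_S2 N F p \<Xi> = {\<lambda>u. \<Sum>i<?K. c i * beta (e i) u | c. True}"
    unfolding spline_space_eq
  proof (intro equalityI subsetI)
    fix m assume "m \<in> {\<lambda>u. \<Sum>k\<in>all_index. c k * beta k u | c. True}"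
    then obtain c where "m = (\<lambda>u. \<Sum>k\<in>all_index. c k * beta k u)" by blast
    then have "m = (\<lambda>u. \<Sum>i<?K. c (e i) * beta (e i) u)"
      using sum.reindex_bij_betw[OF e, of "\<lambda>k. c k * beta k u" for u] by simp
    then show "m \<in> {\<lambda>u. \<Sum>i<?K. c i * beta (e i) u | c. True}"
      by (intro CollectI exI[of _ "\<lambda>i. c (e i)"] conjI TrueI)
  next
    fix m assume "m \<in> {\<lambda>u. \<Sum>i<?K. c i * beta (e i) u | c. True}"
    then obtain c where m: "m = (\<lambda>u. \<Sum>i<?K. c i * beta (e i) u)" by blast
    let ?c = "\<lambda>k. c (the_inv_into {..<?K} e k)"
    have "m u = (\<Sum>k\<in>all_index. ?c k * beta k u)" for u
      unfolding m sum.reindex_bij_betw[OF e, symmetric]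
      using e by (intro sum.cong) (auto simp: bij_betw_def the_inv_into_f_f)
    then have "m = (\<lambda>u. \<Sum>k\<in>all_index. ?c k * beta k u)" by (rule ext)
    then show "m \<in> {\<lambda>u. \<Sum>k\<in>all_index. c k * beta k u | c. True}"
      by (intro CollectI exI[of _ ?c] conjI TrueI)
  qed
  have beta: "beta k \<in> H_mhalf N F" if k: "k \<in> all_index" for k
  proof -
    \<comment> \<open>A single \<open>beta k\<close> is a combination with one nonzero coefficient
      and hence belongs to the spline space, whose members are bounded functionals by
      definition.\<close>
    have "beta k = (\<lambda>u. \<Sum>k'\<in>all_index. (if k' = k then 1 else 0) * beta k' u)"
      using k finite_all_index by (simp add: if_distrib[of "\<lambda>a. a * _"] cong: if_cong)
    then have "beta k \<in> {\<lambda>u. \<Sum>k'\<in>all_index. c k' * beta k' u | c. True}"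
      by (intro CollectI exI[of _ "\<lambda>k'. if k' = k then 1 else 0"] conjI TrueI)
    then show ?thesis unfolding spline_space_eq[symmetric] by (simp add: spline_space_S2_def)
  qed
  have b: "beta (e i) \<in> H_half.L" if "i < ?K" for i
    using beta[of "e i"] e that by (auto simp: bij_betw_def H_mhalf_eq)
  show ?thesis
    using H_half.dual_projection[OF b _ V w, of l] l
    unfolding H_mhalf_projection_def H_mhalf_norm_eq H_mhalf_inner_eq H_mhalf_eq by simp
qed

end

theorem corollary4:
  fixes \<Omega> :: "(real^3) set" and N :: nat and F :: "nat \<Rightarrow> real^2 \<Rightarrow> real^3"
    and p :: "nat \<Rightarrow> 2 \<Rightarrow> nat" and \<theta> s :: real
  assumes "multipatch_geometry \<Omega> N F"
    and "\<forall>j<N. \<forall>i. 1 \<le> p j i"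
    and "1 \<le> \<theta>"
    and "0 \<le> s" and "s \<le> real (min_degree N p)"
  shows "\<exists>C>0. \<forall>(\<Xi> :: nat \<Rightarrow> 2 \<Rightarrow> real list) (f :: real^3 \<Rightarrow> real).
    admissible_knots N F \<theta> p \<Xi> \<longrightarrow>
    f \<in> Hs_pw N F s \<longrightarrow> L2_functional N F f \<in> H_mhalf N F \<longrightarrow>
      H_mhalf_norm N F
        (\<lambda>u. L2_functional N F f u
           - H_mhalf_projection N F (spline_space_S2 N F p \<Xi>) (L2_functional N F f) u)
      \<le> C * mesh_size N \<Xi> powr (s + 1/2) * Hs_pw_norm N F s f"
proof -
  have N: "0 < N" and reg: "\<And>j. j < N \<Longrightarrow> regular_patch (F j)"
    and disj: "disjoint_family_on (\<lambda>j. F j ` open_square) {..<N}"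
    using assms(1) by (auto simp: multipatch_geometry_def)
  interpret multipatch N F by unfold_locales (use reg disj in auto)
  obtain c where c: "0 < c" and cj: "\<And>j x. j < N \<Longrightarrow> x \<in> closed_square \<Longrightarrow> c \<le> jac (F j) x"
    using jac_bounds by blast
  have sp: "s \<le> real (p j i)" if "j < N" for j i
  proof -
    have "{p j i | j i. j < N} = (\<Union>j\<in>{..<N}. range (p j))" by blast
    then have "finite {p j i | j i. j < N}" by simp
    then have "min_degree N p \<le> p j i" unfolding min_degree_def using that by (intro Min_le) blast+
    then show ?thesis using assms(5) by linarith
  qed
  \<comment> \<open>Abbreviates the estimate on patch \<open>j\<close>, so that one constant per
    patch can be chosen before knots and functions are given.\<close>
  define good where "good j C \<longleftrightarrow> (\<forall>q T h e u. (\<forall>i :: 2. open_knots (q i) (T i) \<and> knots_within h (T i) \<and> s \<le> real (Suc (q i))) \<longrightarrow>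
    0 < h \<longrightarrow> h \<le> 1 \<longrightarrow> e \<in> L2 square_measure \<longrightarrow>
    (\<forall>i<length (T 1) - q 1 - 1. \<forall>j<length (T 2) - q 2 - 1.
      l2_inner square_measure e (\<lambda>z. bspline (T 1) (q 1) i (z $ 1) * bspline (T 2) (q 2) j (z $ 2)) = 0) \<longrightarrow>
    u \<in> Hs_square s \<longrightarrow>
    \<bar>l2_inner square_measure (\<lambda>z. jac (F j) z * u z) e\<bar> \<le> C * h powr s * Hs_square_norm s u * l2_norm square_measure e)"
    for j C
  have "\<exists>C>0. good j C" if "j < N" for j
    unfolding good_def by (rule Hs_estimate[OF reg[OF that] assms(4)])
  then have "\<forall>j. \<exists>C. j < N \<longrightarrow> 0 < C \<and> good j C" by blast
  from choice[OF this] obtain C where C0: "\<And>j. j < N \<Longrightarrow> 0 < C j" and C: "\<And>j. j < N \<Longrightarrow> good j (C j)" by blast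
  have "\<forall>j. \<exists>K. j < N \<longrightarrow> 1 \<le> K \<and> (\<forall>x\<in>closed_square. \<forall>y\<in>closed_square. norm (F j x - F j y) \<le> K * norm (x - y))"
    using regular_patch_Lipschitz[OF reg] by blast
  from choice[OF this] obtain K where K: "\<And>j. j < N \<Longrightarrow> 1 \<le> K j" "\<And>j x y. j < N \<Longrightarrow> x \<in> closed_square \<Longrightarrow> y \<in> closed_square \<Longrightarrow>
      norm (F j x - F j y) \<le> K j * norm (x - y)" by blast
  \<comment> \<open>The first summand bounds the \<open>L^2\<close> norm and the second the root of
    the squared seminorm of a pulled-back test function from the unit ball; their sum dominates
    both.\<close>
  define A where "A j = 1 / sqrt c + sqrt (K j ^ 3 / c\<^sup>2)" for j
  have A0: "0 \<le> A j" if "j < N" for j using c K(1)[OF that] by (simp add: A_def)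
  have half: "\<exists>S. (\<lambda>x. u (F j x)) \<in> L2 square_measure \<and> l2_norm square_measure (\<lambda>x. u (F j x)) \<le> A j \<and>
      slobodeckij square_measure (1/2) (\<lambda>x. u (F j x)) = ennreal (S\<^sup>2) \<and> 0 \<le> S \<and> S \<le> A j"
    if u: "u \<in> H_half N F" "H_half_norm N F u \<le> 1" and j: "j < N" for u j
  proof -
    have uL: "u \<in> L2 \<sigma>" and fin: "slobodeckij \<sigma> (1/2) u < \<infinity>" using u by (auto simp: H_half_def)
    note P = L2_pullback[OF c cj uL j]
    have r0: "0 \<le> K j ^ 3 / c\<^sup>2" using K(1)[OF j] by simp
    have "l2_norm square_measure (\<lambda>x. u (F j x)) \<le> 1 / sqrt c"
      using order.trans[OF l2_norm_le_H_half_norm u(2)] c by (intro order.trans[OF P(2)] divide_right_mono) auto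
    moreover have "0 \<le> sqrt (K j ^ 3 / c\<^sup>2)" using r0 by simp
    ultimately have n: "l2_norm square_measure (\<lambda>x. u (F j x)) \<le> A j" unfolding A_def by linarith
    define t where "t = enn2real (slobodeckij \<sigma> (1/2) u)"
    have t: "slobodeckij \<sigma> (1/2) u = ennreal t" "0 \<le> t" using fin by (auto simp: t_def)
    have "t \<le> (H_half_norm N F u)\<^sup>2" unfolding H_half_norm_square t_def by (simp add: l2_inner_self_nonneg)
    also have "\<dots> \<le> 1" using u(2) H_half.nn[of u] by (simp add: power_le_one)
    finally have t1: "t \<le> 1" .
    have "slobodeckij square_measure (1/2) (\<lambda>x. u (F j x)) \<le> ennreal (K j ^ 3 / c\<^sup>2) * ennreal t"
      using slobodeckij_pullback[OF c cj K(1)[OF j] K(2)[OF j] H_half_measurable[OF u(1)] j] t by simp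
    also have "\<dots> = ennreal (K j ^ 3 / c\<^sup>2 * t)" using r0 t by (intro ennreal_mult[symmetric])
    also have "\<dots> \<le> ennreal (K j ^ 3 / c\<^sup>2)" using mult_left_mono[OF t1 r0] by (intro ennreal_leI) simp
    finally have le: "slobodeckij square_measure (1/2) (\<lambda>x. u (F j x)) \<le> ennreal (K j ^ 3 / c\<^sup>2)" .
    define t' where "t' = enn2real (slobodeckij square_measure (1/2) (\<lambda>x. u (F j x)))"
    have t': "slobodeckij square_measure (1/2) (\<lambda>x. u (F j x)) = ennreal t'" "0 \<le> t'"
      using order.strict_trans1[OF le] by (auto simp: t'_def)
    have "t' \<le> K j ^ 3 / c\<^sup>2" using le t' r0 by (simp add: ennreal_le_iff)
    then have "sqrt t' \<le> sqrt (K j ^ 3 / c\<^sup>2)" by simp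
    moreover have "0 \<le> 1 / sqrt c" using c by simp
    ultimately have "sqrt t' \<le> A j" unfolding A_def by linarith
    then show ?thesis using P(1) n t' by (intro exI[of _ "sqrt t'"]) auto
  qed
  \<comment> \<open>On each patch \<open>C j\<close> comes from the size of the error
    \<open>e\<close> and \<open>320 * A j\<close> from its pairing with the test function. The
    summand 1 ensures positivity.\<close>
  define C1 where "C1 = 1 + (\<Sum>j<N. 320 * A j * C j)"
  have C1: "0 < C1" unfolding C1_def using A0 C0 by (intro add_pos_nonneg sum_nonneg) (auto simp: less_imp_le)
  show ?thesis
  proof (intro exI[of _ C1] conjI allI impI C1)
    fix \<Xi> :: "nat \<Rightarrow> 2 \<Rightarrow> real list" and f :: "real^3 \<Rightarrow> real"
    assume adm: "admissible_knots N F \<theta> p \<Xi>" and f: "f \<in> Hs_pw N F s" and l: "L2_functional N F f \<in> H_mhalf N F"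
    interpret multipatch_splines N F p \<Xi>
      by unfold_locales (use N adm in \<open>auto simp: admissible_knots_def\<close>)
    define h where "h = mesh_size N \<Xi>"
    have h: "0 < h" "h \<le> 1" unfolding h_def using mesh_size_bounds(1,2)[where p=p and \<Xi>=\<Xi> and N=N, OF N knots] by blast+
    have fL: "f \<in> L2 \<sigma>" and fs: "\<And>j. j < N \<Longrightarrow> (\<lambda>x. f (F j x)) \<in> Hs_square s"
      using f by (auto simp: Hs_pw_def comp_def)
    define \<phi> where "\<phi> j x = jac (F j) x * f (F j x)" for j x
    obtain CC where CC: "\<And>j x. j < N \<Longrightarrow> x \<in> closed_square \<Longrightarrow> jac (F j) x \<le> CC" using jac_bounds by blast
    have \<phi>L: "\<phi> j \<in> L2 square_measure" if j: "j < N" for j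
      unfolding \<phi>_def
      using CC[OF j open_closed_square] by (intro L2_bounded_mult[OF L2_pullback(1)[OF c cj fL j] jac_measurable[OF j]])
        (auto simp: jac_def)
    have "\<exists>c. j < N \<longrightarrow> (\<forall>i\<in>index j. l2_inner square_measure (\<lambda>x. \<phi> j x - (\<Sum>k\<in>index j. c k * tens j k x)) (tens j i) = 0)" for j
      using L2_projection_finite[where J="index j" and b="tens j" and v="\<phi> j", OF finite_tensor_index tensor_bspline_L2[OF T_open] \<phi>L] by blast
    then have "\<forall>j. \<exists>c. j < N \<longrightarrow> (\<forall>i\<in>index j. l2_inner square_measure (\<lambda>x. \<phi> j x - (\<Sum>k\<in>index j. c k * tens j k x)) (tens j i) = 0)" by blast
    from choice[OF this] obtain d where d: "\<And>j i. j < N \<Longrightarrow> i \<in> index j \<Longrightarrow>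
        l2_inner square_measure (\<lambda>x. \<phi> j x - (\<Sum>k\<in>index j. d j k * tens j k x)) (tens j i) = 0"
      by blast
    define w where "w j x = (\<Sum>k\<in>index j. d j k * tens j k x)" for j x
    define e where "e j x = \<phi> j x - w j x" for j x
    have wL: "w j \<in> L2 square_measure" if "j < N" for j
      unfolding w_def using tensor_bspline_L2[OF T_open[OF that]] by (intro L2_sum L2_cmult) auto
    have eL: "e j \<in> L2 square_measure" if "j < N" for j
      unfolding e_def using \<phi>L[OF that] wL[OF that] by (rule L2_diff)
    have orth: "l2_inner square_measure (e j) (tens j k) = 0" if "j < N" "k \<in> index j" for j k
      using d[OF that] by (simp add: e_def[abs_def] w_def)
    have orth': "l2_inner square_measure (e j) (\<lambda>z. bspline (T j 1) (q j 1) a (z $ 1) * bspline (T j 2) (q j 2) b (z $ 2)) = 0"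
      if "j < N" "a < length (T j 1) - q j 1 - 1" "b < length (T j 2) - q j 2 - 1" for j a b
      using orth[OF that(1), of "(a, b)"] that by (simp add: tensor_index_def tensor_bspline_def)
    \<comment> \<open>Dropping the end knots lowers the degree by one, so \<open>s \<le> p\<close>
      becomes \<open>s \<le> Suc (q j i)\<close>, exactly the range of orders the pairing estimate
      covers.\<close>
    have Tq: "open_knots (q j i) (T j i) \<and> knots_within h (T j i) \<and> s \<le> real (Suc (q j i))" if j: "j < N" for j i
    proof -
      have "Suc (q j i) = p j i" using assms(2) j by (auto simp: q_def Suc_le_eq)
      then show ?thesis using T_open[OF j] T_within[OF j] sp[OF j] by (simp add: h_def)
    qed
    let ?H = "\<lambda>j. Hs_square_norm s (\<lambda>x. f (F j x))"
    have en: "l2_norm square_measure (e j) \<le> C j * h powr s * ?H j" if j: "j < N" for j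
    proof -
      \<comment> \<open>By orthogonality to its own spline part, the squared norm of
        \<open>e j\<close> equals its pairing with \<open>\<phi> j\<close>. The pairing estimate
        leaves one factor \<open>l2_norm\<close> of \<open>e j\<close>, which cancels.\<close>
      have ew: "l2_inner square_measure (e j) (w j) = 0"
        unfolding w_def[abs_def] using tensor_bspline_L2[OF T_open[OF j]] eL[OF j] orth[OF j]
        by (subst l2_inner_commute, subst l2_inner_sum_left)
          (auto intro!: L2_cmult sum.neutral simp: l2_inner_cmult_left l2_inner_commute[of _ _ "e j"])
      have "l2_norm square_measure (e j) * l2_norm square_measure (e j) = l2_inner square_measure (e j) (e j)"
        using l2_norm_square[of square_measure "e j"] by (simp add: power2_eq_square)
      also have "\<dots> = l2_inner square_measure (e j) (\<phi> j) - l2_inner square_measure (e j) (w j)"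
        using l2_inner_diff_right[OF \<phi>L[OF j] wL[OF j] eL[OF j]] by (simp add: e_def[abs_def])
      also have "\<dots> = l2_inner square_measure (\<phi> j) (e j)" by (simp add: ew l2_inner_commute)
      also have "\<dots> \<le> C j * h powr s * ?H j * l2_norm square_measure (e j)"
        using C[OF j, unfolded good_def, rule_format, of "q j" "T j" h "e j" "\<lambda>x. f (F j x)", OF Tq[OF j] h eL[OF j] orth'[OF j] fs[OF j]]
        unfolding \<phi>_def[abs_def] by linarith
      finally have *: "l2_norm square_measure (e j) * l2_norm square_measure (e j) \<le> C j * h powr s * ?H j * l2_norm square_measure (e j)" .
      show ?thesis
      proof (cases "l2_norm square_measure (e j) = 0")
        case True
        have "0 \<le> ?H j" unfolding Hs_square_norm_def by (auto intro!: add_nonneg_nonneg sum_nonneg)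
        then show ?thesis using True C0[OF j] by simp
      next
        case False
        then have "0 < l2_norm square_measure (e j)" using l2_norm_nonneg[of square_measure "e j"] by simp
        then show ?thesis using * by simp
      qed
    qed
    obtain g where g: "g \<in> L2 \<sigma>" "L2_functional N F g = (\<lambda>u. \<Sum>k\<in>all_index. (\<lambda>(j, k). d j k) k * beta k u)"
      "\<And>j x. j < N \<Longrightarrow> x \<in> open_square \<Longrightarrow> jac (F j) x * g (F j x) = w j x"
      using spline_functional[of "\<lambda>(j, k). d j k"] unfolding w_def by auto
    have gV: "L2_functional N F g \<in> spline_space_S2 N F p \<Xi>"
      unfolding spline_space_eq g(2) by (intro CollectI exI[of _ "\<lambda>(j, k). d j k"] conjI TrueI refl)
    have Hle: "?H j \<le> Hs_pw_norm N F s f" if j: "j < N" for j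
    proof -
      have "(?H j)\<^sup>2 \<le> (\<Sum>j<N. (?H j)\<^sup>2)" using j by (intro member_le_sum) auto
      then show ?thesis unfolding Hs_pw_norm_def comp_def by (rule real_le_rsqrt)
    qed
    have main: "\<bar>L2_functional N F f u - L2_functional N F g u\<bar> \<le> C1 * h powr (s + 1/2) * Hs_pw_norm N F s f"
      if u: "u \<in> H_half N F" "H_half_norm N F u \<le> 1" for u
    proof -
      \<comment> \<open>The difference of the weighted pull-backs of \<open>f\<close> and
        \<open>g\<close> on patch \<open>j\<close> is \<open>e j\<close>, so the test function meets
        a function orthogonal to the splines on every patch.\<close>
      have "L2_functional N F f u - L2_functional N F g u = (\<Sum>j<N. l2_inner square_measure (\<lambda>x. u (F j x)) (e j))"
        unfolding L2_functional_patches[OF fL u(1)] L2_functional_patches[OF g(1) u(1)] sum_subtractf[symmetric]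
      proof (intro sum.cong refl)
        fix j assume "j \<in> {..<N}"
        then have j: "j < N" by simp
        have "l2_inner square_measure (\<lambda>x. jac (F j) x * g (F j x)) (\<lambda>x. u (F j x)) = l2_inner square_measure (w j) (\<lambda>x. u (F j x))"
          unfolding l2_inner_def using g(3)[OF j] by (intro Bochner_Integration.integral_cong) auto
        then show "l2_inner square_measure (\<lambda>x. jac (F j) x * f (F j x)) (\<lambda>x. u (F j x)) -
            l2_inner square_measure (\<lambda>x. jac (F j) x * g (F j x)) (\<lambda>x. u (F j x)) = l2_inner square_measure (\<lambda>x. u (F j x)) (e j)"
          using l2_inner_diff_right[OF \<phi>L[OF j] wL[OF j] pullback_L2[OF u(1) j]]
          by (simp add: e_def[abs_def] \<phi>_def[abs_def] l2_inner_commute[of _ _ "\<lambda>x. u (F j x)"])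
      qed
      then have "\<bar>L2_functional N F f u - L2_functional N F g u\<bar> \<le> (\<Sum>j<N. \<bar>l2_inner square_measure (\<lambda>x. u (F j x)) (e j)\<bar>)"
        by (simp add: sum_abs)
      also have "\<dots> \<le> (\<Sum>j<N. (320 * A j * C j) * (h powr (s + 1/2) * Hs_pw_norm N F s f))"
      proof (intro sum_mono)
        fix j assume "j \<in> {..<N}"
        then have j: "j < N" by simp
        obtain S where S: "(\<lambda>x. u (F j x)) \<in> L2 square_measure" "l2_norm square_measure (\<lambda>x. u (F j x)) \<le> A j"
          "slobodeckij square_measure (1/2) (\<lambda>x. u (F j x)) = ennreal (S\<^sup>2)" "0 \<le> S" "S \<le> A j"
          using half[OF u j] by blast
        have "\<bar>l2_inner square_measure (\<lambda>x. u (F j x)) (e j)\<bar> \<le> 320 * h powr (1/2) * A j * l2_norm square_measure (e j)"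
          using Tq[OF j] by (intro H_half_estimate[where q="q j" and T="T j", OF _ _ h eL[OF j] orth'[OF j] S]) auto
        also have "\<dots> \<le> 320 * h powr (1/2) * A j * (C j * h powr s * Hs_pw_norm N F s f)"
          using A0[OF j] C0[OF j] Hle[OF j]
          by (intro mult_left_mono order.trans[OF en[OF j]]) auto
        also have "\<dots> = (320 * A j * C j) * (h powr (s + 1/2) * Hs_pw_norm N F s f)"
          by (simp add: powr_add mult_ac)
        finally show "\<bar>l2_inner square_measure (\<lambda>x. u (F j x)) (e j)\<bar> \<le> (320 * A j * C j) * (h powr (s + 1/2) * Hs_pw_norm N F s f)" .
      qed
      also have "\<dots> = (\<Sum>j<N. 320 * A j * C j) * (h powr (s + 1/2) * Hs_pw_norm N F s f)"
        by (rule sum_distrib_right[symmetric])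
      also have "\<dots> \<le> C1 * (h powr (s + 1/2) * Hs_pw_norm N F s f)"
        unfolding C1_def Hs_pw_norm_def by (intro mult_right_mono mult_nonneg_nonneg) (auto intro!: sum_nonneg)
      finally show ?thesis by (simp add: mult.assoc)
    qed
    have "H_mhalf_norm N F (\<lambda>u. L2_functional N F f u - H_mhalf_projection N F (spline_space_S2 N F p \<Xi>) (L2_functional N F f) u)
        \<le> H_mhalf_norm N F (\<lambda>u. L2_functional N F f u - L2_functional N F g u)"
      by (rule projection_quasi_optimal[OF l gV])
    also have "\<dots> \<le> C1 * h powr (s + 1/2) * Hs_pw_norm N F s f"
      unfolding H_mhalf_norm_eq by (rule H_half.dn_least) (rule main)
    finally show "H_mhalf_norm N F (\<lambda>u. L2_functional N F f u - H_mhalf_projection N F (spline_space_S2 N F p \<Xi>) (L2_functional N F f) u)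
        \<le> C1 * mesh_size N \<Xi> powr (s + 1/2) * Hs_pw_norm N F s f" by (simp add: h_def)
  qed
qed

end
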